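(* Let $p$ be a prime and $n\ge 1$. Let $A_1,A_2,\ldots\in\mathrm{GSp}_{2n}(\mathbb{Q}_p)$ be i.i.d. random matrices whose distribution is invariant under both left- and right-multiplication by $\mathrm{GSp}_{2n}(\mathbb{Z}_p)$. Let $\lambda(k)=(\lambda_1(k),\ldots,\lambda_{2n}(k))=\mathrm{SN}(A_1\cdots A_k)$. For every $1\le i\le 2n$, let $A_1^{(i)}\in\mathrm{Mat}_{(2n-i+1)\times 2n}(\mathbb{Q}_p)$ denote the submatrix of $A_1$ consisting of the last $2n-i+1$ rows and all $2n$ columns. (1) (Strong law of large numbers) Suppose that for all $1\le i\le 2n$ the integer-valued random variable $|\mathrm{SN}(A_1^{(i)})|$ has a finite expectation $\mathbb{E}|\mathrm{SN}(A_1^{(i)})|$. Then, almost surely as $k\to\infty$, $$\Big(\frac{\lambda_1(k)}{k},\ldots,\frac{\lambda_{2n}(k)}{k}\Big)\to\Big(\mathbb{E}|\mathrm{SN}(A_1^{(1)})|-\mathbb{E}|\mathrm{SN}(A_1^{(2)})|,\ldots,\mathbb{E}|\mathrm{SN}(A_1^{(2n-1)})|-\mathbb{E}|\mathrm{SN}(A_1^{(2n)})|,\ \mathbb{E}|\mathrm{SN}(A_1^{(2n)})|\Big).$$ (2) (Central limit theorem) In addition, suppose that for all $1\le i\le 2n$ the random variable $|\mathrm{SN}(A_1^{(i)})|$ has a finite second moment. Then, as $k\to\infty$, the random vector $$\frac{\big(\lambda_1(k)-k\,\mathbb{E}|\mathrm{SN}(A_1^{(1)})|+k\,\mathbb{E}|\mathrm{SN}(A_1^{(2)})|,\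 \ldots,\ \lambda_{2n-1}(k)-k\,\mathbb{E}|\mathrm{SN}(A_1^{(2n-1)})|+k\,\mathbb{E}|\mathrm{SN}(A_1^{(2n)})|,\ \lambda_{2n}(k)-k\,\mathbb{E}|\mathrm{SN}(A_1^{(2n)})|\big)}{\sqrt{k}}$$ converges weakly to the (possibly degenerate) centered Gaussian $N(0,L\Sigma L^T)$, where $L$ is the $2n\times 2n$ matrix with $L_{i,i}=1$ for $1\le i\le 2n$, $L_{i,i+1}=-1$ for $1\le i\le 2n-1$, and all other entries $0$, and $\Sigma=\big(\mathrm{Cov}(|\mathrm{SN}(A_1^{(i)})|,|\mathrm{SN}(A_1^{(j)})|)\big)_{1\le i,j\le 2n}$.
   Context: Let $J_n$ be the $n\times n$ matrix with $1$'s on the antidiagonal and $0$'s elsewhere. Then $$\mathrm{GSp}_{2n}(\mathbb{Q}_p)=\Big\{A\in\mathrm{GL}_{2n}(\mathbb{Q}_p)\ :\ A\begin{pmatrix}0&J_n\\-J_n&0\end{pmatrix}A^T=\begin{pmatrix}0&\mu(A)J_n\\-\mu(A)J_n&0\end{pmatrix}\text{ for some }\mu(A)\in\mathbb{Q}_p^\times\Big\},$$ and $\mathrm{GSp}_{2n}(\mathbb{Z}_p)=\mathrm{GSp}_{2n}(\mathbb{Q}_p)\cap\mathrm{GL}_{2n}(\mathbb{Z}_p)$. For every $A\in\mathrm{GSp}_{2n}(\mathbb{Q}_p)$ there exist $U,V\in\mathrm{GSp}_{2n}(\mathbb{Z}_p)$ with $A=U\,\mathrm{diag}(p^{\lambda_1},\ldots,p^{\lambda_{2n}})V$,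 where $\lambda_1\ge\cdots\ge\lambda_{2n}$ are integers with $\lambda_1+\lambda_{2n}=\lambda_2+\lambda_{2n-1}=\cdots=\lambda_n+\lambda_{n+1}$; write $\mathrm{SN}(A)=(\lambda_1,\ldots,\lambda_{2n})$ (singular numbers). For a rectangular matrix $B\in\mathrm{Mat}_{r\times m}(\mathbb{Q}_p)$, $r\le m$, of rank $r$ (such as $A_1^{(i)}$), $\mathrm{SN}(B)=(\lambda_1\ge\cdots\ge\lambda_r)$ is defined by $B=U\,\mathrm{diag}_{r\times m}(p^{\lambda_1},\ldots,p^{\lambda_r})V$ with $U\in\mathrm{GL}_r(\mathbb{Z}_p)$, $V\in\mathrm{GL}_m(\mathbb{Z}_p)$; the two definitions agree on $\mathrm{GSp}_{2n}(\mathbb{Q}_p)$. For an integer tuple $\lambda$, $|\lambda|$ is the sum of its entries (the weight, a sum of signed integers, not an absolute value). *)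

theory Defs
  imports
    "HOL-Probability.Probability"
    "Berlekamp_Zassenhaus.Finite_Field"
    "Jordan_Normal_Form.Matrix"
begin

section \<open>The field of $p$-adic numbers\<close>

subsection \<open>The $p$-adic absolute value on the rationals\<close>

definition padic_val :: "nat \<Rightarrow> rat \<Rightarrow> int" where
  "padic_val p x = int (multiplicity (int p) (fst (quotient_of x)))
                 - int (multiplicity (int p) (snd (quotient_of x)))"

definition pabs :: "nat \<Rightarrow> rat \<Rightarrow> real" where
  "pabs p x = (if x = 0 then 0 else real p powi (- padic_val p x))"

lemma padic_val_Fract:
  assumes p: "prime p" and a: "a \<noteq> 0" and b: "b \<noteq> 0"
  shows "padic_val p (Rat.Fract a b) = int (multiplicity (int p) a) - int (multiplicity (int p) b)"
proof -
  obtain c d where cd: "quotient_of (Rat.Fract a b) = (c, d)" by force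
  have d: "d > 0" using quotient_of_denom_pos[OF cd] .
  have "Rat.Fract a b = Rat.Fract c d"
    using quotient_of_div[OF cd] by (simp add: Fract_of_int_quotient)
  then have eq: "a * d = c * b" using b d by (simp add: eq_rat)
  then have c: "c \<noteq> 0" using a d by auto
  have pp: "prime_elem (int p)" using p by simp
  have "multiplicity (int p) (a * d) = multiplicity (int p) a + multiplicity (int p) d"
    using prime_elem_multiplicity_mult_distrib[OF pp a] d by simp
  moreover have "multiplicity (int p) (c * b) = multiplicity (int p) c + multiplicity (int p) b"
    using prime_elem_multiplicity_mult_distrib[OF pp c b] .
  ultimately show ?thesis using eq by (simp add: padic_val_def cd)
qed

context
  fixes p :: nat
  assumes p: "prime p"
begin

lemma p_gt_1: "real p > 1"
  using prime_gt_1_nat[OF p] by simp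

lemma pabs_0 [simp]: "pabs p 0 = 0"
  by (simp add: pabs_def)

lemma pabs_pos: "x \<noteq> 0 \<Longrightarrow> pabs p x > 0"
  using p_gt_1 by (simp add: pabs_def)

lemma pabs_nonneg: "pabs p x \<ge> 0"
  using pabs_pos[of x] by (cases "x = 0") auto

lemma pabs_eq_0: "pabs p x = 0 \<longleftrightarrow> x = 0"
  using pabs_pos[of x] by (cases "x = 0") auto

lemma pabs_1 [simp]: "pabs p 1 = 1"
  by (simp add: pabs_def padic_val_def)

lemma padic_val_mult:
  assumes "x \<noteq> 0" "y \<noteq> 0"
  shows "padic_val p (x * y) = padic_val p x + padic_val p y"
proof -
  obtain a b where x: "x = Rat.Fract a b" "b > 0" by (cases x) auto
  obtain c d where y: "y = Rat.Fract c d" "d > 0" by (cases y) auto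
  have nz: "a \<noteq> 0" "c \<noteq> 0" "b \<noteq> 0" "d \<noteq> 0"
    using assms x y by (auto simp: rat_number_collapse)
  have pp: "prime_elem (int p)" using p by simp
  show ?thesis
    using nz by (simp add: x(1) y(1) padic_val_Fract[OF p]
        prime_elem_multiplicity_mult_distrib[OF pp])
qed

lemma pabs_mult: "pabs p (x * y) = pabs p x * pabs p y"
proof (cases "x = 0 \<or> y = 0")
  case False
  then have "- padic_val p (x * y) = - padic_val p x + - padic_val p y"
    by (simp add: padic_val_mult)
  then show ?thesis using False p_gt_1 power_int_add[of "real p" "- padic_val p x" "- padic_val p y"]
    by (simp add: pabs_def)
qed (auto simp: pabs_def)

lemma pabs_minus [simp]: "pabs p (- x) = pabs p x"
proof -
  have "(pabs p (-1))\<^sup>2 = 1"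
    using pabs_mult[of "-1" "-1"] by (simp add: power2_eq_square)
  then have "pabs p (-1) = 1" using pabs_nonneg[of "-1"]
    by (simp add: power2_eq_1_iff)
  then show ?thesis using pabs_mult[of "-1" x] by simp
qed

lemma pabs_inverse: "pabs p (inverse x) = inverse (pabs p x)"
proof (cases "x = 0")
  case False
  then have "pabs p (inverse x) * pabs p x = 1"
    using pabs_mult[of "inverse x" x] by simp
  then show ?thesis using inverse_unique[of "pabs p x" "pabs p (inverse x)"]
    by (simp add: mult.commute)
qed simp

lemma pabs_ultra: "pabs p (x + y) \<le> max (pabs p x) (pabs p y)"
proof (cases "x = 0 \<or> y = 0 \<or> x + y = 0")
  case True
  then show ?thesis using pabs_nonneg[of x] pabs_nonneg[of y] by (auto simp: max_def)
next
  case False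
  obtain a b where x: "x = Rat.Fract a b" "b > 0" by (cases x) auto
  obtain c d where y: "y = Rat.Fract c d" "d > 0" by (cases y) auto
  let ?m = "multiplicity (int p)"
  define u v w where "u = a * d" and "v = c * b" and "w = b * d"
  have w: "w \<noteq> 0" using x y by (simp add: w_def)
  have xw: "x = Rat.Fract u w" and yw: "y = Rat.Fract v w"
    using x y by (simp_all add: u_def v_def w_def eq_rat)
  have sw: "x + y = Rat.Fract (u + v) w"
    using w by (simp add: xw yw eq_rat algebra_simps)
  have nz: "u \<noteq> 0" "v \<noteq> 0" "u + v \<noteq> 0"
  proof -
    have "Rat.Fract u w \<noteq> 0" "Rat.Fract v w \<noteq> 0" "Rat.Fract (u + v) w \<noteq> 0"
      using False by (simp_all flip: xw yw sw)
    then show "u \<noteq> 0" "v \<noteq> 0" "u + v \<noteq> 0" by (auto simp: rat_number_collapse(1))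
  qed
  have "int p ^ min (?m u) (?m v) dvd u + v"
    by (intro dvd_add multiplicity_dvd' min.cobounded1 min.cobounded2)
  moreover have "\<not> is_unit (int p)" using prime_gt_1_nat[OF p] by simp
  ultimately have "?m (u + v) \<ge> min (?m u) (?m v)"
    using nz by (intro multiplicity_geI) auto
  then have "padic_val p (x + y) \<ge> min (padic_val p x) (padic_val p y)"
    unfolding sw unfolding xw yw using nz w by (simp add: padic_val_Fract[OF p])
  then have "- padic_val p (x + y) \<le> - padic_val p x \<or> - padic_val p (x + y) \<le> - padic_val p y"
    by linarith
  then show ?thesis using False p_gt_1
    by (auto simp: pabs_def le_max_iff_disj intro: power_int_increasing)
qed

lemma pabs_triangle: "pabs p (x + y) \<le> pabs p x + pabs p y"
  using pabs_ultra[of x y] pabs_nonneg[of x] pabs_nonneg[of y] by linarith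

lemma pabs_triangle': "pabs p (x - y) \<le> pabs p x + pabs p y"
  using pabs_triangle[of x "- y"] by simp

lemma pabs_diff_commute: "pabs p (x - y) = pabs p (y - x)"
  using pabs_minus[of "x - y"] by simp

lemma pabs_reverse_triangle: "\<bar>pabs p x - pabs p y\<bar> \<le> pabs p (x - y)"
  using pabs_triangle[of "x - y" y] pabs_triangle[of "y - x" x] pabs_diff_commute[of x y]
  by (simp add: abs_le_iff)

end

subsection \<open>Cauchy sequences and null sequences\<close>

definition pvanishes :: "nat \<Rightarrow> (nat \<Rightarrow> rat) \<Rightarrow> bool" where
  "pvanishes p X \<longleftrightarrow> (\<lambda>n. pabs p (X n)) \<longlonglongrightarrow> 0"

definition pcauchy :: "nat \<Rightarrow> (nat \<Rightarrow> rat) \<Rightarrow> bool" where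
  "pcauchy p X \<longleftrightarrow> (\<forall>e>0. \<exists>N. \<forall>m\<ge>N. \<forall>n\<ge>N. pabs p (X m - X n) < e)"

context
  fixes p :: nat
  assumes p: "prime p"
begin

lemma pvanishes_squeeze:
  assumes "g \<longlonglongrightarrow> 0" "\<And>n. pabs p (X n) \<le> g n"
  shows "pvanishes p X"
  unfolding pvanishes_def
  by (rule tendsto_sandwich[OF _ _ tendsto_const assms(1)])
     (auto simp: pabs_nonneg[OF p] assms(2))

lemma pvanishes_add: "pvanishes p X \<Longrightarrow> pvanishes p Y \<Longrightarrow> pvanishes p (\<lambda>n. X n + Y n)"
  by (rule pvanishes_squeeze[where g = "\<lambda>n. pabs p (X n) + pabs p (Y n)"])
     (auto simp: pvanishes_def pabs_triangle[OF p] intro!: tendsto_add_zero)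

lemma pvanishes_minus: "pvanishes p X \<Longrightarrow> pvanishes p (\<lambda>n. - X n)"
  by (simp add: pvanishes_def pabs_minus[OF p])

lemma pvanishes_diff: "pvanishes p X \<Longrightarrow> pvanishes p Y \<Longrightarrow> pvanishes p (\<lambda>n. X n - Y n)"
  using pvanishes_add[of X "\<lambda>n. - Y n"] pvanishes_minus[of Y] by simp

lemma pvanishes_0: "pvanishes p (\<lambda>n. 0)"
  by (simp add: pvanishes_def pabs_0[OF p])

lemma pcauchy_const: "pcauchy p (\<lambda>n. c)"
  by (simp add: pcauchy_def pabs_0[OF p])

lemma pcauchy_add:
  assumes "pcauchy p X" "pcauchy p Y"
  shows "pcauchy p (\<lambda>n. X n + Y n)"
  unfolding pcauchy_def
proof (intro allI impI)
  fix e :: real assume e: "e > 0"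
  obtain M where M: "\<And>m n. m \<ge> M \<Longrightarrow> n \<ge> M \<Longrightarrow> pabs p (X m - X n) < e"
    using assms(1) e unfolding pcauchy_def by metis
  obtain N where N: "\<And>m n. m \<ge> N \<Longrightarrow> n \<ge> N \<Longrightarrow> pabs p (Y m - Y n) < e"
    using assms(2) e unfolding pcauchy_def by metis
  have "pabs p ((X m + Y m) - (X n + Y n)) < e" if "m \<ge> max M N" "n \<ge> max M N" for m n
    using pabs_ultra[OF p, of "X m - X n" "Y m - Y n"] M[of m n] N[of m n] that
    by (simp add: algebra_simps)
  then show "\<exists>K. \<forall>m\<ge>K. \<forall>n\<ge>K. pabs p ((X m + Y m) - (X n + Y n)) < e" by blast
qed

lemma pcauchy_minus:
  assumes "pcauchy p X"
  shows "pcauchy p (\<lambda>n. - X n)"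
proof -
  have "pabs p (- X m - - X n) = pabs p (X m - X n)" for m n
    using pabs_diff_commute[OF p, of "X m" "X n"] by (simp add: algebra_simps)
  then show ?thesis using assms by (simp add: pcauchy_def)
qed

lemma pcauchy_abs_Cauchy:
  assumes "pcauchy p X"
  shows "Cauchy (\<lambda>n. pabs p (X n))"
  unfolding Cauchy_def
proof (intro allI impI)
  fix e :: real assume "e > 0"
  then obtain M where M: "\<And>m n. m \<ge> M \<Longrightarrow> n \<ge> M \<Longrightarrow> pabs p (X m - X n) < e"
    using assms unfolding pcauchy_def by metis
  have "dist (pabs p (X m)) (pabs p (X n)) < e" if "m \<ge> M" "n \<ge> M" for m n
    using M[OF that] pabs_reverse_triangle[OF p, of "X m" "X n"] by (simp add: dist_real_def)
  then show "\<exists>M. \<forall>m\<ge>M. \<forall>n\<ge>M. dist (pabs p (X m)) (pabs p (X n)) < e" by blast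
qed

lemma pcauchy_abs_convergent: "pcauchy p X \<Longrightarrow> convergent (\<lambda>n. pabs p (X n))"
  using pcauchy_abs_Cauchy by (simp add: Cauchy_convergent_iff)

lemma pcauchy_bounded:
  assumes "pcauchy p X"
  obtains b where "b > 0" "\<And>n. pabs p (X n) \<le> b"
proof -
  have "Bseq (\<lambda>n. pabs p (X n))" using pcauchy_abs_Cauchy[OF assms] Cauchy_Bseq by blast
  then show ?thesis using that by (auto simp: Bseq_def pabs_nonneg[OF p])
qed

lemma pvanishes_mult:
  assumes "pcauchy p X" "pvanishes p Y"
  shows "pvanishes p (\<lambda>n. X n * Y n)"
proof -
  obtain b where b: "b > 0" "\<And>n. pabs p (X n) \<le> b" by (rule pcauchy_bounded[OF assms(1)]) auto
  show ?thesis
  proof (rule pvanishes_squeeze[where g = "\<lambda>n. b * pabs p (Y n)"])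
    show "(\<lambda>n. b * pabs p (Y n)) \<longlonglongrightarrow> 0"
      using assms(2) unfolding pvanishes_def by (rule tendsto_mult_right_zero)
    show "pabs p (X n * Y n) \<le> b * pabs p (Y n)" for n
      using b(2)[of n] by (simp add: pabs_mult[OF p] mult_right_mono pabs_nonneg[OF p])
  qed
qed

lemma pcauchy_mult:
  assumes "pcauchy p X" "pcauchy p Y"
  shows "pcauchy p (\<lambda>n. X n * Y n)"
  unfolding pcauchy_def
proof (intro allI impI)
  fix e :: real assume e: "e > 0"
  obtain a where a: "a > 0" "\<And>n. pabs p (X n) \<le> a" by (rule pcauchy_bounded[OF assms(1)]) auto
  obtain b where b: "b > 0" "\<And>n. pabs p (Y n) \<le> b" by (rule pcauchy_bounded[OF assms(2)]) auto
  obtain M where M: "\<And>m n. m \<ge> M \<Longrightarrow> n \<ge> M \<Longrightarrow> pabs p (X m - X n) < e / b"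
    using assms(1) e b unfolding pcauchy_def by (meson divide_pos_pos)
  obtain N where N: "\<And>m n. m \<ge> N \<Longrightarrow> n \<ge> N \<Longrightarrow> pabs p (Y m - Y n) < e / a"
    using assms(2) e a unfolding pcauchy_def by (meson divide_pos_pos)
  have "pabs p (X m * Y m - X n * Y n) < e" if mn: "m \<ge> max M N" "n \<ge> max M N" for m n
  proof -
    have eq: "X m * Y m - X n * Y n = X m * (Y m - Y n) + (X m - X n) * Y n"
      by (simp add: algebra_simps)
    have "pabs p (X m * (Y m - Y n)) \<le> a * pabs p (Y m - Y n)"
      using a(2)[of m] by (simp add: pabs_mult[OF p] mult_right_mono pabs_nonneg[OF p])
    also have "\<dots> < e" using N[of m n] mn a by (simp add: field_simps)
    finally have 1: "pabs p (X m * (Y m - Y n)) < e" .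
    have "pabs p ((X m - X n) * Y n) \<le> pabs p (X m - X n) * b"
      using b(2)[of n] by (simp add: pabs_mult[OF p] mult_left_mono pabs_nonneg[OF p])
    also have "\<dots> < e" using M[of m n] mn b by (simp add: field_simps)
    finally have 2: "pabs p ((X m - X n) * Y n) < e" .
    show ?thesis
      unfolding eq using 1 2 pabs_ultra[OF p, of "X m * (Y m - Y n)" "(X m - X n) * Y n"]
      by linarith
  qed
  then show "\<exists>K. \<forall>m\<ge>K. \<forall>n\<ge>K. pabs p (X m * Y m - X n * Y n) < e" by blast
qed

lemma pcauchy_not_pvanishes:
  assumes "pcauchy p X" "\<not> pvanishes p X"
  obtains b N where "b > 0" "\<And>n. n \<ge> N \<Longrightarrow> b < pabs p (X n)"
proof -
  obtain l where l: "(\<lambda>n. pabs p (X n)) \<longlonglongrightarrow> l"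
    using pcauchy_abs_convergent[OF assms(1)] by (auto simp: convergent_def)
  have "l \<ge> 0" using l by (rule LIMSEQ_le_const) (auto simp: pabs_nonneg[OF p])
  moreover have "l \<noteq> 0" using assms(2) l by (auto simp: pvanishes_def)
  ultimately have l0: "l > 0" by simp
  then have "\<forall>\<^sub>F n in sequentially. l / 2 < pabs p (X n)"
    using l by (intro order_tendstoD) auto
  then show ?thesis using that[of "l / 2"] l0 by (auto simp: eventually_sequentially)
qed

lemma pcauchy_inverse:
  assumes X: "pcauchy p X" "\<not> pvanishes p X"
  shows "pcauchy p (\<lambda>n. inverse (X n))"
  unfolding pcauchy_def
proof (intro allI impI)
  fix e :: real assume e: "e > 0"
  obtain b N where b: "b > 0" "\<And>n. n \<ge> N \<Longrightarrow> b < pabs p (X n)"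
    using pcauchy_not_pvanishes[OF X] by metis
  obtain M where M: "\<And>m n. m \<ge> M \<Longrightarrow> n \<ge> M \<Longrightarrow> pabs p (X m - X n) < e * (b * b)"
    using X(1) e b unfolding pcauchy_def by (meson mult_pos_pos)
  have "pabs p (inverse (X m) - inverse (X n)) < e" if mn: "m \<ge> max M N" "n \<ge> max M N" for m n
  proof -
    have bm: "b < pabs p (X m)" and bn: "b < pabs p (X n)" using b(2) mn by auto
    then have nz: "X m \<noteq> 0" "X n \<noteq> 0" using b(1) by (auto simp: pabs_0[OF p])
    then have "inverse (X m) - inverse (X n) = - ((X m - X n) * inverse (X m * X n))"
      by (simp add: field_simps)
    then have "pabs p (inverse (X m) - inverse (X n)) = pabs p (X m - X n) / (pabs p (X m) * pabs p (X n))"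
      by (simp only: pabs_minus[OF p] pabs_mult[OF p] pabs_inverse[OF p] divide_inverse)
    also have "\<dots> \<le> pabs p (X m - X n) / (b * b)"
      using bm bn b(1) by (intro divide_left_mono mult_mono mult_pos_pos) (auto simp: pabs_nonneg[OF p])
    also have "\<dots> < e" using M[of m n] mn b(1) by (simp add: field_simps)
    finally show ?thesis .
  qed
  then show "\<exists>K. \<forall>m\<ge>K. \<forall>n\<ge>K. pabs p (inverse (X m) - inverse (X n)) < e" by blast
qed

lemma pvanishes_inverse_mult:
  assumes "pcauchy p X" "\<not> pvanishes p X"
  shows "pvanishes p (\<lambda>n. inverse (X n) * X n - 1)"
proof -
  obtain b N where b: "b > 0" "\<And>n. n \<ge> N \<Longrightarrow> b < pabs p (X n)"
    using pcauchy_not_pvanishes[OF assms] by metis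
  have "inverse (X n) * X n - 1 = 0" if "n \<ge> N" for n
    using b(1) b(2)[OF that] by (cases "X n = 0") (auto simp: pabs_0[OF p])
  then have "\<forall>\<^sub>F n in sequentially. 0 = pabs p (inverse (X n) * X n - 1)"
    by (auto simp: eventually_sequentially pabs_0[OF p] intro!: exI[of _ N])
  then show ?thesis unfolding pvanishes_def
    by (rule Lim_transform_eventually[OF tendsto_const])
qed

end

subsection \<open>The completion\<close>

text \<open>The prime is the cardinality of the type argument, so that a type variable of
  class \<^class>\<open>prime_card\<close> stands for an arbitrary prime.\<close>

definition padic_rel :: "'p::prime_card itself \<Rightarrow> (nat \<Rightarrow> rat) \<Rightarrow> (nat \<Rightarrow> rat) \<Rightarrow> bool" where
  "padic_rel _ X Y \<longleftrightarrow> pcauchy CARD('p) X \<and> pcauchy CARD('p) Y \<and> pvanishes CARD('p) (\<lambda>n. X n - Y n)"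

lemma padic_rel_refl: "pcauchy CARD('p) X \<Longrightarrow> padic_rel TYPE('p::prime_card) X X"
  by (simp add: padic_rel_def pvanishes_0 prime_card)

lemma part_equivp_padic_rel: "part_equivp (padic_rel TYPE('p::prime_card))"
proof (rule part_equivpI)
  show "\<exists>X. padic_rel TYPE('p) X X"
    using padic_rel_refl[OF pcauchy_const[OF prime_card]] by blast
  show "symp (padic_rel TYPE('p))"
  proof (rule sympI)
    fix X Y assume "padic_rel TYPE('p) X Y"
    then show "padic_rel TYPE('p) Y X"
      using pvanishes_minus[OF prime_card[where 'a='p], of "\<lambda>n. X n - Y n"]
      by (simp add: padic_rel_def)
  qed
  show "transp (padic_rel TYPE('p))"
  proof (rule transpI)
    fix X Y Z assume "padic_rel TYPE('p) X Y" "padic_rel TYPE('p) Y Z"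
    then show "padic_rel TYPE('p) X Z"
      using pvanishes_add[OF prime_card[where 'a='p], of "\<lambda>n. X n - Y n" "\<lambda>n. Y n - Z n"]
      by (simp add: padic_rel_def)
  qed
qed

typedef 'p padic = "{C. \<exists>X. padic_rel TYPE('p::prime_card) X X \<and> C = Collect (padic_rel TYPE('p) X)}"
  morphisms Rep_padic Abs_padic
  using part_equivp_padic_rel[where 'p='p] unfolding part_equivp_def by blast

definition Padic :: "(nat \<Rightarrow> rat) \<Rightarrow> 'p::prime_card padic" where
  "Padic = quot_type.abs (padic_rel TYPE('p)) Abs_padic"

definition rep_padic :: "'p::prime_card padic \<Rightarrow> nat \<Rightarrow> rat" where
  "rep_padic = quot_type.rep Rep_padic"

definition cr_padic :: "(nat \<Rightarrow> rat) \<Rightarrow> 'p::prime_card padic \<Rightarrow> bool" where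
  "cr_padic = (\<lambda>X x. padic_rel TYPE('p) X X \<and> Padic X = x)"

lemma Quotient_padic:
  "Quotient (padic_rel TYPE('p::prime_card)) Padic rep_padic
     (cr_padic :: (nat \<Rightarrow> rat) \<Rightarrow> 'p padic \<Rightarrow> bool)"
proof -
  let ?Rep = "Rep_padic :: 'p padic \<Rightarrow> _"
  have "quot_type (padic_rel TYPE('p)) Abs_padic ?Rep"
  proof (rule quot_type.intro)
    fix x y :: "'p padic" and C
    show "part_equivp (padic_rel TYPE('p))" by (rule part_equivp_padic_rel)
    show "\<exists>X. padic_rel TYPE('p) X X \<and> Rep_padic x = Collect (padic_rel TYPE('p) X)"
      using Rep_padic[of x] by simp
    show "Abs_padic (Rep_padic x) = x" by (rule Rep_padic_inverse)
    show "(Rep_padic x = Rep_padic y) = (x = y)" by (rule Rep_padic_inject)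
    assume "\<exists>X. padic_rel TYPE('p) X X \<and> C = Collect (padic_rel TYPE('p) X)"
    then show "?Rep (Abs_padic C) = C" by (simp add: Abs_padic_inverse)
  qed
  from quot_type.Quotient[OF this]
  have "Quotient3 (padic_rel TYPE('p)) (Padic :: _ \<Rightarrow> 'p padic) rep_padic"
    by (simp add: Padic_def rep_padic_def)
  then show ?thesis
    by (rule Quotient3_to_Quotient) (simp add: cr_padic_def)
qed

setup_lifting Quotient_padic

instantiation padic :: (prime_card) field
begin

lift_definition zero_padic :: "'a padic" is "\<lambda>n. 0"
  by (intro padic_rel_refl pcauchy_const prime_card)

lift_definition one_padic :: "'a padic" is "\<lambda>n. 1"
  by (intro padic_rel_refl pcauchy_const prime_card)

lift_definition plus_padic :: "'a padic \<Rightarrow> 'a padic \<Rightarrow> 'a padic" is "\<lambda>X Y n. X n + Y n"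
proof -
  fix X X' Y Y' assume "padic_rel TYPE('a) X X'" "padic_rel TYPE('a) Y Y'"
  then show "padic_rel TYPE('a) (\<lambda>n. X n + Y n) (\<lambda>n. X' n + Y' n)"
    using pvanishes_add[OF prime_card[where 'a='a], of "\<lambda>n. X n - X' n" "\<lambda>n. Y n - Y' n"]
    by (simp add: padic_rel_def pcauchy_add prime_card algebra_simps)
qed

lift_definition uminus_padic :: "'a padic \<Rightarrow> 'a padic" is "\<lambda>X n. - X n"
proof -
  fix X X' assume "padic_rel TYPE('a) X X'"
  then show "padic_rel TYPE('a) (\<lambda>n. - X n) (\<lambda>n. - X' n)"
    using pvanishes_minus[OF prime_card[where 'a='a], of "\<lambda>n. X n - X' n"]
    by (simp add: padic_rel_def pcauchy_minus prime_card algebra_simps)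
qed

lift_definition times_padic :: "'a padic \<Rightarrow> 'a padic \<Rightarrow> 'a padic" is "\<lambda>X Y n. X n * Y n"
proof -
  fix X X' Y Y' assume a: "padic_rel TYPE('a) X X'" "padic_rel TYPE('a) Y Y'"
  have "pvanishes CARD('a) (\<lambda>n. X n * (Y n - Y' n) + Y' n * (X n - X' n))"
    using a unfolding padic_rel_def
    by (intro pvanishes_add pvanishes_mult prime_card) auto
  moreover have "(\<lambda>n. X n * (Y n - Y' n) + Y' n * (X n - X' n)) = (\<lambda>n. X n * Y n - X' n * Y' n)"
    by (simp add: algebra_simps)
  ultimately show "padic_rel TYPE('a) (\<lambda>n. X n * Y n) (\<lambda>n. X' n * Y' n)"
    using a by (simp add: padic_rel_def pcauchy_mult prime_card)
qed

lift_definition inverse_padic :: "'a padic \<Rightarrow> 'a padic"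
  is "\<lambda>X. if pvanishes CARD('a) X then (\<lambda>n. 0) else (\<lambda>n. inverse (X n))"
proof -
  fix X Y assume "padic_rel TYPE('a) X Y"
  then have X: "pcauchy CARD('a) X" and Y: "pcauchy CARD('a) Y"
    and XY: "pvanishes CARD('a) (\<lambda>n. X n - Y n)"
    by (simp_all add: padic_rel_def)
  note pc = prime_card[where 'a='a]
  have iff: "pvanishes CARD('a) X \<longleftrightarrow> pvanishes CARD('a) Y"
    using pvanishes_diff[OF pc _ XY, of X] pvanishes_add[OF pc _ XY, of Y] by auto
  show "padic_rel TYPE('a)
      (if pvanishes CARD('a) X then (\<lambda>n. 0) else (\<lambda>n. inverse (X n)))
      (if pvanishes CARD('a) Y then (\<lambda>n. 0) else (\<lambda>n. inverse (Y n)))"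
  proof (cases "pvanishes CARD('a) X")
    case True
    then show ?thesis using iff by (simp add: padic_rel_refl pcauchy_const pc)
  next
    case False
    then have nX: "\<not> pvanishes CARD('a) X" and nY: "\<not> pvanishes CARD('a) Y" using iff by auto
    have iX: "pcauchy CARD('a) (\<lambda>n. inverse (X n))" and iY: "pcauchy CARD('a) (\<lambda>n. inverse (Y n))"
      using pcauchy_inverse[OF pc] X Y nX nY by auto
    have "pvanishes CARD('a) (\<lambda>n. inverse (X n) * (inverse (Y n) * (X n - Y n)))"
      by (intro pvanishes_mult pc iX iY XY)
    then have 1: "pvanishes CARD('a) (\<lambda>n. inverse (Y n) * (inverse (X n) * X n - 1)
        - inverse (X n) * (inverse (Y n) * Y n - 1)
        - inverse (X n) * (inverse (Y n) * (X n - Y n)))"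
      by (intro pvanishes_diff[OF pc] pvanishes_mult[OF pc iY pvanishes_inverse_mult[OF pc X nX]]
          pvanishes_mult[OF pc iX pvanishes_inverse_mult[OF pc Y nY]])
    have "(\<lambda>n. inverse (Y n) * (inverse (X n) * X n - 1)
        - inverse (X n) * (inverse (Y n) * Y n - 1)
        - inverse (X n) * (inverse (Y n) * (X n - Y n))) = (\<lambda>n. inverse (X n) - inverse (Y n))"
      by (simp add: algebra_simps)
    then show ?thesis using False iff iX iY 1 by (simp add: padic_rel_def)
  qed
qed

definition "x - y = x + - y" for x y :: "'a padic"

definition "x div y = x * inverse y" for x y :: "'a padic"

instance
proof
  note pc = prime_card[where 'a='a]
  fix a b c :: "'a padic"
  note [simp] = pcauchy_add[OF pc] pcauchy_mult[OF pc] pcauchy_minus[OF pc]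
    pcauchy_const[OF pc] pvanishes_0[OF pc]
  show "a + b = b + a"
    by transfer (simp add: ac_simps padic_rel_def)
  show "(a + b) + c = a + (b + c)"
    by transfer (simp add: ac_simps padic_rel_def)
  show "0 + a = a"
    by transfer (simp add: padic_rel_def)
  show "- a + a = 0"
    by transfer (simp add: padic_rel_def)
  show "a - b = a + - b"
    by (rule minus_padic_def)
  show "(a * b) * c = a * (b * c)"
    by transfer (simp add: ac_simps padic_rel_def)
  show "a * b = b * a"
    by transfer (simp add: ac_simps padic_rel_def)
  show "1 * a = a"
    by transfer (simp add: padic_rel_def)
  show "(a + b) * c = a * c + b * c"
    by transfer (simp add: distrib_right padic_rel_def)
  show "(0::'a padic) \<noteq> 1"
    by transfer (simp add: padic_rel_def pvanishes_def pabs_minus[OF pc] pabs_1[OF pc] LIMSEQ_const_iff)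
  show "a \<noteq> 0 \<Longrightarrow> inverse a * a = 1"
    by transfer (auto simp: padic_rel_def pcauchy_inverse[OF pc] pvanishes_inverse_mult[OF pc])
  show "a div b = a * inverse b"
    by (rule divide_padic_def)
  show "inverse (0::'a padic) = 0"
    by transfer (simp add: padic_rel_def)
qed

end

subsection \<open>Norm and topology\<close>

lift_definition padic_norm :: "'a::prime_card padic \<Rightarrow> real" is "\<lambda>X. lim (\<lambda>n. pabs CARD('a) (X n))"
proof -
  note pc = prime_card[where 'a='a]
  fix X Y assume "padic_rel TYPE('a) X Y"
  then have X: "pcauchy CARD('a) X" and XY: "pvanishes CARD('a) (\<lambda>n. X n - Y n)"
    by (simp_all add: padic_rel_def)
  obtain l where l: "(\<lambda>n. pabs CARD('a) (X n)) \<longlonglongrightarrow> l"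
    using pcauchy_abs_convergent[OF pc X] by (auto simp: convergent_def)
  have "(\<lambda>n. pabs CARD('a) (Y n) - pabs CARD('a) (X n)) \<longlonglongrightarrow> 0"
  proof (rule Lim_null_comparison)
    show "(\<lambda>n. pabs CARD('a) (X n - Y n)) \<longlonglongrightarrow> 0" using XY by (simp add: pvanishes_def)
    have "\<bar>pabs CARD('a) (Y n) - pabs CARD('a) (X n)\<bar> \<le> pabs CARD('a) (X n - Y n)" for n
      using pabs_reverse_triangle[OF pc, of "X n" "Y n"] by (simp only: abs_minus_commute)
    then show "\<forall>\<^sub>F n in sequentially. norm (pabs CARD('a) (Y n) - pabs CARD('a) (X n)) \<le> pabs CARD('a) (X n - Y n)"
      by (simp only: real_norm_def always_eventually simp_thms)
  qed
  from tendsto_add[OF this l] have "(\<lambda>n. pabs CARD('a) (Y n)) \<longlonglongrightarrow> l" by simp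
  with l show "lim (\<lambda>n. pabs CARD('a) (X n)) = lim (\<lambda>n. pabs CARD('a) (Y n))"
    by (simp add: limI)
qed

lemma padic_norm_tendsto:
  assumes "pcauchy CARD('p) X"
  shows "(\<lambda>n. pabs CARD('p) (X n)) \<longlonglongrightarrow> lim (\<lambda>n. pabs CARD('p::prime_card) (X n))"
  using pcauchy_abs_convergent[OF prime_card assms] by (simp add: convergent_LIMSEQ_iff)

lemma padic_norm_eq_0: "padic_norm (x :: 'p::prime_card padic) = 0 \<longleftrightarrow> x = 0"
proof (transfer, goal_cases)
  case (1 X)
  then have X: "pcauchy CARD('p) X" by (simp add: padic_rel_def)
  show ?case
    using padic_norm_tendsto[OF X] X
    by (auto simp: padic_rel_def pcauchy_const[OF prime_card] pvanishes_def intro: limI)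
qed

lemma padic_norm_ultra: "padic_norm (x + y :: 'p::prime_card padic) \<le> max (padic_norm x) (padic_norm y)"
proof (transfer, goal_cases)
  case (1 X Y)
  then have X: "pcauchy CARD('p) X" and Y: "pcauchy CARD('p) Y" by (simp_all add: padic_rel_def)
  show ?case
    by (rule LIMSEQ_le[OF padic_norm_tendsto[OF pcauchy_add[OF prime_card X Y]]
            tendsto_max[OF padic_norm_tendsto[OF X] padic_norm_tendsto[OF Y]]])
       (auto simp: pabs_ultra prime_card)
qed

lemma padic_norm_mult: "padic_norm (x * y :: 'p::prime_card padic) = padic_norm x * padic_norm y"
proof (transfer, goal_cases)
  case (1 X Y)
  then have X: "pcauchy CARD('p) X" and Y: "pcauchy CARD('p) Y" by (simp_all add: padic_rel_def)
  have "(\<lambda>n. pabs CARD('p) (X n * Y n)) \<longlonglongrightarrow> lim (\<lambda>n. pabs CARD('p) (X n)) * lim (\<lambda>n. pabs CARD('p) (Y n))"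
    using tendsto_mult[OF padic_norm_tendsto[OF X] padic_norm_tendsto[OF Y]]
    by (simp add: pabs_mult prime_card)
  then show ?case by (rule limI)
qed

lemma padic_norm_minus: "padic_norm (- x :: 'p::prime_card padic) = padic_norm x"
  by transfer (simp add: pabs_minus prime_card)

lemma padic_norm_nonneg: "padic_norm (x :: 'p::prime_card padic) \<ge> 0"
proof (transfer, goal_cases)
  case (1 X)
  then have X: "pcauchy CARD('p) X" by (simp add: padic_rel_def)
  show ?case
    by (rule LIMSEQ_le_const[OF padic_norm_tendsto[OF X]]) (auto simp: pabs_nonneg prime_card)
qed

lift_definition padic_of_rat :: "rat \<Rightarrow> 'p::prime_card padic" is "\<lambda>r n. r"
  by (intro padic_rel_refl pcauchy_const prime_card)

lemma padic_norm_of_rat: "padic_norm (padic_of_rat r :: 'p::prime_card padic) = pabs CARD('p) r"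
  by transfer (simp add: limI)

lemma padic_of_rat_of_nat: "padic_of_rat (of_nat k) = (of_nat k :: 'p::prime_card padic)"
proof (induction k)
  case 0
  have "padic_of_rat 0 = (0 :: 'p padic)"
    by transfer (simp add: padic_rel_refl pcauchy_const prime_card)
  then show ?case by simp
next
  case (Suc k)
  have "padic_of_rat (1 + of_nat k) = (1 + padic_of_rat (of_nat k) :: 'p padic)"
    by transfer (simp add: padic_rel_refl pcauchy_const prime_card)
  then show ?case by (simp add: Suc)
qed

lemma padic_norm_prime: "padic_norm (of_nat CARD('p) :: 'p::prime_card padic) = 1 / CARD('p)"
proof -
  have p: "prime CARD('p)" by (rule prime_card)
  have "quotient_of (of_nat CARD('p)) = (int CARD('p), 1)"
    using quotient_of_int[of "int CARD('p)"] by (simp add: of_int_def)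
  then have "padic_val CARD('p) (of_nat CARD('p)) = 1"
    using prime_gt_1_nat[OF p] by (simp add: padic_val_def multiplicity_self)
  then have "pabs CARD('p) (of_nat CARD('p)) = 1 / CARD('p)"
    by (simp add: pabs_def power_int_minus field_simps)
  then show ?thesis by (simp flip: padic_of_rat_of_nat add: padic_norm_of_rat)
qed

instantiation padic :: (prime_card) metric_space
begin

definition dist_padic :: "'a padic \<Rightarrow> 'a padic \<Rightarrow> real" where
  "dist_padic x y = padic_norm (x - y)"

definition uniformity_padic :: "('a padic \<times> 'a padic) filter" where
  "uniformity_padic = (INF e\<in>{0 <..}. principal {(x, y). dist x y < e})"

definition open_padic :: "'a padic set \<Rightarrow> bool" where
  "open_padic U \<longleftrightarrow> (\<forall>x\<in>U. eventually (\<lambda>(x', y). x' = x \<longrightarrow> y \<in> U) uniformity)"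

instance
proof
  fix x y z :: "'a padic" and U :: "'a padic set"
  show "dist x y = 0 \<longleftrightarrow> x = y"
    by (simp add: dist_padic_def padic_norm_eq_0)
  have "padic_norm ((x - z) + (z - y)) \<le> max (padic_norm (x - z)) (padic_norm (z - y))"
    by (rule padic_norm_ultra)
  moreover have "padic_norm (z - y) = padic_norm (y - z)"
    using padic_norm_minus[of "z - y"] by simp
  ultimately show "dist x y \<le> dist x z + dist y z"
    using padic_norm_nonneg[of "x - z"] padic_norm_nonneg[of "y - z"]
    by (simp add: dist_padic_def)
  show "uniformity = (INF e\<in>{0 <..}. principal {(x :: 'a padic, y). dist x y < e})"
    by (rule uniformity_padic_def)
  show "open U \<longleftrightarrow> (\<forall>x\<in>U. \<forall>\<^sub>F (x', y) in uniformity. x' = x \<longrightarrow> y \<in> U)"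
    by (rule open_padic_def)
qed

end

definition padic_ints :: "'p::prime_card padic set" where
  "padic_ints = {x. padic_norm x \<le> 1}"

section \<open>Matrix groups and singular numbers\<close>

text \<open>Rows, columns and list entries are numbered from 0.\<close>

definition GL :: "'a::field set \<Rightarrow> nat \<Rightarrow> 'a mat set" where
  "GL R d = {A \<in> carrier_mat d d. elements_mat A \<subseteq> R \<and>
     (\<exists>B \<in> carrier_mat d d. elements_mat B \<subseteq> R \<and> A * B = 1\<^sub>m d \<and> B * A = 1\<^sub>m d)}"

definition antidiag :: "nat \<Rightarrow> 'a::field mat" where
  "antidiag n = mat n n (\<lambda>(i, j). if i + j + 1 = n then 1 else 0)"

definition symplectic_form :: "nat \<Rightarrow> 'a::field \<Rightarrow> 'a mat" where
  "symplectic_form n c =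
     four_block_mat (0\<^sub>m n n) (c \<cdot>\<^sub>m antidiag n) (- (c \<cdot>\<^sub>m antidiag n)) (0\<^sub>m n n)"

definition GSp_Qp :: "nat \<Rightarrow> 'p::prime_card padic mat set" where
  "GSp_Qp n = {A \<in> GL UNIV (2 * n).
     \<exists>\<mu>. \<mu> \<noteq> 0 \<and> A * symplectic_form n 1 * transpose_mat A = symplectic_form n \<mu>}"

definition GSp_Zp :: "nat \<Rightarrow> 'p::prime_card padic mat set" where
  "GSp_Zp n = GSp_Qp n \<inter> GL padic_ints (2 * n)"

definition diag_ppow :: "nat \<Rightarrow> nat \<Rightarrow> int list \<Rightarrow> 'p::prime_card padic mat" where
  "diag_ppow r m l = mat r m (\<lambda>(i, j). if i = j then of_nat CARD('p) powi (l ! i) else 0)"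

definition SN :: "'p::prime_card padic mat \<Rightarrow> int list" where
  "SN B = (THE l. length l = dim_row B \<and> sorted_wrt (\<ge>) l \<and>
     (\<exists>U \<in> GL padic_ints (dim_row B). \<exists>V \<in> GL padic_ints (dim_col B).
        B = U * diag_ppow (dim_row B) (dim_col B) l * V))"

definition SN_GSp :: "nat \<Rightarrow> 'p::prime_card padic mat \<Rightarrow> int list" where
  "SN_GSp n A = (THE l. length l = 2 * n \<and> sorted_wrt (\<ge>) l \<and>
     (\<forall>i<n. l ! i + l ! (2 * n - 1 - i) = l ! 0 + l ! (2 * n - 1)) \<and>
     (\<exists>U \<in> GSp_Zp n. \<exists>V \<in> GSp_Zp n. A = U * diag_ppow (2 * n) (2 * n) l * V))"

definition last_rows :: "nat \<Rightarrow> 'a mat \<Rightarrow> 'a mat" where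
  "last_rows r A = mat r (dim_col A) (\<lambda>(i, j). A $$ (dim_row A - r + i, j))"

fun mat_prod :: "nat \<Rightarrow> (nat \<Rightarrow> 'a::field mat) \<Rightarrow> nat \<Rightarrow> 'a mat" where
  "mat_prod d A 0 = 1\<^sub>m d"
| "mat_prod d A (Suc k) = mat_prod d A k * A (Suc k)"

section \<open>Probabilistic notions\<close>

text \<open>The Borel sigma-algebra on matrices: that of the space of families of entries.\<close>

definition borel_mat :: "nat \<Rightarrow> nat \<Rightarrow> 'a::topological_space mat measure" where
  "borel_mat r m = vimage_algebra (carrier_mat r m)
     (\<lambda>A. \<lambda>ij\<in>{..<r} \<times> {..<m}. A $$ ij) (Pi\<^sub>M ({..<r} \<times> {..<m}) (\<lambda>_. borel))"

definition borel_GSp :: "nat \<Rightarrow> 'p::prime_card padic mat measure" where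
  "borel_GSp n = restrict_space (borel_mat (2 * n) (2 * n)) (GSp_Qp n)"

definition covariance :: "'w measure \<Rightarrow> ('w \<Rightarrow> real) \<Rightarrow> ('w \<Rightarrow> real) \<Rightarrow> real" where
  "covariance M X Y = (\<integral>w. (X w - (\<integral>v. X v \<partial>M)) * (Y w - (\<integral>v. Y v \<partial>M)) \<partial>M)"

text \<open>Vectors in $\mathbb{R}^d$ are extensional functions on \<open>{..<d}\<close>.\<close>

abbreviation borel_R :: "nat \<Rightarrow> (nat \<Rightarrow> real) measure" where
  "borel_R d \<equiv> Pi\<^sub>M {..<d} (\<lambda>_. borel)"

text \<open>The possibly degenerate Gaussian law $N(0,C)$, given by its characteristic function
  $\exp(-t^T C t / 2)$.\<close>

definition centered_gaussian :: "nat \<Rightarrow> real mat \<Rightarrow> (nat \<Rightarrow> real) measure \<Rightarrow> bool" where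
  "centered_gaussian d C G \<longleftrightarrow> prob_space G \<and> sets G = sets (borel_R d) \<and>
     (\<forall>t :: nat \<Rightarrow> real. (\<integral>x. iexp (\<Sum>i<d. t i * x i) \<partial>G)
        = of_real (exp (- (\<Sum>i<d. \<Sum>j<d. t i * C $$ (i, j) * t j) / 2)))"

definition weak_conv_R :: "nat \<Rightarrow> (nat \<Rightarrow> (nat \<Rightarrow> real) measure) \<Rightarrow> (nat \<Rightarrow> real) measure \<Rightarrow> bool" where
  "weak_conv_R d \<mu> \<nu> \<longleftrightarrow> (\<forall>f :: (nat \<Rightarrow> real) \<Rightarrow> real.
     continuous_map (powertop_real {..<d}) euclideanreal f \<and>
     bounded (f ` topspace (powertop_real {..<d})) \<longrightarrow>
     (\<lambda>k. \<integral>x. f x \<partial>\<mu> k) \<longlonglongrightarrow> (\<integral>x. f x \<partial>\<nu>))"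

end

theory Submission
  imports Defs "Jordan_Normal_Form.Determinant"
begin

text \<open>
  Write $K = \mathrm{GSp}_{2n}(\mathbb{Z}_p)$ and let $w_r(A)$ be the sum of the singular numbers of
  the last $r$ rows of $A$, so that $p^{-w_r(A)}$ is the largest norm of an $r \times r$ minor of these
  rows. By the Iwasawa decomposition $A = T k$ with $T$ upper triangular and $k \in K$, one has
  $w_r(A N) = w_r(A) + w_r(k N)$, and $k$ depends on $A$ only. If $N$ is independent of $A$ and left
  $K$-invariant, then $w_r(k N)$ is independent of $A$ and has the law of $w_r(N)$; hence for every
  $u \in K$ the vectors $(w_r(u A_1 \cdots A_k))_r$ form a random walk with i.i.d. increments
  distributed as $(w_r(A_1))_r$, to which the classical limit theorems apply.

  The sum $s_r(A)$ of the $r$ smallest singular numbers of $A$ satisfies $s_r(A) \le w_r(u A)$ for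
  all $u \in K$. Conversely $w_r(u A) \le s_r(A) + C$ outside a small set of $u$: with $A = U D V$,
  the difference is controlled by the norms of the corner minors of $u U$, and when $u$ is written as
  a product of $2n$ symplectic transvections their product is a polynomial of bounded degree in the
  parameters of $u$ which takes a value of norm 1. Finitely many $u$ suffice for this estimate
  uniformly in $A$, so the limit theorems pass from $w_r$ to $s_r$, and the singular numbers are the
  differences of the $s_r$.
\<close>

section \<open>The strong law of large numbers\<close>

text \<open>The singular numbers are invariant under \<open>GSp_Zp\<close> on both sides but not
  additive along the product; the weights of the last rows form a cocycle but change under left
  multiplication. The comparison of the two has to be uniform in the matrix, since in the Cartan
  form of the k-step product the left factor \<open>U\<close> is a random matrix about which nothing
  is known. This is why the genericity estimate concerns a polynomial whose degree depends on
  \<open>n\<close> only and which, for every \<open>U\<close>, reaches norm 1 at some integral point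
  depending on \<open>U\<close>. Haar measure on the compact group is replaced by counting on a
  finite grid of integer parameters: for each single matrix only a fraction \<epsilon> of the grid
  is bad, and integrating this count bounds the average over the grid of the probabilities of the
  bad events. For the strong law any \<epsilon> < 1 suffices, because it leaves one good translate
  at every time; for the central limit theorem \<epsilon> tends to 0 with the error. Arbitrary
  linear combinations of the weights are treated throughout, which gives the joint law in the manner
  of Cramer and Wold.\<close>

fun max_psum :: "nat \<Rightarrow> (nat \<Rightarrow> real) \<Rightarrow> real" where
  "max_psum 0 x = 0"
| "max_psum (Suc k) x = max 0 (x 0 + max_psum k (\<lambda>i. x (Suc i)))"

lemma max_psum_nonneg: "max_psum k x \<ge> 0"
  by (cases k) auto

text \<open>\<open>max_psum k x\<close> is the largest partial sum of at most \<open>k\<close>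
  terms, the empty sum included. Its recursion splits off the first term, not the last, so that the
  shifted sequence appears in it; the stationarity argument below compares exactly these
  two.\<close>

lemma max_psum_mono: "max_psum k x \<le> max_psum (Suc k) x"
proof (induction k arbitrary: x)
  case (Suc k)
  from Suc[of "\<lambda>i. x (Suc i)"] show ?case by (simp add: max_def)
qed simp

lemma psum_le_max_psum: "j \<le> k \<Longrightarrow> (\<Sum>i<j. x i) \<le> max_psum k x"
proof (induction k arbitrary: j x)
  case (Suc k)
  show ?case
  proof (cases j)
    case (Suc j')
    have "(\<Sum>i<j. x i) = x 0 + (\<Sum>i<j'. x (Suc i))"
      unfolding Suc by (rule sum.lessThan_Suc_shift)
    also have "\<dots> \<le> x 0 + max_psum k (\<lambda>i. x (Suc i))"
      using Suc.IH[of j' "\<lambda>i. x (Suc i)"] Suc.prems Suc by simp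
    finally show ?thesis by simp
  qed simp
qed simp

lemma max_psum_le_sum_abs: "max_psum k x \<le> (\<Sum>i<k. \<bar>x i\<bar>)"
proof (induction k arbitrary: x)
  case (Suc k)
  have "(\<Sum>i<Suc k. \<bar>x i\<bar>) = \<bar>x 0\<bar> + (\<Sum>i<k. \<bar>x (Suc i)\<bar>)"
    by (rule sum.lessThan_Suc_shift)
  moreover have "0 \<le> (\<Sum>i<k. \<bar>x (Suc i)\<bar>)" by (rule sum_nonneg) simp
  ultimately show ?case using Suc[of "\<lambda>i. x (Suc i)"] by (simp only: max_psum.simps)
qed simp

lemma measurable_max_psum [measurable]:
  "max_psum k \<in> borel_measurable (Pi\<^sub>M UNIV (\<lambda>_. borel))"
proof (induction k)
  case (Suc k)
  note [measurable] = Suc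
  have [measurable]: "(\<lambda>x i. x (Suc i)) \<in> Pi\<^sub>M UNIV (\<lambda>_. borel) \<rightarrow>\<^sub>M Pi\<^sub>M UNIV (\<lambda>_. borel :: real measure)"
    by (rule measurable_PiM_single') (auto simp: space_PiM)
  show ?case by simp
qed simp

context prob_space
begin

text \<open>Stationarity of an i.i.d. sequence: independence passes to the shifted family, so both
  laws are products of their marginals, and these coincide.\<close>

lemma iid_sequence_distr:
  fixes X :: "nat \<Rightarrow> 'a \<Rightarrow> real"
  assumes indep: "indep_vars (\<lambda>_. borel) X UNIV"
    and id: "\<And>j. distr M borel (X j) = distr M borel (X 0)"
  shows "distr M (Pi\<^sub>M UNIV (\<lambda>_. borel)) (\<lambda>w j. X (Suc j) w)
       = distr M (Pi\<^sub>M UNIV (\<lambda>_. borel)) (\<lambda>w j. X j w)"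
proof -
  have rv: "X j \<in> M \<rightarrow>\<^sub>M borel" for j using indep by (auto simp: indep_vars_def)
  have indep': "indep_vars (\<lambda>_. borel) (\<lambda>j. X (Suc j)) UNIV"
  proof -
    let ?F = "\<lambda>i. {X i -` A \<inter> space M |A. A \<in> sets borel}"
    have F: "indep_sets ?F UNIV" using indep by (simp add: indep_vars_def2)
    have "indep_sets (\<lambda>i. ?F (Suc i)) UNIV"
    proof (rule indep_setsI)
      show "?F (Suc i) \<subseteq> events" for i using F by (auto simp: indep_sets_def)
      fix A :: "nat \<Rightarrow> 'a set" and J :: "nat set"
      assume J: "J \<noteq> {}" "finite J" and A: "\<forall>j\<in>J. A j \<in> ?F (Suc j)"
      have "prob (\<Inter>j\<in>Suc ` J. A (j - 1)) = (\<Prod>j\<in>Suc ` J. prob (A (j - 1)))"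
        using J A by (intro indep_setsD[OF F]) auto
      then show "prob (\<Inter>j\<in>J. A j) = (\<Prod>j\<in>J. prob (A j))"
        by (simp add: prod.reindex)
    qed
    then show ?thesis using rv by (simp add: indep_vars_def2)
  qed
  have 1: "distr M (Pi\<^sub>M UNIV (\<lambda>_. borel)) (\<lambda>w. \<lambda>j\<in>UNIV. X j w) = Pi\<^sub>M UNIV (\<lambda>j. distr M borel (X j))"
    using indep rv by (subst indep_vars_iff_distr_eq_PiM[symmetric]) auto
  have 2: "distr M (Pi\<^sub>M UNIV (\<lambda>_. borel)) (\<lambda>w. \<lambda>j\<in>UNIV. X (Suc j) w) = Pi\<^sub>M UNIV (\<lambda>j. distr M borel (X (Suc j)))"
    using indep' rv by (subst indep_vars_iff_distr_eq_PiM[symmetric]) auto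
  have "(\<lambda>j. distr M borel (X (Suc j))) = (\<lambda>j. distr M borel (X j))"
    by (rule ext) (rule trans[OF id id[symmetric]])
  then show ?thesis using 1 2 by (simp add: restrict_UNIV)
qed

text \<open>With \<open>m\<close> the maximal partial sum and \<open>\<theta>\<close> the shift, \<open>m\<^sub>k\<^sub>+\<^sub>1 - m\<^sub>k \<circ> \<theta> = max (- m\<^sub>k \<circ> \<theta>) X\<^sub>0\<close>
  has nonnegative mean by stationarity; if the partial sums were unbounded with positive probability,
  hence almost surely by the 0-1 law, it would converge to \<open>X\<^sub>0\<close> by dominated convergence.\<close>

lemma psum_bounded_above_if_mean_neg:
  fixes X :: "nat \<Rightarrow> 'a \<Rightarrow> real"
  assumes indep: "indep_vars (\<lambda>_. borel) X UNIV"
    and id: "\<And>j. distr M borel (X j) = distr M borel (X 0)"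
    and int: "integrable M (X 0)" and neg: "expectation (X 0) < 0"
  shows "AE w in M. \<exists>B. \<forall>k. (\<Sum>j<k. X j w) \<le> B"
proof -
  have rv [measurable]: "X j \<in> M \<rightarrow>\<^sub>M borel" for j using indep by (auto simp: indep_vars_def)
  have intj: "integrable M (X j)" for j
  proof -
    have "integrable (distr M borel (X i)) (\<lambda>x. x) \<longleftrightarrow> integrable M (X i)" for i
      by (rule integrable_distr_eq) auto
    then show ?thesis using int id[of j] by metis
  qed
  \<comment> \<open>The event that the partial sums are unbounded above. The bounds range over the
    naturals, which makes it a countable combination of events.\<close>
  define D where "D = {w\<in>space M. \<forall>B::nat. \<exists>k. (\<Sum>j<k. X j w) > real B}"
  define A where "A = (\<lambda>j. {X j -` B \<inter> space M | B. B \<in> sets borel})"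
  have "D \<in> tail_events A"
    unfolding tail_events_def
  proof
    fix n
    define N where "N = sigma (space M) (\<Union> (A ` {n..}))"
    have sub: "\<Union> (A ` {n..}) \<subseteq> Pow (space M)" by (auto simp: A_def)
    have [simp]: "space N = space M" and setsN: "sets N = sigma_sets (space M) (\<Union> (A ` {n..}))"
      using sub by (auto simp: N_def)
    have XN: "X j \<in> N \<rightarrow>\<^sub>M borel" if "j \<ge> n" for j
      using that by (intro measurableI) (force simp: setsN A_def intro: sigma_sets.Basic)+
    have "D = {w\<in>space N. \<forall>B::nat. \<exists>k. (\<Sum>j\<in>{n..<k}. X j w) > real B}"
    proof -
      \<comment> \<open>Omitting the first \<open>n\<close> terms changes a partial sum by at most
        \<open>c\<close>, which does not affect unboundedness; hence \<open>D\<close> is a tail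
        event.\<close>
      have "(\<forall>B::nat. \<exists>k. (\<Sum>j<k. X j w) > real B) \<longleftrightarrow> (\<forall>B::nat. \<exists>k. (\<Sum>j\<in>{n..<k}. X j w) > real B)" for w
      proof -
        define c where "c = (\<Sum>j<n. \<bar>X j w\<bar>)"
        have split: "(\<Sum>j<k. X j w) = (\<Sum>j<n. X j w) + (\<Sum>j\<in>{n..<k}. X j w)" if "k \<ge> n" for k
          using sum.atLeastLessThan_concat[of 0 n k "\<lambda>j. X j w"] that by (simp add: atLeast0LessThan)
        have bd: "\<bar>\<Sum>j<k. X j w\<bar> \<le> c" if "k \<le> n" for k
        proof -
          have "\<bar>\<Sum>j<k. X j w\<bar> \<le> (\<Sum>j<k. \<bar>X j w\<bar>)" by (rule sum_abs)
          also have "\<dots> \<le> c" unfolding c_def using that by (intro sum_mono2) auto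
          finally show ?thesis .
        qed
        have c0: "c \<ge> 0" unfolding c_def by (rule sum_nonneg) simp
        obtain C :: nat where C: "c \<le> real C" using real_arch_simple by blast
        show ?thesis
        proof (intro iffI allI)
          fix B :: nat
          assume "\<forall>B::nat. \<exists>k. (\<Sum>j<k. X j w) > real B"
          then obtain k where k: "(\<Sum>j<k. X j w) > real (B + C)" by blast
          show "\<exists>k. (\<Sum>j\<in>{n..<k}. X j w) > real B"
          proof (cases "k \<le> n")
            case True then show ?thesis using bd[of k] k C by auto
          next
            case False
            then show ?thesis using split[of k] bd[of n] k C by (intro exI[of _ k]) auto
          qed
        next
          fix B :: nat
          assume "\<forall>B::nat. \<exists>k. (\<Sum>j\<in>{n..<k}. X j w) > real B"
          then obtain k where k: "(\<Sum>j\<in>{n..<k}. X j w) > real (B + C)" by blast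
          have "k \<ge> n" using k by (cases "k \<ge> n") auto
          then show "\<exists>k. (\<Sum>j<k. X j w) > real B"
            using split[of k] bd[of n] k C by (intro exI[of _ k]) auto
        qed
      qed
      then show ?thesis by (simp add: D_def)
    qed
    also have "\<dots> \<in> sets N"
    proof -
      have [measurable]: "(\<lambda>w. \<Sum>j\<in>{n..<k}. X j w) \<in> borel_measurable N" for k
        by (rule borel_measurable_sum) (auto intro: XN)
      show ?thesis by measurable
    qed
    finally show "D \<in> sigma_sets (space M) (\<Union> (A ` {n..}))" by (simp add: setsN)
  qed
  moreover have "sigma_algebra (space M) (A j)" for j
    using sets.sigma_algebra_axioms[of "vimage_algebra (space M) (X j) borel"]
    by (simp add: A_def sets_vimage_algebra2)
  moreover have "indep_sets A UNIV"
    using indep unfolding indep_vars_def2 A_def by auto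
  ultimately have D01: "prob D = 0 \<or> prob D = 1" by (intro kolmogorov_0_1_law[of A]) auto
  have Dm [measurable]: "D \<in> events" unfolding D_def by measurable
  have "prob D \<noteq> 1"
  proof
    assume "prob D = 1"
    then have AE_D: "AE w in M. w \<in> D" by (simp add: prob_eq_1)
    define m where "m = (\<lambda>k w. max_psum k (\<lambda>j. X (Suc j) w))"
    define m0 where "m0 = (\<lambda>k w. max_psum k (\<lambda>j. X j w))"
    have [measurable]: "(\<lambda>w j. X j w) \<in> M \<rightarrow>\<^sub>M Pi\<^sub>M UNIV (\<lambda>_. borel)"
      "(\<lambda>w j. X (Suc j) w) \<in> M \<rightarrow>\<^sub>M Pi\<^sub>M UNIV (\<lambda>_. borel)"
      by (auto intro!: measurable_PiM_single' simp: space_PiM)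
    have mm [measurable]: "m k \<in> borel_measurable M" "m0 k \<in> borel_measurable M" for k
      unfolding m_def m0_def by measurable
    have int0: "integrable M (m0 k)" for k
    proof (rule Bochner_Integration.integrable_bound)
      show "integrable M (\<lambda>w. \<Sum>i<k. \<bar>X i w\<bar>)" using intj by auto
      show "AE w in M. norm (m0 k w) \<le> norm (\<Sum>i<k. \<bar>X i w\<bar>)"
      proof (rule AE_I2)
        fix w
        show "norm (m0 k w) \<le> norm (\<Sum>i<k. \<bar>X i w\<bar>)"
          using max_psum_le_sum_abs[of k "\<lambda>j. X j w"] max_psum_nonneg[of k "\<lambda>j. X j w"]
          by (simp add: m0_def)
      qed
    qed measurable
    have int1: "integrable M (m k)" for k
    proof (rule Bochner_Integration.integrable_bound)
      show "integrable M (\<lambda>w. \<Sum>i<k. \<bar>X (Suc i) w\<bar>)" using intj by auto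
      show "AE w in M. norm (m k w) \<le> norm (\<Sum>i<k. \<bar>X (Suc i) w\<bar>)"
      proof (rule AE_I2)
        fix w
        show "norm (m k w) \<le> norm (\<Sum>i<k. \<bar>X (Suc i) w\<bar>)"
          using max_psum_le_sum_abs[of k "\<lambda>j. X (Suc j) w"] max_psum_nonneg[of k "\<lambda>j. X (Suc j) w"]
          by (simp add: m_def)
      qed
    qed measurable
    have eq: "expectation (m k) = expectation (m0 k)" for k
    proof -
      have "expectation (m k) = (\<integral>x. max_psum k x \<partial>distr M (Pi\<^sub>M UNIV (\<lambda>_. borel)) (\<lambda>w j. X (Suc j) w))"
        unfolding m_def by (subst integral_distr) auto
      also have "\<dots> = expectation (m0 k)"
        unfolding iid_sequence_distr[OF indep id] m0_def by (subst integral_distr) auto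
      finally show ?thesis .
    qed
    define h where "h = (\<lambda>k w. max (- m k w) (X 0 w))"
    have h: "h k w = m0 (Suc k) w - m k w" for k w
      by (simp add: h_def m0_def m_def max_def)
    have pos: "expectation (h k) \<ge> 0" for k
    proof -
      have "expectation (h k) = expectation (m0 (Suc k)) - expectation (m0 k)"
        unfolding h by (subst Bochner_Integration.integral_diff[OF int0 int1]) (simp only: eq)
      moreover have "expectation (m0 k) \<le> expectation (m0 (Suc k))"
        unfolding m0_def by (rule integral_mono[OF int0[unfolded m0_def] int0[unfolded m0_def] max_psum_mono])
      ultimately show ?thesis by simp
    qed
    have "(\<lambda>k. expectation (h k)) \<longlonglongrightarrow> expectation (X 0)"
    proof (rule integral_dominated_convergence)
      show "integrable M (\<lambda>w. \<bar>X 0 w\<bar>)" using int by simp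
      show "AE w in M. norm (h k w) \<le> \<bar>X 0 w\<bar>" for k
      proof (rule AE_I2)
        fix w
        have "0 \<le> m k w" unfolding m_def by (rule max_psum_nonneg)
        then show "norm (h k w) \<le> \<bar>X 0 w\<bar>" unfolding h_def by (auto simp: max_def)
      qed
      show "AE w in M. (\<lambda>k. h k w) \<longlonglongrightarrow> X 0 w"
        using AE_D
      proof eventually_elim
        case (elim w)
        \<comment> \<open>Once a partial sum exceeds \<open>2 * B\<close>, a shifted one exceeds
          \<open>B\<close>, so \<open>- m k w < X 0 w\<close> and \<open>h k w\<close> equals
          \<open>X 0 w\<close> from then on.\<close>
        obtain B :: nat where B: "\<bar>X 0 w\<bar> \<le> real B" using real_arch_simple by blast
        from elim obtain k0 where k0: "(\<Sum>j<k0. X j w) > real (2 * B)" unfolding D_def by blast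
        then obtain k1 where k1: "k0 = Suc k1" by (cases k0) auto
        have "(\<Sum>j<k0. X j w) = X 0 w + (\<Sum>j<k1. X (Suc j) w)"
          unfolding k1 by (rule sum.lessThan_Suc_shift)
        then have "(\<Sum>j<k1. X (Suc j) w) > real B" using k0 B by simp
        then have "h k w = X 0 w" if "k \<ge> k1" for k
          using psum_le_max_psum[OF that, of "\<lambda>j. X (Suc j) w"] B unfolding h_def m_def by simp
        then have "\<forall>\<^sub>F k in sequentially. X 0 w = h k w"
          by (auto simp: eventually_sequentially intro!: exI[of _ k1])
        then show ?case by (rule Lim_transform_eventually[OF tendsto_const])
      qed
    qed (auto simp: h_def)
    then have "expectation (X 0) \<ge> 0"
      using pos by (intro LIMSEQ_le_const) auto
    with neg show False by simp
  qed
  with D01 have "prob D = 0" by simp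
  then have "AE w in M. w \<notin> D" by (simp add: prob_eq_0)
  then show ?thesis
  proof (rule AE_mp, intro AE_I2 impI)
    fix w assume "w \<in> space M" "w \<notin> D"
    then obtain B :: nat where "\<not> (\<exists>k. (\<Sum>j<k. X j w) > real B)" by (auto simp: D_def)
    then show "\<exists>B. \<forall>k. (\<Sum>j<k. X j w) \<le> B" by (auto simp: not_less)
  qed
qed

text \<open>Subtracting slightly more than the mean makes the mean negative, so the partial sums
  become almost surely bounded above, and division by \<open>k\<close> removes the bound. Only the
  countably many margins \<open>1 / real (Suc m)\<close> are used, so one null set serves them
  all.\<close>

lemma limsup_mean_le:
  fixes X :: "nat \<Rightarrow> 'a \<Rightarrow> real"
  assumes indep: "indep_vars (\<lambda>_. borel) X UNIV"
    and id: "\<And>j. distr M borel (X j) = distr M borel (X 0)"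
    and int: "integrable M (X 0)"
  shows "AE w in M. \<forall>e>0. \<forall>\<^sub>F k in sequentially. (\<Sum>j<k. X j w) / real k < expectation (X 0) + e"
proof -
  have rv [measurable]: "X j \<in> M \<rightarrow>\<^sub>M borel" for j using indep by (auto simp: indep_vars_def)
  let ?E = "expectation (X 0)"
  have "AE w in M. \<exists>B. \<forall>k. (\<Sum>j<k. X j w - (?E + 1 / real (Suc m))) \<le> B" for m :: nat
  proof (rule psum_bounded_above_if_mean_neg[of "\<lambda>j w. X j w - (?E + 1 / real (Suc m))"])
    show "indep_vars (\<lambda>_. borel) (\<lambda>j w. X j w - (?E + 1 / real (Suc m))) UNIV"
      by (rule indep_vars_compose2[OF indep]) auto
    show "distr M borel (\<lambda>w. X j w - (?E + 1 / real (Suc m))) = distr M borel (\<lambda>w. X 0 w - (?E + 1 / real (Suc m)))" for j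
    proof -
      have "distr M borel (\<lambda>w. X i w - (?E + 1 / real (Suc m)))
          = distr (distr M borel (X i)) borel (\<lambda>x. x - (?E + 1 / real (Suc m)))" for i
        by (subst distr_distr) (auto simp: comp_def)
      then show ?thesis by (simp only: id[of j])
    qed
  qed (use int in \<open>auto simp: prob_space\<close>)
  then have "AE w in M. \<forall>m::nat. \<exists>B. \<forall>k. (\<Sum>j<k. X j w - (?E + 1 / real (Suc m))) \<le> B"
    by (simp add: AE_all_countable)
  then show ?thesis
  proof eventually_elim
    case (elim w)
    show ?case
    proof (intro allI impI)
      fix e :: real assume e: "e > 0"
      then obtain m :: nat where m: "1 / real (Suc m) < e / 2"
        using nat_approx_posE[of "e/2"] by auto
      from elim obtain B where B: "\<And>k. (\<Sum>j<k. X j w - (?E + 1 / real (Suc m))) \<le> B" by blast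
      have "\<forall>\<^sub>F k in sequentially. B / real k < e / 2"
      proof (rule order_tendstoD)
        show "(\<lambda>k. B / real k) \<longlonglongrightarrow> 0" by (rule lim_const_over_n)
      qed (use e in simp)
      then show "\<forall>\<^sub>F k in sequentially. (\<Sum>j<k. X j w) / real k < ?E + e"
        using eventually_gt_at_top[of 0]
      proof eventually_elim
        case (elim k)
        have "(\<Sum>j<k. X j w) \<le> B + real k * (?E + 1 / real (Suc m))"
          using B[of k] by (simp add: sum_subtractf)
        then have "(\<Sum>j<k. X j w) / real k \<le> (B + real k * (?E + 1 / real (Suc m))) / real k"
          using elim by (intro divide_right_mono) auto
        also have "\<dots> = B / real k + (?E + 1 / real (Suc m))"
          using elim by (simp add: add_divide_distrib)
        also have "\<dots> < ?E + e" using elim m by linarith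
        finally show ?case .
      qed
    qed
  qed
qed

text \<open>The upper bound for \<open>X\<close> and the one for its negative enclose the
  limit.\<close>

theorem strong_law_of_large_numbers:
  fixes X :: "nat \<Rightarrow> 'a \<Rightarrow> real"
  assumes indep: "indep_vars (\<lambda>_. borel) X UNIV"
    and id: "\<And>j. distr M borel (X j) = distr M borel (X 0)"
    and int: "integrable M (X 0)"
  shows "AE w in M. (\<lambda>k. (\<Sum>j<k. X j w) / real k) \<longlonglongrightarrow> expectation (X 0)"
proof -
  have rv [measurable]: "X j \<in> M \<rightarrow>\<^sub>M borel" for j using indep by (auto simp: indep_vars_def)
  have "AE w in M. \<forall>e>0. \<forall>\<^sub>F k in sequentially. (\<Sum>j<k. - X j w) / real k < expectation (\<lambda>w. - X 0 w) + e"
  proof (rule limsup_mean_le[of "\<lambda>j w. - X j w"])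
    show "indep_vars (\<lambda>_. borel) (\<lambda>j w. - X j w) UNIV"
      by (rule indep_vars_compose2[OF indep]) auto
    show "distr M borel (\<lambda>w. - X j w) = distr M borel (\<lambda>w. - X 0 w)" for j
    proof -
      have "distr M borel (\<lambda>w. - X i w) = distr (distr M borel (X i)) borel (\<lambda>x. - x)" for i
        by (subst distr_distr) (auto simp: comp_def)
      then show ?thesis by (simp only: id[of j])
    qed
    show "integrable M (\<lambda>w. - X 0 w)" using int by (rule Bochner_Integration.integrable_minus)
  qed
  with limsup_mean_le[OF assms] show ?thesis
  proof eventually_elim
    case (elim w)
    show ?case
    proof (rule order_tendstoI)
      fix a assume "a < expectation (X 0)"
      with elim(2)[rule_format, of "expectation (X 0) - a"]
      show "\<forall>\<^sub>F k in sequentially. a < (\<Sum>j<k. X j w) / real k"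
        by (simp add: sum_negf)
    next
      fix a assume "expectation (X 0) < a"
      with elim(1)[rule_format, of "a - expectation (X 0)"]
      show "\<forall>\<^sub>F k in sequentially. (\<Sum>j<k. X j w) / real k < a" by simp
    qed
  qed
qed

end

section \<open>Weak convergence to Gaussian laws in several dimensions\<close>

text \<open>Cholesky factorisation by elimination of the last coordinate. If the corner entry
  \<open>c\<close> is positive, the Schur complement is again positive semidefinite and one column
  is added to its factor; if \<open>c\<close> is 0, the last row and column vanish.\<close>

lemma psd_factorization:
  fixes C :: "nat \<Rightarrow> nat \<Rightarrow> real"
  assumes sym: "\<And>i j. i < d \<Longrightarrow> j < d \<Longrightarrow> C i j = C j i"
    and psd: "\<And>t. 0 \<le> (\<Sum>i<d. \<Sum>j<d. t i * C i j * t j)"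
  shows "\<exists>B. \<forall>i<d. \<forall>j<d. C i j = (\<Sum>k<d. B i k * B j k)"
  using assms
proof (induction d arbitrary: C)
  case (Suc d)
  define q where "q = (\<lambda>t. \<Sum>i<d. \<Sum>j<d. t i * C i j * t j)"
  define l where "l = (\<lambda>t. \<Sum>i<d. t i * C i d)"
  define c where "c = C d d"
  \<comment> \<open>The quadratic form at the vector \<open>t\<close> with last coordinate set to
    \<open>x\<close>.\<close>
  have Q: "0 \<le> q t + 2 * x * l t + x\<^sup>2 * c" for t x
  proof -
    let ?t = "t(d := x)"
    have "(\<Sum>i<Suc d. \<Sum>j<Suc d. ?t i * C i j * ?t j)
        = (\<Sum>i<d. (\<Sum>j<d. t i * C i j * t j) + t i * C i d * x)
          + ((\<Sum>j<d. x * C d j * t j) + x * c * x)"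
      by (simp add: c_def)
    also have "(\<Sum>j<d. x * C d j * t j) = x * l t"
      unfolding l_def sum_distrib_left using Suc.prems(1) by (intro sum.cong) auto
    also have "(\<Sum>i<d. (\<Sum>j<d. t i * C i j * t j) + t i * C i d * x) = q t + x * l t"
      by (simp add: q_def l_def sum.distrib sum_distrib_left mult_ac)
    finally show ?thesis using Suc.prems(2)[of ?t] by (simp add: power2_eq_square algebra_simps)
  qed
  have l_delta: "l (\<lambda>k. if k = i then 1 else 0) = C i d" if "i < d" for i
    using that by (simp add: l_def if_distrib[of "\<lambda>x. x * _"] sum.delta cong: if_cong)
  have c0: "c \<ge> 0" using Q[of "\<lambda>_. 0" 1] by (simp add: q_def l_def)
  show ?case
  proof (cases "c = 0")
    case True
    have l0: "l t = 0" for t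
    proof (rule ccontr)
      assume "l t \<noteq> 0"
      \<comment> \<open>With \<open>c = 0\<close> the form is affine in \<open>x\<close>, so a
        nonzero slope would let it take the value -1.\<close>
      then have "q t + 2 * (- (q t + 1) / (2 * l t)) * l t = -1" by (simp add: field_simps)
      then show False using Q[of t "- (q t + 1) / (2 * l t)"] True by simp
    qed
    have z: "C i d = 0" if "i < d" for i using l0 l_delta[OF that] by metis
    have "0 \<le> q t" for t using Q[of t 0] by simp
    then obtain B where B: "\<And>i j. i < d \<Longrightarrow> j < d \<Longrightarrow> C i j = (\<Sum>k<d. B i k * B j k)"
      using Suc.IH[of C] Suc.prems(1) unfolding q_def by auto
    show ?thesis
      by (rule exI[of _ "\<lambda>i k. if i < d \<and> k < d then B i k else 0"])
        (use B z True Suc.prems(1) in \<open>auto simp: less_Suc_eq c_def\<close>)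
  next
    case False
    with c0 have c: "c > 0" by simp
    define C' where "C' = (\<lambda>i j. C i j - C i d * C j d / c)"
    have "0 \<le> (\<Sum>i<d. \<Sum>j<d. t i * C' i j * t j)" for t
    proof -
      have "(\<Sum>i<d. \<Sum>j<d. t i * C' i j * t j) = q t - (\<Sum>i<d. \<Sum>j<d. (t i * C i d) * (t j * C j d) / c)"
        by (simp add: C'_def q_def sum_subtractf[symmetric] algebra_simps)
      also have "(\<Sum>i<d. \<Sum>j<d. (t i * C i d) * (t j * C j d) / c) = l t * l t / c"
        unfolding l_def sum_product by (simp add: sum_divide_distrib)
      \<comment> \<open>Completing the square: the complement at \<open>t\<close> is the full form
        at the minimising value \<open>x = - l t / c\<close>.\<close>
      also have "q t - l t * l t / c = q t + 2 * (- l t / c) * l t + (- l t / c)\<^sup>2 * c"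
        using c by (simp add: power2_eq_square field_simps)
      finally show ?thesis using Q[of t "- l t / c"] by (simp only:)
    qed
    moreover have "C' i j = C' j i" if "i < d" "j < d" for i j
      using that Suc.prems(1) by (simp add: C'_def mult.commute)
    ultimately obtain B where B: "\<And>i j. i < d \<Longrightarrow> j < d \<Longrightarrow> C' i j = (\<Sum>k<d. B i k * B j k)"
      using Suc.IH[of C'] by auto
    define B' where "B' = (\<lambda>i k. if k = d then (if i = d then sqrt c else C i d / sqrt c)
        else if i = d then 0 else B i k)"
    have "C i j = (\<Sum>k<Suc d. B' i k * B' j k)" if "i < Suc d" "j < Suc d" for i j
    proof -
      have "(\<Sum>k<d. B' i k * B' j k) = (if i = d \<or> j = d then 0 else \<Sum>k<d. B i k * B j k)"
        unfolding B'_def by (auto intro!: sum.neutral)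
      moreover have "C i j = C' i j + C i d * C j d / c" by (simp add: C'_def)
      moreover have "sqrt c * sqrt c = c" "C' d d = 0" using c by (simp_all add: C'_def flip: c_def)
      ultimately show ?thesis
        using that c B[of i j] Suc.prems(1)[of d j]
        by (auto simp: B'_def c_def less_Suc_eq simp flip: power2_eq_square)
    qed
    then show ?thesis by blast
  qed
qed simp

text \<open>The image of \<open>d\<close> independent standard normal variables under a matrix
  \<open>B\<close> with \<open>B B^T = C\<close>, where \<open>C\<close> may be singular. The
  characteristic function at \<open>t\<close> is the product of one-dimensional ones at the
  coordinates of \<open>t B\<close>.\<close>

lemma centered_gaussian_exists:
  assumes sym: "\<And>i j. i < d \<Longrightarrow> j < d \<Longrightarrow> C $$ (i, j) = C $$ (j, i)"
    and psd: "\<And>t. 0 \<le> (\<Sum>i<d. \<Sum>j<d. t i * C $$ (i, j) * t j)"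
  shows "\<exists>G. centered_gaussian d C G"
proof -
  obtain B where B: "\<And>i j. i < d \<Longrightarrow> j < d \<Longrightarrow> C $$ (i, j) = (\<Sum>k<d. B i k * B j k)"
    using psd_factorization[of d "\<lambda>i j. C $$ (i, j)"] assms by blast
  define N where "N = Pi\<^sub>M {..<d} (\<lambda>_. std_normal_distribution)"
  define h where "h = (\<lambda>z::nat \<Rightarrow> real. \<lambda>i\<in>{..<d}. \<Sum>k<d. B i k * z k)"
  interpret S: prob_space std_normal_distribution
    using real_dist_normal_dist by (simp add: real_distribution_def)
  interpret P: product_prob_space "\<lambda>_. std_normal_distribution" "{..<d}" ..
  interpret N: prob_space N unfolding N_def by (rule P.prob_space_axioms)
  have [measurable_cong]: "sets N = sets (borel_R d)"
    unfolding N_def by (intro sets_PiM_cong) auto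
  have [measurable]: "h \<in> N \<rightarrow>\<^sub>M borel_R d"
    unfolding h_def by measurable
  have "centered_gaussian d C (distr N (borel_R d) h)"
    unfolding centered_gaussian_def
  proof (intro conjI allI)
    show "prob_space (distr N (borel_R d) h)" by (rule N.prob_space_distr) measurable
    fix t :: "nat \<Rightarrow> real"
    define s where "s = (\<lambda>k. \<Sum>i<d. t i * B i k)"
    have "(\<integral>x. iexp (\<Sum>i<d. t i * x i) \<partial>distr N (borel_R d) h) = (\<integral>z. iexp (\<Sum>i<d. t i * h z i) \<partial>N)"
      by (rule integral_distr) measurable
    also have "\<dots> = (\<integral>z. (\<Prod>k\<in>{..<d}. iexp (s k * z k)) \<partial>N)"
    proof (rule Bochner_Integration.integral_cong[OF refl])
      fix z
      have "(\<Sum>i<d. t i * h z i) = (\<Sum>i<d. \<Sum>k<d. t i * (B i k * z k))"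
        by (simp add: h_def sum_distrib_left)
      also have "\<dots> = (\<Sum>k<d. s k * z k)"
        by (subst sum.swap) (simp add: s_def sum_distrib_left sum_distrib_right mult_ac)
      finally show "iexp (\<Sum>i<d. t i * h z i) = (\<Prod>k\<in>{..<d}. iexp (s k * z k))"
        by (simp add: sum_distrib_left exp_sum)
    qed
    also have "\<dots> = (\<Prod>k\<in>{..<d}. \<integral>z. iexp (s k * z) \<partial>std_normal_distribution)"
      unfolding N_def by (rule P.product_integral_prod) (auto intro!: S.integrable_iexp)
    also have "\<dots> = (\<Prod>k\<in>{..<d}. complex_of_real (exp (- (s k)\<^sup>2 / 2)))"
      using char_std_normal_distribution by (simp add: char_def fun_eq_iff)
    also have "\<dots> = of_real (exp (- (\<Sum>k<d. (s k)\<^sup>2) / 2))"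
      by (simp add: exp_sum[symmetric] sum_negf sum_divide_distrib flip: of_real_prod)
    also have "(\<Sum>k<d. (s k)\<^sup>2) = (\<Sum>k<d. \<Sum>i<d. \<Sum>j<d. t i * B i k * (t j * B j k))"
      by (simp add: s_def power2_eq_square sum_product)
    also have "\<dots> = (\<Sum>i<d. \<Sum>k<d. \<Sum>j<d. t i * B i k * (t j * B j k))"
      by (rule sum.swap)
    also have "\<dots> = (\<Sum>i<d. \<Sum>j<d. \<Sum>k<d. t i * B i k * (t j * B j k))"
      by (intro sum.cong refl sum.swap)
    also have "\<dots> = (\<Sum>i<d. \<Sum>j<d. t i * C $$ (i, j) * t j)"
      by (intro sum.cong refl) (simp add: B sum_distrib_left sum_distrib_right mult_ac)
    finally show "(\<integral>x. iexp (\<Sum>i<d. t i * x i) \<partial>distr N (borel_R d) h)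
        = of_real (exp (- (\<Sum>i<d. \<Sum>j<d. t i * C $$ (i, j) * t j) / 2))" .
  qed simp
  then show ?thesis by blast
qed

text \<open>The complex span of the characters of R^d, that is, the functions whose integrals are
  determined by the values of the characteristic function. It is closed under products, as
  Stone-Weierstrass requires.\<close>

inductive trig_poly :: "nat \<Rightarrow> ((nat \<Rightarrow> real) \<Rightarrow> complex) \<Rightarrow> bool" for d where
  exp: "trig_poly d (\<lambda>x. c * iexp (\<Sum>i<d. a i * x i))"
| add: "trig_poly d f \<Longrightarrow> trig_poly d g \<Longrightarrow> trig_poly d (\<lambda>x. f x + g x)"

lemma trig_poly_mult:
  assumes "trig_poly d f" "trig_poly d g"
  shows "trig_poly d (\<lambda>x. f x * g x)"
  using assms
proof (induction rule: trig_poly.induct)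
  case (exp c a)
  then show ?case
  proof (induction rule: trig_poly.induct)
    case (exp c' a')
    have "(\<lambda>x. c * iexp (\<Sum>i<d. a i * x i) * (c' * iexp (\<Sum>i<d. a' i * x i)))
        = (\<lambda>x. (c * c') * iexp (\<Sum>i<d. (a i + a' i) * x i))"
      by (simp add: fun_eq_iff exp_add[symmetric] distrib_left distrib_right sum.distrib mult_ac)
        (simp add: exp_add mult_ac)
    then show ?case using trig_poly.exp[of d "c * c'" "\<lambda>i. a i + a' i"] by simp
  next
    case (add f g)
    then show ?case using trig_poly.add by (simp add: distrib_left)
  qed
next
  case (add f1 f2)
  then show ?case using trig_poly.add by (simp add: distrib_right)
qed

lemma trig_poly_const: "trig_poly d (\<lambda>x. c)"
  using trig_poly.exp[of d c "\<lambda>_. 0"] by simp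

lemma trig_poly_sin:
  assumes "k < d"
  shows "trig_poly d (\<lambda>x. of_real (sin (b * x k)))"
proof -
  define e where "e = (\<lambda>s i. if i = k then s * b else (0::real))"
  have e: "(\<Sum>i<d. e s i * x i) = s * b * x k" for s x
    using assms by (simp add: e_def if_distrib[of "\<lambda>y. y * _"] sum.delta cong: if_cong)
  have "complex_of_real (sin y) = (1 / (2 * \<i>)) * iexp y + (- 1 / (2 * \<i>)) * iexp (- y)" for y
    by (simp add: sin_of_real[symmetric] sin_exp_eq field_simps)
  then have "(\<lambda>x. of_real (sin (b * x k))) = (\<lambda>x. (1 / (2 * \<i>)) * iexp (\<Sum>i<d. e 1 i * x i)
      + (- 1 / (2 * \<i>)) * iexp (\<Sum>i<d. e (-1) i * x i))"
    unfolding e by (simp add: fun_eq_iff)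
  then show ?thesis by (simp only: trig_poly.exp trig_poly.add)
qed

lemma trig_poly_integrable:
  assumes "trig_poly d h" "prob_space \<mu>" "sets \<mu> = sets (borel_R d)"
  shows "integrable \<mu> h"
  using assms(1)
proof induction
  case (exp c a)
  interpret prob_space \<mu> by fact
  note [measurable_cong] = assms(3)
  have "integrable \<mu> (\<lambda>x. iexp (\<Sum>i<d. a i * x i))"
    by (rule integrable_const_bound[of _ 1]) auto
  then show ?case by simp
qed auto

lemma trig_poly_integral_tendsto:
  assumes "trig_poly d h" "\<And>k. prob_space (\<mu> k)" "\<And>k. sets (\<mu> k) = sets (borel_R d)"
    and "prob_space \<nu>" "sets \<nu> = sets (borel_R d)"
    and "\<And>t. (\<lambda>k. \<integral>x. iexp (\<Sum>i<d. t i * x i) \<partial>\<mu> k) \<longlonglongrightarrow> (\<integral>x. iexp (\<Sum>i<d. t i * x i) \<partial>\<nu>)"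
  shows "(\<lambda>k. \<integral>x. h x \<partial>\<mu> k) \<longlonglongrightarrow> (\<integral>x. h x \<partial>\<nu>)"
  using assms(1)
proof induction
  case (exp c a)
  then show ?case using tendsto_mult_left[OF assms(6), of c] by simp
next
  case (add f g)
  then show ?case
    using trig_poly_integrable[OF _ assms(2,3)] trig_poly_integrable[OF _ assms(4,5)]
    by (simp add: tendsto_add)
qed

text \<open>On the cube \<open>|x\<^sub>i| \<le> R\<close> the function \<open>f\<close> is a continuous function of the \<open>sin (\<pi> x\<^sub>i / (2 R))\<close>,
  so Stone-Weierstrass applies on \<open>[-1,1]\<^sup>d\<close> and yields an approximation which stays bounded off the cube.\<close>

lemma trig_poly_approx:
  fixes f :: "(nat \<Rightarrow> real) \<Rightarrow> real"
  assumes f: "continuous_map (powertop_real {..<d}) euclideanreal f"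
    and B: "\<And>x. x \<in> PiE {..<d} (\<lambda>_. UNIV) \<Longrightarrow> \<bar>f x\<bar> \<le> B"
    and R: "R > 0" and e: "e > 0"
  obtains h where "trig_poly d h"
    "\<And>x. x \<in> PiE {..<d} (\<lambda>_. UNIV) \<Longrightarrow> \<bar>f x - Re (h x)\<bar> \<le> e + 2 * B * indicator {x. \<exists>i<d. \<bar>x i\<bar> > R} x"
proof -
  define a where "a = pi / (2 * R)"
  have a: "a > 0" using R by (simp add: a_def)
  \<comment> \<open>The cube is a set of functions on all naturals, with the fixed value
    \<open>undefined\<close> off \<open>{..<d}\<close>, so that it is compact as a product of
    compact sets inside an ordinary topological space.\<close>
  define S where "S = PiE UNIV (\<lambda>i. if i < d then {-1..1::real} else {undefined})"
  define s where "s = (\<lambda>x::nat \<Rightarrow> real. \<lambda>i\<in>{..<d}. sin (a * x i))"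
  define u where "u = (\<lambda>y::nat \<Rightarrow> real. \<lambda>i\<in>{..<d}. arcsin (y i) / a)"
  \<comment> \<open>The functions on the cube that become trigonometric polynomials after the
    substitution \<open>s\<close>. The coordinates belong to \<open>Q\<close>, so \<open>Q\<close>
    separates points.\<close>
  define Q where "Q = {H. continuous_on S H \<and> trig_poly d (\<lambda>x. of_real (H (s x)))}"
  have sS: "s x \<in> S" for x by (auto simp: S_def s_def)
  have S_coord: "\<bar>y i\<bar> \<le> 1" if "y \<in> S" "i < d" for y i
    using that by (auto simp: S_def PiE_iff abs_le_iff dest!: spec[of _ i])
  have ring: "function_ring_on Q S"
  proof
    show "compact S"
      unfolding S_def compactin_euclidean_iff[symmetric] euclidean_product_topology[symmetric]
      by (subst compactin_PiE) auto
    show "continuous_on S H" if "H \<in> Q" for H using that by (simp add: Q_def)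
    show "(\<lambda>y. H y + H' y) \<in> Q" if "H \<in> Q" "H' \<in> Q" for H H'
      using that by (auto simp: Q_def intro: continuous_on_add trig_poly.add)
    show "(\<lambda>y. H y * H' y) \<in> Q" if "H \<in> Q" "H' \<in> Q" for H H'
      using that by (auto simp: Q_def intro: continuous_on_mult trig_poly_mult)
    show "(\<lambda>_. c) \<in> Q" for c by (auto simp: Q_def intro: trig_poly_const)
    fix x y assume xy: "x \<in> S" "y \<in> S" "x \<noteq> y"
    then obtain i where i: "x i \<noteq> y i" by auto
    have "i < d"
    proof (rule ccontr)
      assume "\<not> i < d"
      then have "x i = undefined" "y i = undefined"
        using xy(1,2) by (auto simp: S_def PiE_iff dest!: spec[of _ i])
      with i show False by simp
    qed
    then have "(\<lambda>y. y i) \<in> Q"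
      using trig_poly_sin[of i d a]
      by (auto simp: Q_def s_def intro: continuous_on_product_coordinates continuous_on_subset)
    then show "\<exists>f\<in>Q. f x \<noteq> f y" by (rule bexI[rotated]) (rule i)
  qed
  have "continuous_map (top_of_set S) (powertop_real {..<d}) u"
    unfolding continuous_map_componentwise
  proof (intro conjI ballI)
    show "u ` topspace (top_of_set S) \<subseteq> extensional {..<d}" by (auto simp: u_def)
    fix k assume k: "k \<in> {..<d}"
    have "continuous_on S (\<lambda>y. arcsin (y k) / a)"
      using k S_coord by (intro continuous_intros continuous_on_subset[OF continuous_on_product_coordinates])
        (use a in \<open>auto simp: abs_le_iff\<close>)
    then show "continuous_map (top_of_set S) euclideanreal (\<lambda>y. u y k)"
      using k by (simp add: u_def)
  qed
  from continuous_map_compose[OF this f] have "continuous_on S (f \<circ> u)" by simp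
  from function_ring_on.Stone_Weierstrass_basic[OF ring this e] obtain H where H: "H \<in> Q" "\<And>y. y \<in> S \<Longrightarrow> \<bar>(f \<circ> u) y - H y\<bar> < e"
    by blast
  show ?thesis
  proof (rule that)
    show "trig_poly d (\<lambda>x. of_real (H (s x)))" using H(1) by (simp add: Q_def)
    fix x :: "nat \<Rightarrow> real" assume x: "x \<in> PiE {..<d} (\<lambda>_. UNIV)"
    have ux: "u (s x) \<in> PiE {..<d} (\<lambda>_. UNIV)" by (auto simp: u_def)
    have 1: "\<bar>f (u (s x)) - H (s x)\<bar> < e" using H(2)[OF sS] by simp
    \<comment> \<open>Off the cube both \<open>f x\<close> and \<open>f (u (s x))\<close> are at
      most \<open>B\<close> in absolute value; this is the origin of the term
      \<open>2 * B\<close>.\<close>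
    show "\<bar>f x - Re (of_real (H (s x)))\<bar> \<le> e + 2 * B * indicator {x. \<exists>i<d. \<bar>x i\<bar> > R} x"
    proof (cases "\<exists>i<d. \<bar>x i\<bar> > R")
      case True
      then show ?thesis using 1 B[OF x] B[OF ux] by simp
    next
      case False
      have "u (s x) i = x i" for i
      proof (cases "i < d")
        case True
        then have "\<bar>x i\<bar> \<le> R" using False by force
        then have "a * \<bar>x i\<bar> \<le> a * R" using a by (intro mult_left_mono) auto
        also have "a * R = pi / 2" using R by (simp add: a_def)
        finally have "\<bar>a * x i\<bar> \<le> pi / 2" using a by (simp add: abs_mult)
        then have "- (pi / 2) \<le> a * x i" "a * x i \<le> pi / 2" by linarith+
        then have "arcsin (sin (a * x i)) = a * x i" by (rule arcsin_sin)
        then show ?thesis using True a by (simp add: u_def s_def)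
      next
        case False
        then show ?thesis using PiE_arb[OF x, of i] by (simp add: u_def)
      qed
      then have "u (s x) = x" by (rule ext)
      with 1 have "\<bar>f x - H (s x)\<bar> < e" by (simp only:)
      with False show ?thesis by (auto simp: indicator_def)
    qed
  qed
qed

text \<open>Convergence of characteristic functions is convergence of the integrals of trigonometric
  polynomials, and a bounded continuous \<open>f\<close> is close to one of these on a cube that
  carries almost all the mass of every late \<open>\<mu> k\<close> and of \<open>\<nu>\<close>.
  Tightness is a hypothesis here because a second moment bound supplies it directly for the
  walk.\<close>

lemma weak_conv_R_of_char:
  assumes \<mu>: "\<And>k. prob_space (\<mu> k)" "\<And>k. sets (\<mu> k) = sets (borel_R d)"
    and \<nu>: "prob_space \<nu>" "sets \<nu> = sets (borel_R d)"
    and char: "\<And>t. (\<lambda>k. \<integral>x. iexp (\<Sum>i<d. t i * x i) \<partial>\<mu> k) \<longlonglongrightarrow> (\<integral>x. iexp (\<Sum>i<d. t i * x i) \<partial>\<nu>)"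
    and tight: "\<And>e. e > 0 \<Longrightarrow> \<exists>R. \<forall>\<^sub>F k in sequentially.
        measure (\<mu> k) {x\<in>space (\<mu> k). \<exists>i<d. \<bar>x i\<bar> > R} \<le> e"
  shows "weak_conv_R d \<mu> \<nu>"
  unfolding weak_conv_R_def
proof (intro allI impI, elim conjE)
  fix f :: "(nat \<Rightarrow> real) \<Rightarrow> real"
  assume f: "continuous_map (powertop_real {..<d}) euclideanreal f"
    and bdd: "bounded (f ` topspace (powertop_real {..<d}))"
  show "(\<lambda>k. \<integral>x. f x \<partial>\<mu> k) \<longlonglongrightarrow> (\<integral>x. f x \<partial>\<nu>)"
  \<comment> \<open>If \<open>f\<close> were not measurable, every integral would be 0 by the
    convention for functions that are not integrable, so the claim holds in that case as
    well.\<close>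
  proof (cases "f \<in> borel_measurable (borel_R d)")
    case False
    then have "\<not> integrable (\<mu> k) f" "\<not> integrable \<nu> f" for k
      using \<mu>(2)[of k] \<nu>(2) borel_measurable_integrable measurable_cong_sets by blast+
    then show ?thesis by (simp add: not_integrable_integral_eq)
  next
    case fm [measurable]: True
    obtain B where B: "\<And>x. x \<in> PiE {..<d} (\<lambda>_. UNIV) \<Longrightarrow> \<bar>f x\<bar> \<le> B"
      using bdd by (auto simp: bounded_iff)
    have B0: "B \<ge> 0" using B[of "\<lambda>i\<in>{..<d}. 0"] by simp
    have out: "{x\<in>space (borel_R d). \<exists>i<d. \<bar>x i\<bar> > R} \<in> sets (borel_R d)" for R :: real
      by measurable
    have approx: "\<bar>(\<integral>x. f x \<partial>\<mu>') - Re (\<integral>x. h x \<partial>\<mu>')\<bar> \<le> e + 2 * B * measure \<mu>' {x\<in>space \<mu>'. \<exists>i<d. \<bar>x i\<bar> > R}"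
      if \<mu>': "prob_space \<mu>'" "sets \<mu>' = sets (borel_R d)" and h: "trig_poly d h"
        and le: "\<And>x. x \<in> PiE {..<d} (\<lambda>_. UNIV) \<Longrightarrow>
            \<bar>f x - Re (h x)\<bar> \<le> e + 2 * B * indicator {x. \<exists>i<d. \<bar>x i\<bar> > R} x" for \<mu>' h e R
    proof -
      interpret prob_space \<mu>' by fact
      note [measurable_cong] = \<mu>'(2)
      have sp: "space \<mu>' = PiE {..<d} (\<lambda>_. UNIV)"
        using sets_eq_imp_space_eq[OF \<mu>'(2)] by (simp add: space_PiM)
      have fi: "integrable \<mu>' f"
        by (rule integrable_const_bound[of _ B]) (auto simp: sp B intro!: AE_I2)
      have hi: "integrable \<mu>' h" by (rule trig_poly_integrable[OF h \<mu>'])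
      let ?O = "{x\<in>space \<mu>'. \<exists>i<d. \<bar>x i\<bar> > R}"
      have O: "?O \<in> events" by measurable
      have "\<bar>(\<integral>x. f x \<partial>\<mu>') - Re (\<integral>x. h x \<partial>\<mu>')\<bar> = \<bar>\<integral>x. f x - Re (h x) \<partial>\<mu>'\<bar>"
        using fi hi by simp
      also have "\<dots> \<le> (\<integral>x. \<bar>f x - Re (h x)\<bar> \<partial>\<mu>')" by (rule integral_abs_bound)
      also have "\<dots> \<le> (\<integral>x. e + 2 * B * indicator ?O x \<partial>\<mu>')"
      proof (rule integral_mono)
        show "integrable \<mu>' (\<lambda>x. e + 2 * B * indicator ?O x)" using O by (simp add: emeasure_eq_measure)
        show "\<bar>f x - Re (h x)\<bar> \<le> e + 2 * B * indicator ?O x" if "x \<in> space \<mu>'" for x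
          using le[of x] that by (simp add: sp indicator_def)
      qed (use fi hi in auto)
      also have "\<dots> = e + 2 * B * measure \<mu>' ?O" using O by (simp add: prob_space emeasure_eq_measure)
      finally show ?thesis .
    qed
    have tight\<nu>: "\<exists>R. measure \<nu> {x\<in>space \<nu>. \<exists>i<d. \<bar>x i\<bar> > R} \<le> e" if e: "e > 0" for e
    proof -
      interpret \<nu>: prob_space \<nu> by fact
      note [measurable_cong] = \<nu>(2)
      let ?A = "\<lambda>m::nat. {x\<in>space \<nu>. \<exists>i<d. \<bar>x i\<bar> > real m}"
      have "(\<lambda>m. measure \<nu> (?A m)) \<longlonglongrightarrow> measure \<nu> (\<Inter>m. ?A m)"
        by (rule \<nu>.finite_Lim_measure_decseq) (auto simp: decseq_def intro: le_less_trans)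
      moreover have "(\<Inter>m. ?A m) = {}"
      proof -
        have "x \<notin> (\<Inter>m. ?A m)" for x
        proof -
          obtain m :: nat where m: "(\<Sum>i<d. \<bar>x i\<bar>) \<le> real m" using real_arch_simple by blast
          have "\<bar>x i\<bar> \<le> real m" if "i < d" for i
            using member_le_sum[of i "{..<d}" "\<lambda>i. \<bar>x i\<bar>"] that m by auto
          then have "\<forall>i<d. \<bar>x i\<bar> \<le> real m" by blast
          then have "\<not> (\<exists>i<d. \<bar>x i\<bar> > real m)" by (auto simp: not_less)
          then have "x \<notin> ?A m" by blast
          then show ?thesis by blast
        qed
        then show ?thesis by blast
      qed
      ultimately have "(\<lambda>m. measure \<nu> (?A m)) \<longlonglongrightarrow> 0" by simp
      then have "\<forall>\<^sub>F m in sequentially. measure \<nu> (?A m) < e" using e by (rule order_tendstoD)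
      then show ?thesis by (auto simp: eventually_sequentially intro: less_imp_le)
    qed
    show ?thesis
    proof (rule LIMSEQ_I)
      fix r :: real assume r: "r > 0"
      \<comment> \<open>Chosen so that each of the two approximation errors is at most
        \<open>r / 4\<close>; the difference of the trigonometric integrals takes another
        \<open>r / 4\<close>.\<close>
      define e where "e = r / (8 * (B + 1))"
      have e: "e > 0" using r B0 by (simp add: e_def)
      have eB: "e + 2 * B * e \<le> r / 4"
      proof -
        have "e + 2 * B * e \<le> 2 * (B + 1) * e" using e by (simp add: algebra_simps)
        also have "\<dots> = r / 4" using B0 by (simp add: e_def field_simps)
        finally show ?thesis .
      qed
      obtain R1 where R1: "\<forall>\<^sub>F k in sequentially. measure (\<mu> k) {x\<in>space (\<mu> k). \<exists>i<d. \<bar>x i\<bar> > R1} \<le> e"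
        using tight[OF e] by blast
      obtain R2 where R2: "measure \<nu> {x\<in>space \<nu>. \<exists>i<d. \<bar>x i\<bar> > R2} \<le> e"
        using tight\<nu>[OF e] by blast
      define R where "R = max 1 (max R1 R2)"
      have R0: "R > 0" and R: "R1 \<le> R" "R2 \<le> R" by (auto simp: R_def)
      have mono: "measure \<mu>' {x\<in>space \<mu>'. \<exists>i<d. \<bar>x i\<bar> > R} \<le> measure \<mu>' {x\<in>space \<mu>'. \<exists>i<d. \<bar>x i\<bar> > R'}"
        if "prob_space \<mu>'" "sets \<mu>' = sets (borel_R d)" "R' \<le> R" for \<mu>' R'
      proof -
        interpret prob_space \<mu>' by fact
        note [measurable_cong] = that(2)
        show ?thesis using that(3) by (intro finite_measure_mono) (auto intro: le_less_trans)
      qed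
      obtain h where h: "trig_poly d h"
        "\<And>x. x \<in> PiE {..<d} (\<lambda>_. UNIV) \<Longrightarrow> \<bar>f x - Re (h x)\<bar> \<le> e + 2 * B * indicator {x. \<exists>i<d. \<bar>x i\<bar> > R} x"
        using trig_poly_approx[OF f B R0 e] by blast
      have "(\<lambda>k. Re (\<integral>x. h x \<partial>\<mu> k)) \<longlonglongrightarrow> Re (\<integral>x. h x \<partial>\<nu>)"
        by (intro tendsto_Re trig_poly_integral_tendsto[OF h(1) \<mu> \<nu> char])
      then have "\<forall>\<^sub>F k in sequentially. dist (Re (\<integral>x. h x \<partial>\<mu> k)) (Re (\<integral>x. h x \<partial>\<nu>)) < r / 4"
        using r by (intro tendstoD) auto
      with R1 have "\<forall>\<^sub>F k in sequentially. norm ((\<integral>x. f x \<partial>\<mu> k) - (\<integral>x. f x \<partial>\<nu>)) < r"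
      proof eventually_elim
        case (elim k)
        have "measure (\<mu> k) {x\<in>space (\<mu> k). \<exists>i<d. \<bar>x i\<bar> > R} \<le> e"
          using order_trans[OF mono[OF \<mu> R(1)] elim(1)] .
        then have "2 * B * measure (\<mu> k) {x\<in>space (\<mu> k). \<exists>i<d. \<bar>x i\<bar> > R} \<le> 2 * B * e"
          using B0 by (intro mult_left_mono) auto
        moreover have "measure \<nu> {x\<in>space \<nu>. \<exists>i<d. \<bar>x i\<bar> > R} \<le> e"
          using order_trans[OF mono[OF \<nu> R(2)] R2] .
        then have "2 * B * measure \<nu> {x\<in>space \<nu>. \<exists>i<d. \<bar>x i\<bar> > R} \<le> 2 * B * e"
          using B0 by (intro mult_left_mono) auto
        moreover note approx[OF \<mu> h, of k] approx[OF \<nu> h] eB elim(2)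
        ultimately show ?case unfolding dist_real_def real_norm_def using r by linarith
      qed
      then show "\<exists>N. \<forall>k\<ge>N. norm ((\<integral>x. f x \<partial>\<mu> k) - (\<integral>x. f x \<partial>\<nu>)) < r"
        by (simp add: eventually_sequentially)
    qed
  qed
qed

text \<open>The classical theorem normalises by the standard deviation \<sigma>, so its
  characteristic function is read off at \<sigma>. Variance 0, where this normalisation breaks down,
  is treated apart: then all variables vanish almost surely. Frequency 1 is enough, since
  \<open>X\<close> will itself be built from an arbitrary linear combination.\<close>

lemma (in prob_space) central_limit_char:
  fixes X :: "nat \<Rightarrow> 'a \<Rightarrow> real"
  assumes indep: "indep_vars (\<lambda>_. borel) X UNIV"
    and id: "\<And>j. distr M borel (X j) = distr M borel (X 0)"
    and mean: "expectation (X 0) = 0" and sq: "integrable M (\<lambda>w. (X 0 w)\<^sup>2)"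
  shows "(\<lambda>k. expectation (\<lambda>w. iexp ((\<Sum>j<k. X j w) / sqrt (real k))))
    \<longlonglongrightarrow> of_real (exp (- expectation (\<lambda>w. (X 0 w)\<^sup>2) / 2))"
proof -
  have rv [measurable]: "X j \<in> M \<rightarrow>\<^sub>M borel" for j using indep by (auto simp: indep_vars_def)
  have E: "expectation (\<lambda>w. g (X j w)) = expectation (\<lambda>w. g (X 0 w))"
    if [measurable]: "g \<in> borel_measurable borel" for g :: "real \<Rightarrow> real" and j
  proof -
    have "expectation (\<lambda>w. g (X i w)) = (\<integral>x. g x \<partial>distr M borel (X i))" for i
      by (subst integral_distr) auto
    then show ?thesis by (simp only: id[of j])
  qed
  have I: "integrable M (\<lambda>w. g (X j w)) \<longleftrightarrow> integrable M (\<lambda>w. g (X 0 w))"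
    if [measurable]: "g \<in> borel_measurable borel" for g :: "real \<Rightarrow> real" and j
  proof -
    have "integrable M (\<lambda>w. g (X i w)) \<longleftrightarrow> integrable (distr M borel (X i)) g" for i
      by (subst integrable_distr_eq) auto
    then show ?thesis by (simp only: id[of j])
  qed
  have sqj: "integrable M (\<lambda>w. (X j w)\<^sup>2)" for j using I[of "\<lambda>x. x\<^sup>2" j] sq by simp
  have meanj: "expectation (X j) = 0" for j using E[of "\<lambda>x. x" j] mean by simp
  define v where "v = expectation (\<lambda>w. (X 0 w)\<^sup>2)"
  have vj: "expectation (\<lambda>w. (X j w)\<^sup>2) = v" for j unfolding v_def using E[of "\<lambda>x. x\<^sup>2" j] by simp
  have v0: "v \<ge> 0" unfolding v_def by (rule Bochner_Integration.integral_nonneg) simp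
  show ?thesis
  proof (cases "v = 0")
    case True
    have "AE w in M. X j w = 0" for j
    proof -
      have "expectation (\<lambda>w. (X j w)\<^sup>2) = 0 \<longleftrightarrow> (AE w in M. (X j w)\<^sup>2 = 0)"
        by (rule integral_nonneg_eq_0_iff_AE[OF sqj]) simp
      then have "AE w in M. (X j w)\<^sup>2 = 0" unfolding vj True by simp
      then show ?thesis by simp
    qed
    then have AE0: "AE w in M. \<forall>j. X j w = 0" by (simp add: AE_all_countable)
    have one: "expectation (\<lambda>w. iexp ((\<Sum>j<k. X j w) / sqrt (real k))) = 1" for k
    proof -
      have "AE w in M. iexp ((\<Sum>j<k. X j w) / sqrt (real k)) = 1"
        using AE0 by (rule eventually_mono) simp
      then have "expectation (\<lambda>w. iexp ((\<Sum>j<k. X j w) / sqrt (real k))) = expectation (\<lambda>w. 1)"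
        by (rule integral_cong_AE[rotated 2]) measurable
      also have "\<dots> = 1" by (simp add: prob_space)
      finally show ?thesis .
    qed
    have 1: "(\<lambda>k. expectation (\<lambda>w. iexp ((\<Sum>j<k. X j w) / sqrt (real k)))) = (\<lambda>_. 1)"
      by (rule ext) (rule one)
    have 2: "complex_of_real (exp (- v / 2)) = 1" unfolding True by simp
    have "(\<lambda>k. expectation (\<lambda>w. iexp ((\<Sum>j<k. X j w) / sqrt (real k)))) \<longlonglongrightarrow> complex_of_real (exp (- v / 2))"
      unfolding 1 2 by (rule tendsto_const)
    then show ?thesis unfolding v_def .
  next
    case False
    define \<sigma> where "\<sigma> = sqrt v"
    have \<sigma>: "\<sigma> > 0" "\<sigma>\<^sup>2 = v" using False v0 by (auto simp: \<sigma>_def)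
    let ?D = "\<lambda>k. distr M borel (\<lambda>w. (\<Sum>j<k. X j w) / sqrt (real k * \<sigma>\<^sup>2))"
    have "weak_conv_m ?D std_normal_distribution"
      by (rule central_limit_theorem_zero_mean[OF indep meanj \<sigma>(1) sqj _ id])
        (simp add: meanj vj \<sigma>)
    then have "(\<lambda>k. char (?D k) \<sigma>) \<longlonglongrightarrow> char std_normal_distribution \<sigma>"
      by (intro levy_continuity1) (auto intro!: real_dist_normal_dist real_distribution_distr)
    moreover have "char (?D k) \<sigma> = expectation (\<lambda>w. iexp ((\<Sum>j<k. X j w) / sqrt (real k)))" for k
    proof -
      have "\<sigma> * ((\<Sum>j<k. X j w) / sqrt (real k * \<sigma>\<^sup>2)) = (\<Sum>j<k. X j w) / sqrt (real k)" for w
        using \<sigma>(1) by (simp add: real_sqrt_mult)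
      then show ?thesis unfolding char_def
        by (subst integral_distr) (auto simp del: of_real_mult of_real_divide)
    qed
    moreover have "char std_normal_distribution \<sigma> = of_real (exp (- v / 2))"
      using \<sigma>(2) by (simp add: char_std_normal_distribution)
    ultimately show ?thesis by (simp add: v_def)
  qed
qed

section \<open>The $p$-adic norm and topology\<close>

lemma padic_norm_0 [simp]: "padic_norm (0 :: 'p::prime_card padic) = 0"
  by (simp add: padic_norm_eq_0)

lemma padic_norm_pos: "x \<noteq> 0 \<Longrightarrow> padic_norm (x :: 'p::prime_card padic) > 0"
  using padic_norm_nonneg[of x] padic_norm_eq_0[of x] by simp

lemma padic_norm_1 [simp]: "padic_norm (1 :: 'p::prime_card padic) = 1"
  using padic_norm_mult[of 1 "1 :: 'p padic"] padic_norm_pos[of "1 :: 'p padic"] by simp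

lemma padic_norm_inverse: "padic_norm (inverse x) = inverse (padic_norm (x :: 'p::prime_card padic))"
proof (cases "x = 0")
  case False
  then have "padic_norm (inverse x) * padic_norm x = 1" by (simp flip: padic_norm_mult)
  then show ?thesis using inverse_unique[of "padic_norm x" "padic_norm (inverse x)"]
    by (simp add: mult.commute)
qed simp

lemma padic_norm_divide: "padic_norm (x / y) = padic_norm x / padic_norm (y :: 'p::prime_card padic)"
  by (simp add: divide_inverse padic_norm_mult padic_norm_inverse)

lemma padic_norm_power: "padic_norm (x ^ k) = padic_norm (x :: 'p::prime_card padic) ^ k"
  by (induction k) (simp_all add: padic_norm_mult)

lemma padic_norm_prod: "padic_norm (\<Prod>i\<in>A. f i :: 'p::prime_card padic) = (\<Prod>i\<in>A. padic_norm (f i))"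
  by (induction A rule: infinite_finite_induct) (simp_all add: padic_norm_mult)

lemma padic_norm_add_le:
  "padic_norm x \<le> b \<Longrightarrow> padic_norm y \<le> b \<Longrightarrow> padic_norm (x + y :: 'p::prime_card padic) \<le> b"
  using padic_norm_ultra[of x y] by linarith

lemma padic_norm_diff_le:
  "padic_norm x \<le> b \<Longrightarrow> padic_norm y \<le> b \<Longrightarrow> padic_norm (x - y :: 'p::prime_card padic) \<le> b"
  using padic_norm_add_le[of x b "- y"] by (simp add: padic_norm_minus)

lemma padic_norm_sum_le:
  "b \<ge> 0 \<Longrightarrow> (\<And>i. i \<in> A \<Longrightarrow> padic_norm (f i) \<le> b) \<Longrightarrow> padic_norm (\<Sum>i\<in>A. f i :: 'p::prime_card padic) \<le> b"
  by (induction A rule: infinite_finite_induct) (simp_all add: padic_norm_add_le)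

lemma padic_norm_mult_le_1:
  "padic_norm x \<le> 1 \<Longrightarrow> padic_norm y \<le> 1 \<Longrightarrow> padic_norm (x * y :: 'p::prime_card padic) \<le> 1"
  by (simp add: padic_norm_mult mult_le_one padic_norm_nonneg)

lemma padic_norm_of_nat_le_1: "padic_norm (of_nat k :: 'p::prime_card padic) \<le> 1"
  by (induction k) (simp_all add: padic_norm_add_le)

lemma padic_norm_sign: "padic_norm (of_int (sign \<pi>) :: 'p::prime_card padic) = 1"
  by (simp add: sign_def padic_norm_minus)

lemma padic_norm_add_eq:
  assumes "padic_norm y < padic_norm (x :: 'p::prime_card padic)"
  shows "padic_norm (x + y) = padic_norm x"
  using padic_norm_ultra[of x y] padic_norm_ultra[of "x + y" "- y"] assms
  by (simp add: padic_norm_minus)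

lemma prime_gt_1_real: "real CARD('p::prime_card) > 1"
  using prime_gt_1_nat[OF prime_card[where 'a='p]] by simp

lemma padic_norm_powi:
  "padic_norm (of_nat CARD('p) powi k :: 'p::prime_card padic) = real CARD('p) powi (- k)"
proof -
  have "padic_norm (x powi k) = padic_norm x powi k" for x :: "'p padic"
    by (cases "k \<ge> 0") (simp_all add: power_int_def padic_norm_power padic_norm_inverse)
  then show ?thesis
    by (simp add: padic_norm_prime power_int_minus power_int_divide_distrib field_simps)
qed

lemma of_nat_prime_neq_0: "(of_nat CARD('p) :: 'p::prime_card padic) \<noteq> 0"
  using padic_norm_prime[where 'p='p] prime_gt_1_real[where 'p='p] by auto

text \<open>The power of \<open>p\<close> that divides \<open>k\<close> is at most \<open>k\<close>.
  This crude bound, uniform in \<open>p\<close>, is what makes integers usable as interpolation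
  nodes.\<close>

lemma padic_norm_of_nat_ge:
  assumes "k > 0"
  shows "padic_norm (of_nat k :: 'p::prime_card padic) \<ge> 1 / real k"
proof -
  let ?p = "CARD('p)" let ?m = "multiplicity (int ?p) (int k)"
  have "quotient_of (of_nat k) = (int k, 1)"
    using quotient_of_int[of "int k"] by (simp add: of_int_def)
  then have val: "padic_val ?p (of_nat k) = int ?m" by (simp add: padic_val_def)
  have "int ?p ^ ?m dvd int k" by (rule multiplicity_dvd)
  then have "?p ^ ?m dvd k" by (metis of_nat_dvd_iff of_nat_power)
  then have "?p ^ ?m \<le> k" using assms by (rule dvd_imp_le)
  then have le: "real ?p ^ ?m \<le> real k" by (metis of_nat_le_iff of_nat_power)
  have "padic_norm (of_nat k :: 'p padic) = 1 / real ?p ^ ?m"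
    using assms val by (simp add: padic_norm_of_rat pabs_def power_int_minus inverse_eq_divide flip: padic_of_rat_of_nat)
  also have "\<dots> \<ge> 1 / real k"
    using le assms prime_gt_1_real[where 'p='p] by (intro divide_left_mono) auto
  finally show ?thesis .
qed

lemma padic_norm_of_nat_diff_ge:
  assumes "i < N" "j < N" "i \<noteq> j"
  shows "padic_norm (of_nat i - of_nat j :: 'p::prime_card padic) \<ge> 1 / real N"
  using assms
proof (induction i j rule: linorder_wlog)
  case (le i j)
  then have "padic_norm (of_nat i - of_nat j :: 'p padic) = padic_norm (of_nat (j - i) :: 'p padic)"
    using padic_norm_minus[of "of_nat i - of_nat j :: 'p padic"] by (simp add: of_nat_diff)
  moreover have "1 / real N \<le> 1 / real (j - i)" using le by (intro divide_left_mono) auto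
  ultimately show ?case using padic_norm_of_nat_ge[of "j - i", where 'p='p] le by linarith
next
  case (sym i j)
  then show ?case using padic_norm_minus[of "of_nat i - of_nat j :: 'p padic"] by simp
qed

text \<open>A late term of a Cauchy sequence representing \<open>x\<close> is a rational close to
  \<open>x\<close>.\<close>

lemma padic_rat_dense:
  fixes x :: "'p::prime_card padic"
  assumes "e > 0"
  shows "\<exists>r. padic_norm (x - padic_of_rat r) < e"
proof -
  have "\<exists>r. padic_norm (x + - padic_of_rat r) < e"
    using assms
  proof (transfer, goal_cases)
    case (1 e X)
    then have X: "pcauchy CARD('p) X" by (simp add: padic_rel_def)
    obtain N where N: "\<And>m n. m \<ge> N \<Longrightarrow> n \<ge> N \<Longrightarrow> pabs CARD('p) (X m - X n) < e / 2"
      using X 1 unfolding pcauchy_def by (meson half_gt_zero)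
    have c: "pcauchy CARD('p) (\<lambda>n. X n + - X N)"
      by (intro pcauchy_add pcauchy_const X prime_card)
    have "lim (\<lambda>n. pabs CARD('p) (X n + - X N)) \<le> e / 2"
      using N by (intro LIMSEQ_le_const2[OF padic_norm_tendsto[OF c]]) (auto intro!: exI[of _ N] less_imp_le)
    then show ?case using 1 by (intro exI[of _ "X N"]) simp
  qed
  then show ?thesis by simp
qed

text \<open>A rational that is closer to \<open>x\<close> than the norm of \<open>x\<close> has the
  same norm by the ultrametric inequality, and the norm of a nonzero rational is a power of
  \<open>p\<close>.\<close>

lemma padic_norm_value:
  assumes "x \<noteq> (0 :: 'p::prime_card padic)"
  shows "\<exists>k. padic_norm x = real CARD('p) powi k"
proof -
  obtain r where r: "padic_norm (x - padic_of_rat r) < padic_norm x"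
    using padic_rat_dense[OF padic_norm_pos[OF assms]] by blast
  have "padic_norm (padic_of_rat r :: 'p padic) = padic_norm x"
    using padic_norm_add_eq[of "- (x - padic_of_rat r)" x] r padic_norm_minus[of "x - padic_of_rat r"] by simp
  then have "pabs CARD('p) r = padic_norm x" by (simp add: padic_norm_of_rat)
  moreover have "r \<noteq> 0" using calculation padic_norm_pos[OF assms] by (auto simp: pabs_def)
  ultimately show ?thesis by (intro exI[of _ "- padic_val CARD('p) r"]) (simp add: pabs_def)
qed

lemma padic_tendsto_add:
  fixes f g :: "'a \<Rightarrow> 'p::prime_card padic"
  assumes "(f \<longlongrightarrow> a) F" "(g \<longlongrightarrow> b) F"
  shows "((\<lambda>x. f x + g x) \<longlongrightarrow> a + b) F"
  unfolding tendsto_iff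
proof (intro allI impI)
  fix e :: real assume e: "e > 0"
  from assms e have "\<forall>\<^sub>F x in F. dist (f x) a < e" "\<forall>\<^sub>F x in F. dist (g x) b < e"
    by (auto simp: tendsto_iff)
  then show "\<forall>\<^sub>F x in F. dist (f x + g x) (a + b) < e"
  proof eventually_elim
    case (elim x)
    then show ?case using padic_norm_ultra[of "f x - a" "g x - b"]
      by (simp add: dist_padic_def algebra_simps)
  qed
qed

lemma padic_tendsto_mult:
  fixes f g :: "'a \<Rightarrow> 'p::prime_card padic"
  assumes "(f \<longlongrightarrow> a) F" "(g \<longlongrightarrow> b) F"
  shows "((\<lambda>x. f x * g x) \<longlongrightarrow> a * b) F"
  unfolding tendsto_iff
proof (intro allI impI)
  fix e :: real assume e: "e > 0"
  define c where "c = padic_norm a + padic_norm b + 1"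
  have c: "c > 0" "padic_norm b < c" "padic_norm a + 1 \<le> c"
    using padic_norm_nonneg[of a] padic_norm_nonneg[of b] by (auto simp: c_def)
  define \<delta> where "\<delta> = min 1 (e / c)"
  have \<delta>: "\<delta> > 0" "\<delta> \<le> 1" "\<delta> * c \<le> e" using e c by (auto simp: \<delta>_def min_def field_simps)
  from assms \<delta> have "\<forall>\<^sub>F x in F. dist (f x) a < \<delta>" "\<forall>\<^sub>F x in F. dist (g x) b < \<delta>"
    by (auto simp: tendsto_iff)
  then show "\<forall>\<^sub>F x in F. dist (f x * g x) (a * b) < e"
  proof eventually_elim
    case (elim x)
    then have fa: "padic_norm (f x - a) < \<delta>" and gb: "padic_norm (g x - b) < \<delta>"
      by (simp_all add: dist_padic_def)
    have "padic_norm (f x) \<le> c"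
      using padic_norm_ultra[of a "f x - a"] fa \<delta> c padic_norm_nonneg[of a] by simp
    then have "padic_norm (f x * (g x - b)) \<le> c * padic_norm (g x - b)"
      unfolding padic_norm_mult by (rule mult_right_mono) (rule padic_norm_nonneg)
    also have "\<dots> < c * \<delta>" using gb c by (intro mult_strict_left_mono)
    finally have 1: "padic_norm (f x * (g x - b)) < e" using \<delta> by (simp add: mult.commute)
    have "padic_norm ((f x - a) * b) \<le> padic_norm (f x - a) * c"
      unfolding padic_norm_mult using c by (intro mult_left_mono) (auto simp: padic_norm_nonneg)
    also have "\<dots> < \<delta> * c" using fa c by (intro mult_strict_right_mono)
    finally have 2: "padic_norm ((f x - a) * b) < e" using \<delta> by simp
    have "f x * g x - a * b = f x * (g x - b) + (f x - a) * b" by (simp add: algebra_simps)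
    then show ?case using padic_norm_ultra[of "f x * (g x - b)" "(f x - a) * b"] 1 2
      by (simp add: dist_padic_def)
  qed
qed

lemma continuous_on_padic_norm: "continuous_on UNIV (padic_norm :: 'p::prime_card padic \<Rightarrow> real)"
proof -
  have "dist (padic_norm x) (padic_norm y) \<le> dist x y" for x y :: "'p padic"
    using padic_norm_add_le[of "x - y" "dist x y + padic_norm y" y]
      padic_norm_add_le[of "y - x" "dist x y + padic_norm x" x] padic_norm_nonneg[of x] padic_norm_nonneg[of y]
      padic_norm_minus[of "x - y"] padic_norm_nonneg[of "x - y"]
    by (simp add: dist_padic_def dist_real_def)
  then show ?thesis
    unfolding continuous_on_iff by (intro ballI allI impI) (auto intro: le_less_trans)
qed

text \<open>Balls of radius \<open>1 / real (Suc n)\<close> around rationals form a countable basis.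
  Second countability makes continuous operations on pairs Borel measurable in their two
  arguments.\<close>

instance padic :: (prime_card) second_countable_topology
proof
  define B where "B = (\<lambda>(r, n). ball (padic_of_rat r :: 'a padic) (1 / real (Suc n))) ` UNIV"
  have "topological_basis B"
  proof (rule topological_basisI)
    show "open b" if "b \<in> B" for b using that by (auto simp: B_def)
    fix O' :: "'a padic set" and x assume "open O'" "x \<in> O'"
    then obtain e where e: "e > 0" "ball x e \<subseteq> O'" by (auto simp: open_contains_ball)
    obtain n where n: "1 / real (Suc n) < e" using nat_approx_posE[OF e(1)] by auto
    obtain r where r: "padic_norm (x - padic_of_rat r) < 1 / real (Suc n)"
      using padic_rat_dense[of "1 / real (Suc n)" x] by auto
    let ?c = "padic_of_rat r :: 'a padic"
    have "ball ?c (1 / real (Suc n)) \<subseteq> ball x e"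
    proof
      fix y assume "y \<in> ball ?c (1 / real (Suc n))"
      then have "padic_norm (?c - y) < 1 / real (Suc n)" by (simp add: dist_padic_def)
      then show "y \<in> ball x e"
        using padic_norm_ultra[of "x - padic_of_rat r" "?c - y"] r n by (simp add: dist_padic_def)
    qed
    moreover have "x \<in> ball ?c (1 / real (Suc n))"
      using r padic_norm_minus[of "x - padic_of_rat r"] by (simp add: dist_padic_def)
    ultimately show "\<exists>B'\<in>B. x \<in> B' \<and> B' \<subseteq> O'" using e by (force simp: B_def)
  qed
  then show "\<exists>B :: 'a padic set set. countable B \<and> open = generate_topology B"
    by (intro exI[of _ B]) (auto simp: B_def intro!: topological_basis_imp_subbasis)
qed

section \<open>Borel measurability of the p-adic operations\<close>

lemma borel_measurable_padic_add [measurable (raw)]: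
  fixes f g :: "'a \<Rightarrow> 'p::prime_card padic"
  assumes "f \<in> borel_measurable M" "g \<in> borel_measurable M"
  shows "(\<lambda>x. f x + g x) \<in> borel_measurable M"
  using assms by (rule borel_measurable_continuous_Pair)
    (unfold continuous_on_def, intro ballI padic_tendsto_add tendsto_fst tendsto_snd tendsto_ident_at)

lemma borel_measurable_padic_mult [measurable (raw)]:
  fixes f g :: "'a \<Rightarrow> 'p::prime_card padic"
  assumes "f \<in> borel_measurable M" "g \<in> borel_measurable M"
  shows "(\<lambda>x. f x * g x) \<in> borel_measurable M"
  using assms by (rule borel_measurable_continuous_Pair)
    (unfold continuous_on_def, intro ballI padic_tendsto_mult tendsto_fst tendsto_snd tendsto_ident_at)

lemma borel_measurable_padic_norm [measurable (raw)]:
  fixes f :: "'a \<Rightarrow> 'p::prime_card padic"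
  assumes "f \<in> borel_measurable M"
  shows "(\<lambda>x. padic_norm (f x)) \<in> borel_measurable M"
  using borel_measurable_continuous_onI[OF continuous_on_padic_norm] assms by (rule measurable_compose_rev)

lemma borel_measurable_padic_sum [measurable (raw)]:
  fixes f :: "'b \<Rightarrow> 'a \<Rightarrow> 'p::prime_card padic"
  assumes "\<And>i. i \<in> A \<Longrightarrow> f i \<in> borel_measurable M"
  shows "(\<lambda>x. \<Sum>i\<in>A. f i x) \<in> borel_measurable M"
  using assms by (induction A rule: infinite_finite_induct) auto

lemma borel_measurable_padic_prod [measurable (raw)]:
  fixes f :: "'b \<Rightarrow> 'a \<Rightarrow> 'p::prime_card padic"
  assumes "\<And>i. i \<in> A \<Longrightarrow> f i \<in> borel_measurable M"
  shows "(\<lambda>x. \<Prod>i\<in>A. f i x) \<in> borel_measurable M"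
  using assms by (induction A rule: infinite_finite_induct) auto

section \<open>Matrices over the $p$-adic integers\<close>

lemma mult_mat_entry:
  assumes "A \<in> carrier_mat r n" "B \<in> carrier_mat n m" "i < r" "k < m"
  shows "(A * B) $$ (i, k) = (\<Sum>j<n. A $$ (i, j) * B $$ (j, k))"
  using assms by (auto simp: scalar_prod_def atLeast0LessThan intro!: sum.cong)

lemma sum_delta_mult:
  fixes f :: "nat \<Rightarrow> 'a::semiring_1"
  assumes "i < d"
  shows "(\<Sum>j<d. (if i = j then 1 else 0) * f j) = f i" "(\<Sum>j<d. f j * (if i = j then 1 else 0)) = f i"
    "(\<Sum>j<d. (if j = i then 1 else 0) * f j) = f i" "(\<Sum>j<d. f j * (if j = i then 1 else 0)) = f i"
  using assms by (simp_all add: if_distrib if_distribR sum.delta sum.delta' cong: if_cong)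

definition int_mat :: "'p::prime_card padic mat \<Rightarrow> bool" where
  "int_mat A \<longleftrightarrow> (\<forall>i<dim_row A. \<forall>j<dim_col A. padic_norm (A $$ (i, j)) \<le> 1)"

lemma elements_subset_padic_ints: "elements_mat A \<subseteq> padic_ints \<longleftrightarrow> int_mat A"
proof
  show "int_mat A" if "elements_mat A \<subseteq> padic_ints"
    using that unfolding int_mat_def padic_ints_def by (blast intro: elements_matI carrier_matI)
  show "elements_mat A \<subseteq> padic_ints" if "int_mat A"
    using that unfolding int_mat_def padic_ints_def by (blast dest: elements_matD)
qed

lemma int_matD: "int_mat A \<Longrightarrow> A \<in> carrier_mat r m \<Longrightarrow> i < r \<Longrightarrow> j < m \<Longrightarrow> padic_norm (A $$ (i, j)) \<le> 1"
  by (auto simp: int_mat_def)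

lemma int_matI:
  "A \<in> carrier_mat r m \<Longrightarrow> (\<And>i j. i < r \<Longrightarrow> j < m \<Longrightarrow> padic_norm (A $$ (i, j)) \<le> 1) \<Longrightarrow> int_mat A"
  by (auto simp: int_mat_def)

lemma int_mat_mult:
  assumes "A \<in> carrier_mat r n" "B \<in> carrier_mat n m" "int_mat A" "int_mat B"
  shows "int_mat (A * B)"
proof (rule int_matI[OF mult_carrier_mat[OF assms(1,2)]])
  fix i k assume "i < r" "k < m"
  then show "padic_norm ((A * B) $$ (i, k)) \<le> 1"
    unfolding mult_mat_entry[OF assms(1,2) \<open>i < r\<close> \<open>k < m\<close>]
    using assms by (intro padic_norm_sum_le padic_norm_mult_le_1) (auto simp: int_matD)
qed

lemma int_mat_one: "int_mat (1\<^sub>m d)"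
  by (auto simp: int_mat_def)

lemma int_mat_transpose: "int_mat A \<Longrightarrow> int_mat (transpose_mat A)"
  by (auto simp: int_mat_def)

lemma padic_norm_det_le:
  assumes A: "A \<in> carrier_mat d d" and c: "\<And>i j. i < d \<Longrightarrow> j < d \<Longrightarrow> padic_norm (A $$ (i, j) :: 'p::prime_card padic) \<le> 1"
  shows "padic_norm (Determinant.det A) \<le> 1"
  unfolding Determinant.det_def'[OF A]
proof (intro padic_norm_sum_le padic_norm_mult_le_1)
  fix \<pi> assume "\<pi> \<in> {\<pi>. \<pi> permutes {0..<d}}"
  then have "\<pi> i < d" if "i < d" for i using that permutes_in_image[of \<pi> "{0..<d}" i] by simp
  then show "padic_norm (\<Prod>i = 0..<d. A $$ (i, \<pi> i)) \<le> 1"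
    unfolding padic_norm_prod by (intro prod_le_1) (auto simp: padic_norm_nonneg c)
qed (auto simp: padic_norm_sign)

abbreviation GLZ :: "nat \<Rightarrow> 'p::prime_card padic mat set" where
  "GLZ \<equiv> GL padic_ints"

lemma GLZ_iff:
  "A \<in> GLZ d \<longleftrightarrow> A \<in> carrier_mat d d \<and> int_mat A \<and>
     (\<exists>B\<in>carrier_mat d d. int_mat B \<and> A * B = 1\<^sub>m d \<and> B * A = 1\<^sub>m d)"
  unfolding GL_def elements_subset_padic_ints by blast

lemma GLZ_carrier: "A \<in> GLZ d \<Longrightarrow> A \<in> carrier_mat d d"
  and GLZ_int_mat: "A \<in> GLZ d \<Longrightarrow> int_mat A"
  by (auto simp: GLZ_iff)

lemma GLZ_inverse:
  assumes "A \<in> GLZ d"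
  shows "\<exists>B\<in>GLZ d. A * B = 1\<^sub>m d \<and> B * A = 1\<^sub>m d"
proof -
  obtain B where B: "B \<in> carrier_mat d d" "int_mat B" "A * B = 1\<^sub>m d" "B * A = 1\<^sub>m d"
    using assms by (auto simp: GLZ_iff)
  then have "B \<in> GLZ d" using assms unfolding GLZ_iff by (intro conjI bexI[of _ A]) auto
  with B show ?thesis by auto
qed

lemma GLZ_I:
  assumes "A \<in> carrier_mat d d" "B \<in> carrier_mat d d" "int_mat A" "int_mat B" "A * B = 1\<^sub>m d"
  shows "A \<in> GLZ d"
  using assms mat_mult_left_right_inverse[of A d B] by (auto simp: GLZ_iff)

lemma GLZ_one: "1\<^sub>m d \<in> GLZ d"
  by (rule GLZ_I[of _ _ "1\<^sub>m d"]) (auto simp: int_mat_one)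

lemma mult_inverse_mult:
  assumes "A \<in> carrier_mat d d" "B \<in> carrier_mat d d" "A' \<in> carrier_mat d d" "B' \<in> carrier_mat d d"
    and "A * A' = 1\<^sub>m d" "B * B' = 1\<^sub>m d"
  shows "(A * B) * (B' * A') = (1\<^sub>m d :: 'a::semiring_1 mat)"
proof -
  have "(A * B) * (B' * A') = A * (B * B') * A'"
    using assms(1-4) by (simp add: assoc_mult_mat[of _ d d _ d _ d])
  then show ?thesis using assms by simp
qed

lemma GLZ_mult:
  assumes "A \<in> GLZ d" "B \<in> GLZ d"
  shows "A * B \<in> GLZ d"
proof -
  obtain A' B' where *: "A' \<in> GLZ d" "A * A' = 1\<^sub>m d" "B' \<in> GLZ d" "B * B' = 1\<^sub>m d"
    using GLZ_inverse assms by blast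
  note c = GLZ_carrier[OF assms(1)] GLZ_carrier[OF assms(2)] GLZ_carrier[OF *(1)] GLZ_carrier[OF *(3)]
  show ?thesis
    by (rule GLZ_I[of _ _ "B' * A'"])
      (use c assms * in \<open>auto intro!: int_mat_mult mult_inverse_mult simp: GLZ_int_mat\<close>)
qed

lemma GLZ_transpose:
  assumes "A \<in> GLZ d"
  shows "transpose_mat A \<in> GLZ d"
proof -
  obtain B where B: "B \<in> GLZ d" "B * A = 1\<^sub>m d" using GLZ_inverse assms by blast
  have "transpose_mat A * transpose_mat B = 1\<^sub>m d"
    using transpose_mult[OF GLZ_carrier[OF B(1)] GLZ_carrier[OF assms]] B(2) by simp
  then show ?thesis
    using GLZ_carrier[OF assms] GLZ_carrier[OF B(1)] GLZ_int_mat[OF assms] GLZ_int_mat[OF B(1)]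
    by (intro GLZ_I[of _ _ "transpose_mat B"]) (auto simp: int_mat_transpose)
qed

text \<open>The determinants of a matrix and of its integral inverse have norms at most 1 with
  product 1.\<close>

lemma padic_norm_det_GLZ:
  assumes "A \<in> GLZ d"
  shows "padic_norm (Determinant.det A) = 1"
proof -
  obtain B where B: "B \<in> GLZ d" "A * B = 1\<^sub>m d" using GLZ_inverse assms by blast
  have "padic_norm (Determinant.det A) * padic_norm (Determinant.det B) = 1"
    using det_mult[OF GLZ_carrier[OF assms] GLZ_carrier[OF B(1)]] B(2) by (simp flip: padic_norm_mult)
  moreover have "padic_norm (Determinant.det A) \<le> 1" "padic_norm (Determinant.det B) \<le> 1"
    using assms B(1) by (auto intro!: padic_norm_det_le int_matD GLZ_carrier GLZ_int_mat)
  ultimately show ?thesis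
    using mult_left_le[of "padic_norm (Determinant.det B)" "padic_norm (Determinant.det A)"]
      padic_norm_nonneg[of "Determinant.det A"] by simp
qed

text \<open>The matrix \<open>1 + a b^T\<close>. The row and column operations of the elimination
  and the symplectic transvections all have this shape, so one inverse formula and one integrality
  criterion serve both.\<close>

definition rank1_mat :: "nat \<Rightarrow> (nat \<Rightarrow> 'a::comm_ring_1) \<Rightarrow> (nat \<Rightarrow> 'a) \<Rightarrow> 'a mat" where
  "rank1_mat d a b = mat d d (\<lambda>(i, k). (if i = k then 1 else 0) + a i * b k)"

lemma rank1_mat_carrier [simp]: "rank1_mat d a b \<in> carrier_mat d d"
  by (simp add: rank1_mat_def)

lemma rank1_mat_entry:
  "i < d \<Longrightarrow> k < d \<Longrightarrow> rank1_mat d a b $$ (i, k) = (if i = k then 1 else 0) + a i * b k"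
  by (simp add: rank1_mat_def)

lemma mult_rank1_mat:
  assumes "A \<in> carrier_mat r d" "i < r" "k < d"
  shows "(A * rank1_mat d a b) $$ (i, k) = A $$ (i, k) + (\<Sum>j<d. A $$ (i, j) * a j) * b k"
proof -
  have "(A * rank1_mat d a b) $$ (i, k) = (\<Sum>j<d. A $$ (i, j) * ((if j = k then 1 else 0) + a j * b k))"
    using assms by (subst mult_mat_entry[of A r d _ d]) (auto simp: rank1_mat_entry)
  also have "\<dots> = A $$ (i, k) + (\<Sum>j<d. A $$ (i, j) * a j) * b k"
    using assms sum_delta_mult(4)[of k d "\<lambda>j. A $$ (i, j)"]
    by (simp only: distrib_left sum.distrib sum_distrib_right mult.assoc)
  finally show ?thesis .
qed

lemma rank1_mat_mult:
  assumes "A \<in> carrier_mat d m" "i < d" "k < m"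
  shows "(rank1_mat d a b * A) $$ (i, k) = A $$ (i, k) + a i * (\<Sum>j<d. b j * A $$ (j, k))"
proof -
  have "(rank1_mat d a b * A) $$ (i, k) = (\<Sum>j<d. ((if i = j then 1 else 0) + a i * b j) * A $$ (j, k))"
    using assms by (subst mult_mat_entry[of _ d d _ m]) (auto simp: rank1_mat_entry)
  also have "\<dots> = A $$ (i, k) + a i * (\<Sum>j<d. b j * A $$ (j, k))"
    using assms sum_delta_mult(1)[of i d "\<lambda>j. A $$ (j, k)"]
    by (simp only: distrib_right sum.distrib sum_distrib_left mult.assoc)
  finally show ?thesis .
qed

text \<open>The Sherman-Morrison formula; \<open>1 + \<beta>\<close> is the determinant.\<close>

lemma rank1_mat_inverse:
  fixes a b :: "nat \<Rightarrow> 'a::field"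
  assumes "(\<Sum>j<d. b j * a j) = \<beta>" "1 + \<beta> \<noteq> 0"
  shows "rank1_mat d a b * rank1_mat d (\<lambda>i. - inverse (1 + \<beta>) * a i) b = 1\<^sub>m d"
proof (rule eq_matI)
  fix i k assume ik: "i < dim_row (1\<^sub>m d :: 'a mat)" "k < dim_col (1\<^sub>m d :: 'a mat)"
  let ?c = "- inverse (1 + \<beta>)"
  have "(\<Sum>j<d. rank1_mat d a b $$ (i, j) * (?c * a j)) = ?c * (a i + a i * \<beta>)"
  proof -
    have "(\<Sum>j<d. rank1_mat d a b $$ (i, j) * (?c * a j))
        = (\<Sum>j<d. ?c * ((if i = j then 1 else 0) * a j) + ?c * a i * (b j * a j))"
      using ik by (intro sum.cong) (auto simp: rank1_mat_entry algebra_simps)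
    also have "\<dots> = ?c * a i + ?c * a i * \<beta>"
      using ik sum_delta_mult(1)[of i d a] assms(1)
      by (simp only: sum.distrib sum_distrib_left[symmetric]) simp
    finally show ?thesis by (simp add: algebra_simps)
  qed
  also have "\<dots> = - a i"
    using assms(2) by (simp add: field_simps)
  finally show "(rank1_mat d a b * rank1_mat d (\<lambda>i. ?c * a i) b) $$ (i, k) = 1\<^sub>m d $$ (i, k)"
    using ik by (subst mult_rank1_mat[of _ d d]) (auto simp: rank1_mat_entry)
qed (auto simp: rank1_mat_def)

lemma int_mat_rank1_mat:
  assumes "\<And>i. i < d \<Longrightarrow> padic_norm (a i) \<le> 1" "\<And>i. i < d \<Longrightarrow> padic_norm (b i) \<le> 1"
  shows "int_mat (rank1_mat d a b)"
  by (rule int_matI[OF rank1_mat_carrier])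
    (use assms in \<open>auto simp: rank1_mat_entry intro!: padic_norm_add_le padic_norm_mult_le_1\<close>)

lemma rank1_mat_GLZ:
  fixes a b :: "nat \<Rightarrow> 'p::prime_card padic"
  assumes "\<And>i. i < d \<Longrightarrow> padic_norm (a i) \<le> 1" "\<And>i. i < d \<Longrightarrow> padic_norm (b i) \<le> 1"
    and "padic_norm (1 + (\<Sum>j<d. b j * a j)) = 1"
  shows "rank1_mat d a b \<in> GLZ d"
proof (rule GLZ_I[OF _ _ _ _ rank1_mat_inverse[OF refl]])
  let ?\<beta> = "\<Sum>j<d. b j * a j"
  show "1 + ?\<beta> \<noteq> 0" using assms(3) by auto
  show "int_mat (rank1_mat d (\<lambda>i. - inverse (1 + ?\<beta>) * a i) b)"
    using assms by (intro int_mat_rank1_mat) (auto simp: padic_norm_mult padic_norm_minus padic_norm_inverse)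
qed (use assms in \<open>auto intro: int_mat_rank1_mat\<close>)

subsection \<open>Expansion of determinants of products\<close>

text \<open>The Cauchy-Binet expansion in raw form: multilinearity in the rows, with the sum over
  all maps \<open>f\<close> instead of the increasing ones. Repetitions of terms are harmless,
  because only norm bounds will be drawn from it.\<close>

lemma det_sum_rows:
  fixes W Y :: "nat \<Rightarrow> nat \<Rightarrow> 'a::comm_ring_1"
  shows "Determinant.det (mat r r (\<lambda>(a, b). \<Sum>j<m. W a j * Y j b))
    = (\<Sum>f\<in>{..<r} \<rightarrow>\<^sub>E {..<m}. (\<Prod>a<r. W a (f a)) * Determinant.det (mat r r (\<lambda>(a, b). Y (f a) b)))"
proof -
  have lt: "\<pi> i < r" if "\<pi> permutes {0..<r}" "i < r" for \<pi> i
    using that permutes_in_image[of \<pi> "{0..<r}" i] by simp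
  have "Determinant.det (mat r r (\<lambda>(a, b). \<Sum>j<m. W a j * Y j b))
      = (\<Sum>\<pi> | \<pi> permutes {0..<r}. of_int (sign \<pi>) * (\<Prod>a<r. \<Sum>j<m. W a j * Y j (\<pi> a)))"
    by (subst Determinant.det_def'[of _ r]) (auto simp: atLeast0LessThan lt intro!: sum.cong prod.cong)
  also have "\<dots> = (\<Sum>\<pi> | \<pi> permutes {0..<r}. \<Sum>f\<in>{..<r} \<rightarrow>\<^sub>E {..<m}.
      of_int (sign \<pi>) * (\<Prod>a<r. W a (f a) * Y (f a) (\<pi> a)))"
    by (simp add: prod_sum_PiE sum_distrib_left)
  also have "\<dots> = (\<Sum>f\<in>{..<r} \<rightarrow>\<^sub>E {..<m}. \<Sum>\<pi> | \<pi> permutes {0..<r}.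
      of_int (sign \<pi>) * (\<Prod>a<r. W a (f a) * Y (f a) (\<pi> a)))"
    by (rule sum.swap)
  also have "\<dots> = (\<Sum>f\<in>{..<r} \<rightarrow>\<^sub>E {..<m}. (\<Prod>a<r. W a (f a)) * Determinant.det (mat r r (\<lambda>(a, b). Y (f a) b)))"
  proof (rule sum.cong[OF refl])
    fix f :: "nat \<Rightarrow> nat"
    have "Determinant.det (mat r r (\<lambda>(a, b). Y (f a) b))
        = (\<Sum>\<pi> | \<pi> permutes {0..<r}. of_int (sign \<pi>) * (\<Prod>a<r. Y (f a) (\<pi> a)))"
      by (subst Determinant.det_def'[of _ r]) (auto simp: atLeast0LessThan lt intro!: sum.cong prod.cong)
    then show "(\<Sum>\<pi> | \<pi> permutes {0..<r}. of_int (sign \<pi>) * (\<Prod>a<r. W a (f a) * Y (f a) (\<pi> a)))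
        = (\<Prod>a<r. W a (f a)) * Determinant.det (mat r r (\<lambda>(a, b). Y (f a) b))"
      by (simp add: prod.distrib sum_distrib_left mult_ac)
  qed
  finally show ?thesis .
qed

lemma det_mat_swap: "Determinant.det (mat r r (\<lambda>(a, b). F b a)) = Determinant.det (mat r r (\<lambda>(a, b). F a b) :: 'a::comm_ring_1 mat)"
  by (subst Determinant.det_transpose[symmetric, of _ r]) (auto intro!: arg_cong[of _ _ Determinant.det])

lemma norm_det_sum_rows_le:
  fixes W Y :: "nat \<Rightarrow> nat \<Rightarrow> 'p::prime_card padic"
  assumes "\<And>a j. a < r \<Longrightarrow> j < m \<Longrightarrow> padic_norm (W a j) \<le> 1" and "c \<ge> 0"
    and "\<And>f. f \<in> {..<r} \<rightarrow>\<^sub>E {..<m} \<Longrightarrow> padic_norm (Determinant.det (mat r r (\<lambda>(a, b). Y (f a) b))) \<le> c"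
  shows "padic_norm (Determinant.det (mat r r (\<lambda>(a, b). \<Sum>j<m. W a j * Y j b))) \<le> c"
  unfolding det_sum_rows
proof (rule padic_norm_sum_le[OF assms(2)])
  fix f assume f: "f \<in> {..<r} \<rightarrow>\<^sub>E {..<m}"
  have "padic_norm (\<Prod>a<r. W a (f a)) \<le> 1"
    unfolding padic_norm_prod using f assms(1) by (intro prod_le_1) (auto simp: padic_norm_nonneg)
  then show "padic_norm ((\<Prod>a<r. W a (f a)) * Determinant.det (mat r r (\<lambda>(a, b). Y (f a) b))) \<le> c"
    unfolding padic_norm_mult
    by (rule order_trans[OF mult_left_le_one_le[OF padic_norm_nonneg padic_norm_nonneg] assms(3)[OF f]])
qed

lemma norm_det_sum_cols_le:
  fixes W Y :: "nat \<Rightarrow> nat \<Rightarrow> 'p::prime_card padic"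
  assumes "\<And>j b. j < m \<Longrightarrow> b < r \<Longrightarrow> padic_norm (Y j b) \<le> 1" and "c \<ge> 0"
    and "\<And>f. f \<in> {..<r} \<rightarrow>\<^sub>E {..<m} \<Longrightarrow> padic_norm (Determinant.det (mat r r (\<lambda>(a, b). W a (f b)))) \<le> c"
  shows "padic_norm (Determinant.det (mat r r (\<lambda>(a, b). \<Sum>j<m. W a j * Y j b))) \<le> c"
proof -
  have "padic_norm (Determinant.det (mat r r (\<lambda>(a, b). \<Sum>j<m. Y j a * W b j))) \<le> c"
  proof (rule norm_det_sum_rows_le[OF _ assms(2)])
    fix f assume "f \<in> {..<r} \<rightarrow>\<^sub>E {..<m}"
    from assms(3)[OF this] show "padic_norm (Determinant.det (mat r r (\<lambda>(a, b). W b (f a)))) \<le> c"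
      by (subst det_mat_swap[of r "\<lambda>a b. W a (f b)"])
  qed (rule assms(1))
  then show ?thesis
    by (subst (asm) mult.commute) (subst (asm) det_mat_swap[of r "\<lambda>a b. \<Sum>j<m. W a j * Y j b"])
qed

text \<open>Induction on \<open>s\<close>, removing the largest index of \<open>S\<close>: its value
  is at least the smallest one, at \<open>m - 1\<close>, and the other indices lie below
  \<open>m - 1\<close>.\<close>

lemma sum_tail_le_sum:
  fixes l :: "nat \<Rightarrow> int"
  assumes "S \<subseteq> {..<m}" "card S = s" and anti: "\<And>i j. i \<le> j \<Longrightarrow> j < m \<Longrightarrow> l j \<le> l i"
  shows "(\<Sum>t<s. l (m - s + t)) \<le> (\<Sum>x\<in>S. l x)"
  using assms
proof (induction s arbitrary: S m)
  case 0
  then have "S = {}" using finite_subset[of S "{..<m}"] by simp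
  then show ?case by simp
next
  case (Suc s)
  have fin: "finite S" and ne: "S \<noteq> {}" using Suc.prems finite_subset[of S "{..<m}"] by auto
  define M where "M = Max S"
  have M: "M \<in> S" "\<And>x. x \<in> S \<Longrightarrow> x \<le> M" using fin ne by (auto simp: M_def)
  have Mm: "M < m" using M(1) Suc.prems(1) by auto
  then obtain m' where m: "m = Suc m'" by (cases m) auto
  have le: "Suc s \<le> m" using Suc.prems card_mono[of "{..<m}" S] by simp
  have "(\<Sum>t<s. l (m' - s + t)) \<le> (\<Sum>x\<in>S - {M}. l x)"
  proof (rule Suc.IH)
    have "x < M" if "x \<in> S - {M}" for x using M(2)[of x] that by simp
    then show "S - {M} \<subseteq> {..<m'}" using Mm m by fastforce
    show "card (S - {M}) = s" using Suc.prems fin M by simp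
  qed (use Suc.prems m in auto)
  moreover have "l m' \<le> l M" using Suc.prems(3)[of M m'] Mm m by simp
  moreover have "(\<Sum>x\<in>S. l x) = l M + (\<Sum>x\<in>S - {M}. l x)" using fin M by (simp add: sum.remove)
  moreover have "m - Suc s = m' - s" "m' - s + s = m'" using m le by auto
  ultimately show ?case by simp
qed

lemma det_diag_mat: "Determinant.det (mat s s (\<lambda>(a, b). if a = b then D a else 0)) = (\<Prod>a<s. D a :: 'a::comm_ring_1)"
proof -
  have "upper_triangular (mat s s (\<lambda>(a, b). if a = b then D a else 0))" by auto
  then have "Determinant.det (mat s s (\<lambda>(a, b). if a = b then D a else 0)) = prod_list (map D [0..<s])"
    by (subst Determinant.det_upper_triangular[of _ s]) (auto simp: diag_mat_def intro!: arg_cong[of _ _ prod_list])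
  then show ?thesis by (simp add: prod.list_conv_set_nth atLeast0LessThan)
qed

lemma det_scale_rows:
  fixes Y :: "nat \<Rightarrow> nat \<Rightarrow> 'a::comm_ring_1"
  shows "Determinant.det (mat s s (\<lambda>(a, b). D a * Y a b)) = (\<Prod>a<s. D a) * Determinant.det (mat s s (\<lambda>(a, b). Y a b))"
proof -
  have lt: "\<pi> i < s" if "\<pi> permutes {0..<s}" "i < s" for \<pi> i
    using that permutes_in_image[of \<pi> "{0..<s}" i] by simp
  show ?thesis
    by (subst (1 2) Determinant.det_def'[of _ s])
      (auto simp: atLeast0LessThan lt prod.distrib sum_distrib_left mult_ac intro!: sum.cong)
qed

section \<open>Powers of p and minors of products with a diagonal matrix\<close>

definition ppow :: "int \<Rightarrow> 'p::prime_card padic" where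
  "ppow k = of_nat CARD('p) powi k"

lemma padic_norm_ppow: "padic_norm (ppow k :: 'p::prime_card padic) = real CARD('p) powi (- k)"
  unfolding ppow_def by (rule padic_norm_powi)

lemma ppow_neq_0: "(ppow k :: 'p::prime_card padic) \<noteq> 0"
  unfolding ppow_def using of_nat_prime_neq_0[where 'p='p] by (simp add: power_int_eq_0_iff)

lemma ppow_diff: "(ppow (k - l) :: 'p::prime_card padic) = ppow k / ppow l"
  unfolding ppow_def using of_nat_prime_neq_0[where 'p='p] by (simp add: power_int_diff)

lemma padic_norm_prod_ppow:
  "padic_norm (\<Prod>a\<in>A. ppow (l a) :: 'p::prime_card padic) = real CARD('p) powi (- (\<Sum>a\<in>A. l a))"
proof (induction A rule: infinite_finite_induct)
  case (insert x F)
  have "real CARD('p) powi (- l x - (\<Sum>a\<in>F. l a)) = real CARD('p) powi (- l x) * real CARD('p) powi (- (\<Sum>a\<in>F. l a))"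
    using prime_gt_1_real[where 'p='p] by (simp add: power_int_add[symmetric])
  with insert show ?case by (simp add: padic_norm_mult padic_norm_ppow)
qed simp_all

lemma powi_prime_le_iff: "real CARD('p::prime_card) powi a \<le> real CARD('p) powi b \<longleftrightarrow> a \<le> b"
  using prime_gt_1_real[where 'p='p] power_int_increasing[of a b "real CARD('p)"]
    power_int_strict_increasing[of b a "real CARD('p)"]
  by (cases "a \<le> b") auto

text \<open>In the expansion over maps \<open>f\<close>, a map with a repeated value gives equal
  rows and so 0, while an injective one contributes at most the product of the \<open>s\<close>
  chosen powers. The largest such product belongs to the \<open>s\<close> smallest
  exponents.\<close>

lemma norm_det_diag_le:
  fixes W Y :: "nat \<Rightarrow> nat \<Rightarrow> 'p::prime_card padic"
  assumes W: "\<And>a j. a < s \<Longrightarrow> j < m \<Longrightarrow> padic_norm (W a j) \<le> 1"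
    and Y: "\<And>j b. j < m \<Longrightarrow> b < s \<Longrightarrow> padic_norm (Y j b) \<le> 1"
    and anti: "\<And>i j. i \<le> j \<Longrightarrow> j < m \<Longrightarrow> l j \<le> l i"
  shows "padic_norm (Determinant.det (mat s s (\<lambda>(a, b). \<Sum>j<m. W a j * (ppow (l j) * Y j b))))
    \<le> real CARD('p) powi (- (\<Sum>t<s. l (m - s + t)))"
proof (rule norm_det_sum_rows_le[of s m W _ "\<lambda>j b. ppow (l j) * Y j b"])
  fix f assume f: "f \<in> {..<s} \<rightarrow>\<^sub>E {..<m}"
  let ?Y = "mat s s (\<lambda>(a, b). Y (f a) b)"
  have eq: "Determinant.det (mat s s (\<lambda>(a, b). ppow (l (f a)) * Y (f a) b)) = (\<Prod>a<s. ppow (l (f a))) * Determinant.det ?Y"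
    by (rule det_scale_rows[of s "\<lambda>a. ppow (l (f a))" "\<lambda>a b. Y (f a) b"])
  show "padic_norm (Determinant.det (mat s s (\<lambda>(a, b). ppow (l (f a)) * Y (f a) b)))
      \<le> real CARD('p) powi (- (\<Sum>t<s. l (m - s + t)))"
  proof (cases "inj_on f {..<s}")
    case False
    then obtain a b where ab: "a < s" "b < s" "a \<noteq> b" "f a = f b" unfolding inj_on_def lessThan_iff by blast
    then have "Determinant.det ?Y = 0"
      by (intro Determinant.det_identical_rows[of _ s a b]) (auto intro!: eq_vecI)
    then show ?thesis unfolding eq using prime_gt_1_real[where 'p='p] by simp
  next
    case True
    have "padic_norm (Determinant.det ?Y) \<le> 1"
      using f Y by (intro padic_norm_det_le[of _ s]) auto
    then have "padic_norm ((\<Prod>a<s. ppow (l (f a))) * Determinant.det ?Y)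
        \<le> real CARD('p) powi (- (\<Sum>a<s. l (f a)))"
      unfolding padic_norm_mult padic_norm_prod_ppow
      using prime_gt_1_real[where 'p='p] by (intro mult_left_le) auto
    also have "\<dots> \<le> real CARD('p) powi (- (\<Sum>t<s. l (m - s + t)))"
      unfolding powi_prime_le_iff
      using sum_tail_le_sum[of "f ` {..<s}" m s l] f True anti PiE_mem[OF f]
      by (auto simp: card_image sum.reindex image_subset_iff)
    finally show ?thesis unfolding eq .
  qed
qed (use W prime_gt_1_real[where 'p='p] in auto)

section \<open>Singular numbers of rectangular matrices\<close>

lemma mult_mat_assoc_dim:
  "dim_col A = dim_row B \<Longrightarrow> dim_col B = dim_row C \<Longrightarrow> (A * B) * C = A * (B * C :: 'a::semiring_0 mat)"
  by (rule assoc_mult_mat[of A "dim_row A" "dim_col A" B "dim_col B" C "dim_col C"]) auto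

lemma diag_ppow_carrier [simp]: "diag_ppow r m l \<in> carrier_mat r m"
  by (simp add: diag_ppow_def)

lemma diag_ppow_entry: "i < r \<Longrightarrow> j < m \<Longrightarrow> diag_ppow r m l $$ (i, j) = (if i = j then ppow (l ! i) else 0)"
  by (simp add: diag_ppow_def ppow_def)

lemma diag_ppow_mult_entry:
  assumes "V \<in> carrier_mat m q" "r \<le> m" "i < r" "k < q"
  shows "(diag_ppow r m l * V) $$ (i, k) = ppow (l ! i) * V $$ (i, k)"
proof -
  have "(diag_ppow r m l * V) $$ (i, k) = (\<Sum>j<m. (if i = j then 1 else 0) * (ppow (l ! i) * V $$ (j, k)))"
    using assms by (subst mult_mat_entry[of _ r m _ q]) (auto simp: diag_ppow_entry intro!: sum.cong)
  also have "\<dots> = ppow (l ! i) * V $$ (i, k)"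
    using assms sum_delta_mult(1)[of i m "\<lambda>j. ppow (l ! i) * V $$ (j, k)"] by simp
  finally show ?thesis .
qed

lemma udv_entry:
  assumes "U \<in> carrier_mat r r" "V \<in> carrier_mat m m" "r \<le> m" "i < r" "k < m"
  shows "(U * diag_ppow r m l * V) $$ (i, k) = (\<Sum>j<r. U $$ (i, j) * (ppow (l ! j) * V $$ (j, k)))"
proof -
  have "U * diag_ppow r m l * V = U * (diag_ppow r m l * V)"
    using assms by (intro assoc_mult_mat) auto
  also have "\<dots> $$ (i, k) = (\<Sum>j<r. U $$ (i, j) * (diag_ppow r m l * V) $$ (j, k))"
    using assms by (intro mult_mat_entry[of _ r r _ m] mult_carrier_mat[of _ r m]) auto
  also have "\<dots> = (\<Sum>j<r. U $$ (i, j) * (ppow (l ! j) * V $$ (j, k)))"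
    using assms by (intro sum.cong) (auto simp: diag_ppow_mult_entry[of V m m])
  finally show ?thesis .
qed

lemma sorted_ge_iff: "sorted_wrt (\<ge>) (l :: int list) \<longleftrightarrow> (\<forall>i j. i \<le> j \<longrightarrow> j < length l \<longrightarrow> l ! j \<le> l ! i)"
  unfolding sorted_wrt_iff_nth_less using le_eq_less_or_eq by (metis order_refl)

text \<open>For a weakly decreasing list this is the sum of the \<open>s\<close> smallest entries,
  the quantity detected by the minors of size \<open>s\<close>.\<close>

definition tail_sum :: "nat \<Rightarrow> int list \<Rightarrow> int" where
  "tail_sum s l = (\<Sum>t<s. l ! (length l - s + t))"

lemma tail_sum_Suc: "s < length l \<Longrightarrow> tail_sum (Suc s) l = l ! (length l - Suc s) + tail_sum s l"
  unfolding tail_sum_def by (subst sum.lessThan_Suc_shift) (auto simp: Suc_diff_Suc intro!: sum.cong arg_cong[of _ _ "nth l"])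

lemma nth_eq_tail_sum_diff:
  assumes "i < length l"
  shows "l ! i = tail_sum (length l - i) l - tail_sum (length l - Suc i) l"
  using tail_sum_Suc[of "length l - Suc i" l] assms by (simp add: Suc_diff_Suc)

lemma norm_det_udv_le:
  fixes U V :: "'p::prime_card padic mat"
  assumes "length l = r" "sorted_wrt (\<ge>) l"
    and "\<And>a j. a < s \<Longrightarrow> j < r \<Longrightarrow> padic_norm (W a j :: 'p padic) \<le> 1"
    and "\<And>j b. j < r \<Longrightarrow> b < s \<Longrightarrow> padic_norm (Y j b) \<le> 1"
  shows "padic_norm (Determinant.det (mat s s (\<lambda>(a, b). \<Sum>j<r. W a j * (ppow (l ! j) * Y j b))))
    \<le> real CARD('p) powi (- tail_sum s l)"
  unfolding tail_sum_def assms(1) using assms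
  by (intro norm_det_diag_le) (auto simp: sorted_ge_iff)

text \<open>The bottom right minor of size \<open>s\<close> of the diagonal matrix for
  \<open>l\<close> has norm exactly \<open>p\<close> to the power \<open>- tail_sum s l\<close>,
  whereas every such minor of the product on the right is bounded by the corresponding power for
  \<open>l'\<close>.\<close>

lemma diag_ppow_tail_sum_le:
  fixes U V :: "'p::prime_card padic mat"
  assumes eq: "diag_ppow r m l = U * diag_ppow r m l' * V" and U: "U \<in> GLZ r" and V: "V \<in> GLZ m"
    and r: "r \<le> m" and l: "length l = r" "length l' = r" "sorted_wrt (\<ge>) l'" and s: "s \<le> r"
  shows "tail_sum s l' \<le> tail_sum s l"
proof -
  note Uc = GLZ_carrier[OF U] and Vc = GLZ_carrier[OF V]
  have eq': "mat s s (\<lambda>(a, b). if a = b then ppow (l ! (r - s + a)) else 0)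
      = mat s s (\<lambda>(a, b). \<Sum>j<r. U $$ (r - s + a, j) * (ppow (l' ! j) * V $$ (j, r - s + b)))"
  proof (rule eq_matI)
    fix a b assume "a < dim_row (mat s s (\<lambda>(a, b). \<Sum>j<r. U $$ (r - s + a, j) * (ppow (l' ! j) * V $$ (j, r - s + b))))"
      and "b < dim_col (mat s s (\<lambda>(a, b). \<Sum>j<r. U $$ (r - s + a, j) * (ppow (l' ! j) * V $$ (j, r - s + b))))"
    then have ab: "a < s" "b < s" by simp_all
    then have i: "r - s + a < r" "r - s + b < r" "r - s + b < m" using s r by linarith+
    have "(if a = b then ppow (l ! (r - s + a)) else 0) = diag_ppow r m l $$ (r - s + a, r - s + b)"
      using diag_ppow_entry[OF i(1,3), of l] by (auto split: if_splits)
    also have "\<dots> = (\<Sum>j<r. U $$ (r - s + a, j) * (ppow (l' ! j) * V $$ (j, r - s + b)))"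
      unfolding eq by (rule udv_entry[OF Uc Vc r i(1,3)])
    finally show "mat s s (\<lambda>(a, b). if a = b then ppow (l ! (r - s + a)) else 0) $$ (a, b)
      = mat s s (\<lambda>(a, b). \<Sum>j<r. U $$ (r - s + a, j) * (ppow (l' ! j) * V $$ (j, r - s + b))) $$ (a, b)"
      using ab by simp
  qed simp_all
  have "padic_norm (Determinant.det (mat s s (\<lambda>(a, b). if a = b then ppow (l ! (r - s + a)) else (0 :: 'p padic))))
      \<le> real CARD('p) powi (- tail_sum s l')"
    unfolding eq' using s r l
    by (intro norm_det_udv_le) (auto intro: int_matD[OF GLZ_int_mat[OF U] Uc] int_matD[OF GLZ_int_mat[OF V] Vc])
  then have "padic_norm (\<Prod>a<s. ppow (l ! (r - s + a)) :: 'p padic) \<le> real CARD('p) powi (- tail_sum s l')"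
    unfolding det_diag_mat .
  then show ?thesis using l by (simp add: padic_norm_prod_ppow powi_prime_le_iff tail_sum_def)
qed

lemma mult_cancel_both_sides:
  fixes D :: "'a::comm_ring_1 mat"
  assumes "U \<in> carrier_mat r r" "V \<in> carrier_mat m m" "D \<in> carrier_mat r m"
    and "U' \<in> carrier_mat r r" "V' \<in> carrier_mat m m" "U' * U = 1\<^sub>m r" "V * V' = 1\<^sub>m m"
  shows "U' * (U * D * V) * V' = D"
proof -
  have "U' * (U * D * V) * V' = (U' * U) * D * (V * V')"
    using assms(1-5) by (simp add: assoc_mult_mat[of _ r r _ r _ m] assoc_mult_mat[of _ r r _ m _ m]
        assoc_mult_mat[of _ r m _ m _ m] assoc_mult_mat[of _ r r _ r _ r] mult_carrier_mat)
  then show ?thesis using assms by simp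
qed

lemma mult_mult_both_sides:
  fixes D :: "'a::comm_ring_1 mat"
  assumes "U \<in> carrier_mat r r" "V \<in> carrier_mat m m" "D \<in> carrier_mat r m"
    and "U' \<in> carrier_mat r r" "V' \<in> carrier_mat m m"
  shows "U' * (U * D * V) * V' = (U' * U) * D * (V * V')"
  using assms by (simp add: assoc_mult_mat[of _ r r _ r _ m] assoc_mult_mat[of _ r r _ m _ m]
        assoc_mult_mat[of _ r m _ m _ m] assoc_mult_mat[of _ r r _ r _ r] mult_carrier_mat)

text \<open>The inequality between tail sums applies in both directions, so all tail sums agree, and
  their differences are the entries.\<close>

lemma diag_ppow_unique:
  fixes U V U' V' :: "'p::prime_card padic mat"
  assumes eq: "U * diag_ppow r m l * V = U' * diag_ppow r m l' * V'"
    and U: "U \<in> GLZ r" "U' \<in> GLZ r" and V: "V \<in> GLZ m" "V' \<in> GLZ m" and r: "r \<le> m"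
    and l: "length l = r" "length l' = r" "sorted_wrt (\<ge>) l" "sorted_wrt (\<ge>) l'"
  shows "l = l'"
proof -
  have le: "tail_sum s l2 \<le> tail_sum s l1"
    if eq: "U1 * diag_ppow r m l1 * V1 = U2 * diag_ppow r m l2 * V2"
      and U: "U1 \<in> GLZ r" "U2 \<in> GLZ r" and V: "V1 \<in> GLZ m" "V2 \<in> GLZ m"
      and l: "length l1 = r" "length l2 = r" "sorted_wrt (\<ge>) l2" and s: "s \<le> r"
    for U1 U2 V1 V2 :: "'p padic mat" and l1 l2 s
  proof -
    obtain Ui Vi where i: "Ui \<in> GLZ r" "Ui * U1 = 1\<^sub>m r" "Vi \<in> GLZ m" "V1 * Vi = 1\<^sub>m m"
      using GLZ_inverse U(1) V(1) by blast
    note c = U[THEN GLZ_carrier] V[THEN GLZ_carrier] i(1,3)[THEN GLZ_carrier]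
    have "diag_ppow r m l1 = Ui * (U1 * diag_ppow r m l1 * V1) * Vi"
      using c i by (intro mult_cancel_both_sides[symmetric]) auto
    also have "\<dots> = (Ui * U2) * diag_ppow r m l2 * (V2 * Vi)"
      unfolding eq using c by (intro mult_mult_both_sides) auto
    finally show ?thesis
      by (rule diag_ppow_tail_sum_le[OF _ _ _ r l s]) (use U V i in \<open>auto intro: GLZ_mult\<close>)
  qed
  have t: "tail_sum s l = tail_sum s l'" if "s \<le> r" for s
    using le[OF eq U V l(1,2,4) that] le[OF eq[symmetric] U(2,1) V(2,1) l(2,1,3) that] by simp
  show ?thesis
  proof (rule nth_equalityI)
    show "l ! i = l' ! i" if "i < length l" for i
      using that l t by (simp add: nth_eq_tail_sum_diff[of i l] nth_eq_tail_sum_diff[of i l'])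
  qed (use l in simp)
qed

lemma SN_eqI:
  fixes U V :: "'p::prime_card padic mat"
  assumes "U \<in> GLZ r" "V \<in> GLZ m" "r \<le> m" "length l = r" "sorted_wrt (\<ge>) l"
  shows "SN (U * diag_ppow r m l * V) = l"
proof -
  let ?B = "U * diag_ppow r m l * V"
  have d: "dim_row ?B = r" "dim_col ?B = m" using assms(1,2)[THEN GLZ_carrier] by auto
  show ?thesis
    unfolding SN_def d
  proof (rule the_equality)
    fix l' assume "length l' = r \<and> sorted_wrt (\<ge>) l' \<and> (\<exists>U\<in>GLZ r. \<exists>V\<in>GLZ m. ?B = U * diag_ppow r m l' * V)"
    then obtain U' V' where "length l' = r" "sorted_wrt (\<ge>) l'" "U' \<in> GLZ r" "V' \<in> GLZ m" "?B = U' * diag_ppow r m l' * V'"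
      by auto
    then show "l' = l" using diag_ppow_unique[of U r m l V U' l' V'] assms by simp
  qed (use assms in auto)
qed

lemma maximal_norm_entry:
  fixes F :: "nat \<Rightarrow> nat \<Rightarrow> 'p::prime_card padic"
  assumes "i < r" "k < m" "F i k \<noteq> 0"
  obtains i0 k0 e where "i0 < r" "k0 < m" "F i0 k0 \<noteq> 0" "padic_norm (F i0 k0) = real CARD('p) powi (- e)"
    "\<And>i k. i < r \<Longrightarrow> k < m \<Longrightarrow> padic_norm (F i k) \<le> real CARD('p) powi (- e)"
proof -
  define S where "S = (\<lambda>(i, k). padic_norm (F i k)) ` ({..<r} \<times> {..<m})"
  have S: "finite S" "S \<noteq> {}" using assms by (auto simp: S_def)
  then have "Max S \<in> S" by simp
  then obtain i0 k0 where ik: "i0 < r" "k0 < m" "Max S = padic_norm (F i0 k0)" by (auto simp: S_def)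
  have le: "padic_norm (F i' k') \<le> padic_norm (F i0 k0)" if "i' < r" "k' < m" for i' k'
    unfolding ik(3)[symmetric] using S that by (intro Max_ge) (auto simp: S_def)
  have "F i0 k0 \<noteq> 0" using le[OF assms(1,2)] padic_norm_pos[OF assms(3)] by auto
  moreover from padic_norm_value[OF this] obtain e where "padic_norm (F i0 k0) = real CARD('p) powi e" by blast
  ultimately show ?thesis using that[of i0 k0 "- e"] ik le by simp
qed

lemma sum_two_deltas:
  fixes f :: "nat \<Rightarrow> 'a::comm_ring_1"
  assumes "i < d" "k < d" "i = k \<Longrightarrow> c = 0"
  shows "(\<Sum>j<d. f j * (if j = i then 1 else if j = k then c else 0)) = f i + c * f k"
    and "(\<Sum>j<d. (if j = i then 1 else if j = k then c else 0) * f j) = f i + c * f k"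
proof -
  have "(\<Sum>j<d. f j * (if j = i then 1 else if j = k then c else 0))
      = (\<Sum>j<d. f j * (if j = i then 1 else 0) + c * (f j * (if j = k then 1 else 0)))"
    using assms(3) by (intro sum.cong) auto
  also have "\<dots> = f i + c * f k"
    using assms(1,2) sum_delta_mult(4)[of i d f] sum_delta_mult(4)[of k d f]
    by (simp only: sum.distrib sum_distrib_left[symmetric])
  finally show "(\<Sum>j<d. f j * (if j = i then 1 else if j = k then c else 0)) = f i + c * f k" .
  then show "(\<Sum>j<d. (if j = i then 1 else if j = k then c else 0) * f j) = f i + c * f k"
    by (simp only: mult.commute)
qed

text \<open>Gaussian elimination from the last row upwards: after \<open>j\<close> steps the last \<open>j\<close> rows are diagonal
  and the diagonal entry found last dominates all entries above it.\<close>

lemma smith_elimination: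
  fixes X Z :: "'p::prime_card padic mat"
  assumes r: "r \<le> m" and X: "X \<in> carrier_mat r m" and Z: "Z \<in> carrier_mat m r" "X * Z = 1\<^sub>m r" and j: "j \<le> r"
  shows "\<exists>U\<in>GLZ r. \<exists>V\<in>GLZ m. \<exists>L. \<exists>Z'\<in>carrier_mat m r. (U * X * V) * Z' = 1\<^sub>m r \<and>
    (\<forall>i k. r - j \<le> i \<longrightarrow> i < r \<longrightarrow> k < m \<longrightarrow> (U * X * V) $$ (i, k) = (if i = k then ppow (L i) else 0)) \<and>
    (\<forall>i k. r - j \<le> k \<longrightarrow> k < r \<longrightarrow> i < r \<longrightarrow> i \<noteq> k \<longrightarrow> (U * X * V) $$ (i, k) = 0) \<and>
    (\<forall>i i'. r - j \<le> i \<longrightarrow> i \<le> i' \<longrightarrow> i' < r \<longrightarrow> L i' \<le> L i) \<and>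
    (j > 0 \<longrightarrow> (\<forall>i<r - j. \<forall>k<m. padic_norm ((U * X * V) $$ (i, k)) \<le> real CARD('p) powi (- L (r - j))))"
  using j
proof (induction j)
  case 0
  show ?case
    by (rule bexI[OF _ GLZ_one], rule bexI[OF _ GLZ_one], rule exI[of _ "\<lambda>_. 0"], rule bexI[of _ Z])
      (use X Z in auto)
next
  case (Suc j)
  define p where "p = real CARD('p)"
  define el where "el = r - Suc j"
  have el: "el < r" "el < m" "r - j = Suc el" using Suc.prems r by (auto simp: el_def)
  from Suc obtain U V L Z' where U: "U \<in> GLZ r" and V: "V \<in> GLZ m" and Z': "Z' \<in> carrier_mat m r" "(U * X * V) * Z' = 1\<^sub>m r"
    and a: "\<And>i k. Suc el \<le> i \<Longrightarrow> i < r \<Longrightarrow> k < m \<Longrightarrow> (U * X * V) $$ (i, k) = (if i = k then ppow (L i) else 0)"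
    and b: "\<And>i k. Suc el \<le> k \<Longrightarrow> k < r \<Longrightarrow> i < r \<Longrightarrow> i \<noteq> k \<Longrightarrow> (U * X * V) $$ (i, k) = 0"
    and c: "\<And>i i'. Suc el \<le> i \<Longrightarrow> i \<le> i' \<Longrightarrow> i' < r \<Longrightarrow> L i' \<le> L i"
    and d: "\<And>i k. j > 0 \<Longrightarrow> i < Suc el \<Longrightarrow> k < m \<Longrightarrow> padic_norm ((U * X * V) $$ (i, k)) \<le> p powi (- L (Suc el))"
    unfolding el(3) p_def by auto
  note Uc = GLZ_carrier[OF U] and Vc = GLZ_carrier[OF V]
  define Y where "Y = U * X * V"
  have Y: "Y \<in> carrier_mat r m" using Uc Vc X by (simp add: Y_def)
  \<comment> \<open>The right inverse \<open>Z'\<close> is carried along so that the next row cannot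
    vanish.\<close>
  obtain k1 where "k1 < m" "Y $$ (el, k1) \<noteq> 0"
  proof (rule ccontr)
    assume "\<not> thesis"
    then have "\<And>k. k < m \<Longrightarrow> Y $$ (el, k) = 0" using that by blast
    then have "(Y * Z') $$ (el, el) = 0"
      using mult_mat_entry[OF Y Z'(1) el(1) el(1)] by simp
    then show False using Z'(2) el by (simp add: Y_def)
  qed
  then obtain i0 k0 e where ik: "i0 < Suc el" "k0 < m" "Y $$ (i0, k0) \<noteq> 0" "padic_norm (Y $$ (i0, k0)) = p powi (- e)"
    and le: "\<And>i k. i < Suc el \<Longrightarrow> k < m \<Longrightarrow> padic_norm (Y $$ (i, k)) \<le> p powi (- e)"
    using maximal_norm_entry[of el "Suc el" k1 m "\<lambda>i k. Y $$ (i, k)"] unfolding p_def by auto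
  have i0r: "i0 < r" using ik el by simp
  have p0: "p powi z > 0" for z using prime_gt_1_real[where 'p='p] by (simp add: p_def)
  \<comment> \<open>The pivot column is not one of those already finished; it may be one of the
    columns beyond \<open>r\<close>.\<close>
  have k0: "\<not> (Suc el \<le> k0 \<and> k0 < r)" using b[of k0 i0] ik i0r by (auto simp: Y_def)
  define u where "u = Y $$ (i0, k0) / ppow e"
  have u: "padic_norm u = 1" "u \<noteq> 0"
    using ik p0[of "-e"] by (auto simp: u_def padic_norm_divide padic_norm_ppow p_def ppow_neq_0)
  have pe: "(ppow e :: 'p padic) \<noteq> 0" "padic_norm (ppow e :: 'p padic) = p powi (- e)"
    by (simp_all add: ppow_neq_0 padic_norm_ppow p_def)

  \<comment> \<open>One row operation that puts the pivot row, divided by the unit \<open>u\<close>,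
    in position \<open>el\<close>. Its determinant is \<open>inverse u\<close>, also when
    \<open>i0 = el\<close>.\<close>
  define a1 where "a1 = (\<lambda>i. if i = el then 1 else if i = i0 then (if i0 = el then 0 else 1) else (0::'p padic))"
  define b1 where "b1 = (\<lambda>i. inverse u * (if i = i0 then 1 else 0) - (if i = el then 1 else 0) :: 'p padic)"
  have b1_sum: "(\<Sum>j<r. b1 j * f j) = inverse u * f i0 - f el" for f
    unfolding b1_def using sum_delta_mult(3)[of i0 r f] sum_delta_mult(3)[of el r f] i0r el
    by (simp only: left_diff_distrib sum_subtractf mult.assoc sum_distrib_left[symmetric])
  have U1: "rank1_mat r a1 b1 \<in> GLZ r"
  proof (rule rank1_mat_GLZ)
    show "padic_norm (1 + (\<Sum>j<r. b1 j * a1 j)) = 1"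
      unfolding b1_sum using u by (simp add: a1_def padic_norm_inverse)
  qed (use u in \<open>auto simp: a1_def b1_def padic_norm_inverse padic_norm_minus intro!: padic_norm_diff_le\<close>)
  define Y1 where "Y1 = rank1_mat r a1 b1 * Y"
  have Y1: "Y1 \<in> carrier_mat r m" unfolding Y1_def by (rule mult_carrier_mat[OF rank1_mat_carrier Y])
  have Y1e: "Y1 $$ (i, k) = Y $$ (i, k) + a1 i * (inverse u * Y $$ (i0, k) - Y $$ (el, k))" if "i < r" "k < m" for i k
    unfolding Y1_def using rank1_mat_mult[OF Y that, of a1 b1] b1_sum[of "\<lambda>j. Y $$ (j, k)"] by simp
  have Y1_hi: "Y1 $$ (i, k) = Y $$ (i, k)" if "Suc el \<le> i" "i < r" "k < m" for i k
    using that ik by (simp add: Y1e a1_def)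
  have Y1_l: "Y1 $$ (el, k) = inverse u * Y $$ (i0, k)" if "k < m" for k
    using that el by (simp add: Y1e a1_def)
  have Y1_l0: "Y1 $$ (el, k0) = ppow e" using ik pe by (simp add: Y1_l u_def)
  have Y1_le: "padic_norm (Y1 $$ (i, k)) \<le> p powi (- e)" if "i < Suc el" "k < m" for i k
    using that le[OF that] le[OF ik(1) that(2)] le[of el k] el u i0r
    by (auto simp: Y1e a1_def padic_norm_mult padic_norm_inverse intro!: padic_norm_add_le padic_norm_diff_le)
  have Y1_col: "Y1 $$ (i, k) = 0" if "Suc el \<le> k" "k < r" "i < Suc el" for i k
    using that b[of k i] b[of k i0] b[of k el] el r i0r ik by (simp add: Y1e Y_def)

  define x where "x = (\<lambda>k. Y1 $$ (el, k) / ppow e)"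
  have x: "padic_norm (x k) \<le> 1" if "k < m" for k
    using Y1_le[of el k] that pe p0[of "-e"] by (simp add: x_def padic_norm_divide)
  have x0: "x k0 = 1" using pe by (simp add: x_def Y1_l0)
  have x_hi: "x k = 0" if "Suc el \<le> k" "k < r" for k using Y1_col[of k el] that by (simp add: x_def)
  \<comment> \<open>This column operation sends the row vector \<open>x\<close> to the unit vector
    at \<open>el\<close>: the pairing of \<open>x\<close> with \<open>a2\<close> is 1, and
    \<open>b2\<close> is that unit vector minus \<open>x\<close>. The pairing of \<open>b2\<close>
    with \<open>a2\<close> is 0, so the determinant is 1.\<close>
  define a2 where "a2 = (\<lambda>i. if i = el then 1 else if i = k0 then 1 - x el else (0::'p padic))"
  define b2 where "b2 = (\<lambda>k. (if k = el then 1 else 0) - x k)"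
  have a2_sum: "(\<Sum>j<m. f j * a2 j) = f el + (1 - x el) * f k0" for f
    unfolding a2_def using sum_two_deltas(1)[of el m k0 "1 - x el" f] el ik x0 by auto
  have V1: "rank1_mat m a2 b2 \<in> GLZ m"
  proof (rule rank1_mat_GLZ)
    have "(\<Sum>j<m. b2 j * a2 j) = 0"
      unfolding a2_sum using x0 by (auto simp: b2_def algebra_simps)
    then show "padic_norm (1 + (\<Sum>j<m. b2 j * a2 j)) = 1" by simp
  qed (use x el in \<open>auto simp: a2_def b2_def padic_norm_minus intro!: padic_norm_diff_le\<close>)
  define Y2 where "Y2 = Y1 * rank1_mat m a2 b2"
  have Y2: "Y2 \<in> carrier_mat r m" using Y1 by (simp add: Y2_def)
  have Y2e: "Y2 $$ (i, k) = Y1 $$ (i, k) + (Y1 $$ (i, el) + (1 - x el) * Y1 $$ (i, k0)) * b2 k" if "i < r" "k < m" for i k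
    unfolding Y2_def using mult_rank1_mat[OF Y1 that, of a2 b2] a2_sum[of "\<lambda>j. Y1 $$ (i, j)"] by simp
  have Y2_l: "Y2 $$ (el, k) = (if k = el then ppow e else 0)" if "k < m" for k
  proof -
    have "Y1 $$ (el, k) = ppow e * x k" for k using pe by (simp add: x_def)
    then show ?thesis using that el x0 by (auto simp: Y2e b2_def algebra_simps)
  qed
  have Y2_hi: "Y2 $$ (i, k) = (if i = k then ppow (L i) else 0)" if "Suc el \<le> i" "i < r" "k < m" for i k
  proof -
    have "i \<noteq> k0" using k0 that by auto
    then show ?thesis using that el ik a[OF that] a[of i el] a[of i k0] by (simp add: Y2e Y1_hi Y_def)
  qed
  have Y2_col: "Y2 $$ (i, k) = 0" if "Suc el \<le> k" "k < r" "i < Suc el" for i k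
    using that Y1_col[of k i] x_hi[of k] el r by (simp add: Y2e b2_def)
  have Y2_le: "padic_norm (Y2 $$ (i, k)) \<le> p powi (- e)" if "i < Suc el" "k < m" for i k
  proof -
    have "padic_norm ((Y1 $$ (i, el) + (1 - x el) * Y1 $$ (i, k0)) * b2 k) \<le> p powi (- e)"
    proof -
      have "padic_norm (b2 k) \<le> 1" unfolding b2_def using x that by (intro padic_norm_diff_le) auto
      moreover have "padic_norm ((1 - x el) * Y1 $$ (i, k0)) \<le> p powi (- e)"
      proof -
        have "padic_norm (1 - x el) \<le> 1" using x el by (intro padic_norm_diff_le) auto
        then show ?thesis unfolding padic_norm_mult
          by (rule order_trans[OF mult_left_le_one_le[OF padic_norm_nonneg padic_norm_nonneg] Y1_le[OF that(1) ik(2)]])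
      qed
      then have "padic_norm (Y1 $$ (i, el) + (1 - x el) * Y1 $$ (i, k0)) \<le> p powi (- e)"
        by (intro padic_norm_add_le Y1_le that el)
      ultimately show ?thesis unfolding padic_norm_mult
        by (intro order_trans[OF mult_right_le_one_le]) (auto simp: padic_norm_nonneg)
    qed
    then show ?thesis using that el Y1_le[OF that] by (subst Y2e) (auto intro!: padic_norm_add_le)
  qed

  \<comment> \<open>Clears the column above the pivot; the quotients are integral because the pivot
    has the largest norm.\<close>
  define a3 where "a3 = (\<lambda>i. if i < el then - (Y2 $$ (i, el) / ppow e) else (0::'p padic))"
  define b3 where "b3 = (\<lambda>i. if i = el then 1 else (0::'p padic))"
  have b3_sum: "(\<Sum>j<r. b3 j * f j) = f el" for f
    unfolding b3_def using sum_delta_mult(3)[of el r f] el by simp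
  have U2: "rank1_mat r a3 b3 \<in> GLZ r"
  proof (rule rank1_mat_GLZ)
    show "padic_norm (1 + (\<Sum>j<r. b3 j * a3 j)) = 1" unfolding b3_sum by (simp add: a3_def)
    show "padic_norm (a3 i) \<le> 1" if "i < r" for i
      using Y2_le[of i el] el pe p0[of "-e"] by (auto simp: a3_def padic_norm_minus padic_norm_divide)
  qed (auto simp: b3_def)
  define Y3 where "Y3 = rank1_mat r a3 b3 * Y2"
  have Y3e: "Y3 $$ (i, k) = Y2 $$ (i, k) + a3 i * Y2 $$ (el, k)" if "i < r" "k < m" for i k
    unfolding Y3_def using rank1_mat_mult[OF Y2 that, of a3 b3] b3_sum[of "\<lambda>j. Y2 $$ (j, k)"] by simp
  let ?U = "rank1_mat r a3 b3 * (rank1_mat r a1 b1 * U)" and ?V = "V * rank1_mat m a2 b2"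
  have UG: "?U \<in> GLZ r" and VG: "?V \<in> GLZ m" using U V U1 V1 U2 by (auto intro!: GLZ_mult)
  have Y3_eq: "Y3 = ?U * X * ?V"
    unfolding Y3_def Y2_def Y1_def Y_def
    by (simp add: mult_mat_assoc_dim carrier_matD[OF Uc] carrier_matD[OF Vc] carrier_matD[OF X]
        carrier_matD[OF rank1_mat_carrier] del: assoc_mult_mat)
  have "\<exists>Z\<in>carrier_mat m r. (?U * X * ?V) * Z = 1\<^sub>m r"
  proof -
    obtain Ui Vi where i: "Ui \<in> GLZ r" "?U * Ui = 1\<^sub>m r" "Vi \<in> GLZ m" "?V * Vi = 1\<^sub>m m"
      using GLZ_inverse UG VG by blast
    note ic = GLZ_carrier[OF i(1)] GLZ_carrier[OF i(3)] and gc = GLZ_carrier[OF UG] GLZ_carrier[OF VG]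
    have "(?U * X * ?V) * (Vi * (Z * Ui)) = ?U * X * (?V * Vi) * (Z * Ui)"
      using carrier_matD[OF ic(1)] carrier_matD[OF ic(2)] carrier_matD[OF gc(1)] carrier_matD[OF gc(2)]
        carrier_matD[OF X] carrier_matD[OF Z(1)]
      by (simp add: mult_mat_assoc_dim del: assoc_mult_mat)
    also have "\<dots> = ?U * (X * Z) * Ui"
      unfolding i(4) right_mult_one_mat[OF mult_carrier_mat[OF gc(1) X]]
      using carrier_matD[OF ic(1)] carrier_matD[OF gc(1)] carrier_matD[OF X] carrier_matD[OF Z(1)]
      by (simp add: mult_mat_assoc_dim del: assoc_mult_mat)
    also have "\<dots> = 1\<^sub>m r" by (simp only: Z(2) right_mult_one_mat[OF gc(1)] i(2))
    finally show ?thesis using ic Z(1) by (intro bexI[of _ "Vi * (Z * Ui)"]) auto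
  qed
  then obtain Z3 where Z3: "Z3 \<in> carrier_mat m r" "(?U * X * ?V) * Z3 = 1\<^sub>m r" by blast
  define L' where "L' = L(el := e)"
  have l1: "Y3 $$ (i, k) = (if i = k then ppow (L' i) else 0)" if "el \<le> i" "i < r" "k < m" for i k
    using that Y2_hi[of i k] Y2_l[of k] by (cases "i = el") (auto simp: Y3e a3_def L'_def)
  have l2: "Y3 $$ (i, k) = 0" if "el \<le> k" "k < r" "i < r" "i \<noteq> k" for i k
  proof (cases "el \<le> i")
    case False
    then show ?thesis using that Y2_col[of k i] Y2_col[of k el] Y2_l[of el] el r pe
      by (cases "k = el") (auto simp: Y3e a3_def)
  next
    case True
    have "k < m" using that r by linarith
    then show ?thesis using l1[OF True that(3)] that(4) by simp
  qed
  \<comment> \<open>The new pivot was among the entries dominated by the previous one; this is what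
    orders the exponents.\<close>
  have e_ge: "L (Suc el) \<le> e" if "j > 0"
    using d[OF that ik(1,2)] ik(4) unfolding Y_def p_def by (simp add: powi_prime_le_iff)
  have l3: "L' i' \<le> L' i" if "el \<le> i" "i \<le> i'" "i' < r" for i i'
  proof (cases "i = el \<and> i' \<noteq> el")
    case True
    then have "j > 0" "Suc el \<le> i'" using that el by auto
    then show ?thesis using True e_ge c[of "Suc el" i'] that by (auto simp: L'_def)
  next
    case False
    show ?thesis
    proof (cases "i = el")
      case True
      with False show ?thesis by simp
    next
      case i: False
      then have "Suc el \<le> i" "i' \<noteq> el" using that by simp_all
      with i show ?thesis using c[of i i'] that by (simp add: L'_def)
    qed
  qed
  have l4: "padic_norm (Y3 $$ (i, k)) \<le> p powi (- L' el)" if "i < el" "k < m" for i k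
    using that el Y2_le[of i k] Y2_l[of k] l2[of el i] p0[of "-e"] by (cases "k = el") (auto simp: Y3e L'_def less_imp_le)
  show ?case
    by (rule bexI[OF _ UG], rule bexI[OF _ VG], rule exI[of _ L'], rule bexI[OF _ Z3(1)])
      (use Z3(2) l1 l2 l3 l4 in \<open>simp add: Y3_eq p_def flip: el_def\<close>)
qed

text \<open>The right inverse expresses full rank. Existence is required because \<open>SN\<close>
  is a definite description.\<close>

lemma smith_normal_form:
  fixes X Z :: "'p::prime_card padic mat"
  assumes r: "r \<le> m" and X: "X \<in> carrier_mat r m" and Z: "Z \<in> carrier_mat m r" "X * Z = 1\<^sub>m r"
  obtains U V l where "U \<in> GLZ r" "V \<in> GLZ m" "length l = r" "sorted_wrt (\<ge>) l" "X = U * diag_ppow r m l * V"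
proof -
  obtain U V L where U: "U \<in> GLZ r" and V: "V \<in> GLZ m"
    and a: "\<And>i k. i < r \<Longrightarrow> k < m \<Longrightarrow> (U * X * V) $$ (i, k) = (if i = k then ppow (L i) else 0)"
    and c: "\<And>i i'. i \<le> i' \<Longrightarrow> i' < r \<Longrightarrow> L i' \<le> L i"
    using smith_elimination[OF assms order_refl] by auto
  obtain Ui Vi where i: "Ui \<in> GLZ r" "Ui * U = 1\<^sub>m r" "Vi \<in> GLZ m" "V * Vi = 1\<^sub>m m"
    using GLZ_inverse U V by blast
  have Yc: "U * X * V \<in> carrier_mat r m" using GLZ_carrier[OF U] GLZ_carrier[OF V] X by (intro mult_carrier_mat)
  have "U * X * V = diag_ppow r m (map L [0..<r])"
  proof (rule eq_matI)
    fix i k assume "i < dim_row (diag_ppow r m (map L [0..<r]) :: 'p padic mat)"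
      and "k < dim_col (diag_ppow r m (map L [0..<r]) :: 'p padic mat)"
    then have ik: "i < r" "k < m" by (simp_all add: diag_ppow_def)
    show "(U * X * V) $$ (i, k) = diag_ppow r m (map L [0..<r]) $$ (i, k)"
      unfolding a[OF ik] using ik by (auto simp: diag_ppow_entry)
  qed (use carrier_matD[OF Yc] in \<open>simp_all only: diag_ppow_def dim_row_mat dim_col_mat\<close>)
  moreover have "X = Ui * (U * X * V) * Vi"
    using i U V X by (intro mult_cancel_both_sides[symmetric]) (auto dest: GLZ_carrier)
  ultimately have "X = Ui * diag_ppow r m (map L [0..<r]) * Vi" by simp
  moreover have "sorted_wrt (\<ge>) (map L [0..<r])" using c by (auto simp: sorted_ge_iff)
  ultimately show ?thesis using that[of Ui Vi "map L [0..<r]"] i by simp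
qed

text \<open>The last rows of an element of \<open>GL\<^sub>m(\<int>\<^sub>p)\<close> are the model of a primitive matrix.\<close>

definition primitive_mat :: "nat \<Rightarrow> nat \<Rightarrow> 'p::prime_card padic mat \<Rightarrow> bool" where
  "primitive_mat r m Y \<longleftrightarrow> Y \<in> carrier_mat r m \<and> int_mat Y \<and> (\<exists>Z\<in>carrier_mat m r. int_mat Z \<and> Y * Z = 1\<^sub>m r)"

text \<open>Multiplication by an integral right inverse \<open>Z\<close> of \<open>Y\<close> gives
  \<open>g = g' * (Y' * Z)\<close> with integral last factor. By symmetry the norm of the
  determinant depends on the product \<open>g * Y\<close> only.\<close>

lemma primitive_frame_det_le:
  fixes g g' Y Y' :: "'p::prime_card padic mat"
  assumes g: "g \<in> carrier_mat r r" "g' \<in> carrier_mat r r" and Y: "primitive_mat r m Y" "primitive_mat r m Y'"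
    and eq: "g * Y = g' * Y'"
  shows "padic_norm (Determinant.det g) \<le> padic_norm (Determinant.det g')"
proof -
  obtain Z where Z: "Z \<in> carrier_mat m r" "int_mat Z" "Y * Z = 1\<^sub>m r" using Y(1) by (auto simp: primitive_mat_def)
  have Yc: "Y \<in> carrier_mat r m" "Y' \<in> carrier_mat r m" "int_mat Y'" using Y by (auto simp: primitive_mat_def)
  have YZ: "Y' * Z \<in> carrier_mat r r" "int_mat (Y' * Z)" using Yc Z by (auto intro!: int_mat_mult)
  have "g = g * (Y * Z)" unfolding Z(3) using g by simp
  also have "\<dots> = g * Y * Z" by (rule assoc_mult_mat[OF g(1) Yc(1) Z(1), symmetric])
  also have "\<dots> = g' * (Y' * Z)" unfolding eq by (rule assoc_mult_mat[OF g(2) Yc(2) Z(1)])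
  finally have "Determinant.det g = Determinant.det g' * Determinant.det (Y' * Z)"
    using det_mult[OF g(2) YZ(1)] by simp
  moreover have "padic_norm (Determinant.det (Y' * Z)) \<le> 1"
    by (rule padic_norm_det_le[OF YZ(1)]) (rule int_matD[OF YZ(2,1)])
  ultimately show ?thesis
    by (simp only: padic_norm_mult mult_right_le_one_le[OF padic_norm_nonneg padic_norm_nonneg])
qed

lemma det_nonzero_inverse:
  fixes g :: "'a::field mat"
  assumes g: "g \<in> carrier_mat r r" "Determinant.det g \<noteq> 0"
  obtains h where "h \<in> carrier_mat r r" "g * h = 1\<^sub>m r" "h * g = 1\<^sub>m r"
proof -
  let ?h = "inverse (Determinant.det g) \<cdot>\<^sub>m adj_mat g"
  have h: "?h \<in> carrier_mat r r" using adj_mat(1)[OF g(1)] by simp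
  have "g * ?h = inverse (Determinant.det g) \<cdot>\<^sub>m (g * adj_mat g)"
    by (rule mult_smult_distrib[OF g(1) adj_mat(1)[OF g(1)]])
  also have "\<dots> = 1\<^sub>m r" unfolding adj_mat(2)[OF g(1)] using g(2) by (intro eq_matI) auto
  finally show ?thesis using that[OF h] mat_mult_left_right_inverse[OF g(1) h] by blast
qed

text \<open>The Smith form yields a second factorisation \<open>(U * D) * (F * V)\<close> of the
  same matrix with \<open>F * V\<close> primitive, where \<open>F\<close> is the identity padded
  with zero columns. The left factors of the two factorisations have determinants of equal
  norm.\<close>

lemma norm_sum_list_SN:
  fixes g Y :: "'p::prime_card padic mat"
  assumes g: "g \<in> carrier_mat r r" "Determinant.det g \<noteq> 0" and Y: "primitive_mat r m Y" and r: "r \<le> m"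
  shows "real CARD('p) powi (- sum_list (SN (g * Y))) = padic_norm (Determinant.det g)"
proof -
  obtain Z where Z: "Z \<in> carrier_mat m r" "Y * Z = 1\<^sub>m r" using Y by (auto simp: primitive_mat_def)
  have Yc: "Y \<in> carrier_mat r m" using Y by (simp add: primitive_mat_def)
  obtain h where h: "h \<in> carrier_mat r r" "g * h = 1\<^sub>m r" by (rule det_nonzero_inverse[OF g])
  have "(g * Y) * (Z * h) = g * (Y * Z) * h"
    using carrier_matD[OF g(1)] carrier_matD[OF Yc] carrier_matD[OF Z(1)] carrier_matD[OF h(1)]
    by (simp add: mult_mat_assoc_dim del: assoc_mult_mat)
  also have "\<dots> = 1\<^sub>m r" by (simp only: Z(2) right_mult_one_mat[OF g(1)] h(2))
  finally obtain U V l where UV: "U \<in> GLZ r" "V \<in> GLZ m" and l: "length l = r" "sorted_wrt (\<ge>) l"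
    and eq: "g * Y = U * diag_ppow r m l * V"
    using smith_normal_form[OF r mult_carrier_mat[OF g(1) Yc] mult_carrier_mat[OF Z(1) h(1)]] by blast
  note Uc = GLZ_carrier[OF UV(1)] and Vc = GLZ_carrier[OF UV(2)]
  define F :: "'p padic mat" where "F = mat r m (\<lambda>(i, k). if i = k then 1 else 0)"
  define F' :: "'p padic mat" where "F' = mat m r (\<lambda>(i, k). if i = k then 1 else 0)"
  have F: "F \<in> carrier_mat r m" "F' \<in> carrier_mat m r" by (simp_all add: F_def F'_def)
  have FF: "F * F' = 1\<^sub>m r"
  proof (rule eq_matI)
    fix i k assume "i < dim_row (1\<^sub>m r :: 'p padic mat)" "k < dim_col (1\<^sub>m r :: 'p padic mat)"
    then have ik: "i < r" "k < r" by simp_all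
    have "(F * F') $$ (i, k) = (\<Sum>j<m. (if i = j then 1 else 0) * (if j = k then 1 else 0))"
      unfolding mult_mat_entry[OF F ik] using ik by (intro sum.cong) (auto simp: F_def F'_def)
    also have "\<dots> = (if i = k then 1 else 0)"
      using sum_delta_mult(1)[of i m "\<lambda>j. if j = k then 1 else 0"] ik r by simp
    finally show "(F * F') $$ (i, k) = 1\<^sub>m r $$ (i, k)" using ik by simp
  qed (use F in auto)
  obtain Vi where Vi: "Vi \<in> GLZ m" "V * Vi = 1\<^sub>m m" using GLZ_inverse UV by blast
  note Vic = GLZ_carrier[OF Vi(1)]
  have FV: "F * V \<in> carrier_mat r m" by (rule mult_carrier_mat[OF F(1) Vc])
  have "F * V * (Vi * F') = F * (V * Vi) * F'"
    using carrier_matD[OF F(1)] carrier_matD[OF F(2)] carrier_matD[OF Vc] carrier_matD[OF Vic]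
    by (simp add: mult_mat_assoc_dim del: assoc_mult_mat)
  also have "\<dots> = 1\<^sub>m r" by (simp only: Vi(2) right_mult_one_mat[OF F(1)] FF)
  finally have "F * V * (Vi * F') = 1\<^sub>m r" .
  moreover have "int_mat (F * V)" "int_mat (Vi * F')"
    using int_mat_mult[OF F(1) Vc _ GLZ_int_mat[OF UV(2)]] int_mat_mult[OF Vic F(2) GLZ_int_mat[OF Vi(1)]]
    by (auto simp: F_def F'_def int_mat_def)
  ultimately have prim: "primitive_mat r m (F * V)"
    unfolding primitive_mat_def using FV mult_carrier_mat[OF Vic F(2)] by blast
  define D :: "'p padic mat" where "D = mat r r (\<lambda>(i, k). if i = k then ppow (l ! i) else 0)"
  have Dc: "D \<in> carrier_mat r r" by (simp add: D_def)
  have "diag_ppow r m l = D * F"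
  proof (rule eq_matI)
    fix i k assume "i < dim_row (D * F)" "k < dim_col (D * F)"
    then have ik: "i < r" "k < m" using Dc F by simp_all
    have "(D * F) $$ (i, k) = (\<Sum>j<r. (if i = j then 1 else 0) * (ppow (l ! i) * F $$ (j, k)))"
      unfolding mult_mat_entry[OF Dc F(1) ik] using ik by (intro sum.cong) (auto simp: D_def)
    also have "\<dots> = ppow (l ! i) * F $$ (i, k)"
      using sum_delta_mult(1)[of i r "\<lambda>j. ppow (l ! i) * F $$ (j, k)"] ik by simp
    finally show "diag_ppow r m l $$ (i, k) = (D * F) $$ (i, k)"
      using ik by (simp add: F_def diag_ppow_entry)
  qed (use Dc F in \<open>auto simp: diag_ppow_def\<close>)
  then have "g * Y = (U * D) * (F * V)"
    unfolding eq using carrier_matD[OF F(1)] carrier_matD[OF Vc] carrier_matD[OF Uc] carrier_matD[OF Dc]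
    by (simp add: mult_mat_assoc_dim del: assoc_mult_mat)
  then have "padic_norm (Determinant.det g) = padic_norm (Determinant.det (U * D))"
    using primitive_frame_det_le[OF g(1) mult_carrier_mat[OF Uc Dc] Y prim]
      primitive_frame_det_le[OF mult_carrier_mat[OF Uc Dc] g(1) prim Y] by simp
  also have "\<dots> = padic_norm (Determinant.det D)"
    unfolding det_mult[OF Uc Dc] padic_norm_mult padic_norm_det_GLZ[OF UV(1)] by simp
  also have "Determinant.det D = (\<Prod>a<r. ppow (l ! a))" unfolding D_def by (rule det_diag_mat)
  also have "padic_norm (\<Prod>a<r. ppow (l ! a) :: 'p padic) = real CARD('p) powi (- sum_list l)"
    unfolding padic_norm_prod_ppow using l(1) by (simp add: sum_list_sum_nth atLeast0LessThan)
  also have "l = SN (g * Y)" unfolding eq by (rule SN_eqI[OF UV r l, symmetric])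
  finally show ?thesis ..
qed

text \<open>Columns are selected by arbitrary maps: repetitions give zero minors and reorderings
  change only signs, so the maximum is the one over ordinary minors.\<close>

definition max_minor :: "nat \<Rightarrow> nat \<Rightarrow> (nat \<Rightarrow> nat \<Rightarrow> 'p::prime_card padic) \<Rightarrow> real" where
  "max_minor r m X = Max ((\<lambda>f. padic_norm (Determinant.det (mat r r (\<lambda>(a, b). X a (f b))))) ` ({..<r} \<rightarrow>\<^sub>E {..<m}))"

lemma max_minor_ge:
  "f \<in> {..<r} \<rightarrow>\<^sub>E {..<m} \<Longrightarrow> padic_norm (Determinant.det (mat r r (\<lambda>(a, b). X a (f b)))) \<le> max_minor r m X"
  unfolding max_minor_def by (intro Max_ge) (auto intro: finite_PiE)

text \<open>The minors of \<open>g * Y\<close> are those of \<open>Y\<close> times the determinant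
  of \<open>g\<close>. The minors of \<open>Y\<close> are integral and one of them is a unit, since
  otherwise Cauchy-Binet would make the determinant of \<open>Y * Z = 1\<close> small.\<close>

lemma max_minor_frame:
  fixes g Y :: "'p::prime_card padic mat"
  assumes g: "g \<in> carrier_mat r r" and Y: "primitive_mat r m Y" and r: "r \<le> m"
  shows "max_minor r m (\<lambda>a k. (g * Y) $$ (a, k)) = padic_norm (Determinant.det g)"
proof -
  obtain Z where Z: "Z \<in> carrier_mat m r" "int_mat Z" "Y * Z = 1\<^sub>m r" using Y by (auto simp: primitive_mat_def)
  have Yc: "Y \<in> carrier_mat r m" "int_mat Y" using Y by (simp_all add: primitive_mat_def)
  let ?M = "\<lambda>f. mat r r (\<lambda>(a, b). Y $$ (a, f b))" and ?S = "{..<r} \<rightarrow>\<^sub>E {..<m}"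
  let ?h = "\<lambda>f. padic_norm (Determinant.det (?M f))"
  have minor: "Determinant.det (mat r r (\<lambda>(a, b). (g * Y) $$ (a, f b))) = Determinant.det g * Determinant.det (?M f)"
    if f: "f \<in> ?S" for f
  proof -
    have "mat r r (\<lambda>(a, b). (g * Y) $$ (a, f b)) = g * ?M f"
    proof (rule eq_matI)
      fix a b assume "a < dim_row (g * ?M f)" "b < dim_col (g * ?M f)"
      then have ab: "a < r" "b < r" using g by simp_all
      have fb: "f b < m" using f ab(2) by auto
      show "mat r r (\<lambda>(a, b). (g * Y) $$ (a, f b)) $$ (a, b) = (g * ?M f) $$ (a, b)"
        using ab mult_mat_entry[OF g Yc(1) ab(1) fb] mult_mat_entry[OF g _ ab, of "?M f"] by simp
    qed (use g in auto)
    then show ?thesis using det_mult[OF g, of "?M f"] by simp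
  qed
  have fin: "finite ?S" by (auto intro: finite_PiE)
  have "(\<lambda>a\<in>{..<r}. a) \<in> ?S" using r by auto
  then have ne: "?S \<noteq> {}" by blast
  have h1: "?h f \<le> 1" if "f \<in> ?S" for f
    using that Yc by (intro padic_norm_det_le[of _ r]) (auto intro: int_matD)
  define c where "c = Max (?h ` ?S)"
  have c0: "c \<ge> 0" using fin ne by (auto simp: c_def Max_ge_iff padic_norm_nonneg)
  have c1: "c \<le> 1" using fin ne h1 by (auto simp: c_def)
  have "padic_norm (Determinant.det (mat r r (\<lambda>(a, b). \<Sum>j<m. Y $$ (a, j) * Z $$ (j, b)))) \<le> c"
    using c0 fin by (intro norm_det_sum_cols_le) (auto intro: int_matD[OF Z(2,1)] simp: c_def)
  moreover have "mat r r (\<lambda>(a, b). \<Sum>j<m. Y $$ (a, j) * Z $$ (j, b)) = Y * Z"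
    using Yc(1) Z(1) by (intro eq_matI) (auto simp: mult_mat_entry[OF Yc(1) Z(1)] simp del: index_mult_mat(1))
  ultimately have "c = 1" using c1 by (simp add: Z(3))
  have "max_minor r m (\<lambda>a k. (g * Y) $$ (a, k)) = Max ((\<lambda>f. padic_norm (Determinant.det g) * ?h f) ` ?S)"
    unfolding max_minor_def by (intro arg_cong[of _ _ Max] image_cong) (auto simp: minor padic_norm_mult)
  also have "\<dots> = padic_norm (Determinant.det g)"
  proof (rule Max_eqI)
    show "y \<le> padic_norm (Determinant.det g)" if "y \<in> (\<lambda>f. padic_norm (Determinant.det g) * ?h f) ` ?S" for y
      using that h1 by (auto intro!: mult_right_le_one_le padic_norm_nonneg)
    have "Max (?h ` ?S) \<in> ?h ` ?S" by (rule Max_in) (use fin ne in auto)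
    then obtain f where f: "f \<in> ?S" "?h f = 1" unfolding \<open>c = 1\<close>[unfolded c_def] by (rule imageE) simp
    show "padic_norm (Determinant.det g) \<in> (\<lambda>f. padic_norm (Determinant.det g) * ?h f) ` ?S"
      by (rule image_eqI[OF _ f(1)]) (simp add: f(2))
  qed (use fin in auto)
  finally show ?thesis .
qed

section \<open>Symplectic similitudes\<close>

text \<open>The alternating form with matrix \<open>symplectic_form n 1\<close>, on row vectors
  given as functions; the coordinates \<open>k\<close> and \<open>2 * n - 1 - k\<close> are dual to
  each other.\<close>

definition om :: "nat \<Rightarrow> (nat \<Rightarrow> 'a::comm_ring_1) \<Rightarrow> (nat \<Rightarrow> 'a) \<Rightarrow> 'a" where
  "om n x y = (\<Sum>k<n. x k * y (2 * n - 1 - k) - x (2 * n - 1 - k) * y k)"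

definition ssgn :: "nat \<Rightarrow> nat \<Rightarrow> 'a::comm_ring_1" where
  "ssgn n i = (if i < n then 1 else -1)"

text \<open>The similitude relation read row by row: the Gram matrix of the rows is \<mu> times that
  of the standard basis. The eliminations use orthogonality of rows in this form.\<close>

definition gsp :: "nat \<Rightarrow> 'a::field \<Rightarrow> 'a mat \<Rightarrow> bool" where
  "gsp n \<mu> A \<longleftrightarrow> A \<in> carrier_mat (2 * n) (2 * n) \<and>
    (\<forall>i<2 * n. \<forall>j<2 * n. om n (\<lambda>k. A $$ (i, k)) (\<lambda>k. A $$ (j, k)) = (if i + j + 1 = 2 * n then \<mu> * ssgn n i else 0))"

lemma sum_pair: "(\<Sum>k<2 * (n::nat). f k) = (\<Sum>k<n. f k + f (2 * n - 1 - k) :: 'a::comm_monoid_add)"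
proof -
  have eq: "{..<2 * n} = {..<n} \<union> {n..<2 * n}" by auto
  have "(\<Sum>k<2 * n. f k) = (\<Sum>k<n. f k) + (\<Sum>k\<in>{n..<2 * n}. f k)"
    unfolding eq by (rule sum.union_disjoint) auto
  also have "(\<Sum>k\<in>{n..<2 * n}. f k) = (\<Sum>k<n. f (2 * n - 1 - k))"
    by (rule sum.reindex_bij_witness[of _ "\<lambda>k. 2 * n - 1 - k" "\<lambda>k. 2 * n - 1 - k"]) auto
  finally show ?thesis by (simp add: sum.distrib)
qed

lemma om_eq_sum: "om n x y = (\<Sum>k<2 * n. ssgn n k * x k * y (2 * n - 1 - k))"
  unfolding om_def sum_pair by (intro sum.cong) (auto simp: ssgn_def)

lemma om_self: "om n v v = 0"
  by (simp add: om_def mult.commute)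

lemma om_add_left: "om n (\<lambda>k. x k + y k) z = om n x z + om n y z"
  unfolding om_eq_sum by (simp add: algebra_simps sum.distrib)

lemma om_add_right: "om n z (\<lambda>k. x k + y k) = om n z x + om n z y"
  unfolding om_eq_sum by (simp add: algebra_simps sum.distrib)

lemma om_scale_left: "om n (\<lambda>k. c * x k) z = c * om n x z"
  unfolding om_eq_sum by (simp add: algebra_simps sum_distrib_left)

lemma om_scale_right: "om n z (\<lambda>k. c * x k) = c * om n z x"
  unfolding om_eq_sum by (simp add: algebra_simps sum_distrib_left)

lemma om_diff_right: "om n z (\<lambda>k. x k - y k) = om n z x - om n z y"
  unfolding om_eq_sum by (simp add: algebra_simps sum_subtractf)

lemma om_swap: "om n y x = - om n x y"
  unfolding om_def sum_negf[symmetric] by (intro sum.cong) (auto simp: mult.commute)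

lemma om_cong: "(\<And>k. k < 2 * n \<Longrightarrow> x k = x' k) \<Longrightarrow> (\<And>k. k < 2 * n \<Longrightarrow> y k = y' k) \<Longrightarrow> om n x y = om n x' y'"
  unfolding om_def by (intro sum.cong) auto

lemma om_unit_right:
  assumes "j < 2 * n"
  shows "om n x (\<lambda>k. if k = j then 1 else 0) = - ssgn n j * x (2 * n - 1 - j)"
proof -
  have "om n x (\<lambda>k. if k = j then 1 else 0) = (\<Sum>k<2 * n. (ssgn n k * x k) * (if k = 2 * n - 1 - j then 1 else 0))"
    unfolding om_eq_sum using assms by (intro sum.cong) auto
  also have "\<dots> = ssgn n (2 * n - 1 - j) * x (2 * n - 1 - j)"
    using assms by (intro sum_delta_mult(4)) auto
  also have "ssgn n (2 * n - 1 - j) = (- ssgn n j :: 'a)" using assms by (auto simp: ssgn_def)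
  finally show ?thesis .
qed

lemma om_unit_left:
  assumes "j < 2 * n"
  shows "om n (\<lambda>k. if k = j then 1 else 0) x = ssgn n j * x (2 * n - 1 - j)"
  using om_unit_right[OF assms, of x] om_swap[of n "\<lambda>k. if k = j then 1 else 0" x] by simp

lemma symplectic_form_carrier [simp]: "symplectic_form n c \<in> carrier_mat (2 * n) (2 * n)"
proof -
  have "four_block_mat (0\<^sub>m n n) (c \<cdot>\<^sub>m antidiag n) (- (c \<cdot>\<^sub>m antidiag n)) (0\<^sub>m n n) \<in> carrier_mat (n + n) (n + n)"
    by (rule four_block_carrier_mat) simp_all
  then show ?thesis by (simp add: symplectic_form_def mult_2)
qed

lemma symplectic_form_entry:
  assumes "i < 2 * n" "j < 2 * n"
  shows "symplectic_form n c $$ (i, j) = (if i + j + 1 = 2 * n then c * ssgn n i else 0)"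
  using assms unfolding symplectic_form_def
  by (subst index_mat_four_block) (auto simp: antidiag_def ssgn_def)

lemma symplectic_gram_entry:
  assumes A: "A \<in> carrier_mat (2 * n) (2 * n)" and ij: "i < 2 * n" "j < 2 * n"
  shows "(A * symplectic_form n 1 * transpose_mat A) $$ (i, j) = om n (\<lambda>k. A $$ (i, k)) (\<lambda>k. A $$ (j, k))"
proof -
  have AJ: "A * symplectic_form n 1 \<in> carrier_mat (2 * n) (2 * n)" using A by simp
  have AJe: "(A * symplectic_form n 1) $$ (i, l) = ssgn n (2 * n - 1 - l) * A $$ (i, 2 * n - 1 - l)" if l: "l < 2 * n" for l
  proof -
    have "(A * symplectic_form n 1) $$ (i, l) = (\<Sum>k<2 * n. (ssgn n k * A $$ (i, k)) * (if k = 2 * n - 1 - l then 1 else 0))"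
      unfolding mult_mat_entry[OF A symplectic_form_carrier ij(1) l]
      using l by (intro sum.cong) (auto simp: symplectic_form_entry)
    also have "\<dots> = ssgn n (2 * n - 1 - l) * A $$ (i, 2 * n - 1 - l)"
      using l by (intro sum_delta_mult(4)) auto
    finally show ?thesis .
  qed
  have "(A * symplectic_form n 1 * transpose_mat A) $$ (i, j)
      = (\<Sum>l<2 * n. ssgn n (2 * n - 1 - l) * A $$ (i, 2 * n - 1 - l) * A $$ (j, l))"
    using A ij by (subst mult_mat_entry[OF AJ _ ij]) (auto simp: AJe intro!: sum.cong)
  also have "\<dots> = (\<Sum>k<2 * n. ssgn n k * A $$ (i, k) * A $$ (j, 2 * n - 1 - k))"
    by (rule sum.reindex_bij_witness[of _ "\<lambda>k. 2 * n - 1 - k" "\<lambda>k. 2 * n - 1 - k"]) auto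
  finally show ?thesis by (simp only: om_eq_sum)
qed

lemma gsp_iff:
  "gsp n \<mu> A \<longleftrightarrow> A \<in> carrier_mat (2 * n) (2 * n) \<and> A * symplectic_form n 1 * transpose_mat A = symplectic_form n \<mu>"
proof -
  have "A * symplectic_form n 1 * transpose_mat A = symplectic_form n \<mu> \<longleftrightarrow>
    (\<forall>i<2 * n. \<forall>j<2 * n. om n (\<lambda>k. A $$ (i, k)) (\<lambda>k. A $$ (j, k)) = (if i + j + 1 = 2 * n then \<mu> * ssgn n i else 0))"
    if A: "A \<in> carrier_mat (2 * n) (2 * n)"
  proof -
    have c: "A * symplectic_form n 1 * transpose_mat A \<in> carrier_mat (2 * n) (2 * n)"
      using A by (intro mult_carrier_mat[of _ _ "2 * n"]) auto
    show ?thesis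
    proof
      assume eq: "A * symplectic_form n 1 * transpose_mat A = symplectic_form n \<mu>"
      show "\<forall>i<2 * n. \<forall>j<2 * n. om n (\<lambda>k. A $$ (i, k)) (\<lambda>k. A $$ (j, k)) = (if i + j + 1 = 2 * n then \<mu> * ssgn n i else 0)"
        by (auto simp: symplectic_gram_entry[OF A, symmetric] eq symplectic_form_entry simp del: assoc_mult_mat)
    next
      assume "\<forall>i<2 * n. \<forall>j<2 * n. om n (\<lambda>k. A $$ (i, k)) (\<lambda>k. A $$ (j, k)) = (if i + j + 1 = 2 * n then \<mu> * ssgn n i else 0)"
      then show "A * symplectic_form n 1 * transpose_mat A = symplectic_form n \<mu>"
        using carrier_matD[OF c] carrier_matD[OF symplectic_form_carrier[of n \<mu>]]
        by (intro eq_matI) (simp_all only: symplectic_gram_entry[OF A] symplectic_form_entry)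
    qed
  qed
  then show ?thesis unfolding gsp_def by blast
qed

lemma symplectic_form_square: "symplectic_form n 1 * symplectic_form n c = (- c) \<cdot>\<^sub>m 1\<^sub>m (2 * n)"
proof (rule eq_matI)
  fix i j assume "i < dim_row ((- c) \<cdot>\<^sub>m 1\<^sub>m (2 * n) :: 'a mat)" "j < dim_col ((- c) \<cdot>\<^sub>m 1\<^sub>m (2 * n) :: 'a mat)"
  then have ij: "i < 2 * n" "j < 2 * n" by simp_all
  have "(symplectic_form n 1 * symplectic_form n c) $$ (i, j)
      = (\<Sum>k<2 * n. (if k = 2 * n - 1 - i then 1 else 0) * (ssgn n i * symplectic_form n c $$ (k, j)))"
    unfolding mult_mat_entry[OF symplectic_form_carrier symplectic_form_carrier ij]
    using ij by (intro sum.cong) (auto simp: symplectic_form_entry)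
  also have "\<dots> = ssgn n i * symplectic_form n c $$ (2 * n - 1 - i, j)"
    using ij by (intro sum_delta_mult(3)) auto
  also have "\<dots> = ((- c) \<cdot>\<^sub>m 1\<^sub>m (2 * n)) $$ (i, j)"
    using ij by (auto simp: symplectic_form_entry ssgn_def)
  finally show "(symplectic_form n 1 * symplectic_form n c) $$ (i, j) = ((- c) \<cdot>\<^sub>m 1\<^sub>m (2 * n)) $$ (i, j)" .
qed (simp_all add: carrier_matD[OF symplectic_form_carrier])

lemma symplectic_form_smult: "symplectic_form n c = c \<cdot>\<^sub>m symplectic_form n 1"
  by (rule eq_matI) (simp_all add: symplectic_form_entry carrier_matD[OF symplectic_form_carrier])

lemma symplectic_form_square': "symplectic_form n c * symplectic_form n 1 = (- c) \<cdot>\<^sub>m 1\<^sub>m (2 * n)"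
proof -
  have "symplectic_form n c * symplectic_form n 1 = c \<cdot>\<^sub>m (symplectic_form n 1 * symplectic_form n 1)"
    unfolding symplectic_form_smult[of n c] by (rule mult_smult_assoc_mat[OF symplectic_form_carrier symplectic_form_carrier])
  then show ?thesis unfolding symplectic_form_square by (auto intro!: eq_matI)
qed

text \<open>With \<open>J\<close> the standard form, \<open>J A^T J\<close> is an inverse of
  \<open>A\<close> up to the factor \<open>- \<mu>\<close>. Commuting the two factors gives the
  relation between the columns, so the transpose is a similitude with the same factor.\<close>

lemma gsp_inverse:
  assumes A: "gsp n \<mu> A" and \<mu>: "\<mu> \<noteq> 0"
  obtains B where "B \<in> carrier_mat (2 * n) (2 * n)" "A * B = 1\<^sub>m (2 * n)" "B * A = 1\<^sub>m (2 * n)"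
    "gsp n \<mu> (transpose_mat A)"
proof -
  let ?J = "symplectic_form n 1 :: 'a mat" and ?I = "1\<^sub>m (2 * n) :: 'a mat"
  have c: "A \<in> carrier_mat (2 * n) (2 * n)" and eq: "A * ?J * transpose_mat A = symplectic_form n \<mu>"
    using A by (auto simp: gsp_iff)
  have Jc: "?J \<in> carrier_mat (2 * n) (2 * n)" by simp
  note dims = carrier_matD[OF c] carrier_matD[OF Jc]
  define C where "C = ?J * transpose_mat A * ?J"
  have Cc: "C \<in> carrier_mat (2 * n) (2 * n)" unfolding C_def using c Jc by (intro mult_carrier_mat) auto
  have AC: "A * C = (- \<mu>) \<cdot>\<^sub>m ?I"
  proof -
    have "A * C = (A * ?J * transpose_mat A) * ?J"
      unfolding C_def using dims by (simp add: mult_mat_assoc_dim del: assoc_mult_mat)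
    then show ?thesis unfolding eq by (simp only: symplectic_form_square')
  qed
  define B where "B = (- inverse \<mu>) \<cdot>\<^sub>m C"
  have Bc: "B \<in> carrier_mat (2 * n) (2 * n)" using Cc by (simp add: B_def)
  have AB: "A * B = ?I"
    unfolding B_def mult_smult_distrib[OF c Cc] AC using \<mu> by (auto intro!: eq_matI)
  have BA: "B * A = ?I" by (rule mat_mult_left_right_inverse[OF c Bc AB])
  have CA: "C * A = (- \<mu>) \<cdot>\<^sub>m ?I"
  proof -
    have "C = (- \<mu>) \<cdot>\<^sub>m B" unfolding B_def using \<mu> by (auto intro!: eq_matI)
    then show ?thesis using mult_smult_assoc_mat[OF Bc c, of "- \<mu>"] BA by simp
  qed
  have "transpose_mat A * ?J * A = symplectic_form n \<mu>"
  proof -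
    have "?J * (C * A) = (?J * ?J) * (transpose_mat A * ?J * A)"
      unfolding C_def using dims by (simp add: mult_mat_assoc_dim del: assoc_mult_mat)
    also have "\<dots> = (- 1) \<cdot>\<^sub>m (transpose_mat A * ?J * A)"
      unfolding symplectic_form_square using c Jc
      by (subst mult_smult_assoc_mat[of _ "2 * n" "2 * n" _ "2 * n"]) (auto simp del: assoc_mult_mat)
    finally have 1: "(- 1) \<cdot>\<^sub>m (transpose_mat A * ?J * A) = ?J * ((- \<mu>) \<cdot>\<^sub>m ?I)" unfolding CA ..
    have "?J * ((- \<mu>) \<cdot>\<^sub>m ?I) = (- \<mu>) \<cdot>\<^sub>m ?J"
      using mult_smult_distrib[OF Jc one_carrier_mat, of "- \<mu>"] right_mult_one_mat[OF Jc] by simp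
    with 1 have "(- 1) \<cdot>\<^sub>m (transpose_mat A * ?J * A) = (- \<mu>) \<cdot>\<^sub>m ?J" by simp
    then have 2: "(- 1) \<cdot>\<^sub>m ((- 1) \<cdot>\<^sub>m (transpose_mat A * ?J * A)) = (- 1) \<cdot>\<^sub>m ((- \<mu>) \<cdot>\<^sub>m ?J)" by (rule arg_cong)
    have 3: "(- 1) \<cdot>\<^sub>m ((- 1) \<cdot>\<^sub>m X) = X" for X :: "'a mat" by (rule eq_matI) auto
    have 4: "(- 1) \<cdot>\<^sub>m ((- \<mu>) \<cdot>\<^sub>m ?J) = \<mu> \<cdot>\<^sub>m ?J" by (rule eq_matI) auto
    show ?thesis using 2 unfolding 3 4 symplectic_form_smult[of n \<mu>] .
  qed
  then have "gsp n \<mu> (transpose_mat A)" using c by (simp add: gsp_iff)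
  with that Bc AB BA show ?thesis by blast
qed

lemma GSp_Qp_iff: "A \<in> GSp_Qp n \<longleftrightarrow> (\<exists>\<mu>. \<mu> \<noteq> 0 \<and> gsp n \<mu> A)"
proof
  assume "A \<in> GSp_Qp n"
  then show "\<exists>\<mu>. \<mu> \<noteq> 0 \<and> gsp n \<mu> A" by (auto simp: GSp_Qp_def gsp_iff GL_def)
next
  assume "\<exists>\<mu>. \<mu> \<noteq> 0 \<and> gsp n \<mu> A"
  then obtain \<mu> where \<mu>: "\<mu> \<noteq> 0" "gsp n \<mu> A" by blast
  obtain B where B: "B \<in> carrier_mat (2 * n) (2 * n)" "A * B = 1\<^sub>m (2 * n)" "B * A = 1\<^sub>m (2 * n)"
    using gsp_inverse[OF \<mu>(2,1)] by metis
  show "A \<in> GSp_Qp n"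
    unfolding GSp_Qp_def GL_def using \<mu> B by (auto simp: gsp_iff)
qed

lemma GSp_Qp_carrier: "A \<in> GSp_Qp n \<Longrightarrow> A \<in> carrier_mat (2 * n) (2 * n)"
  by (auto simp: GSp_Qp_iff gsp_def)

lemma GSp_Qp_transpose: "A \<in> GSp_Qp n \<Longrightarrow> transpose_mat A \<in> GSp_Qp n"
  unfolding GSp_Qp_iff by (metis gsp_inverse)

lemma GSp_Qp_mult:
  assumes "A \<in> GSp_Qp n" "B \<in> GSp_Qp n"
  shows "A * B \<in> GSp_Qp n"
proof -
  from assms obtain \<mu> \<nu> where \<mu>: "\<mu> \<noteq> 0" "gsp n \<mu> A" and \<nu>: "\<nu> \<noteq> 0" "gsp n \<nu> B" by (auto simp: GSp_Qp_iff)
  let ?J = "symplectic_form n 1 :: 'a padic mat"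
  have c: "A \<in> carrier_mat (2 * n) (2 * n)" "B \<in> carrier_mat (2 * n) (2 * n)" "?J \<in> carrier_mat (2 * n) (2 * n)"
    using \<mu> \<nu> by (auto simp: gsp_def)
  note dims = carrier_matD[OF c(1)] carrier_matD[OF c(2)] carrier_matD[OF c(3)]
  have "(A * B) * ?J * transpose_mat (A * B) = A * (B * ?J * transpose_mat B) * transpose_mat A"
    unfolding transpose_mult[OF c(1,2)] using dims by (simp add: mult_mat_assoc_dim del: assoc_mult_mat)
  also have "\<dots> = A * (\<nu> \<cdot>\<^sub>m ?J) * transpose_mat A"
    using \<nu>(2) symplectic_form_smult[of n \<nu>] by (simp add: gsp_iff)
  also have "\<dots> = \<nu> \<cdot>\<^sub>m (A * ?J * transpose_mat A)"
    unfolding mult_smult_distrib[OF c(1,3)] using c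
    by (intro mult_smult_assoc_mat[of _ "2 * n" "2 * n" _ "2 * n"]) auto
  also have "\<dots> = \<nu> \<cdot>\<^sub>m symplectic_form n \<mu>" using \<mu>(2) by (simp add: gsp_iff)
  also have "\<dots> = symplectic_form n (\<nu> * \<mu>)"
    unfolding symplectic_form_smult[of n \<mu>] symplectic_form_smult[of n "\<nu> * \<mu>"] by (auto intro!: eq_matI)
  finally have "gsp n (\<nu> * \<mu>) (A * B)" using mult_carrier_mat[OF c(1,2)] by (simp only: gsp_iff)
  then show ?thesis using \<mu> \<nu> by (auto simp: GSp_Qp_iff intro!: exI[of _ "\<nu> * \<mu>"])
qed

lemma GSp_Qp_one: "1\<^sub>m (2 * n) \<in> GSp_Qp n"
proof -
  have "gsp n 1 (1\<^sub>m (2 * n))"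
    unfolding gsp_iff transpose_one left_mult_one_mat[OF symplectic_form_carrier]
      right_mult_one_mat[OF symplectic_form_carrier] by simp
  then show ?thesis unfolding GSp_Qp_iff by (intro exI[of _ 1]) auto
qed

lemma GSp_Qp_inverse:
  assumes A: "A \<in> GSp_Qp n"
  obtains B where "B \<in> GSp_Qp n" "A * B = 1\<^sub>m (2 * n)" "B * A = 1\<^sub>m (2 * n)"
proof -
  obtain \<mu> where \<mu>: "\<mu> \<noteq> 0" "gsp n \<mu> A" using A by (auto simp: GSp_Qp_iff)
  obtain B where B: "B \<in> carrier_mat (2 * n) (2 * n)" "A * B = 1\<^sub>m (2 * n)" "B * A = 1\<^sub>m (2 * n)"
    by (rule gsp_inverse[OF \<mu>(2,1)])
  let ?J = "symplectic_form n 1 :: 'a padic mat"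
  have c: "A \<in> carrier_mat (2 * n) (2 * n)" "?J \<in> carrier_mat (2 * n) (2 * n)" using \<mu> by (auto simp: gsp_def)
  have tt: "transpose_mat A * transpose_mat B = 1\<^sub>m (2 * n)"
    using transpose_mult[OF B(1) c(1)] B(3) by simp
  have BJB: "B * ?J * transpose_mat B \<in> carrier_mat (2 * n) (2 * n)"
    using B(1) c by (intro mult_carrier_mat) auto
  note dims = carrier_matD[OF c(1)] carrier_matD[OF c(2)] carrier_matD[OF B(1)]
  have "B * (A * ?J * transpose_mat A) * transpose_mat B = (B * A) * ?J * (transpose_mat A * transpose_mat B)"
    using dims by (simp add: mult_mat_assoc_dim del: assoc_mult_mat)
  also have "\<dots> = ?J" unfolding B(3) tt using left_mult_one_mat[OF c(2)] right_mult_one_mat[OF c(2)] by simp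
  also have "A * ?J * transpose_mat A = \<mu> \<cdot>\<^sub>m ?J"
    using \<mu>(2) symplectic_form_smult[of n \<mu>] by (simp add: gsp_iff)
  also have "B * (\<mu> \<cdot>\<^sub>m ?J) * transpose_mat B = \<mu> \<cdot>\<^sub>m (B * ?J * transpose_mat B)"
    unfolding mult_smult_distrib[OF B(1) c(2)] using c B(1)
    by (intro mult_smult_assoc_mat[of _ "2 * n" "2 * n" _ "2 * n"]) auto
  finally have "inverse \<mu> \<cdot>\<^sub>m (\<mu> \<cdot>\<^sub>m (B * ?J * transpose_mat B)) = inverse \<mu> \<cdot>\<^sub>m ?J" by (rule arg_cong)
  moreover have "inverse \<mu> \<cdot>\<^sub>m (\<mu> \<cdot>\<^sub>m X) = X" for X :: "'a padic mat" using \<mu>(1) by (intro eq_matI) auto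
  ultimately have "B * ?J * transpose_mat B = symplectic_form n (inverse \<mu>)"
    by (simp only: symplectic_form_smult[of n "inverse \<mu>"])
  then have "gsp n (inverse \<mu>) B" using B(1) by (simp only: gsp_iff)
  then have "B \<in> GSp_Qp n" using \<mu>(1) unfolding GSp_Qp_iff by (intro exI[of _ "inverse \<mu>"]) auto
  with that B show ?thesis by blast
qed

lemma GSp_ZpD: "A \<in> GSp_Zp n \<Longrightarrow> A \<in> GSp_Qp n" "A \<in> GSp_Zp n \<Longrightarrow> A \<in> GLZ (2 * n)"
  by (auto simp: GSp_Zp_def)

lemma GSp_Zp_carrier: "A \<in> GSp_Zp n \<Longrightarrow> A \<in> carrier_mat (2 * n) (2 * n)"
  by (auto simp: GSp_Zp_def intro: GLZ_carrier)

lemma GSp_Zp_mult: "A \<in> GSp_Zp n \<Longrightarrow> B \<in> GSp_Zp n \<Longrightarrow> A * B \<in> GSp_Zp n"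
  by (auto simp: GSp_Zp_def intro: GSp_Qp_mult GLZ_mult)

lemma GSp_Zp_one: "1\<^sub>m (2 * n) \<in> GSp_Zp n"
  by (auto simp: GSp_Zp_def GLZ_one GSp_Qp_one)

lemma GSp_Zp_transpose: "A \<in> GSp_Zp n \<Longrightarrow> transpose_mat A \<in> GSp_Zp n"
  by (auto simp: GSp_Zp_def intro: GSp_Qp_transpose GLZ_transpose)

text \<open>The symplectic inverse and the integral inverse are the same matrix.\<close>

lemma GSp_Zp_inverse:
  assumes "A \<in> GSp_Zp n"
  obtains B where "B \<in> GSp_Zp n" "A * B = 1\<^sub>m (2 * n)" "B * A = 1\<^sub>m (2 * n)"
proof -
  obtain B where B: "B \<in> GSp_Qp n" "A * B = 1\<^sub>m (2 * n)" "B * A = 1\<^sub>m (2 * n)"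
    using GSp_Qp_inverse[OF GSp_ZpD(1)[OF assms]] by blast
  obtain B' where B': "B' \<in> GLZ (2 * n)" "A * B' = 1\<^sub>m (2 * n)"
    using GLZ_inverse[OF GSp_ZpD(2)[OF assms]] by blast
  note c = GSp_Zp_carrier[OF assms] GSp_Qp_carrier[OF B(1)] GLZ_carrier[OF B'(1)]
  have "B = B * (A * B')" unfolding B'(2) right_mult_one_mat[OF c(2)] ..
  also have "\<dots> = (B * A) * B'" by (rule assoc_mult_mat[OF c(2,1,3), symmetric])
  also have "\<dots> = B'" unfolding B(3) by (rule left_mult_one_mat[OF c(3)])
  finally have "B \<in> GSp_Zp n" using B(1) B'(1) by (simp add: GSp_Zp_def)
  with that B show ?thesis by blast
qed

subsection \<open>Transvections\<close>

text \<open>The symplectic transvection, acting from the right: a row vector \<open>x\<close> goes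
  to \<open>x\<close> plus \<open>c * om n x v\<close> times \<open>v\<close>.\<close>

definition tv :: "nat \<Rightarrow> (nat \<Rightarrow> 'a::comm_ring_1) \<Rightarrow> 'a \<Rightarrow> 'a mat" where
  "tv n v c = rank1_mat (2 * n) (\<lambda>i. c * (ssgn n i * v (2 * n - 1 - i))) v"

lemma tv_carrier [simp]: "tv n v c \<in> carrier_mat (2 * n) (2 * n)"
  by (simp add: tv_def)

lemma tv_entry:
  "i < 2 * n \<Longrightarrow> k < 2 * n \<Longrightarrow>
    tv n v c $$ (i, k) = (if i = k then 1 else 0) + c * om n (\<lambda>k. if k = i then 1 else 0) v * v k"
  by (simp add: tv_def rank1_mat_entry om_unit_left mult.assoc)

lemma mult_tv:
  assumes "A \<in> carrier_mat r (2 * n)" "i < r" "k < 2 * n"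
  shows "(A * tv n v c) $$ (i, k) = A $$ (i, k) + c * om n (\<lambda>k. A $$ (i, k)) v * v k"
proof -
  have "(\<Sum>j<2 * n. A $$ (i, j) * (c * (ssgn n j * v (2 * n - 1 - j)))) = c * om n (\<lambda>k. A $$ (i, k)) v"
    unfolding om_eq_sum sum_distrib_left by (intro sum.cong) (auto simp: mult_ac)
  then show ?thesis unfolding tv_def using mult_rank1_mat[OF assms] by simp
qed

text \<open>The two terms linear in \<open>c\<close> cancel because the form is alternating, and the
  quadratic one vanishes because \<open>v\<close> is orthogonal to itself.\<close>

lemma gsp_tv: "gsp n 1 (tv n v (c :: 'a::field))"
  unfolding gsp_def
proof (intro conjI allI impI)
  fix i j assume ij: "i < 2 * n" "j < 2 * n"
  let ?e = "\<lambda>i k. if k = i then 1 else (0 :: 'a)"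
  have row: "om n (\<lambda>k. tv n v c $$ (i, k)) y = om n (\<lambda>k. ?e i k + c * om n (?e i) v * v k) y"
    "om n y (\<lambda>k. tv n v c $$ (i, k)) = om n y (\<lambda>k. ?e i k + c * om n (?e i) v * v k)"
    if "i < 2 * n" for i y
    using that by (auto intro!: om_cong simp: tv_entry)
  have "om n (\<lambda>k. tv n v c $$ (i, k)) (\<lambda>k. tv n v c $$ (j, k))
      = om n (?e i) (?e j) + c * om n (?e j) v * om n (?e i) v + c * om n (?e i) v * om n v (?e j)"
    unfolding row(1)[OF ij(1)] row(2)[OF ij(2)]
    by (simp only: om_add_left om_add_right om_scale_left om_scale_right om_self) (simp add: algebra_simps)
  also have "om n v (?e j) = - om n (?e j) v" by (rule om_swap)
  also have "om n (?e i) (?e j) = (if i + j + 1 = 2 * n then 1 * ssgn n i else 0)"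
    using ij by (subst om_unit_left) auto
  finally show "om n (\<lambda>k. tv n v c $$ (i, k)) (\<lambda>k. tv n v c $$ (j, k)) = (if i + j + 1 = 2 * n then 1 * ssgn n i else 0)"
    by simp
qed simp

lemma tv_GSp_Zp:
  fixes v :: "nat \<Rightarrow> 'p::prime_card padic"
  assumes v: "\<And>i. i < 2 * n \<Longrightarrow> padic_norm (v i) \<le> 1" and c: "padic_norm c \<le> 1"
  shows "tv n v c \<in> GSp_Zp n"
proof -
  have "tv n v c \<in> GLZ (2 * n)"
    unfolding tv_def
  proof (rule rank1_mat_GLZ)
    have "(\<Sum>j<2 * n. v j * (c * (ssgn n j * v (2 * n - 1 - j)))) = c * om n v v"
      unfolding om_eq_sum sum_distrib_left by (intro sum.cong) (auto simp: mult_ac)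
    then show "padic_norm (1 + (\<Sum>j<2 * n. v j * (c * (ssgn n j * v (2 * n - 1 - j))))) = 1"
      by (simp add: om_self)
    show "padic_norm (c * (ssgn n i * v (2 * n - 1 - i))) \<le> 1" if "i < 2 * n" for i
      using v[of "2 * n - 1 - i"] that c by (auto simp: ssgn_def padic_norm_minus intro!: padic_norm_mult_le_1)
  qed (rule v)
  moreover have "tv n v c \<in> GSp_Qp n" unfolding GSp_Qp_iff using gsp_tv[of n v c] by (intro exI[of _ 1]) auto
  ultimately show ?thesis by (simp add: GSp_Zp_def)
qed

text \<open>\<open>tv n (y - x) (1 / om n x y)\<close> maps \<open>x\<close> to \<open>y\<close>; when \<open>om n x e\<^sub>l\<close> is not a unit an
  intermediate vector \<open>z\<close> is needed.\<close>

lemma transvections_to_unit_vector: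
  fixes x :: "nat \<Rightarrow> 'p::prime_card padic"
  assumes j: "j < n" and x: "\<And>k. k < 2 * n \<Longrightarrow> padic_norm (x k) \<le> 1"
    and supp: "\<And>k. k < 2 * n \<Longrightarrow> k < j \<or> 2 * n - j \<le> k \<Longrightarrow> x k = 0"
    and k0: "j \<le> k0" "k0 < 2 * n - j" "x k0 = 1"
  obtains v1 c1 v2 c2 where
    "\<And>k. k < 2 * n \<Longrightarrow> padic_norm (v1 k) \<le> 1" "padic_norm c1 \<le> 1"
    "\<And>k. k < 2 * n \<Longrightarrow> padic_norm (v2 k) \<le> 1" "padic_norm c2 \<le> 1"
    "\<And>k. k < 2 * n \<Longrightarrow> k < j \<or> 2 * n - j \<le> k \<Longrightarrow> v1 k = 0"
    "\<And>k. k < 2 * n \<Longrightarrow> k < j \<or> 2 * n - j \<le> k \<Longrightarrow> v2 k = 0"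
    "\<And>k. k < 2 * n \<Longrightarrow> (let x1 = (\<lambda>k. x k + c1 * om n x v1 * v1 k) in
        x1 k + c2 * om n x1 v2 * v2 k) = (if k = 2 * n - 1 - j then 1 else 0)"
proof -
  define l where "l = 2 * n - 1 - j"
  define k' where "k' = 2 * n - 1 - k0"
  have l: "l < 2 * n" "j \<le> l" "l < 2 * n - j" "n \<le> l" "2 * n - 1 - l = j" using j by (auto simp: l_def)
  have k': "k' < 2 * n" "j \<le> k'" "k' < 2 * n - j" "2 * n - 1 - k' = k0" using k0 j by (auto simp: k'_def)
  let ?e = "\<lambda>i k. if k = i then 1 else (0 :: 'p padic)"
  have xj: "om n x (?e j) = - x l" using om_unit_right[of j n x] j by (simp add: ssgn_def l_def)
  have xk: "om n x (?e k') = - ssgn n k'" using om_unit_right[of k' n x] k' k0 by simp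
  \<comment> \<open>The intermediate vector must pair to a unit with \<open>x\<close> and have
    coordinate 1 at \<open>j\<close>. If \<open>x l\<close> is not a unit, adding the basis vector
    dual to the coordinate \<open>k0\<close> changes the pairing by a sign, and a sign minus a
    non-unit is a unit.\<close>
  define z where "z = (if padic_norm (x l) = 1 then ?e j else (\<lambda>k. ?e j k + ?e k' k))"
  have z: "padic_norm (z k) \<le> 1" for k
    using padic_norm_of_nat_le_1[of 2, where 'p='p] by (auto simp: z_def intro!: padic_norm_add_le)
  have zsupp: "z k = 0" if "k < 2 * n" "k < j \<or> 2 * n - j \<le> k" for k
    using that k' j by (auto simp: z_def)
  have zj: "z j = 1"
  proof (cases "padic_norm (x l) = 1")
    case False
    then have "k0 \<noteq> l" using k0 by auto
    then have "k' \<noteq> j" using k' l by auto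
    with False show ?thesis by (simp add: z_def)
  qed (simp add: z_def)
  have xz: "padic_norm (om n x z) = 1"
  proof (cases "padic_norm (x l) = 1")
    case True
    then show ?thesis by (simp add: z_def xj padic_norm_minus)
  next
    case False
    have "om n x z = - ssgn n k' + - x l" using False by (simp add: z_def om_add_right xj xk)
    also have "padic_norm \<dots> = padic_norm (- ssgn n k' :: 'p padic)"
      using False x[OF l(1)] by (intro padic_norm_add_eq) (auto simp: ssgn_def padic_norm_minus)
    finally show ?thesis by (auto simp: ssgn_def padic_norm_minus)
  qed
  have xz0: "om n x z \<noteq> 0" using xz by auto
  \<comment> \<open>Both differences vanish off the middle coordinates, so the finished outer part
    stays untouched. The second parameter can be 1 since \<open>om n z v2 = 1\<close>.\<close>
  define v1 c1 v2 where "v1 = (\<lambda>k. z k - x k)" and "c1 = inverse (om n x z)" and "v2 = (\<lambda>k. ?e l k - z k)"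
  have x1: "x k + c1 * om n x v1 * v1 k = z k" for k
    unfolding v1_def c1_def om_diff_right om_self using xz0 by simp
  have zl: "om n z v2 = 1"
    unfolding v2_def om_diff_right om_self using om_unit_right[OF l(1), of z] l zj by (simp add: ssgn_def)
  show ?thesis
  proof (rule that)
    show "padic_norm (v1 k) \<le> 1" if "k < 2 * n" for k
      unfolding v1_def using x that z by (intro padic_norm_diff_le) auto
    show "padic_norm c1 \<le> 1" by (simp add: c1_def padic_norm_inverse xz)
    show "padic_norm (v2 k) \<le> 1" for k unfolding v2_def using z by (intro padic_norm_diff_le) auto
    show "padic_norm (1 :: 'p padic) \<le> 1" by simp
    show "v1 k = 0" if "k < 2 * n" "k < j \<or> 2 * n - j \<le> k" for k
      using zsupp[OF that] supp[OF that] by (simp add: v1_def)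
    show "v2 k = 0" if "k < 2 * n" "k < j \<or> 2 * n - j \<le> k" for k
      using zsupp[OF that] that l by (auto simp: v2_def)
    show "(let x1 = (\<lambda>k. x k + c1 * om n x v1 * v1 k) in x1 k + 1 * om n x1 v2 * v2 k)
        = (if k = 2 * n - 1 - j then 1 else 0)" if "k < 2 * n" for k
      unfolding Let_def x1 zl by (simp add: v2_def l_def)
  qed
qed

subsection \<open>Triangular and diagonal forms under transvections\<close>

fun tv_prod :: "nat \<Rightarrow> ((nat \<Rightarrow> 'a) \<times> 'a) list \<Rightarrow> 'a::comm_ring_1 mat" where
  "tv_prod n [] = 1\<^sub>m (2 * n)"
| "tv_prod n ((v, c) # ts) = tv n v c * tv_prod n ts"

definition int_tv :: "nat \<Rightarrow> ((nat \<Rightarrow> 'p::prime_card padic) \<times> 'p padic) list \<Rightarrow> bool" where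
  "int_tv n ts \<longleftrightarrow> (\<forall>(v, c)\<in>set ts. (\<forall>k<2 * n. padic_norm (v k) \<le> 1) \<and> padic_norm c \<le> 1)"

lemma tv_prod_carrier [simp]: "tv_prod n ts \<in> carrier_mat (2 * n) (2 * n)"
  by (induction n ts rule: tv_prod.induct) (auto intro: mult_carrier_mat[OF tv_carrier])

lemma tv_prod_append: "tv_prod n (ts @ us) = tv_prod n ts * tv_prod n us"
proof (induction n ts rule: tv_prod.induct)
  case (1 n)
  show ?case using left_mult_one_mat[OF tv_prod_carrier[of n us]] by simp
next
  case (2 n v c ts)
  then show ?case using assoc_mult_mat[OF tv_carrier[of n v c] tv_prod_carrier[of n ts] tv_prod_carrier[of n us]]
    by simp
qed

lemma tv_prod_GSp_Zp: "int_tv n ts \<Longrightarrow> tv_prod n ts \<in> GSp_Zp n"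
  by (induction n ts rule: tv_prod.induct) (auto simp: int_tv_def GSp_Zp_one intro!: GSp_Zp_mult tv_GSp_Zp)

lemma gsp_om: "gsp n \<mu> A \<Longrightarrow> i < 2 * n \<Longrightarrow> j < 2 * n \<Longrightarrow>
    om n (\<lambda>k. A $$ (i, k)) (\<lambda>k. A $$ (j, k)) = (if i + j + 1 = 2 * n then \<mu> * ssgn n i else 0)"
  by (simp add: gsp_def)

text \<open>Row \<open>i\<close> is orthogonal to the triangular row \<open>2 * n - 1 - c\<close>.
  By induction on \<open>c\<close> all terms of their pairing vanish except
  \<open>B $$ (i, c)\<close> times a nonzero diagonal entry.\<close>

lemma gsp_triangular_rows:
  assumes B: "gsp n \<mu> B" and j: "j \<le> n"
    and tri: "\<And>i k. 2 * n - j \<le> i \<Longrightarrow> i < 2 * n \<Longrightarrow> k < i \<Longrightarrow> B $$ (i, k) = 0"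
    and nz: "\<And>i. 2 * n - j \<le> i \<Longrightarrow> i < 2 * n \<Longrightarrow> B $$ (i, i) \<noteq> 0"
    and i: "j \<le> i" "i < 2 * n"
  shows "c < j \<Longrightarrow> B $$ (i, c) = 0"
proof (induction c rule: less_induct)
  case (less c)
  define k where "k = 2 * n - 1 - c"
  have k: "2 * n - j \<le> k" "k < 2 * n" "2 * n - 1 - c = k" using less.prems j by (auto simp: k_def)
  have "0 = om n (\<lambda>t. B $$ (i, t)) (\<lambda>t. B $$ (k, t))"
    using gsp_om[OF B i(2) k(2)] less.prems i j by (auto simp: k_def)
  also have "\<dots> = (\<Sum>t<2 * n. ssgn n t * B $$ (i, t) * B $$ (k, 2 * n - 1 - t))" by (rule om_eq_sum)
  also have "\<dots> = ssgn n c * B $$ (i, c) * B $$ (k, k) + (\<Sum>t\<in>{..<2 * n} - {c}. ssgn n t * B $$ (i, t) * B $$ (k, 2 * n - 1 - t))"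
    using less.prems j k by (subst sum.remove[of _ c]) auto
  also have "(\<Sum>t\<in>{..<2 * n} - {c}. ssgn n t * B $$ (i, t) * B $$ (k, 2 * n - 1 - t)) = 0"
  proof (rule sum.neutral, rule ballI)
    fix t assume t: "t \<in> {..<2 * n} - {c}"
    show "ssgn n t * B $$ (i, t) * B $$ (k, 2 * n - 1 - t) = 0"
    proof (cases "t < c")
      case True
      then show ?thesis using less.IH[of t] less.prems by simp
    next
      case False
      then have "2 * n - 1 - t < k" using t by (auto simp: k_def)
      then show ?thesis using tri[OF k(1,2)] by simp
    qed
  qed
  finally show ?case using nz[OF k(1,2)] by (auto simp: ssgn_def split: if_splits)
qed

lemma om_zero:
  assumes "\<And>k. k < 2 * n \<Longrightarrow> x k = 0 \<or> y (2 * n - 1 - k) = 0"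
  shows "om n x y = 0"
  unfolding om_eq_sum using assms by (intro sum.neutral) fastforce

text \<open>Rows are made triangular from the bottom, by two transvections each. The vectors of
  these transvections live on the middle coordinates, hence are orthogonal to the rows already
  finished and leave them unchanged.\<close>

lemma iwasawa_elimination:
  fixes A :: "'p::prime_card padic mat"
  assumes A: "A \<in> GSp_Qp n" and "j \<le> n"
  shows "\<exists>ts. length ts = 2 * j \<and> int_tv n ts \<and>
    (\<forall>i k. 2 * n - j \<le> i \<longrightarrow> i < 2 * n \<longrightarrow> k < i \<longrightarrow> (A * tv_prod n ts) $$ (i, k) = 0) \<and>
    (\<forall>i. 2 * n - j \<le> i \<longrightarrow> i < 2 * n \<longrightarrow> (A * tv_prod n ts) $$ (i, i) \<noteq> 0)"
  using assms(2)
proof (induction j)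
  case 0
  show ?case by (rule exI[of _ "[]"]) (auto simp: int_tv_def)
next
  case (Suc j)
  then obtain ts where ts: "length ts = 2 * j" "int_tv n ts"
    and tri: "\<And>i k. 2 * n - j \<le> i \<Longrightarrow> i < 2 * n \<Longrightarrow> k < i \<Longrightarrow> (A * tv_prod n ts) $$ (i, k) = 0"
    and nz: "\<And>i. 2 * n - j \<le> i \<Longrightarrow> i < 2 * n \<Longrightarrow> (A * tv_prod n ts) $$ (i, i) \<noteq> 0"
    by auto
  define B where "B = A * tv_prod n ts"
  note tri = tri[folded B_def] and nz = nz[folded B_def]
  have BG: "B \<in> GSp_Qp n" unfolding B_def by (rule GSp_Qp_mult[OF A GSp_ZpD(1)[OF tv_prod_GSp_Zp[OF ts(2)]]])
  have Bc: "B \<in> carrier_mat (2 * n) (2 * n)" by (rule GSp_Qp_carrier[OF BG])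
  obtain \<mu> where \<mu>: "\<mu> \<noteq> 0" "gsp n \<mu> B" using BG by (auto simp: GSp_Qp_iff)
  define l where "l = 2 * n - 1 - j"
  have j: "j < n" using Suc.prems by simp
  have l: "l < 2 * n" "j \<le> l" "l < 2 * n - j" "l + j + 1 = 2 * n" using j by (auto simp: l_def)
  have lo: "B $$ (i, c) = 0" if "j \<le> i" "i < 2 * n" "c < j" for i c
    by (rule gsp_triangular_rows[OF \<mu>(2) _ tri nz that]) (use j in auto)
  \<comment> \<open>If row \<open>l\<close> vanished on the middle coordinates it would be
    orthogonal to row \<open>j\<close>, but these two rows pair to \<open>- \<mu>\<close>.\<close>
  have "\<exists>k. j \<le> k \<and> k < 2 * n - j \<and> B $$ (l, k) \<noteq> 0"
  proof (rule ccontr)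
    assume no: "\<not> ?thesis"
    have "om n (\<lambda>k. B $$ (l, k)) (\<lambda>k. B $$ (j, k)) = 0"
    proof (rule om_zero)
      fix k assume k: "k < 2 * n"
      consider "k < j" | "j \<le> k" "k < 2 * n - j" | "2 * n - j \<le> k" by linarith
      then show "B $$ (l, k) = 0 \<or> B $$ (j, 2 * n - 1 - k) = 0"
      proof cases
        case 1 then show ?thesis using lo[OF l(2,1)] by simp
      next
        case 2 then show ?thesis using no by blast
      next
        case 3
        then have "2 * n - 1 - k < j" using k j by linarith
        then show ?thesis using lo[of j] j by simp
      qed
    qed
    then show False using gsp_om[OF \<mu>(2) l(1), of j] \<mu>(1) l j by (auto simp: ssgn_def split: if_splits)
  qed
  then obtain k1 where k1: "j \<le> k1" "k1 < 2 * n - j" "B $$ (l, k1) \<noteq> 0" by blast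
  \<comment> \<open>The row index of \<open>?F\<close> is a dummy: the lemma on maximal entries is
    applied to a single row, cut down to the middle coordinates.\<close>
  let ?F = "\<lambda>i::nat. \<lambda>k. if j \<le> k \<and> k < 2 * n - j then B $$ (l, k) else 0"
  obtain i0 k0 e where k0': "k0 < 2 * n" "?F i0 k0 \<noteq> 0" and e: "padic_norm (?F i0 k0) = real CARD('p) powi (- e)"
    and le: "\<And>i k. i < 1 \<Longrightarrow> k < 2 * n \<Longrightarrow> padic_norm (?F i k) \<le> real CARD('p) powi (- e)"
    by (rule maximal_norm_entry[of 0 1 k1 "2 * n" ?F]) (use k1 in auto)
  from k0' have k0: "j \<le> k0" "k0 < 2 * n - j" "B $$ (l, k0) \<noteq> 0" by (auto split: if_splits)
  define a where "a = B $$ (l, k0)"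
  have a: "a \<noteq> 0" "padic_norm a = real CARD('p) powi (- e)" using k0 e by (auto simp: a_def)
  \<comment> \<open>The row splits into \<open>a\<close> times an integral vector with an entry 1 on
    the middle coordinates, and a rest \<open>w\<close> on the last \<open>j\<close> ones, which is
    orthogonal to every transvection vector in use.\<close>
  define x where "x = (\<lambda>k. if j \<le> k \<and> k < 2 * n - j then B $$ (l, k) / a else 0)"
  define w where "w = (\<lambda>k. if 2 * n - j \<le> k then B $$ (l, k) else 0)"
  have row_l: "B $$ (l, k) = a * x k + w k" if "k < 2 * n" for k
    using a lo[OF l(2,1), of k] that by (auto simp: x_def w_def)
  obtain v1 c1 v2 c2 where v1: "\<And>k. k < 2 * n \<Longrightarrow> padic_norm (v1 k) \<le> 1" "padic_norm c1 \<le> 1"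
    and v2: "\<And>k. k < 2 * n \<Longrightarrow> padic_norm (v2 k) \<le> 1" "padic_norm c2 \<le> 1"
    and s1: "\<And>k. k < 2 * n \<Longrightarrow> k < j \<or> 2 * n - j \<le> k \<Longrightarrow> v1 k = 0"
    and s2: "\<And>k. k < 2 * n \<Longrightarrow> k < j \<or> 2 * n - j \<le> k \<Longrightarrow> v2 k = 0"
    and x2: "\<And>k. k < 2 * n \<Longrightarrow> (let x1 = (\<lambda>k. x k + c1 * om n x v1 * v1 k) in
        x1 k + c2 * om n x1 v2 * v2 k) = (if k = 2 * n - 1 - j then 1 else 0)"
  proof (rule transvections_to_unit_vector[OF j, of x k0])
    show "padic_norm (x k) \<le> 1" if "k < 2 * n" for k
      using le[of 0 k] that a padic_norm_pos[OF a(1)] by (auto simp: x_def padic_norm_divide split: if_splits)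
  qed (use k0 a in \<open>auto simp: x_def a_def\<close>)
  define x1 where "x1 = (\<lambda>k. x k + c1 * om n x v1 * v1 k)"
  have x2: "x1 k + c2 * om n x1 v2 * v2 k = (if k = l then 1 else 0)" if "k < 2 * n" for k
    using x2[OF that] by (simp add: x1_def l_def)
  have om_hi: "om n y v = 0" if "\<And>k. k < 2 * n - j \<Longrightarrow> y k = 0" "\<And>k. k < 2 * n \<Longrightarrow> k < j \<or> 2 * n - j \<le> k \<Longrightarrow> v k = 0" for y v :: "nat \<Rightarrow> 'p padic"
  proof (rule om_zero)
    fix k assume k: "k < 2 * n"
    show "y k = 0 \<or> v (2 * n - 1 - k) = 0"
    proof (cases "k < 2 * n - j")
      case False
      then have "2 * n - 1 - k < j" "2 * n - 1 - k < 2 * n" using k j by linarith+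
      then show ?thesis using that(2) by blast
    qed (use that in blast)
  qed
  let ?B1 = "B * tv n v1 c1" and ?B2 = "B * tv n v1 c1 * tv n v2 c2"
  have B1c: "?B1 \<in> carrier_mat (2 * n) (2 * n)" by (rule mult_carrier_mat[OF Bc tv_carrier])
  have hi: "?B2 $$ (i, k) = B $$ (i, k)" if i: "2 * n - j \<le> i" "i < 2 * n" "k < 2 * n" for i k
  proof -
    have r: "B $$ (i, k) = 0" if "k < 2 * n - j" for k using tri[of i k] i that by simp
    have 1: "?B1 $$ (i, k) = B $$ (i, k)" if "k < 2 * n" for k
      unfolding mult_tv[OF Bc i(2) that] using om_hi[of "\<lambda>k. B $$ (i, k)" v1] r s1 by simp
    have "om n (\<lambda>k. ?B1 $$ (i, k)) v2 = om n (\<lambda>k. B $$ (i, k)) v2" by (rule om_cong) (simp_all only: 1)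
    also have "\<dots> = 0" using om_hi[of "\<lambda>k. B $$ (i, k)" v2] r s2 by simp
    finally show ?thesis unfolding mult_tv[OF B1c i(2,3)] 1[OF i(3)] by simp
  qed
  have row2: "?B2 $$ (l, k) = a * (if k = l then 1 else 0) + w k" if k: "k < 2 * n" for k
  proof -
    have w0: "om n w v1 = 0" "om n w v2 = 0" using om_hi[of w v1] om_hi[of w v2] s1 s2 by (auto simp: w_def)
    have "om n (\<lambda>k. B $$ (l, k)) v1 = om n (\<lambda>k. a * x k + w k) v1" by (rule om_cong) (simp_all add: row_l)
    also have "\<dots> = a * om n x v1" by (simp add: om_add_left om_scale_left w0)
    finally have 1: "?B1 $$ (l, k) = a * x1 k + w k" if "k < 2 * n" for k
      unfolding mult_tv[OF Bc l(1) that] row_l[OF that] by (simp add: x1_def algebra_simps)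
    have "om n (\<lambda>k. ?B1 $$ (l, k)) v2 = om n (\<lambda>k. a * x1 k + w k) v2" by (rule om_cong) (simp_all only: 1)
    also have "\<dots> = a * om n x1 v2" by (simp add: om_add_left om_scale_left w0)
    finally have "?B2 $$ (l, k) = a * (x1 k + c2 * om n x1 v2 * v2 k) + w k"
      unfolding mult_tv[OF B1c l(1) k] 1[OF k] by (simp add: algebra_simps)
    then show ?thesis unfolding x2[OF k] .
  qed
  let ?us = "ts @ [(v1, c1), (v2, c2)]"
  have eq: "A * tv_prod n ?us = ?B2"
  proof -
    have "tv_prod n ?us = tv_prod n ts * (tv n v1 c1 * tv n v2 c2)"
      unfolding tv_prod_append by (simp add: right_mult_one_mat[OF tv_carrier])
    then show ?thesis unfolding B_def
      by (simp add: mult_mat_assoc_dim carrier_matD[OF GSp_Qp_carrier[OF A]] carrier_matD[OF tv_prod_carrier]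
          carrier_matD[OF tv_carrier] del: assoc_mult_mat)
  qed
  have "?B2 $$ (i, k) = 0" if "2 * n - Suc j \<le> i" "i < 2 * n" "k < i" for i k
  proof (cases "i = l")
    case True
    then show ?thesis using row2[of k] that l by (simp add: w_def)
  next
    case False
    then have "2 * n - j \<le> i" using that by (simp add: l_def)
    then show ?thesis using hi[of i k] tri[of i k] that by simp
  qed
  moreover have "?B2 $$ (i, i) \<noteq> 0" if "2 * n - Suc j \<le> i" "i < 2 * n" for i
  proof (cases "i = l")
    case True
    then show ?thesis using row2[of l] a l by (simp add: w_def)
  next
    case False
    then have "2 * n - j \<le> i" using that by (simp add: l_def)
    then show ?thesis using hi[of i i] nz[of i] that by simp
  qed
  moreover have "length ?us = 2 * Suc j" "int_tv n ?us"
    using ts v1 v2 by (auto simp: int_tv_def)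
  ultimately show ?case by (intro exI[of _ ?us]) (simp only: eq, blast)
qed

text \<open>It suffices to treat the lower half: the symplectic relations then force the zeros of
  the upper half, row \<open>i\<close> following from the \<open>i\<close> rows at the bottom. The
  number of transvections is the same for every \<open>A\<close>, so that one polynomial family will
  contain them all.\<close>

lemma iwasawa:
  fixes A :: "'p::prime_card padic mat"
  assumes A: "A \<in> GSp_Qp n"
  obtains ts where "length ts = 2 * n" "int_tv n ts"
    "\<And>i k. i < 2 * n \<Longrightarrow> k < i \<Longrightarrow> (A * tv_prod n ts) $$ (i, k) = 0"
proof -
  obtain ts where ts: "length ts = 2 * n" "int_tv n ts"
    and tri: "\<And>i k. n \<le> i \<Longrightarrow> i < 2 * n \<Longrightarrow> k < i \<Longrightarrow> (A * tv_prod n ts) $$ (i, k) = 0"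
    and nz: "\<And>i. n \<le> i \<Longrightarrow> i < 2 * n \<Longrightarrow> (A * tv_prod n ts) $$ (i, i) \<noteq> 0"
    using iwasawa_elimination[OF A order_refl] by auto
  have "A * tv_prod n ts \<in> GSp_Qp n" by (rule GSp_Qp_mult[OF A GSp_ZpD(1)[OF tv_prod_GSp_Zp[OF ts(2)]]])
  then obtain \<mu> where \<mu>: "gsp n \<mu> (A * tv_prod n ts)" by (auto simp: GSp_Qp_iff)
  have "(A * tv_prod n ts) $$ (i, k) = 0" if "i < 2 * n" "k < i" for i k
  proof (cases "n \<le> i")
    case False
    show ?thesis
      by (rule gsp_triangular_rows[OF \<mu> _ tri nz, of i]) (use False that in auto)
  qed (use tri that in blast)
  with ts that show ?thesis by blast
qed

section \<open>The integral group of the middle coordinates, and the Cartan decomposition\<close>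

definition mid_id :: "nat \<Rightarrow> nat \<Rightarrow> 'a::comm_ring_1 mat \<Rightarrow> bool" where
  "mid_id n j M \<longleftrightarrow> (\<forall>i<2 * n. \<forall>k<2 * n. (i < j \<or> 2 * n - j \<le> i) \<or> (k < j \<or> 2 * n - j \<le> k) \<longrightarrow>
     M $$ (i, k) = (if i = k then 1 else 0))"

lemma mid_id_mult:
  assumes "mid_id n j M" "mid_id n j N" "M \<in> carrier_mat (2 * n) (2 * n)" "N \<in> carrier_mat (2 * n) (2 * n)"
  shows "mid_id n j (M * N)"
  unfolding mid_id_def
proof (intro allI impI)
  fix i k assume ik: "i < 2 * n" "k < 2 * n" and o: "(i < j \<or> 2 * n - j \<le> i) \<or> (k < j \<or> 2 * n - j \<le> k)"
  show "(M * N) $$ (i, k) = (if i = k then 1 else 0)"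
  proof (cases "i < j \<or> 2 * n - j \<le> i")
    case True
    have "(M * N) $$ (i, k) = (\<Sum>t<2 * n. (if i = t then 1 else 0) * N $$ (t, k))"
      unfolding mult_mat_entry[OF assms(3,4) ik] using True ik assms(1) by (intro sum.cong) (auto simp: mid_id_def)
    also have "\<dots> = N $$ (i, k)" by (rule sum_delta_mult(1)[OF ik(1)])
    finally show ?thesis using assms(2) o ik by (auto simp: mid_id_def)
  next
    case False
    with o have o: "k < j \<or> 2 * n - j \<le> k" by blast
    have "(M * N) $$ (i, k) = (\<Sum>t<2 * n. M $$ (i, t) * (if t = k then 1 else 0))"
      unfolding mult_mat_entry[OF assms(3,4) ik] using o ik assms(2) by (intro sum.cong) (auto simp: mid_id_def)
    also have "\<dots> = M $$ (i, k)" by (rule sum_delta_mult(4)[OF ik(2)])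
    finally show ?thesis using assms(1) o ik by (auto simp: mid_id_def)
  qed
qed

lemma mid_id_tv:
  assumes "\<And>k. k < 2 * n \<Longrightarrow> k < j \<or> 2 * n - j \<le> k \<Longrightarrow> v k = 0"
  shows "mid_id n j (tv n v c)"
  unfolding mid_id_def
proof (intro allI impI)
  fix i k assume ik: "i < 2 * n" "k < 2 * n" and o: "(i < j \<or> 2 * n - j \<le> i) \<or> (k < j \<or> 2 * n - j \<le> k)"
  have "v (2 * n - 1 - i) = 0 \<or> v k = 0"
  proof (cases "k < j \<or> 2 * n - j \<le> k")
    case False
    then have "2 * n - 1 - i < j \<or> 2 * n - j \<le> 2 * n - 1 - i" using o ik by linarith
    then show ?thesis using assms[of "2 * n - 1 - i"] ik by simp
  qed (use assms ik in blast)
  then show "tv n v c $$ (i, k) = (if i = k then 1 else 0)"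
    using ik by (auto simp: tv_entry om_unit_left)
qed

lemma mid_id_transpose: "mid_id n j M \<Longrightarrow> M \<in> carrier_mat (2 * n) (2 * n) \<Longrightarrow> mid_id n j (transpose_mat M)"
  unfolding mid_id_def by auto

text \<open>Outside the middle block the factor is the identity and \<open>Y\<close> is diagonal, so
  those entries survive; inside, the ultrametric inequality keeps the bound because \<open>M\<close>
  is integral.\<close>

lemma mid_id_mult_left:
  fixes M Y :: "'p::prime_card padic mat"
  assumes M: "mid_id n j M" "M \<in> carrier_mat (2 * n) (2 * n)" "int_mat M" and Y: "Y \<in> carrier_mat (2 * n) (2 * n)"
    and off: "\<And>i k. i < 2 * n \<Longrightarrow> k < 2 * n \<Longrightarrow> (i < j \<or> 2 * n - j \<le> i) \<or> (k < j \<or> 2 * n - j \<le> k) \<Longrightarrow> i \<noteq> k \<Longrightarrow> Y $$ (i, k) = 0"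
    and ik: "i < 2 * n" "k < 2 * n"
  shows "(i < j \<or> 2 * n - j \<le> i) \<or> (k < j \<or> 2 * n - j \<le> k) \<Longrightarrow> (M * Y) $$ (i, k) = Y $$ (i, k)"
    and "\<lbrakk>\<And>i k. j \<le> i \<Longrightarrow> i < 2 * n - j \<Longrightarrow> j \<le> k \<Longrightarrow> k < 2 * n - j \<Longrightarrow> padic_norm (Y $$ (i, k)) \<le> c;
      c \<ge> 0; j \<le> i; i < 2 * n - j; j \<le> k; k < 2 * n - j\<rbrakk> \<Longrightarrow> padic_norm ((M * Y) $$ (i, k)) \<le> c"
proof -
  assume o: "(i < j \<or> 2 * n - j \<le> i) \<or> (k < j \<or> 2 * n - j \<le> k)"
  show "(M * Y) $$ (i, k) = Y $$ (i, k)"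
  proof (cases "i < j \<or> 2 * n - j \<le> i")
    case True
    have "(M * Y) $$ (i, k) = (\<Sum>t<2 * n. (if i = t then 1 else 0) * Y $$ (t, k))"
      unfolding mult_mat_entry[OF M(2) Y ik] using True ik M(1) by (intro sum.cong) (auto simp: mid_id_def)
    then show ?thesis using sum_delta_mult(1)[OF ik(1), of "\<lambda>t. Y $$ (t, k)"] by simp
  next
    case False
    with o have o: "k < j \<or> 2 * n - j \<le> k" by blast
    then have "(M * Y) $$ (i, k) = (\<Sum>t<2 * n. 0)"
      unfolding mult_mat_entry[OF M(2) Y ik]
    proof (intro sum.cong refl)
      fix t assume "t \<in> {..<2 * n}"
      then have t: "t < 2 * n" by simp
      have "M $$ (i, k) = 0" using M(1) ik o False by (auto simp: mid_id_def)
      then show "M $$ (i, t) * Y $$ (t, k) = 0" using off[OF t ik(2)] o by (cases "t = k") auto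
    qed
    moreover have "Y $$ (i, k) = 0" using off[OF ik] o False by auto
    ultimately show ?thesis by simp
  qed
next
  assume c: "\<And>i k. j \<le> i \<Longrightarrow> i < 2 * n - j \<Longrightarrow> j \<le> k \<Longrightarrow> k < 2 * n - j \<Longrightarrow> padic_norm (Y $$ (i, k)) \<le> c"
    "c \<ge> 0" and m: "j \<le> i" "i < 2 * n - j" "j \<le> k" "k < 2 * n - j"
  show "padic_norm ((M * Y) $$ (i, k)) \<le> c"
    unfolding mult_mat_entry[OF M(2) Y ik]
  proof (rule padic_norm_sum_le[OF c(2)])
    fix t assume "t \<in> {..<2 * n}"
    then have t: "t < 2 * n" by simp
    have "padic_norm (Y $$ (t, k)) \<le> c"
    proof (cases "t < j \<or> 2 * n - j \<le> t")
      case True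
      then have "Y $$ (t, k) = 0" using off[OF t ik(2)] m by auto
      then show ?thesis using c(2) by simp
    qed (use c(1)[of t k] m in auto)
    moreover have "padic_norm (M $$ (i, t)) \<le> 1" by (rule int_matD[OF M(3,2) ik(1) t])
    ultimately show "padic_norm (M $$ (i, t) * Y $$ (t, k)) \<le> c"
      unfolding padic_norm_mult by (intro order_trans[OF mult_left_le_one_le]) (auto simp: padic_norm_nonneg)
  qed
qed

lemma tv_inverse: "tv n v c * tv n v (- c) = 1\<^sub>m (2 * n)"
proof (rule eq_matI)
  fix i k assume "i < dim_row (1\<^sub>m (2 * n) :: 'a mat)" "k < dim_col (1\<^sub>m (2 * n) :: 'a mat)"
  then have ik: "i < 2 * n" "k < 2 * n" by simp_all
  let ?e = "\<lambda>k. if k = i then 1 else (0 :: 'a)"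
  have "om n (\<lambda>k. tv n v c $$ (i, k)) v = om n (\<lambda>k. ?e k + c * om n ?e v * v k) v"
    using ik by (intro om_cong) (auto simp: tv_entry)
  also have "\<dots> = om n ?e v" by (simp add: om_add_left om_scale_left om_self)
  finally show "(tv n v c * tv n v (- c)) $$ (i, k) = 1\<^sub>m (2 * n) $$ (i, k)"
    unfolding mult_tv[OF tv_carrier ik] using ik by (simp add: tv_entry)
qed (auto simp: carrier_matD[OF tv_carrier])

text \<open>Integral transvections of the middle block carry any integral vector with an entry 1 to
  a unit vector. The inverse is returned as well, because bringing a row of a matrix into place uses
  a row of the inverse.\<close>

lemma mid_transitive:
  fixes x :: "nat \<Rightarrow> 'p::prime_card padic"
  assumes "j < n" "\<And>k. k < 2 * n \<Longrightarrow> padic_norm (x k) \<le> 1"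
    "\<And>k. k < 2 * n \<Longrightarrow> k < j \<or> 2 * n - j \<le> k \<Longrightarrow> x k = 0"
    "j \<le> k0" "k0 < 2 * n - j" "x k0 = 1"
  obtains M M' where "M \<in> GSp_Zp n" "M' \<in> GSp_Zp n" "mid_id n j M" "mid_id n j M'" "M * M' = 1\<^sub>m (2 * n)"
    "\<And>k. k < 2 * n \<Longrightarrow> (\<Sum>t<2 * n. x t * M $$ (t, k)) = (if k = 2 * n - 1 - j then 1 else 0)"
proof -
  obtain v1 c1 v2 c2 where v1: "\<And>k. k < 2 * n \<Longrightarrow> padic_norm (v1 k) \<le> 1" "padic_norm c1 \<le> 1"
    and v2: "\<And>k. k < 2 * n \<Longrightarrow> padic_norm (v2 k) \<le> 1" "padic_norm c2 \<le> 1"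
    and s1: "\<And>k. k < 2 * n \<Longrightarrow> k < j \<or> 2 * n - j \<le> k \<Longrightarrow> v1 k = 0"
    and s2: "\<And>k. k < 2 * n \<Longrightarrow> k < j \<or> 2 * n - j \<le> k \<Longrightarrow> v2 k = 0"
    and x2: "\<And>k. k < 2 * n \<Longrightarrow> (let x1 = (\<lambda>k. x k + c1 * om n x v1 * v1 k) in
        x1 k + c2 * om n x1 v2 * v2 k) = (if k = 2 * n - 1 - j then 1 else 0)"
    by (rule transvections_to_unit_vector[of j n x k0]) (use assms in auto)
  define M where "M = tv n v1 c1 * tv n v2 c2"
  define M' where "M' = tv n v2 (- c2) * tv n v1 (- c1)"
  have K: "tv n v1 c1 \<in> GSp_Zp n" "tv n v2 c2 \<in> GSp_Zp n" "tv n v1 (- c1) \<in> GSp_Zp n" "tv n v2 (- c2) \<in> GSp_Zp n"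
    using v1 v2 by (auto intro!: tv_GSp_Zp simp: padic_norm_minus)
  have z1: "(0 :: nat) < 1" by simp
  define X where "X = mat 1 (2 * n) (\<lambda>(i, k). x k)"
  have X: "X \<in> carrier_mat 1 (2 * n)" "\<And>k. k < 2 * n \<Longrightarrow> X $$ (0, k) = x k" by (auto simp: X_def)
  have X1: "X * tv n v1 c1 \<in> carrier_mat 1 (2 * n)" by (rule mult_carrier_mat[OF X(1) tv_carrier])
  have o1: "om n (\<lambda>k. X $$ (0, k)) v1 = om n x v1" by (rule om_cong) (auto simp: X)
  have X1e: "(X * tv n v1 c1) $$ (0, k) = x k + c1 * om n x v1 * v1 k" if "k < 2 * n" for k
    using mult_tv[OF X(1) z1 that, of v1 c1] X(2)[OF that] o1 by simp
  have o2: "om n (\<lambda>k. (X * tv n v1 c1) $$ (0, k)) v2 = om n (\<lambda>k. x k + c1 * om n x v1 * v1 k) v2"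
    by (rule om_cong) (simp_all only: X1e)
  show ?thesis
  proof (rule that)
    show "M \<in> GSp_Zp n" "M' \<in> GSp_Zp n" unfolding M_def M'_def using K by (auto intro: GSp_Zp_mult)
    show "mid_id n j M" "mid_id n j M'" unfolding M_def M'_def by (intro mid_id_mult mid_id_tv s1 s2 tv_carrier; assumption)+
    show "M * M' = 1\<^sub>m (2 * n)" unfolding M_def M'_def
      by (rule mult_inverse_mult) (auto simp: tv_inverse)
    fix k assume k: "k < 2 * n"
    have "(\<Sum>t<2 * n. x t * M $$ (t, k)) = (X * M) $$ (0, k)"
      using mult_mat_entry[OF X(1) _ z1 k, of M] X(2) by (simp add: M_def mult_carrier_mat[OF tv_carrier tv_carrier])
    also have "X * M = X * tv n v1 c1 * tv n v2 c2"
      unfolding M_def by (rule assoc_mult_mat[OF X(1) tv_carrier tv_carrier, symmetric])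
    also have "\<dots> $$ (0, k) = (if k = 2 * n - 1 - j then 1 else 0)"
      unfolding mult_tv[OF X1 z1 k] o2 X1e[OF k] using x2[OF k] by (simp add: Let_def)
    finally show "(\<Sum>t<2 * n. x t * M $$ (t, k)) = (if k = 2 * n - 1 - j then 1 else 0)" .
  qed
qed

text \<open>Besides sending \<open>y\<close> to a unit vector, \<open>M\<close> keeps its own column
  at \<open>2 * n - 1 - j\<close> equal to a unit vector, because both transvection vectors vanish
  there. Its transpose therefore clears a column without spoiling the row that is already
  clear.\<close>

lemma mid_clear_column:
  fixes y :: "nat \<Rightarrow> 'p::prime_card padic"
  assumes j: "j < n" and y: "\<And>k. k < 2 * n \<Longrightarrow> padic_norm (y k) \<le> 1"
    and supp: "\<And>k. k < 2 * n \<Longrightarrow> k < j \<or> 2 * n - j \<le> k \<Longrightarrow> y k = 0"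
    and yl: "y (2 * n - 1 - j) = 1"
  obtains M where "M \<in> GSp_Zp n" "mid_id n j M"
    "\<And>k. k < 2 * n \<Longrightarrow> (\<Sum>t<2 * n. y t * M $$ (t, k)) = (if k = 2 * n - 1 - j then 1 else 0)"
    "\<And>i. i < 2 * n \<Longrightarrow> M $$ (i, 2 * n - 1 - j) = (if i = 2 * n - 1 - j then 1 else 0)"
proof -
  define l where "l = 2 * n - 1 - j"
  have l: "l < 2 * n" "j \<le> l" "l < 2 * n - j" "n \<le> l" "2 * n - 1 - l = j" "j \<noteq> l" using j by (auto simp: l_def)
  let ?e = "\<lambda>i k. if k = i then 1 else (0 :: 'p padic)"
  define z where "z = (\<lambda>k. y k + (1 - y j) * ?e j k)"
  have zj: "z j = 1" "z l = 1" using l yl by (auto simp: z_def l_def)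
  have y1: "padic_norm (1 - y j) \<le> 1" using y[of j] j by (intro padic_norm_diff_le) auto
  have z: "padic_norm (z k) \<le> 1" if "k < 2 * n" for k
    unfolding z_def using y[OF that] y1 by (intro padic_norm_add_le padic_norm_mult_le_1) auto
  \<comment> \<open>The first transvection only corrects coordinate \<open>j\<close> to 1; then
    \<open>om n z v2 = 1\<close>, and the second one needs no denominator.\<close>
  define v1 c1 v2 where "v1 = ?e j" and "c1 = y j - 1" and "v2 = (\<lambda>k. ?e l k - z k)"
  have oy: "om n y v1 = - 1" using om_unit_right[of j n y] j yl by (simp add: v1_def ssgn_def)
  have o1: "y k + c1 * om n y v1 * v1 k = z k" for k
    unfolding oy by (simp add: c1_def v1_def z_def)
  have oz: "om n z v2 = 1"
    unfolding v2_def om_diff_right om_self using om_unit_right[OF l(1), of z] l zj by (simp add: ssgn_def)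
  have s1: "v1 k = 0" if "k < 2 * n" "k < j \<or> 2 * n - j \<le> k" for k using that j by (auto simp: v1_def)
  have s2: "v2 k = 0" if "k < 2 * n" "k < j \<or> 2 * n - j \<le> k" for k
    using that j l supp[OF that] by (auto simp: v2_def z_def)
  define M where "M = tv n v1 c1 * tv n v2 1"
  have "tv n v1 c1 \<in> GSp_Zp n" "tv n v2 1 \<in> GSp_Zp n"
    using y[of j] j z by (auto intro!: tv_GSp_Zp padic_norm_diff_le simp: v1_def c1_def v2_def)
  then have MK: "M \<in> GSp_Zp n" unfolding M_def by (rule GSp_Zp_mult)
  have z1: "(0 :: nat) < 1" by simp
  define X where "X = mat 1 (2 * n) (\<lambda>(i, k). y k)"
  have X: "X \<in> carrier_mat 1 (2 * n)" "\<And>k. k < 2 * n \<Longrightarrow> X $$ (0, k) = y k" by (auto simp: X_def)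
  have X1: "X * tv n v1 c1 \<in> carrier_mat 1 (2 * n)" by (rule mult_carrier_mat[OF X(1) tv_carrier])
  have p1: "om n (\<lambda>k. X $$ (0, k)) v1 = om n y v1" by (rule om_cong) (auto simp: X)
  have X1e: "(X * tv n v1 c1) $$ (0, k) = z k" if "k < 2 * n" for k
    using mult_tv[OF X(1) z1 that, of v1 c1] X(2)[OF that] p1 o1 by simp
  have p2: "om n (\<lambda>k. (X * tv n v1 c1) $$ (0, k)) v2 = om n z v2" by (rule om_cong) (simp_all only: X1e)
  show ?thesis
  proof (rule that[OF MK])
    show "mid_id n j M" unfolding M_def by (intro mid_id_mult mid_id_tv s1 s2 tv_carrier; assumption)+
    fix k assume k: "k < 2 * n"
    have "(\<Sum>t<2 * n. y t * M $$ (t, k)) = (X * M) $$ (0, k)"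
      using mult_mat_entry[OF X(1) _ z1 k, of M] X(2) by (simp add: M_def mult_carrier_mat[OF tv_carrier tv_carrier])
    also have "X * M = X * tv n v1 c1 * tv n v2 1"
      unfolding M_def by (rule assoc_mult_mat[OF X(1) tv_carrier tv_carrier, symmetric])
    also have "\<dots> $$ (0, k) = (if k = l then 1 else 0)"
      unfolding mult_tv[OF X1 z1 k] p2 X1e[OF k] oz by (simp add: v2_def)
    finally show "(\<Sum>t<2 * n. y t * M $$ (t, k)) = (if k = 2 * n - 1 - j then 1 else 0)" by (simp add: l_def)
  next
    fix i assume i: "i < 2 * n"
    have v0: "v1 l = 0" "v2 l = 0" using l zj by (auto simp: v1_def v2_def)
    have "M $$ (i, l) = (\<Sum>t<2 * n. tv n v1 c1 $$ (i, t) * (if t = l then 1 else 0))"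
      unfolding M_def mult_mat_entry[OF tv_carrier tv_carrier i l(1)]
      using l v0 by (intro sum.cong) (auto simp: tv_entry)
    also have "\<dots> = tv n v1 c1 $$ (i, l)" by (rule sum_delta_mult(4)[OF l(1)])
    also have "\<dots> = (if i = l then 1 else 0)" using i l v0 by (simp add: tv_entry)
    finally show "M $$ (i, 2 * n - 1 - j) = (if i = 2 * n - 1 - j then 1 else 0)" unfolding l_def .
  qed
qed

lemma mid_id_mult_right:
  fixes M Y :: "'p::prime_card padic mat"
  assumes M: "mid_id n j M" "M \<in> carrier_mat (2 * n) (2 * n)" "int_mat M" and Y: "Y \<in> carrier_mat (2 * n) (2 * n)"
    and off: "\<And>i k. i < 2 * n \<Longrightarrow> k < 2 * n \<Longrightarrow> (i < j \<or> 2 * n - j \<le> i) \<or> (k < j \<or> 2 * n - j \<le> k) \<Longrightarrow> i \<noteq> k \<Longrightarrow> Y $$ (i, k) = 0"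
    and ik: "i < 2 * n" "k < 2 * n"
  shows "(i < j \<or> 2 * n - j \<le> i) \<or> (k < j \<or> 2 * n - j \<le> k) \<Longrightarrow> (Y * M) $$ (i, k) = Y $$ (i, k)"
    and "\<lbrakk>\<And>i k. j \<le> i \<Longrightarrow> i < 2 * n - j \<Longrightarrow> j \<le> k \<Longrightarrow> k < 2 * n - j \<Longrightarrow> padic_norm (Y $$ (i, k)) \<le> c;
      c \<ge> 0; j \<le> i; i < 2 * n - j; j \<le> k; k < 2 * n - j\<rbrakk> \<Longrightarrow> padic_norm ((Y * M) $$ (i, k)) \<le> c"
proof -
  let ?T = transpose_mat
  have T: "mid_id n j (?T M)" "?T M \<in> carrier_mat (2 * n) (2 * n)" "int_mat (?T M)" "?T Y \<in> carrier_mat (2 * n) (2 * n)"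
    using M Y by (auto intro: mid_id_transpose int_mat_transpose)
  have YT: "?T Y $$ (k, i) = Y $$ (i, k)" if "i < 2 * n" "k < 2 * n" for i k using that Y by simp
  have off': "?T Y $$ (i, k) = 0"
    if "i < 2 * n" "k < 2 * n" "(i < j \<or> 2 * n - j \<le> i) \<or> (k < j \<or> 2 * n - j \<le> k)" "i \<noteq> k" for i k
    using off[of k i] that YT[of k i] by auto
  have eq: "(Y * M) $$ (i, k) = (?T M * ?T Y) $$ (k, i)"
    using transpose_mult[OF Y M(2)] ik mult_carrier_mat[OF Y M(2)] by (metis carrier_matD index_transpose_mat(1))
  note L = mid_id_mult_left[OF T(1,2,3,4) off' ik(2,1)]
  show "(Y * M) $$ (i, k) = Y $$ (i, k)" if "(i < j \<or> 2 * n - j \<le> i) \<or> (k < j \<or> 2 * n - j \<le> k)"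
    unfolding eq using L(1) that YT[OF ik] by auto
  show "padic_norm ((Y * M) $$ (i, k)) \<le> c"
    if c: "\<And>i k. j \<le> i \<Longrightarrow> i < 2 * n - j \<Longrightarrow> j \<le> k \<Longrightarrow> k < 2 * n - j \<Longrightarrow> padic_norm (Y $$ (i, k)) \<le> c"
      "c \<ge> 0" "j \<le> i" "i < 2 * n - j" "j \<le> k" "k < 2 * n - j"
  proof -
    have "padic_norm (?T Y $$ (i, k)) \<le> c" if "j \<le> i" "i < 2 * n - j" "j \<le> k" "k < 2 * n - j" for i k
      using c(1)[of k i] that YT[of k i] by simp
    then show ?thesis unfolding eq using L(2) that by blast
  qed
qed

text \<open>The diagonal is cleared from both ends towards the middle; the entry chosen in each step has
  maximal norm, hence sits in the lower half.\<close>

definition cartan_state :: "nat \<Rightarrow> nat \<Rightarrow> 'p::prime_card padic mat \<Rightarrow> (nat \<Rightarrow> int) \<Rightarrow> bool" where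
  "cartan_state n j Y L \<longleftrightarrow>
    (\<forall>i<2 * n. \<forall>k<2 * n. (i < j \<or> 2 * n - j \<le> i) \<or> (k < j \<or> 2 * n - j \<le> k) \<longrightarrow> i \<noteq> k \<longrightarrow> Y $$ (i, k) = 0) \<and>
    (\<forall>i. 2 * n - j \<le> i \<longrightarrow> i < 2 * n \<longrightarrow> padic_norm (Y $$ (i, i)) = real CARD('p) powi (- L i)) \<and>
    (\<forall>i i'. 2 * n - j \<le> i \<longrightarrow> i \<le> i' \<longrightarrow> i' < 2 * n \<longrightarrow> L i' \<le> L i) \<and>
    (j > 0 \<longrightarrow> (\<forall>i k. j \<le> i \<longrightarrow> i < 2 * n - j \<longrightarrow> j \<le> k \<longrightarrow> k < 2 * n - j \<longrightarrow>
        padic_norm (Y $$ (i, k)) \<le> real CARD('p) powi (- L (2 * n - j)))) \<and>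
    (\<forall>i<j. padic_norm (Y $$ (i, i)) \<le> padic_norm (Y $$ (2 * n - 1 - i, 2 * n - 1 - i)))"

text \<open>In each step the largest middle entry is moved to position \<open>(l, l)\<close>, its
  row is cleared by \<open>V1\<close> and its column by \<open>U2\<close>. The dual row and column
  \<open>j\<close> are then cleared without further work, by orthogonality to row and column
  \<open>l\<close>.\<close>

lemma cartan_elimination:
  fixes A :: "'p::prime_card padic mat"
  assumes A: "A \<in> GSp_Qp n" and "j \<le> n"
  shows "\<exists>U\<in>GSp_Zp n. \<exists>V\<in>GSp_Zp n. \<exists>L. cartan_state n j (U * A * V) L"
  using assms(2)
proof (induction j)
  case 0
  show ?case by (rule bexI[OF _ GSp_Zp_one], rule bexI[OF _ GSp_Zp_one], rule exI[of _ "\<lambda>_. 0"])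
      (auto simp: cartan_state_def)
next
  case (Suc j)
  define p where "p = real CARD('p)"
  define out where "out = (\<lambda>i. i < j \<or> 2 * n - j \<le> i)"
  obtain U V L where U: "U \<in> GSp_Zp n" and V: "V \<in> GSp_Zp n" and st: "cartan_state n j (U * A * V) L"
    using Suc by auto
  note Uc = GSp_Zp_carrier[OF U] and Vc = GSp_Zp_carrier[OF V] and Ac = GSp_Qp_carrier[OF A]
  define Y where "Y = U * A * V"
  note st = st[folded Y_def, unfolded cartan_state_def, folded p_def]
  have a: "Y $$ (i, k) = 0" if "i < 2 * n" "k < 2 * n" "(i < j \<or> 2 * n - j \<le> i) \<or> (k < j \<or> 2 * n - j \<le> k)" "i \<noteq> k" for i k
    using st[THEN conjunct1] that by blast
  have b: "padic_norm (Y $$ (i, i)) = p powi (- L i)" if "2 * n - j \<le> i" "i < 2 * n" for i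
    using st[THEN conjunct2, THEN conjunct1] that by blast
  have c: "L i' \<le> L i" if "2 * n - j \<le> i" "i \<le> i'" "i' < 2 * n" for i i'
    using st[THEN conjunct2, THEN conjunct2, THEN conjunct1] that by blast
  have d: "padic_norm (Y $$ (i, k)) \<le> p powi (- L (2 * n - j))"
    if "j > 0" "j \<le> i" "i < 2 * n - j" "j \<le> k" "k < 2 * n - j" for i k
    using st[THEN conjunct2, THEN conjunct2, THEN conjunct2, THEN conjunct1] that by blast
  have e: "padic_norm (Y $$ (i, i)) \<le> padic_norm (Y $$ (2 * n - 1 - i, 2 * n - 1 - i))" if "i < j" for i
    using st[THEN conjunct2, THEN conjunct2, THEN conjunct2, THEN conjunct2] that by blast
  have YG: "Y \<in> GSp_Qp n" unfolding Y_def using U V A by (intro GSp_Qp_mult) (auto dest: GSp_ZpD)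
  have Yc: "Y \<in> carrier_mat (2 * n) (2 * n)" by (rule GSp_Qp_carrier[OF YG])
  have p0: "p powi z > 0" for z using prime_gt_1_real[where 'p='p] by (simp add: p_def)
  define l where "l = 2 * n - 1 - j"
  have j: "j < n" using Suc.prems by simp
  have l: "l < 2 * n" "j \<le> l" "l < 2 * n - j" "l + j + 1 = 2 * n" "j \<noteq> l" "n \<le> l" using j by (auto simp: l_def)
  let ?F = "\<lambda>i k. if (j \<le> i \<and> i < 2 * n - j) \<and> (j \<le> k \<and> k < 2 * n - j) then Y $$ (i, k) else 0"
  have "\<exists>k<2 * n. ?F l k \<noteq> 0"
  proof (rule ccontr)
    assume no: "\<not> ?thesis"
    have z: "Y $$ (l, k) = 0" if k: "k < 2 * n" for k
    proof (cases "k < j \<or> 2 * n - j \<le> k")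
      case True
      then show ?thesis using a[OF l(1) k] l by auto
    next
      case False
      then show ?thesis using no k l by auto
    qed
    obtain \<mu> where \<mu>: "\<mu> \<noteq> 0" "gsp n \<mu> Y" using YG by (auto simp: GSp_Qp_iff)
    have "om n (\<lambda>k. Y $$ (l, k)) (\<lambda>k. Y $$ (j, k)) = 0" by (rule om_zero) (simp add: z)
    then show False using gsp_om[OF \<mu>(2) l(1), of j] \<mu>(1) l j by (auto simp: ssgn_def split: if_splits)
  qed
  then obtain k1 where k1: "k1 < 2 * n" "?F l k1 \<noteq> 0" by blast
  obtain i0 k0 q where F0: "?F i0 k0 \<noteq> 0" and q: "padic_norm (?F i0 k0) = p powi (- q)"
    and le: "\<And>i k. i < 2 * n \<Longrightarrow> k < 2 * n \<Longrightarrow> padic_norm (?F i k) \<le> p powi (- q)"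
    unfolding p_def by (rule maximal_norm_entry[of l "2 * n" k1 "2 * n" ?F]) (use k1 l in auto)
  from F0 have m0: "j \<le> i0" "i0 < 2 * n - j" "j \<le> k0" "k0 < 2 * n - j" "Y $$ (i0, k0) \<noteq> 0"
    by (auto split: if_splits)
  define y0 where "y0 = Y $$ (i0, k0)"
  have y0: "y0 \<noteq> 0" "padic_norm y0 = p powi (- q)" using m0 q by (auto simp: y0_def)
  have Yle: "padic_norm (Y $$ (i, k)) \<le> p powi (- q)" if "j \<le> i" "i < 2 * n - j" "j \<le> k" "k < 2 * n - j" for i k
    using le[of i k] that by simp
  have q0: "p powi (- q) \<ge> 0" using p0 less_imp_le by blast

  let ?e = "\<lambda>i k. if k = i then 1 else (0 :: 'p padic)"
  \<comment> \<open>\<open>N\<close> sends the unit vector at \<open>i0\<close> to the one at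
    \<open>l\<close>, so row \<open>l\<close> of its inverse \<open>U1\<close> is the unit vector at
    \<open>i0\<close>, and left multiplication by \<open>U1\<close> puts row \<open>i0\<close> in
    position \<open>l\<close>.\<close>
  obtain N U1 where N: "N \<in> GSp_Zp n" "U1 \<in> GSp_Zp n" "mid_id n j N" "mid_id n j U1" "N * U1 = 1\<^sub>m (2 * n)"
    and Nrow: "\<And>k. k < 2 * n \<Longrightarrow> (\<Sum>t<2 * n. ?e i0 t * N $$ (t, k)) = (if k = 2 * n - 1 - j then 1 else 0)"
    by (rule mid_transitive[OF j, of "?e i0" i0]) (use m0 in \<open>auto split: if_splits\<close>)
  note Nc = GSp_Zp_carrier[OF N(1)] GSp_Zp_carrier[OF N(2)]
  have i0n: "i0 < 2 * n" "k0 < 2 * n" using m0 by auto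
  have U1row: "U1 $$ (l, k) = (if i0 = k then 1 else 0)" if k: "k < 2 * n" for k
  proof -
    have Ne: "N $$ (i0, t) = (if t = l then 1 else 0)" if "t < 2 * n" for t
      using Nrow[OF that] sum_delta_mult(3)[OF i0n(1), of "\<lambda>s. N $$ (s, t)"] by (simp add: l_def)
    have "(if i0 = k then 1 else 0) = (N * U1) $$ (i0, k)" using N(5) i0n k by simp
    also have "\<dots> = (\<Sum>t<2 * n. (if t = l then 1 else 0) * U1 $$ (t, k))"
      unfolding mult_mat_entry[OF Nc i0n(1) k] by (intro sum.cong) (auto simp: Ne)
    also have "\<dots> = U1 $$ (l, k)" by (rule sum_delta_mult(3)[OF l(1)])
    finally show ?thesis ..
  qed
  define Y1 where "Y1 = U1 * Y"
  have Y1c: "Y1 \<in> carrier_mat (2 * n) (2 * n)" unfolding Y1_def by (rule mult_carrier_mat[OF Nc(2) Yc])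
  note L1 = mid_id_mult_left[OF N(4) Nc(2) GLZ_int_mat[OF GSp_ZpD(2)[OF N(2)]] Yc a, folded Y1_def]
  have Y1out: "Y1 $$ (i, k) = Y $$ (i, k)" if "i < 2 * n" "k < 2 * n" "out i \<or> out k" for i k
    using L1(1)[of i k] that(1,2) that(3) by (auto simp: out_def)
  have Y1le: "padic_norm (Y1 $$ (i, k)) \<le> p powi (- q)" if "\<not> out i" "\<not> out k" for i k
    using L1(2)[of i k "p powi (- q)"] Yle q0 that by (auto simp: out_def)
  have Y1row: "Y1 $$ (l, k) = Y $$ (i0, k)" if k: "k < 2 * n" for k
  proof -
    have "Y1 $$ (l, k) = (\<Sum>t<2 * n. (if i0 = t then 1 else 0) * Y $$ (t, k))"
      unfolding Y1_def mult_mat_entry[OF Nc(2) Yc l(1) k] by (intro sum.cong) (auto simp: U1row)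
    then show ?thesis using sum_delta_mult(1)[OF i0n(1), of "\<lambda>t. Y $$ (t, k)"] by simp
  qed
  have lout: "\<not> out l" using l by (auto simp: out_def)

  define x where "x = (\<lambda>k. Y1 $$ (l, k) / y0)"
  have xout: "x k = 0" if "k < 2 * n" "k < j \<or> 2 * n - j \<le> k" for k
    using Y1row[OF that(1)] a[of i0 k] that m0 by (auto simp: x_def)
  obtain V1 V1' where V1: "V1 \<in> GSp_Zp n" "V1' \<in> GSp_Zp n" "mid_id n j V1" "mid_id n j V1'" "V1 * V1' = 1\<^sub>m (2 * n)"
    and V1row: "\<And>k. k < 2 * n \<Longrightarrow> (\<Sum>t<2 * n. x t * V1 $$ (t, k)) = (if k = 2 * n - 1 - j then 1 else 0)"
  proof (rule mid_transitive[OF j, of x k0])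
    show "padic_norm (x k) \<le> 1" if k: "k < 2 * n" for k
    proof (cases "out k")
      case True
      then show ?thesis using xout[OF k] by (simp add: out_def)
    next
      case False
      then show ?thesis using Y1le[OF lout False] y0 p0[of "- q"] by (simp add: x_def padic_norm_divide)
    qed
    show "x k0 = 1" using Y1row[OF i0n(2)] y0 by (simp add: x_def y0_def)
  qed (use xout m0 in auto)
  note V1c = GSp_Zp_carrier[OF V1(1)]
  define Y2 where "Y2 = Y1 * V1"
  have Y2c: "Y2 \<in> carrier_mat (2 * n) (2 * n)" unfolding Y2_def by (rule mult_carrier_mat[OF Y1c V1c])
  have a1: "Y1 $$ (i, k) = 0" if "i < 2 * n" "k < 2 * n" "(i < j \<or> 2 * n - j \<le> i) \<or> (k < j \<or> 2 * n - j \<le> k)" "i \<noteq> k" for i k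
    using Y1out[OF that(1,2)] a[OF that] that(3) by (auto simp: out_def)
  note L2 = mid_id_mult_right[OF V1(3) V1c GLZ_int_mat[OF GSp_ZpD(2)[OF V1(1)]] Y1c a1, folded Y2_def]
  have Y2out: "Y2 $$ (i, k) = Y $$ (i, k)" if "i < 2 * n" "k < 2 * n" "out i \<or> out k" for i k
    using L2(1)[of i k] that(1,2) that(3) Y1out[OF that] by (auto simp: out_def)
  have Y2le: "padic_norm (Y2 $$ (i, k)) \<le> p powi (- q)" if "\<not> out i" "\<not> out k" for i k
    using L2(2)[of i k "p powi (- q)"] Y1le q0 that by (auto simp: out_def)
  have Y2row: "Y2 $$ (l, k) = (if k = l then y0 else 0)" if k: "k < 2 * n" for k
  proof -
    have "Y1 $$ (l, t) = y0 * x t" for t using y0 by (simp add: x_def)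
    then have "Y2 $$ (l, k) = y0 * (\<Sum>t<2 * n. x t * V1 $$ (t, k))"
      unfolding Y2_def mult_mat_entry[OF Y1c V1c l(1) k] by (simp add: sum_distrib_left mult.assoc)
    then show ?thesis unfolding V1row[OF k] by (simp add: l_def)
  qed

  define y where "y = (\<lambda>i. Y2 $$ (i, l) / y0)"
  have yout: "y i = 0" if "i < 2 * n" "i < j \<or> 2 * n - j \<le> i" for i
    using Y2out[OF that(1) l(1)] a[OF that(1) l(1)] that l by (auto simp: y_def out_def)
  obtain M where M: "M \<in> GSp_Zp n" "mid_id n j M"
    and Mrow: "\<And>k. k < 2 * n \<Longrightarrow> (\<Sum>t<2 * n. y t * M $$ (t, k)) = (if k = 2 * n - 1 - j then 1 else 0)"
    and Mcol: "\<And>i. i < 2 * n \<Longrightarrow> M $$ (i, 2 * n - 1 - j) = (if i = 2 * n - 1 - j then 1 else 0)"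
  proof (rule mid_clear_column[OF j, of y])
    show "padic_norm (y k) \<le> 1" if k: "k < 2 * n" for k
    proof (cases "out k")
      case True
      then show ?thesis using yout[OF k] by (simp add: out_def)
    next
      case False
      then show ?thesis using Y2le[OF False lout] y0 p0[of "- q"] by (simp add: y_def padic_norm_divide)
    qed
    show "y (2 * n - 1 - j) = 1" unfolding l_def[symmetric] using Y2row[OF l(1)] y0 by (simp add: y_def)
  qed (use yout in auto)
  note Mc = GSp_Zp_carrier[OF M(1)]
  define U2 where "U2 = transpose_mat M"
  have U2: "U2 \<in> GSp_Zp n" "mid_id n j U2" unfolding U2_def by (rule GSp_Zp_transpose[OF M(1)], rule mid_id_transpose[OF M(2) Mc])
  note U2c = GSp_Zp_carrier[OF U2(1)]
  have U2e: "U2 $$ (i, k) = M $$ (k, i)" if "i < 2 * n" "k < 2 * n" for i k using Mc that by (simp add: U2_def)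
  define Y3 where "Y3 = U2 * Y2"
  have a2: "Y2 $$ (i, k) = 0" if "i < 2 * n" "k < 2 * n" "(i < j \<or> 2 * n - j \<le> i) \<or> (k < j \<or> 2 * n - j \<le> k)" "i \<noteq> k" for i k
    using Y2out[OF that(1,2)] a[OF that] that(3) by (auto simp: out_def)
  note L3 = mid_id_mult_left[OF U2(2) U2c GLZ_int_mat[OF GSp_ZpD(2)[OF U2(1)]] Y2c a2, folded Y3_def]
  have Y3out: "Y3 $$ (i, k) = Y $$ (i, k)" if "i < 2 * n" "k < 2 * n" "out i \<or> out k" for i k
    using L3(1)[of i k] that(1,2) that(3) Y2out[OF that] by (auto simp: out_def)
  have Y3le: "padic_norm (Y3 $$ (i, k)) \<le> p powi (- q)" if "\<not> out i" "\<not> out k" for i k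
    using L3(2)[of i k "p powi (- q)"] Y2le q0 that by (auto simp: out_def)
  have Y3row: "Y3 $$ (l, k) = (if k = l then y0 else 0)" if k: "k < 2 * n" for k
  proof -
    have "Y3 $$ (l, k) = (\<Sum>t<2 * n. (if t = l then 1 else 0) * Y2 $$ (t, k))"
      unfolding Y3_def mult_mat_entry[OF U2c Y2c l(1) k]
      using l Mcol by (intro sum.cong) (auto simp: U2e l_def)
    also have "\<dots> = Y2 $$ (l, k)" by (rule sum_delta_mult(3)[OF l(1)])
    finally show ?thesis unfolding Y2row[OF k] .
  qed
  have Y3col: "Y3 $$ (i, l) = (if i = l then y0 else 0)" if i: "i < 2 * n" for i
  proof -
    have "Y2 $$ (t, l) = y0 * y t" for t using y0 by (simp add: y_def)
    then have "Y3 $$ (i, l) = y0 * (\<Sum>t<2 * n. y t * M $$ (t, i))"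
      unfolding Y3_def mult_mat_entry[OF U2c Y2c i l(1)] sum_distrib_left using i
      by (intro sum.cong) (auto simp: U2e)
    then show ?thesis unfolding Mrow[OF i] by (simp add: l_def)
  qed
  let ?U = "U2 * (U1 * U)" and ?V = "V * V1"
  have UK: "?U \<in> GSp_Zp n" and VK: "?V \<in> GSp_Zp n" using U V U2 V1 N by (auto intro!: GSp_Zp_mult)
  have Y3eq: "Y3 = ?U * A * ?V"
    unfolding Y3_def Y2_def Y1_def Y_def
    by (simp add: mult_mat_assoc_dim carrier_matD[OF Uc] carrier_matD[OF Vc] carrier_matD[OF Ac]
        carrier_matD[OF U2c] carrier_matD[OF Nc(2)] carrier_matD[OF V1c] del: assoc_mult_mat)
  have Y3G: "Y3 \<in> GSp_Qp n" unfolding Y3eq by (rule GSp_Qp_mult[OF GSp_Qp_mult[OF GSp_ZpD(1)[OF UK] A] GSp_ZpD(1)[OF VK]])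
  note Y3c = GSp_Qp_carrier[OF Y3G]
  obtain \<mu> where \<mu>: "gsp n \<mu> Y3" using Y3G by (auto simp: GSp_Qp_iff)
  obtain \<nu> where \<nu>: "gsp n \<nu> (transpose_mat Y3)" using GSp_Qp_transpose[OF Y3G] by (auto simp: GSp_Qp_iff)
  have om_l: "om n z (\<lambda>k. if k = l then y0 else 0) = y0 * z j" for z
  proof -
    have "(\<lambda>k. if k = l then y0 else 0) = (\<lambda>k. y0 * ?e l k)" by auto
    moreover have "2 * n - 1 - l = j" using l by linarith
    ultimately show ?thesis using om_unit_right[OF l(1), of z] l by (simp add: om_scale_right ssgn_def)
  qed
  \<comment> \<open>Row \<open>l\<close> is now \<open>y0\<close> times a unit vector, so pairing
    with it reads off column \<open>j\<close>.\<close>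
  have Y3colj: "Y3 $$ (i, j) = 0" if i: "i < 2 * n" "i \<noteq> j" for i
  proof -
    have "y0 * Y3 $$ (i, j) = om n (\<lambda>k. Y3 $$ (i, k)) (\<lambda>k. if k = l then y0 else 0)" by (rule om_l[symmetric])
    also have "\<dots> = om n (\<lambda>k. Y3 $$ (i, k)) (\<lambda>k. Y3 $$ (l, k))" by (rule om_cong) (simp_all add: Y3row)
    also have "\<dots> = 0" using gsp_om[OF \<mu> i(1) l(1)] i l by auto
    finally show ?thesis using y0 by simp
  qed
  have Y3rowj: "Y3 $$ (j, k) = 0" if k: "k < 2 * n" "k \<noteq> j" for k
  proof -
    have "y0 * Y3 $$ (j, k) = om n (\<lambda>i. Y3 $$ (i, k)) (\<lambda>k. if k = l then y0 else 0)" by (rule om_l[symmetric])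
    also have "\<dots> = om n (\<lambda>i. transpose_mat Y3 $$ (k, i)) (\<lambda>i. transpose_mat Y3 $$ (l, i))"
      using Y3c k l by (intro om_cong) (auto simp: Y3col)
    also have "\<dots> = 0" using gsp_om[OF \<nu> k(1) l(1)] k l by auto
    finally show ?thesis using y0 by simp
  qed
  define L' where "L' = L(l := q)"
  have suc: "i < Suc j \<or> 2 * n - Suc j \<le> i \<longleftrightarrow> out i \<or> i = j \<or> i = l" for i
    using j by (auto simp: out_def l_def)
  have r1: "Y3 $$ (i, k) = 0"
    if "i < 2 * n" "k < 2 * n" "(i < Suc j \<or> 2 * n - Suc j \<le> i) \<or> (k < Suc j \<or> 2 * n - Suc j \<le> k)" "i \<noteq> k" for i k
  proof (cases "out i \<or> out k")
    case True
    then show ?thesis using Y3out[OF that(1,2)] a[of i k] that by (auto simp: out_def)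
  next
    case False
    with that(3) have "i = j \<or> i = l \<or> k = j \<or> k = l" unfolding suc by blast
    then show ?thesis using that Y3colj Y3rowj Y3row Y3col by auto
  qed
  have r2: "padic_norm (Y3 $$ (i, i)) = p powi (- L' i)" if "2 * n - Suc j \<le> i" "i < 2 * n" for i
  proof (cases "i = l")
    case True
    then show ?thesis using Y3row[OF l(1)] y0 by (simp add: L'_def)
  next
    case False
    then have "2 * n - j \<le> i" using that by (simp add: l_def)
    then show ?thesis using Y3out[of i i] b[of i] that False by (simp add: L'_def out_def)
  qed
  have q_ge: "L (2 * n - j) \<le> q" if "j > 0"
    using d[OF that m0(1-4)] y0(2) unfolding y0_def p_def by (simp add: powi_prime_le_iff)
  have r3: "L' i' \<le> L' i" if "2 * n - Suc j \<le> i" "i \<le> i'" "i' < 2 * n" for i i'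
  proof (cases "i = l")
    case True
    show ?thesis
    proof (cases "i' = l")
      case False
      then have "j > 0" "2 * n - j \<le> i'" using True that j by (auto simp: l_def)
      then show ?thesis using q_ge c[of "2 * n - j" i'] that True False by (simp add: L'_def)
    qed (use True in simp)
  next
    case False
    then have "2 * n - j \<le> i" "i' \<noteq> l" using that by (auto simp: l_def)
    then show ?thesis using c[of i i'] that False by (simp add: L'_def)
  qed
  have l': "2 * n - Suc j = l" by (simp add: l_def)
  have r4: "padic_norm (Y3 $$ (i, k)) \<le> p powi (- L' (2 * n - Suc j))"
    if "Suc j \<le> i" "i < 2 * n - Suc j" "Suc j \<le> k" "k < 2 * n - Suc j" for i k
    unfolding l' using Y3le[of i k] that by (auto simp: L'_def out_def)
  have r5: "padic_norm (Y3 $$ (i, i)) \<le> padic_norm (Y3 $$ (2 * n - 1 - i, 2 * n - 1 - i))" if i: "i < Suc j" for i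
  proof (cases "i = j")
    case True
    have "\<not> out j" using j by (auto simp: out_def)
    then have "padic_norm (Y3 $$ (j, j)) \<le> padic_norm (Y3 $$ (l, l))" using Y3le[of j j] Y3row[OF l(1)] y0 by simp
    then show ?thesis unfolding True l_def .
  next
    case False
    then have "out i" "out (2 * n - 1 - i)" "i < 2 * n" "2 * n - 1 - i < 2 * n" "i < j" using i j by (auto simp: out_def)
    then show ?thesis using e[of i] Y3out[of i i] Y3out[of "2 * n - 1 - i" "2 * n - 1 - i"] by simp
  qed
  have "cartan_state n (Suc j) Y3 L'"
    unfolding cartan_state_def p_def[symmetric]
    by (intro conjI allI impI r1 r2 r3 r4 r5; assumption)
  then show ?case unfolding Y3eq by (intro bexI[OF _ UK] bexI[OF _ VK] exI[of _ L'])
qed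

lemma gsp_diag:
  fixes w :: "nat \<Rightarrow> 'a::field"
  assumes "\<And>i. i < n \<Longrightarrow> w i * w (2 * n - 1 - i) = \<mu>"
  shows "gsp n \<mu> (mat (2 * n) (2 * n) (\<lambda>(i, k). if i = k then w i else 0))" (is "gsp n \<mu> ?W")
  unfolding gsp_def
proof (intro conjI allI impI)
  fix i j assume ij: "i < 2 * n" "j < 2 * n"
  let ?e = "\<lambda>i k. if k = i then 1 else (0 :: 'a)"
  have "om n (\<lambda>k. ?W $$ (i, k)) (\<lambda>k. ?W $$ (j, k)) = om n (\<lambda>k. w i * ?e i k) (\<lambda>k. w j * ?e j k)"
    using ij by (intro om_cong) auto
  also have "\<dots> = w i * (w j * (ssgn n i * ?e j (2 * n - 1 - i)))"
    by (simp only: om_scale_left om_scale_right om_unit_left[OF ij(1)])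
  also have "\<dots> = (if i + j + 1 = 2 * n then \<mu> * ssgn n i else 0)"
  proof (cases "i + j + 1 = 2 * n")
    case True
    then have j: "j = 2 * n - 1 - i" by linarith
    have "w i * w j = \<mu>"
    proof (cases "i < n")
      case False
      then have "j < n" "2 * n - 1 - j = i" using True by linarith+
      then show ?thesis using assms[of j] by (simp add: mult.commute)
    qed (use assms[of i] j in simp)
    then show ?thesis using True j by simp
  next
    case False
    then have "2 * n - 1 - i \<noteq> j" using ij by linarith
    with False show ?thesis by auto
  qed
  finally show "om n (\<lambda>k. ?W $$ (i, k)) (\<lambda>k. ?W $$ (j, k)) = (if i + j + 1 = 2 * n then \<mu> * ssgn n i else 0)" .
qed simp

lemma diag_units_GSp_Zp:
  fixes w :: "nat \<Rightarrow> 'p::prime_card padic"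
  assumes w: "\<And>i. i < n \<Longrightarrow> w i * w (2 * n - 1 - i) = \<mu>" and u: "\<And>i. i < 2 * n \<Longrightarrow> padic_norm (w i) = 1" and \<mu>: "\<mu> \<noteq> 0"
  shows "mat (2 * n) (2 * n) (\<lambda>(i, k). if i = k then w i else 0) \<in> GSp_Zp n" (is "?W \<in> _")
proof -
  let ?V = "mat (2 * n) (2 * n) (\<lambda>(i, k). if i = k then inverse (w i) else 0)"
  have "?W * ?V = 1\<^sub>m (2 * n)"
  proof (rule eq_matI)
    fix i k assume "i < dim_row (1\<^sub>m (2 * n) :: 'p padic mat)" "k < dim_col (1\<^sub>m (2 * n) :: 'p padic mat)"
    then have ik: "i < 2 * n" "k < 2 * n" by simp_all
    have "(?W * ?V) $$ (i, k) = (\<Sum>j<2 * n. (if i = j then 1 else 0) * (w i * ?V $$ (j, k)))"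
      using ik by (subst mult_mat_entry[of _ "2 * n" "2 * n" _ "2 * n"]) (auto intro!: sum.cong)
    also have "\<dots> = w i * ?V $$ (i, k)" by (rule sum_delta_mult(1)[OF ik(1)])
    also have "\<dots> = 1\<^sub>m (2 * n) $$ (i, k)" using ik u[OF ik(1)] padic_norm_eq_0[of "w i"] by auto
    finally show "(?W * ?V) $$ (i, k) = 1\<^sub>m (2 * n) $$ (i, k)" .
  qed simp_all
  then have "?W \<in> GLZ (2 * n)"
    using u by (intro GLZ_I[of _ _ ?V]) (auto simp: int_mat_def padic_norm_inverse)
  moreover have "?W \<in> GSp_Qp n" unfolding GSp_Qp_iff using gsp_diag[of n w \<mu>] w \<mu> by blast
  ultimately show ?thesis by (simp add: GSp_Zp_def)
qed

text \<open>Elimination leaves a diagonal matrix whose entries at dual positions multiply to \<mu>.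
  Removing the powers of \<open>p\<close> leaves units whose dual products are again constant, so
  they form an element of \<open>GSp_Zp\<close> that is absorbed on the right. The exponents of the
  upper half are determined by those of the lower half.\<close>

lemma cartan_decomposition:
  fixes A :: "'p::prime_card padic mat"
  assumes A: "A \<in> GSp_Qp n" and n: "n \<ge> 1"
  obtains U V l where "U \<in> GSp_Zp n" "V \<in> GSp_Zp n" "length l = 2 * n" "sorted_wrt (\<ge>) l"
    "\<forall>i<n. l ! i + l ! (2 * n - 1 - i) = l ! 0 + l ! (2 * n - 1)"
    "A = U * diag_ppow (2 * n) (2 * n) l * V"
proof -
  define p where "p = real CARD('p)"
  obtain U V L where U: "U \<in> GSp_Zp n" and V: "V \<in> GSp_Zp n" and st: "cartan_state n n (U * A * V) L"
    using cartan_elimination[OF A order_refl] by blast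
  define Y where "Y = U * A * V"
  note st = st[folded Y_def, unfolded cartan_state_def, folded p_def]
  note Uc = GSp_Zp_carrier[OF U] and Vc = GSp_Zp_carrier[OF V] and Ac = GSp_Qp_carrier[OF A]
  have off: "Y $$ (i, k) = 0" if "i < 2 * n" "k < 2 * n" "i \<noteq> k" for i k
  proof -
    have "i < n \<or> 2 * n - n \<le> i" by linarith
    then show ?thesis using st[THEN conjunct1] that by blast
  qed
  have b: "padic_norm (Y $$ (i, i)) = p powi (- L i)" if "n \<le> i" "i < 2 * n" for i
    using st[THEN conjunct2, THEN conjunct1] that by simp
  have c: "L i' \<le> L i" if "n \<le> i" "i \<le> i'" "i' < 2 * n" for i i'
    using st[THEN conjunct2, THEN conjunct2, THEN conjunct1] that by simp
  have e: "padic_norm (Y $$ (i, i)) \<le> padic_norm (Y $$ (2 * n - 1 - i, 2 * n - 1 - i))" if "i < n" for i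
    using st[THEN conjunct2, THEN conjunct2, THEN conjunct2, THEN conjunct2] that by blast
  have YG: "Y \<in> GSp_Qp n" unfolding Y_def by (rule GSp_Qp_mult[OF GSp_Qp_mult[OF GSp_ZpD(1)[OF U] A] GSp_ZpD(1)[OF V]])
  note Yc = GSp_Qp_carrier[OF YG]
  obtain \<mu> where \<mu>: "\<mu> \<noteq> 0" "gsp n \<mu> Y" using YG by (auto simp: GSp_Qp_iff)
  define d where "d = (\<lambda>i. Y $$ (i, i))"
  have dd: "d i * d (2 * n - 1 - i) = \<mu>" if i: "i < n" for i
  proof -
    have i': "i < 2 * n" "2 * n - 1 - i < 2 * n" using i by linarith+
    let ?e = "\<lambda>i k. if k = i then 1 else (0 :: 'p padic)"
    have row: "Y $$ (a, k) = d a * ?e a k" if "a < 2 * n" "k < 2 * n" for a k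
      using off[of a k] that by (auto simp: d_def)
    have "om n (\<lambda>k. Y $$ (i, k)) (\<lambda>k. Y $$ (2 * n - 1 - i, k)) = om n (\<lambda>k. d i * ?e i k) (\<lambda>k. d (2 * n - 1 - i) * ?e (2 * n - 1 - i) k)"
      by (rule om_cong) (simp_all only: row i')
    also have "\<dots> = d i * (d (2 * n - 1 - i) * (ssgn n i * ?e (2 * n - 1 - i) (2 * n - 1 - i)))"
      by (simp only: om_scale_left om_scale_right om_unit_left[OF i'(1)])
    finally have "d i * (d (2 * n - 1 - i) * (ssgn n i * ?e (2 * n - 1 - i) (2 * n - 1 - i))) = \<mu> * ssgn n i"
      using gsp_om[OF \<mu>(2) i'] i by simp
    then show ?thesis using i by (simp add: ssgn_def)
  qed
  obtain E where E: "padic_norm \<mu> = p powi (- E)"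
    using padic_norm_value[OF \<mu>(1)] unfolding p_def by (metis minus_minus)
  have p0: "p powi z \<noteq> 0" for z using prime_gt_1_real[where 'p='p] by (simp add: p_def)
  define L' where "L' = (\<lambda>i. if n \<le> i then L i else E - L (2 * n - 1 - i))"
  have dn: "padic_norm (d i) = p powi (- L' i)" if i: "i < 2 * n" for i
  proof (cases "n \<le> i")
    case True
    then show ?thesis using b i by (simp add: d_def L'_def)
  next
    case False
    then have j: "n \<le> 2 * n - 1 - i" "2 * n - 1 - i < 2 * n" "i < n" by linarith+
    have "padic_norm (d i) * p powi (- L (2 * n - 1 - i)) = p powi (- E)"
      unfolding E[symmetric] dd[OF j(3), symmetric] padic_norm_mult b[OF j(1,2), symmetric] by (simp add: d_def)
    then have "padic_norm (d i) = p powi (- E) / p powi (- L (2 * n - 1 - i))" using p0 by (simp add: field_simps)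
    also have "\<dots> = p powi (- E - (- L (2 * n - 1 - i)))"
      using prime_gt_1_real[where 'p='p] by (intro power_int_diff[symmetric]) (auto simp: p_def)
    finally show ?thesis using False by (simp add: L'_def)
  qed
  have anti: "L' k \<le> L' i" if ik: "i \<le> k" "k < 2 * n" for i k
  proof -
    consider "n \<le> i" | "k < n" | "i < n" "n \<le> k" by linarith
    then show ?thesis
    proof cases
      case 1
      then show ?thesis using c[of i k] ik by (simp add: L'_def)
    next
      case 2
      have "L (2 * n - 1 - i) \<le> L (2 * n - 1 - k)" using 2 ik by (intro c) auto
      moreover have "\<not> n \<le> i" "\<not> n \<le> k" using 2 ik by linarith+
      ultimately show ?thesis by (simp add: L'_def)
    next
      case 3
      \<comment> \<open>The order across the middle is not inherited from either half; it comes from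
        the last clause of \<open>cartan_state\<close>.\<close>
      have n1: "2 * n - 1 - (n - 1) = n" "n - 1 < n" "n < 2 * n" "n - 1 < 2 * n" using n by linarith+
      have "padic_norm (d (n - 1)) \<le> padic_norm (d n)" using e[OF n1(2)] unfolding n1(1) d_def .
      then have "L' n \<le> L' (n - 1)" unfolding dn[OF n1(3)] dn[OF n1(4)] p_def powi_prime_le_iff by simp
      then have L1: "L' n \<le> L' (n - 1)" .
      have "L (2 * n - 1 - i) \<le> L (2 * n - 1 - (n - 1))" using 3 by (intro c) auto
      moreover have "\<not> n \<le> i" "\<not> n \<le> n - 1" using 3 n by linarith+
      ultimately have L2: "L' (n - 1) \<le> L' i" by (simp add: L'_def)
      have L3: "L' k \<le> L' n" using c[of n k] 3 ik by (simp add: L'_def)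
      show ?thesis using L1 L2 L3 by simp
    qed
  qed
  define l where "l = map L' [0..<2 * n]"
  have ln: "length l = 2 * n" "\<And>i. i < 2 * n \<Longrightarrow> l ! i = L' i" by (simp_all add: l_def)
  have sorted: "sorted_wrt (\<ge>) l" unfolding sorted_ge_iff using anti ln by auto
  have sumE: "l ! i + l ! (2 * n - 1 - i) = E" if "i < n" for i
  proof -
    have "l ! i = E - L (2 * n - 1 - i)" "l ! (2 * n - 1 - i) = L (2 * n - 1 - i)"
      using that ln(2)[of i] ln(2)[of "2 * n - 1 - i"] by (simp_all add: L'_def split: if_splits)
    then show ?thesis by simp
  qed
  define w where "w = (\<lambda>i. d i / ppow (L' i))"
  define W where "W = mat (2 * n) (2 * n) (\<lambda>(i, k). if i = k then w i else 0)"
  have dw: "d i = ppow (L' i) * w i" for i by (simp add: w_def ppow_neq_0)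
  have "w i * w (2 * n - 1 - i) = \<mu> / ppow E" if i: "i < n" for i
  proof -
    have "\<not> n \<le> i" "n \<le> 2 * n - 1 - i" using i by linarith+
    then have L'i: "L' i = E - L' (2 * n - 1 - i)" by (simp add: L'_def)
    have "(ppow (L' i) :: 'p padic) = ppow E / ppow (L' (2 * n - 1 - i))" unfolding L'i by (rule ppow_diff)
    then show ?thesis using dd[OF i] by (simp add: w_def ppow_neq_0 field_simps)
  qed
  moreover have "padic_norm (w i) = 1" if "i < 2 * n" for i
    using dn[OF that] p0 by (simp add: w_def padic_norm_divide padic_norm_ppow p_def)
  ultimately have WK: "W \<in> GSp_Zp n"
    unfolding W_def using \<mu>(1) by (intro diag_units_GSp_Zp[of n w "\<mu> / ppow E"]) (auto simp: ppow_neq_0)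
  note Wc = GSp_Zp_carrier[OF WK]
  have YD: "Y = diag_ppow (2 * n) (2 * n) l * W"
  proof (rule eq_matI)
    fix i k assume "i < dim_row (diag_ppow (2 * n) (2 * n) l * W)" "k < dim_col (diag_ppow (2 * n) (2 * n) l * W)"
    then have ik: "i < 2 * n" "k < 2 * n" using Wc by (auto simp: diag_ppow_def)
    show "Y $$ (i, k) = (diag_ppow (2 * n) (2 * n) l * W) $$ (i, k)"
      unfolding diag_ppow_mult_entry[OF Wc order_refl ik] using off[OF ik] ik dw[of i] ln(2)[OF ik(1)]
      by (auto simp: W_def d_def)
  qed (use Yc Wc in \<open>auto simp: diag_ppow_def\<close>)
  obtain Ui where Ui: "Ui \<in> GSp_Zp n" "U * Ui = 1\<^sub>m (2 * n)" "Ui * U = 1\<^sub>m (2 * n)" by (rule GSp_Zp_inverse[OF U])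
  obtain Vi where Vi: "Vi \<in> GSp_Zp n" "V * Vi = 1\<^sub>m (2 * n)" "Vi * V = 1\<^sub>m (2 * n)" by (rule GSp_Zp_inverse[OF V])
  note ic = GSp_Zp_carrier[OF Ui(1)] GSp_Zp_carrier[OF Vi(1)]
  have "A = Ui * Y * Vi"
    unfolding Y_def by (rule mult_cancel_both_sides[OF Uc Vc Ac ic Ui(3) Vi(2), symmetric])
  also have "\<dots> = Ui * diag_ppow (2 * n) (2 * n) l * (W * Vi)"
    unfolding YD by (simp add: mult_mat_assoc_dim carrier_matD[OF ic(1)] carrier_matD[OF ic(2)] carrier_matD[OF Wc]
        carrier_matD[OF diag_ppow_carrier] del: assoc_mult_mat)
  finally have "A = Ui * diag_ppow (2 * n) (2 * n) l * (W * Vi)" .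
  moreover have "l ! i + l ! (2 * n - 1 - i) = l ! 0 + l ! (2 * n - 1)" if "i < n" for i
    using sumE[OF that] sumE[of 0] n by simp
  ultimately show ?thesis by (intro that[OF Ui(1) GSp_Zp_mult[OF WK Vi(1)] ln(1) sorted]) blast+
qed

text \<open>The Cartan decomposition gives existence; uniqueness of the exponents already holds for
  double cosets of the larger group \<open>GLZ\<close>.\<close>

lemma SN_GSp_decomposition:
  fixes A :: "'p::prime_card padic mat"
  assumes A: "A \<in> GSp_Qp n" and n: "n \<ge> 1"
  obtains U V where "U \<in> GSp_Zp n" "V \<in> GSp_Zp n" "length (SN_GSp n A) = 2 * n" "sorted_wrt (\<ge>) (SN_GSp n A)"
    "A = U * diag_ppow (2 * n) (2 * n) (SN_GSp n A) * V"
proof -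
  obtain U V l where UV: "U \<in> GSp_Zp n" "V \<in> GSp_Zp n" and l: "length l = 2 * n" "sorted_wrt (\<ge>) l"
    "\<forall>i<n. l ! i + l ! (2 * n - 1 - i) = l ! 0 + l ! (2 * n - 1)"
    and eq: "A = U * diag_ppow (2 * n) (2 * n) l * V"
    by (rule cartan_decomposition[OF A n])
  have "SN_GSp n A = l"
    unfolding SN_GSp_def
  proof (rule the_equality)
    fix l' assume "length l' = 2 * n \<and> sorted_wrt (\<ge>) l' \<and>
      (\<forall>i<n. l' ! i + l' ! (2 * n - 1 - i) = l' ! 0 + l' ! (2 * n - 1)) \<and>
      (\<exists>U\<in>GSp_Zp n. \<exists>V\<in>GSp_Zp n. A = U * diag_ppow (2 * n) (2 * n) l' * V)"
    then obtain U' V' where *: "length l' = 2 * n" "sorted_wrt (\<ge>) l'" "U' \<in> GSp_Zp n" "V' \<in> GSp_Zp n"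
      "A = U' * diag_ppow (2 * n) (2 * n) l' * V'" by blast
    have "U' * diag_ppow (2 * n) (2 * n) l' * V' = U * diag_ppow (2 * n) (2 * n) l * V" using *(5) eq by simp
    then show "l' = l"
      by (rule diag_ppow_unique) (use * UV l in \<open>auto dest: GSp_ZpD(2)\<close>)
  qed (intro conjI bexI[OF _ UV(1)] bexI[OF _ UV(2)] l eq)
  note SN = this
  show ?thesis
    by (rule that[OF UV]) (simp_all only: SN l eq[symmetric])
qed

subsection \<open>Weights of the last rows\<close>

definition corner :: "nat \<Rightarrow> nat \<Rightarrow> 'a mat \<Rightarrow> 'a mat" where
  "corner n r M = mat r r (\<lambda>(a, b). M $$ (2 * n - r + a, 2 * n - r + b))"

lemma corner_carrier [simp]: "corner n r M \<in> carrier_mat r r"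
  by (simp add: corner_def)

lemma last_rows_carrier: "A \<in> carrier_mat d m \<Longrightarrow> last_rows r A \<in> carrier_mat r m"
  by (auto simp: last_rows_def)

lemma last_rows_entry: "A \<in> carrier_mat d m \<Longrightarrow> a < r \<Longrightarrow> k < m \<Longrightarrow> last_rows r A $$ (a, k) = A $$ (d - r + a, k)"
  by (auto simp: last_rows_def)

definition upper_tri :: "nat \<Rightarrow> 'a::zero mat \<Rightarrow> bool" where
  "upper_tri n T \<longleftrightarrow> (\<forall>i<2 * n. \<forall>k<i. T $$ (i, k) = 0)"

lemma det_corner_triangular:
  assumes tri: "upper_tri n (T :: 'a::comm_ring_1 mat)" and r: "r \<le> 2 * n"
  shows "Determinant.det (corner n r T) = (\<Prod>a<r. T $$ (2 * n - r + a, 2 * n - r + a))"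
proof -
  have "upper_triangular (corner n r T)"
    using tri r by (intro upper_triangularI) (auto simp: corner_def upper_tri_def)
  then have "Determinant.det (corner n r T) = prod_list (map (\<lambda>a. T $$ (2 * n - r + a, 2 * n - r + a)) [0..<r])"
    by (subst Determinant.det_upper_triangular[of _ r])
      (auto simp: diag_mat_def corner_def intro!: arg_cong[of _ _ prod_list])
  then show ?thesis by (simp add: prod.list_conv_set_nth atLeast0LessThan)
qed

lemma last_rows_triangular_mult:
  assumes T: "T \<in> carrier_mat (2 * n) (2 * n)" and tri: "upper_tri n (T :: 'a::comm_ring_1 mat)"
    and X: "X \<in> carrier_mat (2 * n) m" and r: "r \<le> 2 * n"
  shows "last_rows r (T * X) = corner n r T * last_rows r X"
proof (rule eq_matI)
  have Lc: "last_rows r X \<in> carrier_mat r m" by (rule last_rows_carrier[OF X])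
  fix a k assume "a < dim_row (corner n r T * last_rows r X)" "k < dim_col (corner n r T * last_rows r X)"
  then have ak: "a < r" "k < m" using carrier_matD[OF Lc] carrier_matD[OF corner_carrier[of n r T]] by simp_all
  have i: "2 * n - r + a < 2 * n" using ak r by linarith
  have tri_i: "T $$ (2 * n - r + a, t) = 0" if "t < 2 * n - r + a" for t using tri i that by (simp add: upper_tri_def)
  have un: "{..<2 * n} = {..<2 * n - r} \<union> {2 * n - r..<2 * n}" using r by auto
  have "last_rows r (T * X) $$ (a, k) = (\<Sum>t<2 * n. T $$ (2 * n - r + a, t) * X $$ (t, k))"
    unfolding last_rows_entry[OF mult_carrier_mat[OF T X] ak] by (rule mult_mat_entry[OF T X i ak(2)])
  also have "\<dots> = (\<Sum>t<2 * n - r. T $$ (2 * n - r + a, t) * X $$ (t, k)) + (\<Sum>t\<in>{2 * n - r..<2 * n}. T $$ (2 * n - r + a, t) * X $$ (t, k))"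
    unfolding un by (rule sum.union_disjoint) auto
  also have "(\<Sum>t<2 * n - r. T $$ (2 * n - r + a, t) * X $$ (t, k)) = 0"
    using tri_i by (intro sum.neutral) auto
  also have "(\<Sum>t\<in>{2 * n - r..<2 * n}. T $$ (2 * n - r + a, t) * X $$ (t, k))
      = (\<Sum>b<r. T $$ (2 * n - r + a, 2 * n - r + b) * X $$ (2 * n - r + b, k))"
    using r by (intro sum.reindex_bij_witness[of _ "\<lambda>b. 2 * n - r + b" "\<lambda>t. t - (2 * n - r)"]) auto
  also have "0 + \<dots> = (corner n r T * last_rows r X) $$ (a, k)"
    unfolding mult_mat_entry[OF corner_carrier Lc ak] using ak last_rows_entry[OF X _ ak(2)]
    by (auto simp: corner_def intro!: sum.cong)
  finally show "last_rows r (T * X) $$ (a, k) = (corner n r T * last_rows r X) $$ (a, k)" .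
qed (use T X in \<open>auto simp: last_rows_def corner_def\<close>)

text \<open>The last \<open>r\<close> columns of the inverse form an integral right inverse.\<close>

lemma primitive_last_rows:
  assumes K: "K \<in> GLZ d" and r: "r \<le> d"
  shows "primitive_mat r d (last_rows r K)"
proof -
  obtain K' where K': "K' \<in> GLZ d" "K * K' = 1\<^sub>m d" using GLZ_inverse[OF K] by blast
  note c = GLZ_carrier[OF K] GLZ_carrier[OF K'(1)] and i = GLZ_int_mat[OF K] GLZ_int_mat[OF K'(1)]
  define Z where "Z = mat d r (\<lambda>(k, b). K' $$ (k, d - r + b))"
  have Zc: "Z \<in> carrier_mat d r" by (simp add: Z_def)
  note Lc = last_rows_carrier[OF c(1), of r]
  have "last_rows r K * Z = 1\<^sub>m r"
  proof (rule eq_matI)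
    fix a b assume "a < dim_row (1\<^sub>m r :: 'a padic mat)" "b < dim_col (1\<^sub>m r :: 'a padic mat)"
    then have ab: "a < r" "b < r" by simp_all
    then have ab': "d - r + a < d" "d - r + b < d" using r by linarith+
    have "(last_rows r K * Z) $$ (a, b) = (\<Sum>k<d. K $$ (d - r + a, k) * K' $$ (k, d - r + b))"
      unfolding mult_mat_entry[OF Lc Zc ab] using last_rows_entry[OF c(1) ab(1)] ab
      by (intro sum.cong) (auto simp: Z_def)
    also have "\<dots> = (K * K') $$ (d - r + a, d - r + b)" by (rule mult_mat_entry[OF c ab', symmetric])
    also have "\<dots> = 1\<^sub>m r $$ (a, b)" unfolding K'(2) using ab ab' by simp
    finally show "(last_rows r K * Z) $$ (a, b) = 1\<^sub>m r $$ (a, b)" .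
  qed (use Lc Zc in auto)
  moreover have "int_mat (last_rows r K)"
    using r by (intro int_matI[OF Lc]) (auto simp: last_rows_entry[OF c(1)] intro!: int_matD[OF i(1) c(1)])
  moreover have "int_mat Z"
    using r by (intro int_matI[OF Zc]) (auto simp: Z_def intro!: int_matD[OF i(2) c(2)])
  ultimately show ?thesis using Lc Zc by (auto simp: primitive_mat_def)
qed

definition weight :: "nat \<Rightarrow> 'p::prime_card padic mat \<Rightarrow> int" where
  "weight r A = sum_list (SN (last_rows r A))"

lemma triangular_GSp_nonzero:
  fixes T :: "'p::prime_card padic mat"
  assumes T: "T \<in> GSp_Qp n" and tri: "upper_tri n T" and i: "i < 2 * n"
  shows "T $$ (i, i) \<noteq> 0"
proof -
  obtain T' where T': "T' \<in> GSp_Qp n" "T * T' = 1\<^sub>m (2 * n)" "T' * T = 1\<^sub>m (2 * n)" by (rule GSp_Qp_inverse[OF T])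
  note c = GSp_Qp_carrier[OF T] GSp_Qp_carrier[OF T'(1)]
  have "Determinant.det T * Determinant.det T' = 1" using det_mult[OF c] T'(2) by simp
  then have "Determinant.det T \<noteq> 0" by auto
  moreover have "corner n (2 * n) T = T" using c by (auto simp: corner_def)
  ultimately have "(\<Prod>a<2 * n. T $$ (a, a)) \<noteq> 0" using det_corner_triangular[OF tri order_refl] by simp
  then show ?thesis using i by auto
qed

lemma iwasawa_decomposition:
  fixes A :: "'p::prime_card padic mat"
  assumes A: "A \<in> GSp_Qp n"
  obtains T K where "T \<in> GSp_Qp n" "K \<in> GSp_Zp n" "A = T * K" "upper_tri n T"
proof -
  obtain ts where ts: "int_tv n ts" "\<And>i k. i < 2 * n \<Longrightarrow> k < i \<Longrightarrow> (A * tv_prod n ts) $$ (i, k) = 0"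
    by (rule iwasawa[OF A]) blast
  note PK = tv_prod_GSp_Zp[OF ts(1)]
  obtain K where K: "K \<in> GSp_Zp n" "tv_prod n ts * K = 1\<^sub>m (2 * n)" by (rule GSp_Zp_inverse[OF PK])
  have "A * tv_prod n ts * K = A * (tv_prod n ts * K)"
    by (rule assoc_mult_mat[OF GSp_Qp_carrier[OF A] tv_prod_carrier GSp_Zp_carrier[OF K(1)]])
  also have "\<dots> = A" unfolding K(2) by (rule right_mult_one_mat[OF GSp_Qp_carrier[OF A]])
  finally show ?thesis using that[of "A * tv_prod n ts" K] GSp_Qp_mult[OF A GSp_ZpD(1)[OF PK]] K ts(2) by (simp add: upper_tri_def)
qed

text \<open>The last rows of \<open>T * K\<close> are the corner of \<open>T\<close> times a
  primitive matrix, so the determinant of that corner yields both the weight and the largest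
  minor.\<close>

lemma weight_triangular_mult:
  fixes T K :: "'p::prime_card padic mat"
  assumes T: "T \<in> GSp_Qp n" and tri: "upper_tri n T"
    and K: "K \<in> GSp_Zp n" and r: "r \<le> 2 * n"
  shows "real CARD('p) powi (- weight r (T * K)) = padic_norm (Determinant.det (corner n r T))"
    and "Determinant.det (corner n r T) \<noteq> 0"
    and "max_minor r (2 * n) (\<lambda>a k. (T * K) $$ (2 * n - r + a, k)) = padic_norm (Determinant.det (corner n r T))"
proof -
  note Tc = GSp_Qp_carrier[OF T] and Kc = GSp_Zp_carrier[OF K]
  have nz: "T $$ (2 * n - r + a, 2 * n - r + a) \<noteq> 0" if "a < r" for a
    using triangular_GSp_nonzero[OF T tri] that r by simp
  show d: "Determinant.det (corner n r T) \<noteq> 0"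
    unfolding det_corner_triangular[OF tri r] using nz by simp
  have eq: "last_rows r (T * K) = corner n r T * last_rows r K"
    by (rule last_rows_triangular_mult[OF Tc tri Kc r])
  note prim = primitive_last_rows[OF GSp_ZpD(2)[OF K] r]
  show "real CARD('p) powi (- weight r (T * K)) = padic_norm (Determinant.det (corner n r T))"
    unfolding weight_def eq by (rule norm_sum_list_SN[OF corner_carrier d prim r])
  have "max_minor r (2 * n) (\<lambda>a k. (T * K) $$ (2 * n - r + a, k))
      = max_minor r (2 * n) (\<lambda>a k. (corner n r T * last_rows r K) $$ (a, k))"
    unfolding max_minor_def eq[symmetric] using last_rows_entry[OF mult_carrier_mat[OF Tc Kc]]
    by (intro arg_cong[of _ _ Max] image_cong refl arg_cong[of _ _ padic_norm] arg_cong[of _ _ Determinant.det] eq_matI)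
      (auto dest: PiE_mem simp del: index_mult_mat)
  also have "\<dots> = padic_norm (Determinant.det (corner n r T))" by (rule max_minor_frame[OF corner_carrier prim r])
  finally show "max_minor r (2 * n) (\<lambda>a k. (T * K) $$ (2 * n - r + a, k)) = padic_norm (Determinant.det (corner n r T))" .
qed

text \<open>Expresses the weight through the entries of \<open>A\<close>; measurability and the
  comparison with minors in arbitrary rows rest on this.\<close>

lemma weight_eq_max_minor:
  fixes A :: "'p::prime_card padic mat"
  assumes A: "A \<in> GSp_Qp n" and r: "r \<le> 2 * n"
  shows "real CARD('p) powi (- weight r A) = max_minor r (2 * n) (\<lambda>a k. A $$ (2 * n - r + a, k))"
proof -
  obtain T K where TK: "T \<in> GSp_Qp n" "K \<in> GSp_Zp n" and eq: "A = T * K"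
    and tri: "upper_tri n T"
    by (rule iwasawa_decomposition[OF A]) blast
  show ?thesis unfolding eq
    using weight_triangular_mult(1)[OF TK(1) tri TK(2) r] weight_triangular_mult(3)[OF TK(1) tri TK(2) r] by simp
qed

lemma powi_prime_inj: "real CARD('p::prime_card) powi a = real CARD('p) powi b \<Longrightarrow> a = b"
  using powi_prime_le_iff[of a b, where 'p='p] powi_prime_le_iff[of b a, where 'p='p] by simp

text \<open>The cocycle property: \<open>K\<close> depends on \<open>A\<close> only, and \<open>K N\<close> has the law of \<open>N\<close> when
  \<open>N\<close> is left invariant.\<close>

lemma weight_cocycle:
  fixes A :: "'p::prime_card padic mat"
  assumes A: "A \<in> GSp_Qp n"
  obtains K where "K \<in> GSp_Zp n"
    "\<And>r N. r \<le> 2 * n \<Longrightarrow> N \<in> GSp_Qp n \<Longrightarrow> weight r (A * N) = weight r A + weight r (K * N)"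
proof -
  obtain T K where T: "T \<in> GSp_Qp n" and K: "K \<in> GSp_Zp n" and eq: "A = T * K"
    and tri: "upper_tri n T"
    by (rule iwasawa_decomposition[OF A]) blast
  note Tc = GSp_Qp_carrier[OF T] and Kc = GSp_Zp_carrier[OF K]
  have "weight r (A * N) = weight r A + weight r (K * N)" if r: "r \<le> 2 * n" and N: "N \<in> GSp_Qp n" for r N
  proof -
    \<comment> \<open>A second decomposition, of \<open>K * N\<close>, turns the corner for
      \<open>A * N\<close> into a product of two corners, and determinants are
      multiplicative.\<close>
    obtain T' K' where T': "T' \<in> GSp_Qp n" and K': "K' \<in> GSp_Zp n" and eq': "K * N = T' * K'"
      and tri': "upper_tri n T'"
      by (rule iwasawa_decomposition[OF GSp_Qp_mult[OF GSp_ZpD(1)[OF K] N]]) blast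
    note c' = GSp_Qp_carrier[OF T'] GSp_Zp_carrier[OF K']
    have "last_rows r (A * N) = last_rows r (T * (T' * K'))"
      unfolding eq eq'[symmetric] using assoc_mult_mat[OF Tc Kc GSp_Qp_carrier[OF N]] by simp
    also have "\<dots> = corner n r T * last_rows r (T' * K')"
      by (rule last_rows_triangular_mult[OF Tc tri mult_carrier_mat[OF c'] r])
    also have "\<dots> = corner n r T * (corner n r T' * last_rows r K')"
      unfolding last_rows_triangular_mult[OF c'(1) tri' c'(2) r] ..
    also have "\<dots> = (corner n r T * corner n r T') * last_rows r K'"
      by (rule assoc_mult_mat[OF corner_carrier corner_carrier last_rows_carrier[OF c'(2)], symmetric])
    finally have l: "last_rows r (A * N) = (corner n r T * corner n r T') * last_rows r K'" .
    note w = weight_triangular_mult(1,2)[OF T tri K r] weight_triangular_mult(1,2)[OF T' tri' K' r]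
    have "real CARD('p) powi (- weight r (A * N)) = padic_norm (Determinant.det (corner n r T * corner n r T'))"
      unfolding weight_def l
      by (rule norm_sum_list_SN[OF mult_carrier_mat[OF corner_carrier corner_carrier] _ primitive_last_rows[OF GSp_ZpD(2)[OF K'] r] r])
        (use det_mult[OF corner_carrier corner_carrier, of n r T n T'] w in simp)
    also have "\<dots> = real CARD('p) powi (- weight r A) * real CARD('p) powi (- weight r (K * N))"
      unfolding det_mult[OF corner_carrier corner_carrier] padic_norm_mult eq eq' using w by simp
    also have "\<dots> = real CARD('p) powi (- weight r A + - weight r (K * N))"
      using prime_gt_1_real[where 'p='p] by (intro power_int_add[symmetric]) simp
    finally show ?thesis using powi_prime_inj by fastforce
  qed
  with K that show ?thesis by blast
qed

section \<open>Weights compared with sums of the smallest singular numbers\<close>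

definition all_minor :: "nat \<Rightarrow> nat \<Rightarrow> 'p::prime_card padic mat \<Rightarrow> real" where
  "all_minor n r A = Max ((\<lambda>\<rho>. max_minor r (2 * n) (\<lambda>a k. A $$ (\<rho> a, k))) ` ({..<r} \<rightarrow>\<^sub>E {..<2 * n}))"

lemma all_minor_ge: "\<rho> \<in> {..<r} \<rightarrow>\<^sub>E {..<2 * n} \<Longrightarrow> max_minor r (2 * n) (\<lambda>a k. A $$ (\<rho> a, k)) \<le> all_minor n r A"
  unfolding all_minor_def by (intro Max_ge) (auto intro: finite_PiE)

text \<open>Every minor of size \<open>r\<close> of \<open>U D V\<close> is bounded by the one for
  the \<open>r\<close> smallest exponents. Writing \<open>D = U' A V'\<close> and expanding in rows
  and in columns gives the reverse inequality.\<close>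

lemma tail_sum_eq_all_minor:
  fixes A :: "'p::prime_card padic mat"
  assumes A: "A \<in> GSp_Qp n" and n: "n \<ge> 1" and r: "r \<le> 2 * n"
  shows "real CARD('p) powi (- tail_sum r (SN_GSp n A)) = all_minor n r A"
proof -
  define l where "l = SN_GSp n A"
  obtain U V where UV: "U \<in> GSp_Zp n" "V \<in> GSp_Zp n" and l: "length l = 2 * n" "sorted_wrt (\<ge>) l"
    and eq: "A = U * diag_ppow (2 * n) (2 * n) l * V"
    unfolding l_def by (rule SN_GSp_decomposition[OF A n]) blast
  note c = GSp_Zp_carrier[OF UV(1)] GSp_Zp_carrier[OF UV(2)] and Ac = GSp_Qp_carrier[OF A]
  note im = GLZ_int_mat[OF GSp_ZpD(2)[OF UV(1)]] GLZ_int_mat[OF GSp_ZpD(2)[OF UV(2)]]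
  let ?S = "{..<r} \<rightarrow>\<^sub>E {..<2 * n}"
  have fin: "finite ?S" by (auto intro: finite_PiE)
  have id: "(\<lambda>a\<in>{..<r}. 2 * n - r + a) \<in> ?S" using r by auto
  then have ne: "?S \<noteq> {}" by blast
  have le: "padic_norm (Determinant.det (mat r r (\<lambda>(a, b). A $$ (\<rho> a, f b)))) \<le> real CARD('p) powi (- tail_sum r l)"
    if \<rho>: "\<rho> \<in> ?S" and f: "f \<in> ?S" for \<rho> f
  proof -
    have "mat r r (\<lambda>(a, b). A $$ (\<rho> a, f b)) = mat r r (\<lambda>(a, b). \<Sum>j<2 * n. U $$ (\<rho> a, j) * (ppow (l ! j) * V $$ (j, f b)))"
    proof (rule eq_matI)
      fix a b assume "a < dim_row (mat r r (\<lambda>(a, b). \<Sum>j<2 * n. U $$ (\<rho> a, j) * (ppow (l ! j) * V $$ (j, f b))))"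
        "b < dim_col (mat r r (\<lambda>(a, b). \<Sum>j<2 * n. U $$ (\<rho> a, j) * (ppow (l ! j) * V $$ (j, f b))))"
      then have ab: "a < r" "b < r" by simp_all
      then have "\<rho> a < 2 * n" "f b < 2 * n" using \<rho> f by auto
      from udv_entry[OF c order_refl this, of l] ab
      show "mat r r (\<lambda>(a, b). A $$ (\<rho> a, f b)) $$ (a, b) = mat r r (\<lambda>(a, b). \<Sum>j<2 * n. U $$ (\<rho> a, j) * (ppow (l ! j) * V $$ (j, f b))) $$ (a, b)"
        by (simp add: eq)
    qed simp_all
    moreover have "padic_norm (Determinant.det (mat r r (\<lambda>(a, b). \<Sum>j<2 * n. U $$ (\<rho> a, j) * (ppow (l ! j) * V $$ (j, f b)))))
        \<le> real CARD('p) powi (- tail_sum r l)"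
      using \<rho> f by (intro norm_det_udv_le[OF l] int_matD[OF im(1) c(1)] int_matD[OF im(2) c(2)]) auto
    ultimately show ?thesis by (simp only:)
  qed
  have "all_minor n r A \<le> real CARD('p) powi (- tail_sum r l)"
    unfolding all_minor_def max_minor_def
    by (intro Max.boundedI) (use fin ne le in \<open>auto intro!: Max.boundedI simp del: PiE_eq_empty_iff\<close>)
  moreover have "real CARD('p) powi (- tail_sum r l) \<le> all_minor n r A"
  proof -
    obtain U' where U': "U' \<in> GSp_Zp n" "U' * U = 1\<^sub>m (2 * n)" by (rule GSp_Zp_inverse[OF UV(1)])
    obtain V' where V': "V' \<in> GSp_Zp n" "V * V' = 1\<^sub>m (2 * n)" by (rule GSp_Zp_inverse[OF UV(2)])
    note c' = GSp_Zp_carrier[OF U'(1)] GSp_Zp_carrier[OF V'(1)]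
    note im' = GLZ_int_mat[OF GSp_ZpD(2)[OF U'(1)]] GLZ_int_mat[OF GSp_ZpD(2)[OF V'(1)]]
    have D: "diag_ppow (2 * n) (2 * n) l = U' * (A * V')"
    proof -
      have "diag_ppow (2 * n) (2 * n) l = U' * A * V'"
        unfolding eq by (rule mult_cancel_both_sides[OF c diag_ppow_carrier c' U'(2) V'(2), symmetric])
      also have "\<dots> = U' * (A * V')" by (rule assoc_mult_mat[OF c'(1) Ac c'(2)])
      finally show ?thesis .
    qed
    let ?W = "\<lambda>a i. U' $$ (2 * n - r + a, i)" and ?Y = "\<lambda>k b. V' $$ (k, 2 * n - r + b)"
    have e: "mat r r (\<lambda>(a, b). if a = b then ppow (l ! (2 * n - r + a)) else 0)
        = mat r r (\<lambda>(a, b). \<Sum>i<2 * n. ?W a i * (\<Sum>k<2 * n. A $$ (i, k) * ?Y k b))"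
    proof (rule eq_matI)
      fix a b assume "a < dim_row (mat r r (\<lambda>(a, b). \<Sum>i<2 * n. ?W a i * (\<Sum>k<2 * n. A $$ (i, k) * ?Y k b)))"
        "b < dim_col (mat r r (\<lambda>(a, b). \<Sum>i<2 * n. ?W a i * (\<Sum>k<2 * n. A $$ (i, k) * ?Y k b)))"
      then have ab: "a < r" "b < r" by simp_all
      then have ab': "2 * n - r + a < 2 * n" "2 * n - r + b < 2 * n" using r by linarith+
      have "(if a = b then ppow (l ! (2 * n - r + a)) else 0) = diag_ppow (2 * n) (2 * n) l $$ (2 * n - r + a, 2 * n - r + b)"
        using diag_ppow_entry[OF ab', of l] by (auto split: if_splits)
      also have "\<dots> = (\<Sum>i<2 * n. ?W a i * (A * V') $$ (i, 2 * n - r + b))"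
        unfolding D by (rule mult_mat_entry[OF c'(1) mult_carrier_mat[OF Ac c'(2)] ab'])
      also have "\<dots> = (\<Sum>i<2 * n. ?W a i * (\<Sum>k<2 * n. A $$ (i, k) * ?Y k b))"
        using mult_mat_entry[OF Ac c'(2) _ ab'(2)] by (intro sum.cong) auto
      finally show "mat r r (\<lambda>(a, b). if a = b then ppow (l ! (2 * n - r + a)) else 0) $$ (a, b)
          = mat r r (\<lambda>(a, b). \<Sum>i<2 * n. ?W a i * (\<Sum>k<2 * n. A $$ (i, k) * ?Y k b)) $$ (a, b)"
        using ab by simp
    qed simp_all
    have am0: "all_minor n r A \<ge> 0"
      using all_minor_ge[OF id, of A] max_minor_ge[OF id] padic_norm_nonneg by (meson order_trans)
    have "padic_norm (Determinant.det (mat r r (\<lambda>(a, b). \<Sum>i<2 * n. ?W a i * (\<Sum>k<2 * n. A $$ (i, k) * ?Y k b)))) \<le> all_minor n r A"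
    proof (rule norm_det_sum_rows_le[OF _ am0])
      show "padic_norm (?W a j) \<le> 1" if "a < r" "j < 2 * n" for a j
        using that r by (intro int_matD[OF im'(1) c'(1)]) auto
      fix \<rho> assume \<rho>: "\<rho> \<in> ?S"
      show "padic_norm (Determinant.det (mat r r (\<lambda>(a, b). \<Sum>k<2 * n. A $$ (\<rho> a, k) * ?Y k b))) \<le> all_minor n r A"
      proof (rule norm_det_sum_cols_le[OF _ am0])
        show "padic_norm (?Y k b) \<le> 1" if "k < 2 * n" "b < r" for k b
          using that r by (intro int_matD[OF im'(2) c'(2)]) auto
        fix f assume f: "f \<in> ?S"
        show "padic_norm (Determinant.det (mat r r (\<lambda>(a, b). A $$ (\<rho> a, f b)))) \<le> all_minor n r A"
          by (rule order_trans[OF max_minor_ge[OF f] all_minor_ge[OF \<rho>]])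
      qed
    qed
    then have "padic_norm (\<Prod>a<r. ppow (l ! (2 * n - r + a)) :: 'p padic) \<le> all_minor n r A"
      unfolding e[symmetric] det_diag_mat .
    then show ?thesis unfolding padic_norm_prod_ppow tail_sum_def l(1) .
  qed
  ultimately show ?thesis unfolding l_def by simp
qed

lemma max_minor_cong:
  assumes "\<And>a k. a < r \<Longrightarrow> k < m \<Longrightarrow> X a k = Y a k"
  shows "max_minor r m X = max_minor r m Y"
proof -
  have "mat r r (\<lambda>(a, b). X a (f b)) = mat r r (\<lambda>(a, b). Y a (f b))" if "f \<in> {..<r} \<rightarrow>\<^sub>E {..<m}" for f
    using that by (intro eq_matI) (auto dest: PiE_mem intro!: assms)
  then show ?thesis unfolding max_minor_def by (intro arg_cong[of _ _ Max] image_cong refl) (simp only:)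
qed

text \<open>The weight involves the minors of the last rows only, and a maximum over fewer minors
  means a larger exponent.\<close>

lemma tail_sum_le_weight:
  fixes A :: "'p::prime_card padic mat"
  assumes A: "A \<in> GSp_Qp n" and n: "n \<ge> 1" and r: "r \<le> 2 * n"
  shows "tail_sum r (SN_GSp n A) \<le> weight r A"
proof -
  have id: "(\<lambda>a\<in>{..<r}. 2 * n - r + a) \<in> {..<r} \<rightarrow>\<^sub>E {..<2 * n}" using r by auto
  have "real CARD('p) powi (- weight r A) \<le> all_minor n r A"
    unfolding weight_eq_max_minor[OF A r] using all_minor_ge[OF id, of A]
    max_minor_cong[of r "2 * n" "\<lambda>a k. A $$ ((\<lambda>a\<in>{..<r}. 2 * n - r + a) a, k)" "\<lambda>a k. A $$ (2 * n - r + a, k)"]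
    by simp
  then show ?thesis
    unfolding tail_sum_eq_all_minor[OF A n r, symmetric] powi_prime_le_iff by simp
qed

lemma tail_sum_left_mult:
  fixes A :: "'p::prime_card padic mat"
  assumes A: "A \<in> GSp_Qp n" and n: "n \<ge> 1" and W: "W \<in> GSp_Zp n"
  shows "SN_GSp n (W * A) = SN_GSp n A"
proof -
  obtain U V where UV: "U \<in> GSp_Zp n" "V \<in> GSp_Zp n" and l: "length (SN_GSp n A) = 2 * n" "sorted_wrt (\<ge>) (SN_GSp n A)"
    and eq: "A = U * diag_ppow (2 * n) (2 * n) (SN_GSp n A) * V"
    by (rule SN_GSp_decomposition[OF A n]) blast
  note WA = GSp_Qp_mult[OF GSp_ZpD(1)[OF W] A]
  obtain U' V' where UV': "U' \<in> GSp_Zp n" "V' \<in> GSp_Zp n" and l': "length (SN_GSp n (W * A)) = 2 * n" "sorted_wrt (\<ge>) (SN_GSp n (W * A))"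
    and eq': "W * A = U' * diag_ppow (2 * n) (2 * n) (SN_GSp n (W * A)) * V'"
    by (rule SN_GSp_decomposition[OF WA n]) blast
  note c = GSp_Zp_carrier[OF UV(1)] GSp_Zp_carrier[OF UV(2)] GSp_Zp_carrier[OF W]
  have "W * A = (W * U) * diag_ppow (2 * n) (2 * n) (SN_GSp n A) * V"
    by (subst eq) (simp add: mult_mat_assoc_dim carrier_matD[OF c(1)] carrier_matD[OF c(2)] carrier_matD[OF c(3)]
        carrier_matD[OF diag_ppow_carrier] del: assoc_mult_mat)
  with eq' have "U' * diag_ppow (2 * n) (2 * n) (SN_GSp n (W * A)) * V' = (W * U) * diag_ppow (2 * n) (2 * n) (SN_GSp n A) * V"
    by simp
  then show ?thesis
    by (rule diag_ppow_unique) (use UV UV' l l' W in \<open>auto dest: GSp_ZpD(2) intro: GLZ_mult\<close>)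
qed

lemma weight_right_mult:
  fixes A :: "'p::prime_card padic mat"
  assumes A: "A \<in> GSp_Qp n" and V: "V \<in> GSp_Zp n" and r: "r \<le> 2 * n"
  shows "weight r (A * V) = weight r A"
proof -
  obtain T K where T: "T \<in> GSp_Qp n" and K: "K \<in> GSp_Zp n" and eq: "A = T * K"
    and tri: "upper_tri n T"
    by (rule iwasawa_decomposition[OF A]) blast
  have "A * V = T * (K * V)"
    unfolding eq by (rule assoc_mult_mat[OF GSp_Qp_carrier[OF T] GSp_Zp_carrier[OF K] GSp_Zp_carrier[OF V]])
  then have "real CARD('p) powi (- weight r (A * V)) = real CARD('p) powi (- weight r A)"
    unfolding eq using weight_triangular_mult(1)[OF T tri K r] weight_triangular_mult(1)[OF T tri GSp_Zp_mult[OF K V] r] by simp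
  then show ?thesis using powi_prime_inj by fastforce
qed

text \<open>The minor of \<open>U D\<close> in the last \<open>r\<close> rows and columns is the
  corner minor of \<open>U\<close> times the last \<open>r\<close> powers, and it is one of the
  minors that define the weight. The factor \<open>V\<close> disappears by right invariance of the
  weight.\<close>

lemma corner_norm_le_weight:
  fixes U :: "'p::prime_card padic mat"
  assumes U: "U \<in> GSp_Zp n" and V: "V \<in> GSp_Zp n" and l: "length l = 2 * n" and D: "(diag_ppow (2 * n) (2 * n) l :: 'p padic mat) \<in> GSp_Qp n"
    and r: "r \<le> 2 * n"
  shows "padic_norm (Determinant.det (corner n r U)) * real CARD('p) powi (- tail_sum r l)
    \<le> real CARD('p) powi (- weight r (U * diag_ppow (2 * n) (2 * n) l * V))"
proof -
  let ?D = "diag_ppow (2 * n) (2 * n) l :: 'p padic mat"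
  note Uc = GSp_Zp_carrier[OF U]
  have UD: "U * ?D \<in> GSp_Qp n" by (rule GSp_Qp_mult[OF GSp_ZpD(1)[OF U] D])
  have id: "(\<lambda>a\<in>{..<r}. 2 * n - r + a) \<in> {..<r} \<rightarrow>\<^sub>E {..<2 * n}" using r by auto
  have UDe: "(U * ?D) $$ (i, k) = ppow (l ! k) * U $$ (i, k)" if "i < 2 * n" "k < 2 * n" for i k
  proof -
    have "(U * ?D) $$ (i, k) = (\<Sum>t<2 * n. (ppow (l ! t) * U $$ (i, t)) * (if t = k then 1 else 0))"
      unfolding mult_mat_entry[OF Uc diag_ppow_carrier that] using that by (intro sum.cong) (auto simp: diag_ppow_entry)
    also have "\<dots> = ppow (l ! k) * U $$ (i, k)" by (rule sum_delta_mult(4)[OF that(2)])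
    finally show ?thesis .
  qed
  have "mat r r (\<lambda>(a, b). (U * ?D) $$ (2 * n - r + a, (\<lambda>a\<in>{..<r}. 2 * n - r + a) b))
      = mat r r (\<lambda>(a, b). ppow (l ! (2 * n - r + b)) * U $$ (2 * n - r + a, 2 * n - r + b))"
    using r by (intro eq_matI) (auto simp: UDe)
  then have "Determinant.det (mat r r (\<lambda>(a, b). (U * ?D) $$ (2 * n - r + a, (\<lambda>a\<in>{..<r}. 2 * n - r + a) b)))
      = Determinant.det (mat r r (\<lambda>(a, b). ppow (l ! (2 * n - r + b)) * U $$ (2 * n - r + a, 2 * n - r + b)))" by (rule arg_cong)
  also have "\<dots> = Determinant.det (mat r r (\<lambda>(a, b). ppow (l ! (2 * n - r + a)) * U $$ (2 * n - r + b, 2 * n - r + a)))"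
    by (rule det_mat_swap[of r "\<lambda>b a. ppow (l ! (2 * n - r + b)) * U $$ (2 * n - r + a, 2 * n - r + b)"])
  also have "\<dots> = (\<Prod>a<r. ppow (l ! (2 * n - r + a))) * Determinant.det (mat r r (\<lambda>(a, b). U $$ (2 * n - r + b, 2 * n - r + a)))"
    by (rule det_scale_rows)
  also have "Determinant.det (mat r r (\<lambda>(a, b). U $$ (2 * n - r + b, 2 * n - r + a))) = Determinant.det (corner n r U)"
    unfolding corner_def by (rule det_mat_swap[of r "\<lambda>a b. U $$ (2 * n - r + a, 2 * n - r + b)"])
  finally have "padic_norm (Determinant.det (mat r r (\<lambda>(a, b). (U * ?D) $$ (2 * n - r + a, (\<lambda>a\<in>{..<r}. 2 * n - r + a) b))))
      = real CARD('p) powi (- tail_sum r l) * padic_norm (Determinant.det (corner n r U))"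
    by (simp only: padic_norm_mult padic_norm_prod_ppow tail_sum_def l)
  then show ?thesis
    unfolding weight_right_mult[OF UD V r] weight_eq_max_minor[OF UD r]
    using max_minor_ge[OF id, of "\<lambda>a k. (U * ?D) $$ (2 * n - r + a, k)"] by (simp add: mult.commute)
qed

subsection \<open>Genericity\<close>

text \<open>Polynomial of degree at most \<open>D\<close> in each variable separately, the others
  being fixed. This is all that an argument moving one coordinate at a time uses, and it does
  without multivariate polynomials.\<close>

definition pdeg :: "nat \<Rightarrow> ((nat \<Rightarrow> 'a::comm_ring_1) \<Rightarrow> 'a) \<Rightarrow> bool" where
  "pdeg D f \<longleftrightarrow> (\<forall>y i. \<exists>q. degree q \<le> D \<and> (\<forall>t. f (y(i := t)) = poly q t))"

lemma pdegE:
  assumes "pdeg D f" obtains q where "degree q \<le> D" "\<And>t. f (y(i := t)) = poly q t"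
  using assms unfolding pdeg_def by blast

lemma pdeg_const: "pdeg D (\<lambda>_. c)"
  unfolding pdeg_def by (intro allI exI[of _ "[:c:]"]) simp

lemma pdeg_var: "D \<ge> 1 \<Longrightarrow> pdeg D (\<lambda>y. y j)"
  unfolding pdeg_def
proof (intro allI)
  fix y :: "nat \<Rightarrow> 'a" and i assume "D \<ge> 1"
  then show "\<exists>q. degree q \<le> D \<and> (\<forall>t. (y(i := t)) j = poly q t)"
    by (intro exI[of _ "if i = j then [:0, 1:] else [:y j:]"]) auto
qed

lemma pdeg_add:
  assumes "pdeg D f" "pdeg D g" shows "pdeg D (\<lambda>y. f y + g y)"
  unfolding pdeg_def
proof (intro allI)
  fix y i
  obtain q where q: "degree q \<le> D" "\<And>t. f (y(i := t)) = poly q t" using pdegE[OF assms(1)] by metis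
  obtain s where s: "degree s \<le> D" "\<And>t. g (y(i := t)) = poly s t" using pdegE[OF assms(2)] by metis
  show "\<exists>q. degree q \<le> D \<and> (\<forall>t. f (y(i := t)) + g (y(i := t)) = poly q t)"
    using q s by (intro exI[of _ "q + s"]) (simp add: degree_add_le)
qed

lemma pdeg_mult:
  assumes "pdeg D f" "pdeg E g" shows "pdeg (D + E) (\<lambda>y. f y * g y)"
  unfolding pdeg_def
proof (intro allI)
  fix y i
  obtain q where q: "degree q \<le> D" "\<And>t. f (y(i := t)) = poly q t" using pdegE[OF assms(1)] by metis
  obtain s where s: "degree s \<le> E" "\<And>t. g (y(i := t)) = poly s t" using pdegE[OF assms(2)] by metis
  have "degree (q * s) \<le> D + E" using degree_mult_le[of q s] q(1) s(1) by linarith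
  then show "\<exists>q. degree q \<le> D + E \<and> (\<forall>t. f (y(i := t)) * g (y(i := t)) = poly q t)"
    using q s by (intro exI[of _ "q * s"]) simp
qed

lemma pdeg_sum: "(\<And>i. i \<in> I \<Longrightarrow> pdeg D (f i)) \<Longrightarrow> pdeg D (\<lambda>y. \<Sum>i\<in>I. f i y)"
  by (induction I rule: infinite_finite_induct) (auto intro: pdeg_const pdeg_add)

lemma pdeg_prod: "finite I \<Longrightarrow> (\<And>i. i \<in> I \<Longrightarrow> pdeg D (f i)) \<Longrightarrow> pdeg (card I * D) (\<lambda>y. \<Prod>i\<in>I. f i y)"
proof (induction I rule: finite_induct)
  case (insert i I)
  have "pdeg (D + card I * D) (\<lambda>y. f i y * (\<Prod>i\<in>I. f i y))" using insert by (intro pdeg_mult) auto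
  then show ?case using insert(1,2) by simp
qed (simp add: pdeg_const)

lemma det_mat_leibniz:
  "Determinant.det (mat r r (\<lambda>(a, b). F a b)) = (\<Sum>\<pi>\<in>{\<pi>. \<pi> permutes {0..<r}}. signof \<pi> * (\<Prod>a\<in>{0..<r}. F a (\<pi> a)))"
  unfolding Determinant.det_def by (auto intro!: sum.cong prod.cong arg_cong2[of _ _ _ _ "(*)"] dest: permutes_in_image)

lemma pdeg_det:
  assumes "\<And>a b. a < r \<Longrightarrow> b < r \<Longrightarrow> pdeg D (\<lambda>y. F y a b)"
  shows "pdeg (r * D) (\<lambda>y. Determinant.det (mat r r (\<lambda>(a, b). F y a b)))"
proof -
  have eq: "Determinant.det (mat r r (\<lambda>(a, b). F y a b)) = (\<Sum>\<pi>\<in>{\<pi>. \<pi> permutes {0..<r}}. signof \<pi> * (\<Prod>a\<in>{0..<r}. F y a (\<pi> a)))" for y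
    by (rule det_mat_leibniz)
  have "pdeg (0 + card {0..<r} * D) (\<lambda>y. signof \<pi> * (\<Prod>a\<in>{0..<r}. F y a (\<pi> a)))" if "\<pi> permutes {0..<r}" for \<pi>
    using that assms by (intro pdeg_mult[OF pdeg_const] pdeg_prod) (auto dest: permutes_in_image)
  then show ?thesis unfolding eq by (intro pdeg_sum) simp
qed

text \<open>Lagrange interpolation, with the differences of nodes below \<open>N\<close> of norm at least \<open>1 / N\<close>.\<close>

lemma norm_poly_less:
  fixes q :: "'p::prime_card padic poly"
  assumes "degree q \<le> D" "S \<subseteq> {..<N}" "D < card S" "\<And>t. t \<in> S \<Longrightarrow> padic_norm (poly q (of_nat t)) < \<delta>" "padic_norm x \<le> 1"
  shows "padic_norm (poly q x) < \<delta> * real N ^ D"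
  using assms
proof (induction D arbitrary: q S \<delta>)
  case 0
  then obtain t where "t \<in> S" by fastforce
  moreover have "degree q = 0" using 0 by simp
  then obtain a where "q = [:a:]" by (rule degree_eq_zeroE)
  ultimately show ?case using 0(4)[of t] by simp
next
  case (Suc D)
  then obtain t0 where t0: "t0 \<in> S" by fastforce
  \<comment> \<open>The quotient by one node is small at the other nodes: a difference of two small
    values is divided by a difference of nodes of norm at least \<open>1 / N\<close>. Each degree
    thus costs one factor \<open>N\<close>.\<close>
  define q' where "q' = synthetic_div q (of_nat t0)"
  have q: "poly q x = (x - of_nat t0) * poly q' x + poly q (of_nat t0)" for x
    using arg_cong[OF synthetic_div_correct'[of "of_nat t0" q], of "\<lambda>p. poly p x"] by (simp add: q'_def algebra_simps)
  have fS: "finite S" using Suc.prems(2) finite_subset by blast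
  have N: "real N \<ge> 1" using t0 Suc.prems(2) by force
  have d0: "\<delta> > 0" using Suc.prems(4)[OF t0] padic_norm_nonneg[of "poly q (of_nat t0)"] by linarith
  have "padic_norm (poly q' x) < (\<delta> * real N) * real N ^ D"
  proof (rule Suc.IH)
    show "degree q' \<le> D" using Suc.prems(1) by (simp add: q'_def degree_synthetic_div)
    show "S - {t0} \<subseteq> {..<N}" using Suc.prems(2) by blast
    show "D < card (S - {t0})" using Suc.prems(3) t0 fS by simp
    fix t assume t: "t \<in> S - {t0}"
    have e: "poly q (of_nat t) - poly q (of_nat t0) = (of_nat t - of_nat t0) * poly q' (of_nat t)"
      using q[of "of_nat t"] by simp
    have g: "padic_norm (of_nat t - of_nat t0 :: 'p padic) \<ge> 1 / real N"
      using t t0 Suc.prems(2) by (intro padic_norm_of_nat_diff_ge) auto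
    have "padic_norm (poly q' (of_nat t)) * (1 / real N) \<le> padic_norm (poly q' (of_nat t)) * padic_norm (of_nat t - of_nat t0 :: 'p padic)"
      by (intro mult_left_mono g padic_norm_nonneg)
    also have "\<dots> = padic_norm (poly q (of_nat t) + - poly q (of_nat t0))"
      using arg_cong[OF e, of padic_norm] by (simp add: padic_norm_mult mult.commute)
    also have "\<dots> \<le> max (padic_norm (poly q (of_nat t))) (padic_norm (- poly q (of_nat t0)))" by (rule padic_norm_ultra)
    also have "\<dots> < \<delta>" using Suc.prems(4)[of t] Suc.prems(4)[OF t0] t by (simp add: padic_norm_minus)
    finally show "padic_norm (poly q' (of_nat t)) < \<delta> * real N" using N by (simp add: field_simps)
  qed fact
  moreover have "padic_norm (x - of_nat t0) \<le> 1"
    using Suc.prems(5) padic_norm_of_nat_le_1[of t0, where 'p='p] by (intro padic_norm_diff_le)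
  then have "padic_norm (x - of_nat t0) * padic_norm (poly q' x) \<le> 1 * padic_norm (poly q' x)"
    by (intro mult_right_mono padic_norm_nonneg)
  moreover have "\<delta> * 1 \<le> \<delta> * real N ^ Suc D" using N d0 one_le_power[OF N, of "Suc D"] by (intro mult_left_mono) auto
  then have "padic_norm (poly q (of_nat t0)) < \<delta> * real N ^ Suc D" using Suc.prems(4)[OF t0] by simp
  ultimately show ?case
    unfolding q[of x] using padic_norm_ultra[of "(x - of_nat t0) * poly q' x" "poly q (of_nat t0)"]
    by (simp add: padic_norm_mult mult.assoc)
qed

text \<open>Starting from a point \<open>y\<close> with a large value, the coordinates are replaced
  one after the other by integers below \<open>N\<close>. As long as the value is not too small, at
  most \<open>D\<close> of the \<open>N\<close> choices for the next coordinate can lower it by more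
  than the factor \<open>N ^ D\<close>, since \<open>D + 1\<close> of them would by interpolation
  force a small value at \<open>y s\<close> too. Over \<open>s\<close> coordinates this adds up to a
  bad fraction of at most \<open>s * D / N\<close>.\<close>

lemma pdeg_anticoncentration:
  fixes f :: "(nat \<Rightarrow> 'p::prime_card padic) \<Rightarrow> 'p padic"
  assumes f: "pdeg D f" and y: "\<And>i. padic_norm (y i) \<le> 1" and c: "c \<le> padic_norm (f y)" and N: "N \<ge> 1"
  shows "N * card {t \<in> {..<s} \<rightarrow>\<^sub>E {..<N}. padic_norm (f (\<lambda>i. if i < s then of_nat (t i) else y i)) * (real N ^ D) ^ s < c}
    \<le> s * D * N ^ s"
proof (induction s)
  case 0
  have "{t \<in> {..<0} \<rightarrow>\<^sub>E {..<N}. padic_norm (f (\<lambda>i. if i < 0 then of_nat (t i) else y i)) * (real N ^ D) ^ 0 < c} = {}"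
    using c by auto
  then show ?case by simp
next
  case (Suc s)
  define P where "P = (\<lambda>s t i. if i < s then of_nat (t i) else y i)"
  define bad where "bad = (\<lambda>s t. padic_norm (f (P s t)) * (real N ^ D) ^ s < c)"
  define B where "B = (\<lambda>s. {t \<in> {..<s} \<rightarrow>\<^sub>E {..<N}. bad s t})"
  define G where "G = {..<s} \<rightarrow>\<^sub>E {..<N}"
  have fin: "finite G" and cG: "card G = N ^ s" by (auto simp: G_def card_PiE intro: finite_PiE)
  have IH: "N * card (B s) \<le> s * D * N ^ s" using Suc by (simp add: B_def bad_def P_def)
  have ext: "card {x \<in> {..<N}. bad (Suc s) (t(s := x))} \<le> D" if nb: "\<not> bad s t" for t
  proof (rule ccontr)
    assume "\<not> ?thesis"
    then have D: "D < card {x \<in> {..<N}. bad (Suc s) (t(s := x))}" by simp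
    obtain q where q: "degree q \<le> D" "\<And>x. f ((P s t)(s := x)) = poly q x" using pdegE[OF f] by metis
    have P1: "P (Suc s) (t(s := x)) = (P s t)(s := of_nat x)" for x
      by (auto simp: P_def fun_eq_iff)
    have P2: "(P s t)(s := y s) = P s t" by (auto simp: P_def fun_eq_iff)
    have ND: "real N ^ D > 0" using N by simp
    have "padic_norm (poly q (y s)) < (c / (real N ^ D) ^ Suc s) * real N ^ D"
    proof (rule norm_poly_less[OF q(1) _ D _ y])
      show "padic_norm (poly q (of_nat x)) < c / (real N ^ D) ^ Suc s" if "x \<in> {x \<in> {..<N}. bad (Suc s) (t(s := x))}" for x
        using that ND unfolding bad_def P1 q(2) by (simp add: pos_less_divide_eq)
    qed auto
    moreover have "(c / (real N ^ D) ^ Suc s) * real N ^ D = c / (real N ^ D) ^ s" using ND by simp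
    ultimately have "padic_norm (f (P s t)) < c / (real N ^ D) ^ s"
      unfolding q(2)[symmetric] P2 by simp
    then show False using nb ND by (simp add: bad_def pos_less_divide_eq)
  qed
  have "B (Suc s) \<subseteq> (\<Union>t\<in>G. (\<lambda>x. t(s := x)) ` {x \<in> {..<N}. bad (Suc s) (t(s := x))})"
    by (auto simp: B_def G_def lessThan_Suc PiE_insert_eq)
  then have "card (B (Suc s)) \<le> card (\<Union>t\<in>G. (\<lambda>x. t(s := x)) ` {x \<in> {..<N}. bad (Suc s) (t(s := x))})"
    using fin by (intro card_mono) auto
  also have "\<dots> \<le> (\<Sum>t\<in>G. card ((\<lambda>x. t(s := x)) ` {x \<in> {..<N}. bad (Suc s) (t(s := x))}))"
    by (rule card_UN_le[OF fin])
  also have "\<dots> \<le> (\<Sum>t\<in>G. (if t \<in> B s then N else 0) + D)"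
  proof (rule sum_mono)
    fix t assume t: "t \<in> G"
    have "card ((\<lambda>x. t(s := x)) ` {x \<in> {..<N}. bad (Suc s) (t(s := x))}) \<le> card {x \<in> {..<N}. bad (Suc s) (t(s := x))}"
      by (rule card_image_le) simp
    also have "\<dots> \<le> (if t \<in> B s then N else 0) + D"
    proof (cases "bad s t")
      case True
      then have "t \<in> B s" using t by (simp add: B_def G_def)
      moreover have "card {x \<in> {..<N}. bad (Suc s) (t(s := x))} \<le> card {..<N}" by (intro card_mono) auto
      ultimately show ?thesis by simp
    qed (use ext[of t] in simp)
    finally show "card ((\<lambda>x. t(s := x)) ` {x \<in> {..<N}. bad (Suc s) (t(s := x))}) \<le> (if t \<in> B s then N else 0) + D" .
  qed
  also have "\<dots> = N * card (B s) + D * N ^ s"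
  proof -
    have BG: "G \<inter> B s = B s" by (auto simp: B_def G_def)
    have "(\<Sum>t\<in>G. (if t \<in> B s then N else 0)) = (\<Sum>t\<in>G \<inter> B s. N)"
      by (rule sum.inter_restrict[OF fin, symmetric])
    then show ?thesis by (simp add: sum.distrib cG BG)
  qed
  finally have "N * card (B (Suc s)) \<le> N * (N * card (B s) + D * N ^ s)" by (rule mult_le_mono2)
  also have "\<dots> \<le> N * (s * D * N ^ s + D * N ^ s)" using IH by (intro mult_le_mono2) simp
  also have "\<dots> = Suc s * D * N ^ Suc s" by (simp add: algebra_simps)
  finally show ?case unfolding B_def bad_def P_def .
qed

section \<open>A polynomial family in the integral group and its corner minors\<close>

lemma prod_le_factor:
  fixes f :: "'b \<Rightarrow> real"
  assumes "finite I" "i \<in> I" "\<And>i. i \<in> I \<Longrightarrow> 0 \<le> f i \<and> f i \<le> 1"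
  shows "(\<Prod>i\<in>I. f i) \<le> f i"
proof -
  have "(\<Prod>i\<in>I. f i) = f i * (\<Prod>i\<in>I - {i}. f i)" by (rule prod.remove[OF assms(1,2)])
  also have "\<dots> \<le> f i * 1" using assms by (intro mult_left_mono prod_le_1) auto
  finally show ?thesis by simp
qed

text \<open>The entries of \<open>y\<close> are the parameters of \<open>2 n\<close> transvections, \<open>2 n + 1\<close> for each.\<close>

definition tv_param :: "nat \<Rightarrow> (nat \<Rightarrow> 'a) \<Rightarrow> ((nat \<Rightarrow> 'a) \<times> 'a) list" where
  "tv_param n y = map (\<lambda>i. (\<lambda>k. y (i * (2 * n + 1) + k), y (i * (2 * n + 1) + 2 * n))) [0..<2 * n]"

text \<open>The elimination multiplies on the right and produces upper triangular matrices, whereas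
  translates act on the left; the transpose converts one into the other.\<close>

definition gen_mat :: "nat \<Rightarrow> (nat \<Rightarrow> 'a::comm_ring_1) \<Rightarrow> 'a mat" where
  "gen_mat n y = transpose_mat (tv_prod n (tv_param n y))"

lemma gen_mat_carrier [simp]: "gen_mat n y \<in> carrier_mat (2 * n) (2 * n)"
  unfolding gen_mat_def transpose_carrier_mat by (rule tv_prod_carrier)

lemma gen_mat_GSp_Zp:
  assumes "\<And>i. padic_norm (y i :: 'p::prime_card padic) \<le> 1" shows "gen_mat n y \<in> GSp_Zp n"
  unfolding gen_mat_def using assms by (intro GSp_Zp_transpose tv_prod_GSp_Zp) (auto simp: int_tv_def tv_param_def)

text \<open>Apart from the identity, an entry of a transvection is \<open>c\<close> times two
  coordinates of \<open>v\<close>, up to sign, whence degree at most 3 for each factor. The maps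
  \<open>a\<close> and \<open>b\<close> say which variables serve as parameters.\<close>

lemma pdeg_tv_prod:
  assumes "i < 2 * n" "k < 2 * n"
  shows "pdeg (3 * length js) (\<lambda>y. tv_prod n (map (\<lambda>j. (\<lambda>k. y (a j k), y (b j))) js) $$ (i, k) :: 'a::comm_ring_1)"
  using assms
proof (induction js arbitrary: i k)
  case Nil
  then show ?case by (simp add: pdeg_const)
next
  case (Cons j js)
  let ?R = "\<lambda>y. tv_prod n (map (\<lambda>j. (\<lambda>k. y (a j k), y (b j))) js) :: 'a mat"
  have e: "tv_prod n (map (\<lambda>j. (\<lambda>k. y (a j k), y (b j))) (j # js)) $$ (i, k)
     = (\<Sum>t<2 * n. ((if i = t then 1 else 0) + y (b j) * (ssgn n i * y (a j (2 * n - 1 - i))) * y (a j t)) * ?R y $$ (t, k))" for y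
    using Cons.prems by (simp add: mult_mat_entry[OF tv_carrier tv_prod_carrier] tv_entry om_unit_left)
  have "pdeg (3 + 3 * length js) (\<lambda>y. ((if i = t then 1 else 0) + y (b j) * (ssgn n i * y (a j (2 * n - 1 - i))) * y (a j t)) * ?R y $$ (t, k))"
    if "t < 2 * n" for t
  proof (intro pdeg_mult pdeg_add pdeg_const Cons.IH that Cons.prems(2))
    have "pdeg ((1 + (0 + 1)) + 1) (\<lambda>y. y (b j) * (ssgn n i * y (a j (2 * n - 1 - i))) * y (a j t) :: 'a)"
      by (intro pdeg_mult pdeg_var pdeg_const) simp_all
    then show "pdeg 3 (\<lambda>y. y (b j) * (ssgn n i * y (a j (2 * n - 1 - i))) * y (a j t) :: 'a)" by (simp add: numeral_3_eq_3)
  qed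
  then show ?case unfolding e by (intro pdeg_sum) simp
qed

text \<open>One product for all \<open>r\<close>, so that a single exceptional set controls all
  corner minors. The factor for \<open>r = 0\<close> is 1.\<close>

definition corner_prod :: "nat \<Rightarrow> 'a::comm_ring_1 mat \<Rightarrow> 'a" where
  "corner_prod n U = (\<Prod>r\<in>{..2 * n}. Determinant.det (corner n r U))"

text \<open>The entries have degree at most \<open>6 * n\<close>, namely 3 for each of the
  \<open>2 * n\<close> transvections; a determinant multiplies this by at most \<open>2 * n\<close>,
  and there are \<open>2 * n + 1\<close> factors. The bound is independent of
  \<open>U\<close>.\<close>

lemma pdeg_corner_prod:
  assumes U: "U \<in> carrier_mat (2 * n) (2 * n)"
  shows "pdeg ((2 * n + 1) * (2 * n * (6 * n))) (\<lambda>y. corner_prod n (gen_mat n y * U) :: 'a::comm_ring_1)"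
proof -
  have entry: "pdeg (6 * n) (\<lambda>y. (gen_mat n y * U) $$ (i, k))" if ik: "i < 2 * n" "k < 2 * n" for i k
  proof -
    have e: "(gen_mat n y * U) $$ (i, k) = (\<Sum>t<2 * n. tv_prod n (tv_param n y) $$ (t, i) * U $$ (t, k))" for y
      unfolding mult_mat_entry[OF gen_mat_carrier U ik]
      using ik carrier_matD[OF tv_prod_carrier[of n "tv_param n y"]] by (intro sum.cong) (auto simp: gen_mat_def)
    have "pdeg (3 * length [0..<2 * n] + 0) (\<lambda>y. tv_prod n (tv_param n y) $$ (t, i) * U $$ (t, k))" if "t < 2 * n" for t
      unfolding tv_param_def by (intro pdeg_mult pdeg_const pdeg_tv_prod that ik)
    then show ?thesis unfolding e by (intro pdeg_sum) simp
  qed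
  have mono: "pdeg D f \<Longrightarrow> D \<le> E \<Longrightarrow> pdeg E f" for D E and f :: "(nat \<Rightarrow> 'a) \<Rightarrow> 'a"
    unfolding pdeg_def by (meson order_trans)
  have "pdeg (2 * n * (6 * n)) (\<lambda>y. Determinant.det (corner n r (gen_mat n y * U)))" if r: "r \<le> 2 * n" for r
  proof (rule mono)
    show "pdeg (r * (6 * n)) (\<lambda>y. Determinant.det (corner n r (gen_mat n y * U)))"
      unfolding corner_def using r by (intro pdeg_det entry) auto
  qed (use r in simp)
  then have "pdeg (card {..2 * n} * (2 * n * (6 * n))) (\<lambda>y. corner_prod n (gen_mat n y * U))"
    unfolding corner_prod_def by (intro pdeg_prod) auto
  then show ?thesis by simp
qed

lemma norm_det_corner_le:
  assumes U: "U \<in> GSp_Zp n" and r: "r \<le> 2 * n"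
  shows "padic_norm (Determinant.det (corner n r U) :: 'p::prime_card padic) \<le> 1"
proof (rule padic_norm_det_le[OF corner_carrier])
  show "padic_norm (corner n r U $$ (a, b)) \<le> 1" if "a < r" "b < r" for a b
    using r that by (auto simp: corner_def intro!: int_matD[OF GLZ_int_mat[OF GSp_ZpD(2)[OF U]] GSp_Zp_carrier[OF U]])
qed

lemma tv_prod_cong:
  assumes "length ts = length us"
    "\<And>i. i < length us \<Longrightarrow> snd (ts ! i) = snd (us ! i) \<and> (\<forall>k<2 * n. fst (ts ! i) k = fst (us ! i) k)"
  shows "tv_prod n ts = tv_prod n us"
  using assms
proof (induction ts us rule: list_induct2)
  case (Cons t ts u us)
  obtain v c where t: "t = (v, c)" by (cases t)
  obtain v' c' where u: "u = (v', c')" by (cases u)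
  have c: "c = c'" and v: "k < 2 * n \<Longrightarrow> v k = v' k" for k using Cons.prems[of 0] t u by auto
  have "tv n v c = tv n v' c'"
    unfolding tv_def rank1_mat_def c by (intro eq_matI) (auto simp: v)
  moreover have "tv_prod n ts = tv_prod n us" using Cons.prems[of "Suc _"] by (intro Cons.IH) auto
  ultimately show ?case by (simp add: t u)
qed simp

text \<open>Triangularising the transpose of \<open>U\<close> yields parameters for which
  \<open>gen_mat n y * U\<close> is lower triangular and integral with a unit as determinant. Its
  diagonal entries are then units, and so are all corner minors.\<close>

lemma corner_prod_point:
  fixes U :: "'p::prime_card padic mat"
  assumes U: "U \<in> GSp_Zp n"
  obtains y where "\<forall>i. padic_norm (y i) \<le> 1" "\<forall>i. 2 * n * (2 * n + 1) \<le> i \<longrightarrow> y i = 0"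
    "padic_norm (corner_prod n (gen_mat n y * U)) = 1"
proof -
  note Uc = GSp_Zp_carrier[OF U] and UT = GSp_Zp_transpose[OF U]
  obtain ts where ts: "length ts = 2 * n" "int_tv n ts" and "\<And>i k. i < 2 * n \<Longrightarrow> k < i \<Longrightarrow> (transpose_mat U * tv_prod n ts) $$ (i, k) = 0"
    by (rule iwasawa[OF GSp_ZpD(1)[OF UT]]) blast
  then have tri: "upper_tri n (transpose_mat U * tv_prod n ts)" (is "upper_tri n ?R") by (simp add: upper_tri_def)
  \<comment> \<open>Splits an index into the number \<open>i\<close> of a transvection and a
    coordinate \<open>k\<close>, the place \<open>k = 2 * n\<close> holding the scalar; all further
    parameters are 0.\<close>
  define y where "y = (\<lambda>j. let i = j div (2 * n + 1); k = j mod (2 * n + 1) in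
    if i < 2 * n then if k = 2 * n then snd (ts ! i) else fst (ts ! i) k else 0)"
  have "tv_prod n (tv_param n y) = tv_prod n ts"
  proof (rule tv_prod_cong)
    have dm: "(i * m + k) div m = i" "(i * m + k) mod m = k" if "k < m" for i k m :: nat using that by simp_all
    have yk: "y (i * (2 * n + 1) + k) = (if k = 2 * n then snd (ts ! i) else fst (ts ! i) k)" if "i < 2 * n" "k \<le> 2 * n" for i k
    proof -
      have "k < 2 * n + 1" using that by simp
      then show ?thesis using that(1) unfolding y_def Let_def dm[OF \<open>k < 2 * n + 1\<close>] by simp
    qed
    fix i assume "i < length ts"
    then have i: "i < 2 * n" by (simp add: ts)
    then have e: "tv_param n y ! i = (\<lambda>k. y (i * (2 * n + 1) + k), y (i * (2 * n + 1) + 2 * n))"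
      by (simp add: tv_param_def)
    show "snd (tv_param n y ! i) = snd (ts ! i) \<and> (\<forall>k<2 * n. fst (tv_param n y ! i) k = fst (ts ! i) k)"
      unfolding e fst_conv snd_conv using yk[OF i] by simp
  qed (simp add: tv_param_def ts)
  then have "gen_mat n y * U = transpose_mat (tv_prod n ts) * U" by (simp add: gen_mat_def)
  also have "\<dots> = transpose_mat ?R"
    using transpose_mult[of "transpose_mat U" "2 * n" "2 * n" "tv_prod n ts" "2 * n"] Uc by simp
  finally have gm: "gen_mat n y * U = transpose_mat ?R" .
  have RK: "?R \<in> GSp_Zp n" by (rule GSp_Zp_mult[OF UT tv_prod_GSp_Zp[OF ts(2)]])
  note Rc = GSp_Zp_carrier[OF RK]
  have ent: "padic_norm (?R $$ (i, i)) \<le> 1" if "i < 2 * n" for i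
    by (rule int_matD[OF GLZ_int_mat[OF GSp_ZpD(2)[OF RK]] Rc that that])
  have "corner n (2 * n) ?R = ?R" using carrier_matD[OF Rc] by (intro eq_matI) (simp_all add: corner_def)
  then have one: "(\<Prod>a<2 * n. padic_norm (?R $$ (a, a))) = 1"
    using padic_norm_det_GLZ[OF GSp_ZpD(2)[OF RK]] det_corner_triangular[OF tri order_refl] by (simp add: padic_norm_prod)
  have diag: "padic_norm (?R $$ (i, i)) = 1" if i: "i < 2 * n" for i
    using prod_le_factor[of "{..<2 * n}" i "\<lambda>a. padic_norm (?R $$ (a, a))"] i ent one ent[OF i]
    by (auto simp: padic_norm_nonneg)
  have "padic_norm (Determinant.det (corner n r (gen_mat n y * U))) = 1" if r: "r \<le> 2 * n" for r
  proof -
    have "corner n r (transpose_mat ?R) = transpose_mat (corner n r ?R)"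
      using r carrier_matD[OF Rc] by (intro eq_matI) (auto simp: corner_def)
    then have "Determinant.det (corner n r (gen_mat n y * U)) = Determinant.det (corner n r ?R)"
      unfolding gm by (simp only: det_transpose[OF corner_carrier])
    then show ?thesis unfolding det_corner_triangular[OF tri r] using r diag by (simp add: padic_norm_prod)
  qed
  then have "padic_norm (corner_prod n (gen_mat n y * U)) = 1" by (simp add: corner_prod_def padic_norm_prod)
  moreover have "padic_norm (y i) \<le> 1" for i
  proof -
    have m: "(\<forall>k<2 * n. padic_norm (fst (ts ! j) k) \<le> 1) \<and> padic_norm (snd (ts ! j)) \<le> 1" if "j < 2 * n" for j
      using ts that nth_mem[of j ts] by (cases "ts ! j") (fastforce simp: int_tv_def)
    have "i mod (2 * n + 1) < 2 * n \<or> i mod (2 * n + 1) = 2 * n" using mod_less_divisor[of "2 * n + 1" i] by linarith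
    then show ?thesis using m[of "i div (2 * n + 1)"] by (auto simp: y_def Let_def padic_norm_0)
  qed
  moreover have "y i = 0" if "2 * n * (2 * n + 1) \<le> i" for i
  proof -
    have "2 * n \<le> i div (2 * n + 1)" using div_le_mono[OF that, of "2 * n + 1"] by (simp del: mult_Suc_right)
    then show ?thesis by (simp add: y_def Let_def)
  qed
  ultimately show ?thesis by (intro that[of y]) blast+
qed

text \<open>Up to a bounded error, \<open>tail_sum\<close> is the weight of a generic translate by \<open>K\<close>, and finitely
  many translates are enough to see this uniformly in \<open>A\<close>.\<close>

lemma generic_translates:
  assumes n: "n \<ge> 1" and \<epsilon>: "\<epsilon> > 0"
  obtains I :: "(nat \<Rightarrow> nat) set" and u :: "(nat \<Rightarrow> nat) \<Rightarrow> 'p::prime_card padic mat" and C :: int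
  where "finite I" "I \<noteq> {}" "\<forall>t. u t \<in> GSp_Zp n"
    "\<forall>A\<in>GSp_Qp n.
      real (card {t \<in> I. \<exists>r\<le>2 * n. tail_sum r (SN_GSp n A) + C < weight r (u t * A)}) \<le> \<epsilon> * real (card I)"
proof -
  define s where "s = 2 * n * (2 * n + 1)"
  define D where "D = (2 * n + 1) * (2 * n * (6 * n))"
  \<comment> \<open>The bad fraction \<open>s * D / N\<close> has to be at most \<epsilon>.\<close>
  obtain N0 :: nat where N0: "real s * real D / \<epsilon> \<le> real N0" using real_arch_simple by blast
  define N where "N = max 1 N0"
  have "real s * real D \<le> \<epsilon> * real N0" using N0 \<epsilon> by (simp add: field_simps)
  also have "\<dots> \<le> \<epsilon> * real N" using \<epsilon> by (intro mult_left_mono) (auto simp: N_def)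
  finally have N: "N \<ge> 1" "real s * real D \<le> \<epsilon> * real N" by (simp_all add: N_def)
  define I where "I = {..<s} \<rightarrow>\<^sub>E {..<N}"
  define P :: "(nat \<Rightarrow> nat) \<Rightarrow> nat \<Rightarrow> 'p padic" where "P = (\<lambda>t i. if i < s then of_nat (t i) else 0)"
  define p where "p = real CARD('p)"
  have p1: "p > 1" using prime_gt_1_real[where 'p='p] by (simp add: p_def)
  \<comment> \<open>A lower bound for the norm of the product of corner minors at good grid points;
    \<open>C\<close> turns it into an exponent of \<open>p\<close>.\<close>
  define \<eta> where "\<eta> = 1 / (real N ^ D) ^ s"
  have \<eta>: "\<eta> > 0" using N by (simp add: \<eta>_def)
  obtain m where m: "(1 / p) ^ m < \<eta>" using real_arch_pow_inv[OF \<eta>, of "1 / p"] p1 by auto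
  define C where "C = int m"
  have C: "p powi (- C) < \<eta>" using m p1 by (simp add: C_def power_int_minus power_one_over field_simps)
  have uK: "gen_mat n (P t) \<in> GSp_Zp n" for t
    by (rule gen_mat_GSp_Zp) (simp add: P_def padic_norm_0 padic_norm_of_nat_le_1)
  have "0 \<in> {..<N}" using N(1) by simp
  then have cI: "finite I" "I \<noteq> {}" "card I = N ^ s" by (auto simp: I_def card_PiE PiE_eq_empty_iff intro: finite_PiE)
  have "real (card {t \<in> I. \<exists>r\<le>2 * n. tail_sum r (SN_GSp n A) + C < weight r (gen_mat n (P t) * A)}) \<le> \<epsilon> * real (card I)"
    if A: "A \<in> GSp_Qp n" for A
  proof -
    define l where "l = SN_GSp n A"
    obtain U V where UV: "U \<in> GSp_Zp n" "V \<in> GSp_Zp n" and l: "length l = 2 * n" "sorted_wrt (\<ge>) l"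
      and eq: "A = U * diag_ppow (2 * n) (2 * n) l * V"
      unfolding l_def by (rule SN_GSp_decomposition[OF A n]) blast
    note Uc = GSp_Zp_carrier[OF UV(1)] and Vc = GSp_Zp_carrier[OF UV(2)]
    obtain U' where U': "U' \<in> GSp_Zp n" "U' * U = 1\<^sub>m (2 * n)" by (rule GSp_Zp_inverse[OF UV(1)])
    obtain V' where V': "V' \<in> GSp_Zp n" "V * V' = 1\<^sub>m (2 * n)" by (rule GSp_Zp_inverse[OF UV(2)])
    have "U' * A * V' = diag_ppow (2 * n) (2 * n) l"
      unfolding eq by (rule mult_cancel_both_sides[OF Uc Vc diag_ppow_carrier GSp_Zp_carrier[OF U'(1)] GSp_Zp_carrier[OF V'(1)] U'(2) V'(2)])
    then have DG: "(diag_ppow (2 * n) (2 * n) l :: 'p padic mat) \<in> GSp_Qp n"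
      using GSp_Qp_mult[OF GSp_Qp_mult[OF GSp_ZpD(1)[OF U'(1)] A] GSp_ZpD(1)[OF V'(1)]] by simp
    obtain y where y: "\<forall>i. padic_norm (y i) \<le> 1" "\<forall>i. s \<le> i \<longrightarrow> y i = 0"
      "padic_norm (corner_prod n (gen_mat n y * U)) = 1"
      unfolding s_def by (rule corner_prod_point[OF UV(1)])
    \<comment> \<open>The anticoncentration bound keeps the coordinates of \<open>y\<close> beyond
      \<open>s\<close>. As these are 0, the grid points do not depend on \<open>y\<close>, and
      therefore not on \<open>A\<close>.\<close>
    have Py: "(\<lambda>i. if i < s then of_nat (t i) else y i) = P t" for t
      using y(2) by (auto simp: P_def fun_eq_iff)
    have "N * card {t \<in> I. padic_norm (corner_prod n (gen_mat n (P t) * U)) * (real N ^ D) ^ s < 1} \<le> s * D * N ^ s"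
      using pdeg_anticoncentration[OF pdeg_corner_prod[OF Uc] _ _ N(1), where y=y and c=1 and s=s]
      unfolding Py I_def D_def y(3) using y(1) by (simp only: order_refl simp_thms)
    then have "real (N * card {t \<in> I. padic_norm (corner_prod n (gen_mat n (P t) * U)) * (real N ^ D) ^ s < 1}) \<le> real (s * D * N ^ s)"
      by (rule of_nat_mono)
    also have "\<dots> \<le> real N * (\<epsilon> * real (card I))"
      using mult_right_mono[OF N(2), of "real N ^ s"] by (simp add: cI(3) ac_simps)
    finally have bd: "real (card {t \<in> I. padic_norm (corner_prod n (gen_mat n (P t) * U)) * (real N ^ D) ^ s < 1}) \<le> \<epsilon> * real (card I)"
      using N(1) by simp
    have "weight r (gen_mat n (P t) * A) \<le> tail_sum r l + C"
      if r: "r \<le> 2 * n" and good: "\<not> padic_norm (corner_prod n (gen_mat n (P t) * U)) * (real N ^ D) ^ s < 1" for r t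
    proof -
      let ?G = "gen_mat n (P t) * U"
      have GK: "?G \<in> GSp_Zp n" by (rule GSp_Zp_mult[OF uK UV(1)])
      have "\<eta> \<le> padic_norm (corner_prod n ?G)" using good N(1) by (simp add: \<eta>_def field_simps)
      also have "\<dots> = (\<Prod>r\<in>{..2 * n}. padic_norm (Determinant.det (corner n r ?G)))"
        by (simp add: corner_prod_def padic_norm_prod)
      \<comment> \<open>All factors have norm at most 1, so each one is at least as large as the
        product.\<close>
      also have "\<dots> \<le> padic_norm (Determinant.det (corner n r ?G))"
        using r norm_det_corner_le[OF GK] padic_norm_nonneg by (intro prod_le_factor) auto
      finally have le: "p powi (- C) \<le> padic_norm (Determinant.det (corner n r ?G))" using C by simp
      have GA: "gen_mat n (P t) * A = ?G * diag_ppow (2 * n) (2 * n) l * V"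
        unfolding eq by (simp add: mult_mat_assoc_dim carrier_matD[OF Uc] carrier_matD[OF Vc] carrier_matD[OF gen_mat_carrier]
          carrier_matD[OF diag_ppow_carrier] del: assoc_mult_mat)
      have "p powi (- C + - tail_sum r l) = p powi (- C) * p powi (- tail_sum r l)"
        using p1 by (intro power_int_add) simp
      also have "\<dots> \<le> padic_norm (Determinant.det (corner n r ?G)) * p powi (- tail_sum r l)"
        using p1 by (intro mult_right_mono le) simp
      also have "\<dots> \<le> p powi (- weight r (gen_mat n (P t) * A))"
        unfolding GA p_def by (rule corner_norm_le_weight[OF GK UV(2) l(1) DG r])
      finally show ?thesis unfolding p_def powi_prime_le_iff by linarith
    qed
    then have "{t \<in> I. \<exists>r\<le>2 * n. tail_sum r l + C < weight r (gen_mat n (P t) * A)}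
        \<subseteq> {t \<in> I. padic_norm (corner_prod n (gen_mat n (P t) * U)) * (real N ^ D) ^ s < 1}"
      by (auto simp: not_less[symmetric])
    then have "card {t \<in> I. \<exists>r\<le>2 * n. tail_sum r l + C < weight r (gen_mat n (P t) * A)}
        \<le> card {t \<in> I. padic_norm (corner_prod n (gen_mat n (P t) * U)) * (real N ^ D) ^ s < 1}"
      using cI(1) by (intro card_mono) auto
    then show ?thesis using bd unfolding l_def by linarith
  qed
  then have "\<forall>A\<in>GSp_Qp n. real (card {t \<in> I. \<exists>r\<le>2 * n. tail_sum r (SN_GSp n A) + C < weight r (gen_mat n (P t) * A)}) \<le> \<epsilon> * real (card I)"
    by blast
  then show ?thesis by (rule that[OF cI(1,2) allI[OF uK]])
qed

section \<open>Measurability\<close>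

lemma space_borel_mat: "space (borel_mat r m) = carrier_mat r m"
  by (simp add: borel_mat_def)

lemma space_borel_GSp: "space (borel_GSp n) = GSp_Qp n"
  by (auto simp: borel_GSp_def space_restrict_space space_borel_mat dest: GSp_Qp_carrier)

lemma measurable_mat_entry:
  assumes ij: "i < r" "j < m"
  shows "(\<lambda>A. A $$ (i, j)) \<in> borel_measurable (borel_mat r m :: 'a::topological_space mat measure)"
proof -
  have "(\<lambda>A. \<lambda>ij\<in>{..<r} \<times> {..<m}. A $$ ij) \<in> (borel_mat r m :: 'a mat measure) \<rightarrow>\<^sub>M Pi\<^sub>M ({..<r} \<times> {..<m}) (\<lambda>_. borel)"
    unfolding borel_mat_def by (rule measurable_vimage_algebra1) (auto simp: space_PiM)
  from measurable_compose[OF this measurable_component_singleton[of "(i, j)"]] show ?thesis using ij by simp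
qed

lemma measurable_GSp_entry:
  assumes "i < 2 * n" "j < 2 * n"
  shows "(\<lambda>A. A $$ (i, j)) \<in> borel_measurable (borel_GSp n :: 'p::prime_card padic mat measure)"
  unfolding borel_GSp_def by (rule measurable_restrict_space1[OF measurable_mat_entry[OF assms]])

lemma measurable_GSpI:
  fixes f :: "'b \<Rightarrow> 'p::prime_card padic mat"
  assumes f: "\<And>w. w \<in> space N \<Longrightarrow> f w \<in> GSp_Qp n"
    and e: "\<And>i j. i < 2 * n \<Longrightarrow> j < 2 * n \<Longrightarrow> (\<lambda>w. f w $$ (i, j)) \<in> borel_measurable N"
  shows "f \<in> N \<rightarrow>\<^sub>M borel_GSp n"
  unfolding borel_GSp_def
proof (rule measurable_restrict_space2)
  show "f \<in> space N \<rightarrow> GSp_Qp n" using f by blast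
  show "f \<in> N \<rightarrow>\<^sub>M borel_mat (2 * n) (2 * n)"
    unfolding borel_mat_def
  proof (rule measurable_vimage_algebra2)
    show "f \<in> space N \<rightarrow> carrier_mat (2 * n) (2 * n)" using GSp_Qp_carrier[OF f] by blast
    show "(\<lambda>w. \<lambda>ij\<in>{..<2 * n} \<times> {..<2 * n}. f w $$ ij) \<in> N \<rightarrow>\<^sub>M Pi\<^sub>M ({..<2 * n} \<times> {..<2 * n}) (\<lambda>_. borel)"
      using e by (intro measurable_restrict) auto
  qed
qed

lemma measurable_GSp_mult:
  fixes f g :: "'b \<Rightarrow> 'p::prime_card padic mat"
  assumes f: "f \<in> N \<rightarrow>\<^sub>M borel_GSp n" and g: "g \<in> N \<rightarrow>\<^sub>M borel_GSp n"
  shows "(\<lambda>w. f w * g w) \<in> N \<rightarrow>\<^sub>M borel_GSp n"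
proof (rule measurable_GSpI)
  have fG: "f w \<in> GSp_Qp n" and gG: "g w \<in> GSp_Qp n" if "w \<in> space N" for w
    using measurable_space[OF f that] measurable_space[OF g that] by (simp_all add: space_borel_GSp)
  show "f w * g w \<in> GSp_Qp n" if "w \<in> space N" for w by (rule GSp_Qp_mult[OF fG[OF that] gG[OF that]])
  fix i j assume ij: "i < 2 * n" "j < 2 * n"
  have "(\<lambda>w. \<Sum>k<2 * n. f w $$ (i, k) * g w $$ (k, j)) \<in> borel_measurable N"
    by (intro borel_measurable_padic_sum borel_measurable_padic_mult measurable_compose[OF f measurable_GSp_entry]
        measurable_compose[OF g measurable_GSp_entry] ij) auto
  then show "(\<lambda>w. (f w * g w) $$ (i, j)) \<in> borel_measurable N"
    by (rule measurable_cong[THEN iffD2, rotated])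
      (rule mult_mat_entry[OF GSp_Qp_carrier[OF fG] GSp_Qp_carrier[OF gG] ij])
qed

lemma measurable_GSp_const: "U \<in> GSp_Qp n \<Longrightarrow> (\<lambda>_. U) \<in> N \<rightarrow>\<^sub>M borel_GSp n"
  by (intro measurable_const) (simp add: space_borel_GSp)

text \<open>The power determines the exponent, and the integers are countable, so it is enough to
  measure level sets.\<close>

lemma measurable_powi_exponent:
  assumes "(\<lambda>w. real CARD('p::prime_card) powi (- f w)) \<in> borel_measurable N"
  shows "f \<in> N \<rightarrow>\<^sub>M count_space UNIV"
proof -
  have "f -` {z} \<inter> space N \<in> sets N" for z
  proof -
    have "f -` {z} \<inter> space N = (\<lambda>w. real CARD('p) powi (- f w)) -` {real CARD('p) powi (- z)} \<inter> space N"
      by (auto dest: powi_prime_inj)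
    then show ?thesis using measurable_sets[OF assms, of "{real CARD('p) powi (- z)}"] by simp
  qed
  then show ?thesis by (simp add: measurable_count_space_eq2_countable)
qed

lemma measurable_max_minor:
  assumes "\<And>a k. a < r \<Longrightarrow> k < m \<Longrightarrow> (\<lambda>w. X w a k) \<in> borel_measurable N"
  shows "(\<lambda>w. max_minor r m (X w)) \<in> borel_measurable N"
  unfolding max_minor_def
proof (intro borel_measurable_Max borel_measurable_padic_norm)
  fix f assume f: "f \<in> {..<r} \<rightarrow>\<^sub>E {..<m}"
  have eq: "Determinant.det (mat r r (\<lambda>(a, b). X w a (f b)))
      = (\<Sum>\<pi>\<in>{\<pi>. \<pi> permutes {0..<r}}. signof \<pi> * (\<Prod>a\<in>{0..<r}. X w a (f (\<pi> a))))" for w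
    by (rule det_mat_leibniz)
  show "(\<lambda>w. Determinant.det (mat r r (\<lambda>(a, b). X w a (f b)))) \<in> borel_measurable N"
    unfolding eq
  proof (intro borel_measurable_padic_sum borel_measurable_padic_mult borel_measurable_const borel_measurable_padic_prod assms)
    fix \<pi> a assume "\<pi> \<in> {\<pi>. \<pi> permutes {0..<r}}" "a \<in> {0..<r}"
    then have "\<pi> a < r" "a < r" using permutes_in_image[of \<pi> "{0..<r}" a] by auto
    then show "a < r" "f (\<pi> a) < m" using PiE_mem[OF f, of "\<pi> a"] by auto
  qed
qed (auto intro: finite_PiE)

lemma measurable_weight:
  assumes r: "r \<le> 2 * n"
  shows "weight r \<in> (borel_GSp n :: 'p::prime_card padic mat measure) \<rightarrow>\<^sub>M count_space UNIV"
proof (rule measurable_powi_exponent)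
  have "(\<lambda>A :: 'p padic mat. max_minor r (2 * n) (\<lambda>a k. A $$ (2 * n - r + a, k))) \<in> borel_measurable (borel_GSp n)"
    using r by (intro measurable_max_minor measurable_GSp_entry) auto
  then show "(\<lambda>A :: 'p padic mat. real CARD('p) powi (- weight r A)) \<in> borel_measurable (borel_GSp n)"
    by (rule measurable_cong[THEN iffD2, rotated]) (simp only: space_borel_GSp weight_eq_max_minor[OF _ r])
qed

lemma measurable_tail_sum:
  assumes n: "n \<ge> 1" and r: "r \<le> 2 * n"
  shows "(\<lambda>A. tail_sum r (SN_GSp n A)) \<in> (borel_GSp n :: 'p::prime_card padic mat measure) \<rightarrow>\<^sub>M count_space UNIV"
proof (rule measurable_powi_exponent)
  have "(\<lambda>A :: 'p padic mat. all_minor n r A) \<in> borel_measurable (borel_GSp n)"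
    unfolding all_minor_def
    by (intro borel_measurable_Max measurable_max_minor measurable_GSp_entry) (auto intro: finite_PiE dest: PiE_mem)
  then show "(\<lambda>A :: 'p padic mat. real CARD('p) powi (- tail_sum r (SN_GSp n A))) \<in> borel_measurable (borel_GSp n)"
    by (rule measurable_cong[THEN iffD2, rotated]) (simp only: space_borel_GSp tail_sum_eq_all_minor[OF _ n r])
qed

section \<open>The increments of the weights\<close>

text \<open>Arbitrary real combinations of the weights, the one-dimensional variables to which the
  joint limit theorem is reduced.\<close>

definition wsum :: "nat \<Rightarrow> (nat \<Rightarrow> real) \<Rightarrow> 'p::prime_card padic mat \<Rightarrow> real" where
  "wsum n a N = (\<Sum>r\<le>2 * n. a r * real_of_int (weight r N))"

lemma measurable_wsum: "(wsum n a :: 'p::prime_card padic mat \<Rightarrow> real) \<in> borel_measurable (borel_GSp n)"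
  unfolding wsum_def
proof (intro borel_measurable_sum borel_measurable_times borel_measurable_const)
  fix r assume "r \<in> {..2 * n}"
  then show "(\<lambda>N. real_of_int (weight r N)) \<in> borel_measurable (borel_GSp n :: 'p padic mat measure)"
    by (intro measurable_compose[OF measurable_weight, where g = real_of_int]) auto
qed

text \<open>The compact factor of the Iwasawa decomposition of \<open>A\<close> works for all
  \<open>r\<close> at once and for every \<open>N\<close>, so the cocycle relation is linear in the
  coefficients.\<close>

lemma wsum_cocycle:
  assumes A: "A \<in> GSp_Qp n"
  obtains K where "K \<in> GSp_Zp n" "\<forall>N\<in>GSp_Qp n. wsum n a (A * N) - wsum n a A = wsum n a (K * N)"
proof -
  obtain K where K: "K \<in> GSp_Zp n"
    and *: "\<And>r N. r \<le> 2 * n \<Longrightarrow> N \<in> GSp_Qp n \<Longrightarrow> weight r (A * N) = weight r A + weight r (K * N)"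
    using weight_cocycle[OF A] by metis
  have "wsum n a (A * N) - wsum n a A = wsum n a (K * N)" if "N \<in> GSp_Qp n" for N
  proof -
    have "a r * real_of_int (weight r (A * N)) - a r * real_of_int (weight r A) = a r * real_of_int (weight r (K * N))"
      if "r \<in> {..2 * n}" for r
      using *[of r, OF _ \<open>N \<in> GSp_Qp n\<close>] that by (simp add: algebra_simps)
    then show ?thesis unfolding wsum_def sum_subtractf[symmetric] by (intro sum.cong) auto
  qed
  with K that show ?thesis by blast
qed

text \<open>The identity serves as triangular part. Hence every translated walk of weights starts at
  0.\<close>

lemma weight_GSp_Zp:
  assumes K: "K \<in> GSp_Zp n" and r: "r \<le> 2 * n" shows "weight r K = 0"
proof -
  have one: "(1\<^sub>m (2 * n) :: 'a padic mat) \<in> GSp_Qp n" by (rule GSp_ZpD(1)[OF GSp_Zp_one])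
  have tri: "upper_tri n (1\<^sub>m (2 * n) :: 'a padic mat)" by (simp add: upper_tri_def)
  have "real CARD('a) powi (- weight r K) = real CARD('a) powi (- 0)"
    using weight_triangular_mult(1)[OF one tri K r] det_corner_triangular[OF tri r] r GSp_Zp_carrier[OF K]
    by (simp add: padic_norm_1)
  then show ?thesis using powi_prime_inj by fastforce
qed

lemma mat_prod_cong: "(\<And>j. 1 \<le> j \<Longrightarrow> j \<le> k \<Longrightarrow> A j = B j) \<Longrightarrow> mat_prod d A k = mat_prod d B k"
  by (induction k) auto

lemma mat_prod_GSp_Qp: "(\<And>j. 1 \<le> j \<Longrightarrow> j \<le> k \<Longrightarrow> A j \<in> GSp_Qp n) \<Longrightarrow> mat_prod (2 * n) A k \<in> GSp_Qp n"
  by (induction k) (auto intro!: GSp_Qp_mult GSp_ZpD(1)[OF GSp_Zp_one])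

lemma measurable_mat_prod:
  assumes "\<And>j. 1 \<le> j \<Longrightarrow> j \<le> k \<Longrightarrow> F j \<in> N \<rightarrow>\<^sub>M borel_GSp n"
  shows "(\<lambda>w. mat_prod (2 * n) (\<lambda>j. F j w) k) \<in> N \<rightarrow>\<^sub>M borel_GSp n"
  using assms
proof (induction k)
  case 0
  then show ?case using measurable_GSp_const[OF GSp_ZpD(1)[OF GSp_Zp_one]] by simp
next
  case (Suc k)
  then show ?case by (simp del: One_nat_def) (intro measurable_GSp_mult; simp)
qed

lemma (in prob_space) iid_varsI:
  fixes Y :: "nat \<Rightarrow> 'a \<Rightarrow> real"
  assumes Y [measurable]: "\<And>j. Y j \<in> borel_measurable M" and Z [measurable]: "Z \<in> borel_measurable M"
    and p: "\<And>m B. (\<And>j. B j \<in> sets borel) \<Longrightarrow>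
      prob {w \<in> space M. \<forall>j<m. Y j w \<in> B j} = (\<Prod>j<m. prob {w \<in> space M. Z w \<in> B j})"
  shows "indep_vars (\<lambda>_. borel) Y UNIV" "distr M borel (Y j) = distr M borel Z"
proof -
  have one: "prob {w \<in> space M. Y j w \<in> B} = prob {w \<in> space M. Z w \<in> B}" if B: "B \<in> sets borel" for j B
  proof -
    have "{w \<in> space M. \<forall>i<Suc j. Y i w \<in> (if i = j then B else UNIV)} = {w \<in> space M. Y j w \<in> B}" by auto
    then have "prob {w \<in> space M. Y j w \<in> B} = (\<Prod>i<Suc j. prob {w \<in> space M. Z w \<in> (if i = j then B else UNIV)})"
      using p[of "\<lambda>i. if i = j then B else UNIV" "Suc j"] B by simp
    also have "\<dots> = prob {w \<in> space M. Z w \<in> B}" by (simp add: prob_space)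
    finally show ?thesis .
  qed
  show "distr M borel (Y j) = distr M borel Z"
  proof (rule measure_eqI)
    fix B assume "B \<in> sets (distr M borel (Y j))"
    then have B: "B \<in> sets borel" by simp
    have e: "f -` B \<inter> space M = {w \<in> space M. f w \<in> B}" for f :: "'a \<Rightarrow> real" by auto
    show "emeasure (distr M borel (Y j)) B = emeasure (distr M borel Z) B"
      using one[OF B, of j] by (simp add: emeasure_distr B e emeasure_eq_measure)
  qed simp
  show "indep_vars (\<lambda>_. borel) Y UNIV"
    unfolding indep_vars_def2
  proof (intro conjI ballI Y indep_setsI)
    fix A J assume J: "J \<noteq> {}" "finite (J :: nat set)" and A: "\<forall>j\<in>J. A j \<in> {Y j -` B \<inter> space M |B. B \<in> sets borel}"
    then have "\<forall>j\<in>J. \<exists>B. B \<in> sets borel \<and> A j = Y j -` B \<inter> space M" by blast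
    then obtain B where B: "\<And>j. j \<in> J \<Longrightarrow> B j \<in> sets borel" "\<And>j. j \<in> J \<Longrightarrow> A j = Y j -` B j \<inter> space M" by metis
    define B' where "B' = (\<lambda>j. if j \<in> J then B j else UNIV)"
    have B': "B' j \<in> sets borel" for j using B(1) by (simp add: B'_def)
    obtain m where m: "J \<subseteq> {..<m}" using finite_nat_iff_bounded J(2) by blast
    have "(\<Inter>j\<in>J. A j) = {w \<in> space M. \<forall>j<m. Y j w \<in> B' j}"
      using J(1) m B(2) by (auto simp: B'_def)
    then have "prob (\<Inter>j\<in>J. A j) = (\<Prod>j<m. prob {w \<in> space M. Z w \<in> B' j})" using p[OF B'] by simp
    also have "\<dots> = (\<Prod>j\<in>J. prob {w \<in> space M. Z w \<in> B' j})"
      using m by (intro prod.mono_neutral_right) (auto simp: B'_def prob_space)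
    also have "\<dots> = (\<Prod>j\<in>J. prob (A j))"
    proof (intro prod.cong refl)
      fix j assume j: "j \<in> J"
      have "A j = {w \<in> space M. Y j w \<in> B' j}" using B(2)[OF j] j by (auto simp: B'_def)
      then show "prob {w \<in> space M. Z w \<in> B' j} = prob (A j)" using one[OF B'[of j], of j] by simp
    qed
    finally show "prob (\<Inter>j\<in>J. A j) = (\<Prod>j\<in>J. prob (A j))" .
  qed (auto intro: measurable_sets)
qed

section \<open>The random walk and the independence of its increments\<close>

locale gsp_walk = prob_space M for M :: "'w measure" +
  fixes A :: "nat \<Rightarrow> 'w \<Rightarrow> 'p::prime_card padic mat" and n :: nat
  assumes n: "n \<ge> 1"
    and indep: "indep_vars (\<lambda>_. borel_GSp n) A {1..}"
    and ident: "\<And>k. k \<ge> 1 \<Longrightarrow> distr M (borel_GSp n) (A k) = distr M (borel_GSp n) (A 1)"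
    and left_inv: "\<And>U. U \<in> GSp_Zp n \<Longrightarrow>
          distr M (borel_GSp n) (\<lambda>w. U * A 1 w) = distr M (borel_GSp n) (A 1)"
begin

abbreviation walk :: "nat \<Rightarrow> 'w \<Rightarrow> 'p padic mat" where
  "walk k w \<equiv> mat_prod (2 * n) (\<lambda>j. A j w) k"

definition incr :: "(nat \<Rightarrow> real) \<Rightarrow> 'p padic mat \<Rightarrow> nat \<Rightarrow> 'w \<Rightarrow> real" where
  "incr a u j w = wsum n a (u * walk (Suc j) w) - wsum n a (u * walk j w)"

lemma A_measurable: "j \<ge> 1 \<Longrightarrow> A j \<in> M \<rightarrow>\<^sub>M borel_GSp n"
  using indep by (simp add: indep_vars_def2)

lemma A_GSp: "w \<in> space M \<Longrightarrow> j \<ge> 1 \<Longrightarrow> A j w \<in> GSp_Qp n"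
  using measurable_space[OF A_measurable] by (simp add: space_borel_GSp)

lemma walk_measurable: "walk k \<in> M \<rightarrow>\<^sub>M borel_GSp n"
  by (intro measurable_mat_prod A_measurable)

lemma walk_GSp: "w \<in> space M \<Longrightarrow> walk k w \<in> GSp_Qp n"
  by (intro mat_prod_GSp_Qp A_GSp)

lemma incr_measurable: "u \<in> GSp_Zp n \<Longrightarrow> incr a u j \<in> borel_measurable M"
  unfolding incr_def
  by (intro borel_measurable_diff measurable_compose[OF _ measurable_wsum] measurable_GSp_mult measurable_GSp_const walk_measurable GSp_ZpD(1))

lemma sum_incr: "u \<in> GSp_Zp n \<Longrightarrow> (\<Sum>j<k. incr a u j w) = wsum n a (u * walk k w)"
proof -
  assume u: "u \<in> GSp_Zp n"
  have "(\<Sum>j<k. incr a u j w) = wsum n a (u * walk k w) - wsum n a (u * walk 0 w)"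
    unfolding incr_def by (rule sum_lessThan_telescope)
  moreover have "wsum n a (u * walk 0 w) = 0"
    using right_mult_one_mat[OF GSp_Zp_carrier[OF u]] weight_GSp_Zp[OF u] by (simp add: wsum_def)
  ultimately show ?thesis by simp
qed

text \<open>For deterministic \<open>K\<close>: identical distribution replaces \<open>A k\<close>
  by \<open>A 1\<close>, and left invariance removes \<open>K\<close>.\<close>

lemma prob_wsum_left:
  assumes K: "K \<in> GSp_Zp n" and B: "B \<in> sets borel" and k: "k \<ge> 1"
  shows "emeasure M {w \<in> space M. wsum n a (K * A k w) \<in> B}
    = emeasure M {w \<in> space M. wsum n a (A 1 w) \<in> B}"
proof -
  note A1 = A_measurable[OF order_refl]
  have KA: "(\<lambda>w. K * A 1 w) \<in> M \<rightarrow>\<^sub>M borel_GSp n"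
    by (intro measurable_GSp_mult measurable_GSp_const GSp_ZpD(1) K A1)
  have Kid: "(\<lambda>x. wsum n a (K * x)) \<in> borel_measurable (borel_GSp n)"
    by (intro measurable_compose[OF _ measurable_wsum] measurable_GSp_mult measurable_GSp_const GSp_ZpD(1) K measurable_ident_sets[OF refl])
  have s1: "{x \<in> space (borel_GSp n). wsum n a (K * x) \<in> B} \<in> sets (borel_GSp n)"
    using measurable_sets[OF Kid B] by (simp add: vimage_def Int_def conj_commute)
  have s2: "{x \<in> space (borel_GSp n). wsum n a x \<in> B} \<in> sets (borel_GSp n)"
    using measurable_sets[OF measurable_wsum B] by (simp add: vimage_def Int_def conj_commute)
  note Ak = A_measurable[OF k]
  have "emeasure M {w \<in> space M. wsum n a (K * A k w) \<in> B}
      = emeasure (distr M (borel_GSp n) (A k)) {x \<in> space (borel_GSp n). wsum n a (K * x) \<in> B}"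
    unfolding emeasure_distr[OF Ak s1] using measurable_space[OF Ak] by (intro arg_cong[of _ _ "emeasure M"]) auto
  also have "\<dots> = emeasure (distr M (borel_GSp n) (A 1)) {x \<in> space (borel_GSp n). wsum n a (K * x) \<in> B}"
    unfolding ident[OF k] ..
  also have "\<dots> = emeasure M {w \<in> space M. wsum n a (K * A 1 w) \<in> B}"
    unfolding emeasure_distr[OF A1 s1] using measurable_space[OF A1] by (intro arg_cong[of _ _ "emeasure M"]) auto
  also have "\<dots> = emeasure (distr M (borel_GSp n) (\<lambda>w. K * A 1 w)) {x \<in> space (borel_GSp n). wsum n a x \<in> B}"
    unfolding emeasure_distr[OF KA s2] using measurable_space[OF KA] by (intro arg_cong[of _ _ "emeasure M"]) auto
  also have "\<dots> = emeasure M {w \<in> space M. wsum n a (A 1 w) \<in> B}"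
    unfolding left_inv[OF K] emeasure_distr[OF A1 s2] using measurable_space[OF A1] by (intro arg_cong[of _ _ "emeasure M"]) auto
  finally show ?thesis .
qed

text \<open>Induction on \<open>m\<close> with Fubini over the first \<open>m\<close> factors. For
  fixed values of these, the next increment is \<open>wsum n a (K * A (Suc m) w)\<close> with a
  fixed \<open>K\<close>, so its conditional law is the law of \<open>wsum n a (A 1 w)\<close>
  whatever the past.\<close>

lemma prob_incr:
  assumes u: "u \<in> GSp_Zp n" and B: "\<And>j. B j \<in> sets borel"
  shows "prob {w \<in> space M. \<forall>j<m. incr a u j w \<in> B j} = (\<Prod>j<m. prob {w \<in> space M. wsum n a (A 1 w) \<in> B j})"
proof (induction m)
  case 0
  then show ?case by (simp add: prob_space)
next
  case (Suc m)
  define N where "N = Pi\<^sub>M {1..m} (\<lambda>_. borel_GSp n :: 'p padic mat measure)"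
  define T where "T = (\<lambda>w. \<lambda>j\<in>{1..m}. A j w)"
  define S where "S = (\<lambda>k t. u * mat_prod (2 * n) t k)"
  define c where "c = emeasure M {w \<in> space M. wsum n a (A 1 w) \<in> B m}"
  let ?G = "borel_GSp n :: 'p padic mat measure"
  have ST: "S k (T w) = u * walk k w" if "k \<le> m" for k w
    unfolding S_def T_def using that by (intro arg_cong[of _ _ "(*) u"] mat_prod_cong) auto
  have Sm: "S k \<in> N \<rightarrow>\<^sub>M ?G" if "k \<le> m" for k
    unfolding S_def N_def using that u
    by (intro measurable_GSp_mult measurable_GSp_const GSp_ZpD(1) measurable_mat_prod measurable_component_singleton) auto
  have Wm: "(\<lambda>t. wsum n a (S k t)) \<in> borel_measurable N" if "k \<le> m" for k
    by (rule measurable_compose[OF Sm[OF that] measurable_wsum])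
  define H where "H = (\<lambda>t. \<forall>j\<in>{..<m}. wsum n a (S (Suc j) t) - wsum n a (S j t) \<in> B j)"
  have Hm: "{t \<in> space N. H t} \<in> sets N"
    unfolding H_def
  proof (rule sets.sets_Collect_finite_All)
    fix j assume "j \<in> {..<m}"
    then have "(\<lambda>t. wsum n a (S (Suc j) t) - wsum n a (S j t)) \<in> borel_measurable N"
      by (intro borel_measurable_diff Wm) auto
    from measurable_sets[OF this B[of j]]
    show "{t \<in> space N. wsum n a (S (Suc j) t) - wsum n a (S j t) \<in> B j} \<in> sets N"
      by (simp add: vimage_def Int_def conj_commute)
  qed simp
  \<comment> \<open>A product over a single index: independence of the past and the next factor is
    obtained for disjoint blocks of indices.\<close>
  define P where "P = Pi\<^sub>M {Suc m} (\<lambda>_. ?G)"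
  define R where "R = (\<lambda>w. \<lambda>j\<in>{Suc m}. A j w)"
  have "indep_var N T P R"
    unfolding N_def T_def P_def R_def by (rule indep_var_restrict[OF indep]) auto
  then have T: "T \<in> M \<rightarrow>\<^sub>M N" and R: "R \<in> M \<rightarrow>\<^sub>M P"
    and pr: "distr M N T \<Otimes>\<^sub>M distr M P R = distr M (N \<Otimes>\<^sub>M P) (\<lambda>w. (T w, R w))"
    by (auto simp: indep_var_distribution_eq)
  have RA: "R w (Suc m) = A (Suc m) w" for w by (simp add: R_def)
  have comp: "(\<lambda>s. s (Suc m)) \<in> P \<rightarrow>\<^sub>M ?G" unfolding P_def by (rule measurable_component_singleton) simp
  define \<mu> where "\<mu> = distr M P R"
  interpret \<mu>: prob_space \<mu> unfolding \<mu>_def by (rule prob_space_distr[OF R])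
  define Q where "Q = {x \<in> space (N \<Otimes>\<^sub>M P). H (fst x) \<and> wsum n a (S m (fst x) * snd x (Suc m)) - wsum n a (S m (fst x)) \<in> B m}"
  have fm: "(\<lambda>x. wsum n a (S m (fst x) * snd x (Suc m)) - wsum n a (S m (fst x))) \<in> borel_measurable (N \<Otimes>\<^sub>M P)"
    by (intro borel_measurable_diff measurable_compose[OF _ measurable_wsum] measurable_GSp_mult
        measurable_compose[OF measurable_fst Sm] measurable_compose[OF measurable_snd comp]) auto
  have "Q = {t \<in> space N. H t} \<times> space P \<inter> ((\<lambda>x. wsum n a (S m (fst x) * snd x (Suc m)) - wsum n a (S m (fst x))) -` B m \<inter> space (N \<Otimes>\<^sub>M P))"
    by (auto simp: Q_def space_pair_measure)
  then have Q: "Q \<in> sets (N \<Otimes>\<^sub>M P)" using Hm measurable_sets[OF fm B[of m]] by auto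
  have "emeasure M {w \<in> space M. \<forall>j<Suc m. incr a u j w \<in> B j} = emeasure (distr M (N \<Otimes>\<^sub>M P) (\<lambda>w. (T w, R w))) Q"
  proof -
    have TR: "(\<lambda>w. (T w, R w)) \<in> M \<rightarrow>\<^sub>M N \<Otimes>\<^sub>M P" by (intro measurable_Pair T R)
    have "(\<forall>j<Suc m. incr a u j w \<in> B j) \<longleftrightarrow> (T w, R w) \<in> Q" if w: "w \<in> space M" for w
    proof -
      have "u * (walk m w * A (Suc m) w) = (u * walk m w) * A (Suc m) w"
        by (rule assoc_mult_mat[symmetric, OF GSp_Zp_carrier[OF u] GSp_Qp_carrier[OF walk_GSp[OF w]] GSp_Qp_carrier[OF A_GSp[OF w]]]) simp
      moreover have "H (T w) \<longleftrightarrow> (\<forall>j<m. incr a u j w \<in> B j)" by (simp add: H_def ST incr_def Ball_def del: mat_prod.simps)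
      ultimately show ?thesis using measurable_space[OF TR w] by (auto simp: Q_def ST RA incr_def less_Suc_eq)
    qed
    then have "{w \<in> space M. \<forall>j<Suc m. incr a u j w \<in> B j} = (\<lambda>w. (T w, R w)) -` Q \<inter> space M" by auto
    then show ?thesis by (simp add: emeasure_distr[OF TR Q])
  qed
  also have "\<dots> = emeasure (distr M N T \<Otimes>\<^sub>M \<mu>) Q" unfolding pr[symmetric] \<mu>_def ..
  also have "\<dots> = (\<integral>\<^sup>+ t. emeasure \<mu> (Pair t -` Q) \<partial>distr M N T)"
    by (rule \<mu>.emeasure_pair_measure_alt) (use Q in \<open>simp add: \<mu>_def cong: sets_pair_measure_cong\<close>)
  also have "\<dots> = (\<integral>\<^sup>+ t. c * indicator {t \<in> space N. H t} t \<partial>distr M N T)"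
  proof (intro nn_integral_cong)
    fix t assume "t \<in> space (distr M N T)"
    then have t: "t \<in> space N" by simp
    then have St: "S m t \<in> GSp_Qp n" using measurable_space[OF Sm[OF order_refl]] by (simp add: space_borel_GSp)
    \<comment> \<open>\<open>K\<close> is picked separately for each \<open>t\<close>; since the
      inner probability is the constant \<open>c\<close>, the way it varies with \<open>t\<close>
      does not matter.\<close>
    obtain K where K: "K \<in> GSp_Zp n" "\<forall>N\<in>GSp_Qp n. wsum n a (S m t * N) - wsum n a (S m t) = wsum n a (K * N)"
      by (rule wsum_cocycle[OF St])
    define E where "E = {s \<in> space P. wsum n a (K * s (Suc m)) \<in> B m}"
    have Pe: "Pair t -` Q = (if H t then E else {})"
      using t K(2) measurable_space[OF comp] by (auto simp: Q_def E_def space_pair_measure space_borel_GSp)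
    have "(\<lambda>s. wsum n a (K * s (Suc m))) \<in> borel_measurable P"
      by (intro measurable_compose[OF _ measurable_wsum] measurable_GSp_mult measurable_GSp_const GSp_ZpD(1) K(1) comp)
    from measurable_sets[OF this B[of m]] have "E \<in> sets P" by (simp add: E_def vimage_def Int_def conj_commute)
    then have "emeasure \<mu> E = emeasure M {w \<in> space M. wsum n a (K * A (Suc m) w) \<in> B m}"
      unfolding \<mu>_def using measurable_space[OF R]
      by (subst emeasure_distr[OF R]) (auto simp: E_def RA intro!: arg_cong[of _ _ "emeasure M"])
    also have "\<dots> = c" unfolding c_def by (rule prob_wsum_left[OF K(1) B]) simp
    finally show "emeasure \<mu> (Pair t -` Q) = c * indicator {t \<in> space N. H t} t"
      using t by (simp add: Pe)
  qed
  also have "\<dots> = c * emeasure (distr M N T) {t \<in> space N. H t}"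
    using Hm by (intro nn_integral_cmult_indicator) simp
  also have "emeasure (distr M N T) {t \<in> space N. H t} = emeasure M {w \<in> space M. \<forall>j<m. incr a u j w \<in> B j}"
    unfolding emeasure_distr[OF T Hm] using measurable_space[OF T]
    by (intro arg_cong[of _ _ "emeasure M"]) (auto simp: H_def ST incr_def Ball_def simp del: mat_prod.simps)
  finally have "prob {w \<in> space M. \<forall>j<Suc m. incr a u j w \<in> B j}
      = prob {w \<in> space M. wsum n a (A 1 w) \<in> B m} * prob {w \<in> space M. \<forall>j<m. incr a u j w \<in> B j}"
    by (simp add: c_def emeasure_eq_measure flip: ennreal_mult' del: less_Suc_eq)
  then show ?case by (simp add: Suc)
qed

lemma incr_iid:
  assumes u: "u \<in> GSp_Zp n"
  shows "indep_vars (\<lambda>_. borel) (incr a u) UNIV"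
    "distr M borel (incr a u j) = distr M borel (\<lambda>w. wsum n a (A 1 w))"
proof -
  note * = incr_measurable[OF u] measurable_compose[OF A_measurable[OF order_refl] measurable_wsum] prob_incr[OF u]
  show "indep_vars (\<lambda>_. borel) (incr a u) UNIV" "distr M borel (incr a u j) = distr M borel (\<lambda>w. wsum n a (A 1 w))"
    by (rule iid_varsI[OF *]; assumption)+
qed

end

section \<open>The two limit theorems for the walk\<close>

lemma norm_iexp_diff: "norm (iexp x - iexp y) \<le> \<bar>x - y\<bar>"
proof -
  have "iexp x - iexp y = iexp y * (iexp (x - y) - 1)"
    by (simp add: algebra_simps flip: exp_add)
  then have "norm (iexp x - iexp y) = norm (iexp (x - y) - 1)" by (simp add: norm_mult)
  also have "\<dots> \<le> \<bar>x - y\<bar>" using iexp_approx1[of "x - y" 0] by simp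
  finally show ?thesis .
qed

text \<open>Off \<open>B\<close> the integrands differ by at most \<open>d\<close>, since
  \<open>iexp\<close> is 1-Lipschitz, and on \<open>B\<close> by at most 2.\<close>

lemma (in prob_space) norm_expectation_iexp_diff:
  assumes [measurable]: "f \<in> borel_measurable M" "g \<in> borel_measurable M" "B \<in> events"
    and d: "d \<ge> 0" "\<And>w. w \<in> space M \<Longrightarrow> w \<notin> B \<Longrightarrow> \<bar>f w - g w\<bar> \<le> d"
  shows "norm (expectation (\<lambda>w. iexp (f w)) - expectation (\<lambda>w. iexp (g w))) \<le> d + 2 * prob B"
proof -
  have i: "integrable M (\<lambda>w. iexp (f w))" "integrable M (\<lambda>w. iexp (g w))"
    by (auto intro!: integrable_const_bound[of _ 1])
  have "norm (expectation (\<lambda>w. iexp (f w)) - expectation (\<lambda>w. iexp (g w))) = norm (expectation (\<lambda>w. iexp (f w) - iexp (g w)))"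
    using i by simp
  also have "\<dots> \<le> expectation (\<lambda>w. norm (iexp (f w) - iexp (g w)))" by (rule integral_norm_bound)
  also have "\<dots> \<le> expectation (\<lambda>w. d + 2 * indicator B w)"
  proof (rule integral_mono)
    show "integrable M (\<lambda>w. norm (iexp (f w) - iexp (g w)))"
      using i by (intro integrable_norm Bochner_Integration.integrable_diff)
    show "integrable M (\<lambda>w. d + 2 * indicator B w :: real)" by (simp add: emeasure_eq_measure)
    fix w assume w: "w \<in> space M"
    have "norm (iexp (f w) - iexp (g w)) \<le> norm (iexp (f w)) + norm (iexp (g w))" by (rule norm_triangle_ineq4)
    then have "norm (iexp (f w) - iexp (g w)) \<le> 2" by simp
    then show "norm (iexp (f w) - iexp (g w)) \<le> d + 2 * indicator B w"
      using d(2)[OF w] norm_iexp_diff[of "f w" "g w"] d(1) by (cases "w \<in> B") auto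
  qed
  also have "\<dots> = d + 2 * prob B"
    by (subst Bochner_Integration.integral_add) (auto simp: prob_space emeasure_eq_measure)
  finally show ?thesis .
qed

lemma (in prob_space) same_distr_expectation:
  fixes h :: "real \<Rightarrow> real"
  assumes f: "f \<in> borel_measurable M" and g: "g \<in> borel_measurable M" and eq: "distr M borel f = distr M borel g"
    and h: "h \<in> borel_measurable borel"
  shows "integrable M (\<lambda>w. h (f w)) \<longleftrightarrow> integrable M (\<lambda>w. h (g w))"
    "expectation (\<lambda>w. h (f w)) = expectation (\<lambda>w. h (g w))"
  using integrable_distr_eq[OF f h] integrable_distr_eq[OF g h] integral_distr[OF f h] integral_distr[OF g h] eq by simp_all

text \<open>The mixed term has mean 0 by independence and centring, so variances add.\<close>

lemma (in prob_space) iid_second_moment: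
  fixes Y :: "nat \<Rightarrow> 'a \<Rightarrow> real"
  assumes indep: "indep_vars (\<lambda>_. borel) Y UNIV" and id: "\<And>j. distr M borel (Y j) = distr M borel (Y 0)"
    and mean: "expectation (Y 0) = 0" and sq: "integrable M (\<lambda>w. (Y 0 w)\<^sup>2)"
  shows "integrable M (\<lambda>w. (\<Sum>j<k. Y j w)\<^sup>2) \<and> expectation (\<lambda>w. (\<Sum>j<k. Y j w)\<^sup>2) = real k * expectation (\<lambda>w. (Y 0 w)\<^sup>2)"
proof (induction k)
  case (Suc k)
  have Ym: "Y j \<in> borel_measurable M" for j using indep by (simp add: indep_vars_def2)
  have h: "(\<lambda>x :: real. x\<^sup>2) \<in> borel_measurable borel" "(\<lambda>x :: real. x) \<in> borel_measurable borel" by simp_all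
  have sqj: "integrable M (\<lambda>w. (Y j w)\<^sup>2)" "expectation (\<lambda>w. (Y j w)\<^sup>2) = expectation (\<lambda>w. (Y 0 w)\<^sup>2)" for j
    using same_distr_expectation[OF Ym Ym id h(1)] sq by simp_all
  have mj: "expectation (Y j) = 0" for j using same_distr_expectation(2)[OF Ym Ym id h(2)] mean by simp
  have ij: "integrable M (Y j)" for j by (rule square_integrable_imp_integrable[OF Ym sqj(1)])
  let ?S = "\<lambda>w. \<Sum>j<k. Y j w"
  have S: "integrable M ?S" using ij by (intro Bochner_Integration.integrable_sum)
  have iv: "indep_var borel (Y k) borel ?S"
    by (rule indep_vars_sum[OF _ _ indep_vars_subset[OF indep]]) auto
  note p = indep_var_integrable[OF iv ij S] indep_var_lebesgue_integral[OF iv ij S]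
  have e: "(\<Sum>j<Suc k. Y j w)\<^sup>2 = (?S w)\<^sup>2 + 2 * (Y k w * ?S w) + (Y k w)\<^sup>2" for w
    by (simp add: power2_sum)
  show ?case unfolding e using Suc p sqj mj by (simp add: algebra_simps)
qed simp

text \<open>Chebyshev's inequality; the bound does not depend on \<open>k\<close> and therefore
  yields tightness.\<close>

lemma (in prob_space) iid_normalised_tail:
  fixes Y :: "nat \<Rightarrow> 'a \<Rightarrow> real"
  assumes indep: "indep_vars (\<lambda>_. borel) Y UNIV" and id: "\<And>j. distr M borel (Y j) = distr M borel (Y 0)"
    and mean: "expectation (Y 0) = 0" and sq: "integrable M (\<lambda>w. (Y 0 w)\<^sup>2)" and y: "y > 0" and k: "k \<ge> 1"
  shows "prob {w \<in> space M. y < \<bar>(\<Sum>j<k. Y j w) / sqrt (real k)\<bar>} \<le> expectation (\<lambda>w. (Y 0 w)\<^sup>2) / y\<^sup>2"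
proof -
  have [measurable]: "Y j \<in> borel_measurable M" for j using indep by (simp add: indep_vars_def2)
  let ?S = "\<lambda>w. \<Sum>j<k. Y j w"
  note m = iid_second_moment[OF indep id mean sq, of k]
  have k0: "real k > 0" using k by simp
  have sub: "y\<^sup>2 * real k \<le> (?S w)\<^sup>2" if "y < \<bar>?S w / sqrt (real k)\<bar>" for w
  proof -
    have "y\<^sup>2 \<le> \<bar>?S w / sqrt (real k)\<bar>\<^sup>2" using that y by (intro power_mono) auto
    then show ?thesis using k0 by (simp add: power_divide field_simps)
  qed
  have "prob {w \<in> space M. y < \<bar>?S w / sqrt (real k)\<bar>} \<le> prob {w \<in> space M. y\<^sup>2 * real k \<le> (?S w)\<^sup>2}"
    using sub by (intro finite_measure_mono) auto
  also have "\<dots> \<le> expectation (\<lambda>w. (?S w)\<^sup>2) / (y\<^sup>2 * real k)"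
    using m y k0 by (intro integral_Markov_inequality_measure[where A = "{}"]) auto
  also have "\<dots> = expectation (\<lambda>w. (Y 0 w)\<^sup>2) / y\<^sup>2" using m k0 by simp
  finally show ?thesis .
qed

definition tsum :: "nat \<Rightarrow> (nat \<Rightarrow> real) \<Rightarrow> 'p::prime_card padic mat \<Rightarrow> real" where
  "tsum n a N = (\<Sum>r\<le>2 * n. a r * real_of_int (tail_sum r (SN_GSp n N)))"

lemma measurable_tsum: "n \<ge> 1 \<Longrightarrow> (tsum n a :: 'p::prime_card padic mat \<Rightarrow> real) \<in> borel_measurable (borel_GSp n)"
  unfolding tsum_def
proof (intro borel_measurable_sum borel_measurable_times borel_measurable_const)
  fix r assume "n \<ge> 1" "r \<in> {..2 * n}"
  then show "(\<lambda>N. real_of_int (tail_sum r (SN_GSp n N))) \<in> borel_measurable (borel_GSp n :: 'p padic mat measure)"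
    by (intro measurable_compose[OF measurable_tail_sum, where g = real_of_int]) auto
qed

lemma wsum_unit: "r \<le> 2 * n \<Longrightarrow> wsum n (\<lambda>s. if s = r then 1 else 0) N = real_of_int (weight r N)"
proof -
  assume r: "r \<le> 2 * n"
  have "wsum n (\<lambda>s. if s = r then 1 else 0) N = (\<Sum>s\<le>2 * n. if s = r then real_of_int (weight r N) else 0)"
    unfolding wsum_def by (intro sum.cong) auto
  then show ?thesis using r by simp
qed

context gsp_walk
begin

text \<open>Singular numbers are unchanged by the left factor \<open>u\<close>, so the inequality
  between tail sums and weights holds for every translate.\<close>

lemma tail_sum_le_translate:
  assumes u: "u \<in> GSp_Zp n" and r: "r \<le> 2 * n" and N: "N \<in> GSp_Qp n"
  shows "tail_sum r (SN_GSp n N) \<le> weight r (u * N)"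
  using tail_sum_le_weight[OF GSp_Qp_mult[OF GSp_ZpD(1)[OF u] N] n r] tail_sum_left_mult[OF N n u] by simp

lemma translate_measurable: "u \<in> GSp_Zp n \<Longrightarrow> (\<lambda>w. u * walk k w) \<in> M \<rightarrow>\<^sub>M borel_GSp n"
  by (intro measurable_GSp_mult measurable_GSp_const walk_measurable GSp_ZpD(1))

lemma wsum_A_measurable: "(\<lambda>w. wsum n a (A 1 w)) \<in> borel_measurable M"
  by (rule measurable_compose[OF A_measurable[OF order_refl] measurable_wsum])

lemma weight_lln:
  assumes u: "u \<in> GSp_Zp n" and r: "r \<le> 2 * n" and int: "integrable M (\<lambda>w. real_of_int (weight r (A 1 w)))"
  shows "AE w in M. (\<lambda>k. real_of_int (weight r (u * walk k w)) / real k) \<longlonglongrightarrow> expectation (\<lambda>w. real_of_int (weight r (A 1 w)))"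
proof -
  define a where "a = (\<lambda>s. if s = r then 1 else (0 :: real))"
  have wa: "wsum n a N = real_of_int (weight r N)" for N :: "'p padic mat" unfolding a_def by (rule wsum_unit[OF r])
  have id: "(\<lambda>x :: real. x) \<in> borel_measurable borel" by simp
  note eq = same_distr_expectation[OF incr_measurable[OF u] wsum_A_measurable incr_iid(2)[OF u, of a 0] id]
  have "distr M borel (incr a u j) = distr M borel (incr a u 0)" for j using incr_iid(2)[OF u] by simp
  moreover have "integrable M (incr a u 0)" using eq(1) int by (simp add: wa)
  ultimately have "AE w in M. (\<lambda>k. (\<Sum>j<k. incr a u j w) / real k) \<longlonglongrightarrow> expectation (incr a u 0)"
    by (intro strong_law_of_large_numbers incr_iid(1)[OF u])
  then show ?thesis using eq(2) by (simp add: sum_incr[OF u] wa)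
qed

text \<open>With \<epsilon> = 1/2 not all translates can be bad, so at every time \<open>k\<close>
  some \<open>t\<close> in \<open>I\<close> has its weight within \<open>C\<close> of the tail sum.
  This \<open>t\<close> may vary with \<open>k\<close>, but \<open>I\<close> is finite and all its
  translates have the same limit, which gives the lower bound. The upper bound holds for any one
  translate.\<close>

lemma tail_sum_lln:
  assumes r: "r \<le> 2 * n" and int: "integrable M (\<lambda>w. real_of_int (weight r (A 1 w)))"
  shows "AE w in M. (\<lambda>k. real_of_int (tail_sum r (SN_GSp n (walk k w))) / real k) \<longlonglongrightarrow> expectation (\<lambda>w. real_of_int (weight r (A 1 w)))"
proof -
  obtain I :: "(nat \<Rightarrow> nat) set" and u :: "(nat \<Rightarrow> nat) \<Rightarrow> 'p padic mat" and C
    where I: "finite I" "I \<noteq> {}" and u': "\<forall>t. u t \<in> GSp_Zp n"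
    and C': "\<forall>N\<in>GSp_Qp n. real (card {t \<in> I. \<exists>r\<le>2 * n. tail_sum r (SN_GSp n N) + C < weight r (u t * N)}) \<le> (1 / 2) * real (card I)"
    by (rule generic_translates[OF n, of "1 / 2"]) (simp, blast)
  note u = u'[rule_format] and C = C'[rule_format]
  let ?E = "expectation (\<lambda>w. real_of_int (weight r (A 1 w)))"
  have "AE w in M. \<forall>t\<in>I. (\<lambda>k. real_of_int (weight r (u t * walk k w)) / real k) \<longlonglongrightarrow> ?E"
    using I(1) weight_lln[OF u r int] by (subst AE_finite_all) auto
  then show ?thesis
  proof (rule AE_mp, intro AE_I2 impI)
    fix w assume w: "w \<in> space M" and lim: "\<forall>t\<in>I. (\<lambda>k. real_of_int (weight r (u t * walk k w)) / real k) \<longlonglongrightarrow> ?E"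
    have G: "walk k w \<in> GSp_Qp n" for k by (rule walk_GSp[OF w])
    have good: "\<exists>t\<in>I. weight r (u t * walk k w) \<le> tail_sum r (SN_GSp n (walk k w)) + C" for k
    proof (rule ccontr)
      assume "\<not> ?thesis"
      then have "{t \<in> I. \<exists>r\<le>2 * n. tail_sum r (SN_GSp n (walk k w)) + C < weight r (u t * walk k w)} = I" using r by (auto simp: not_le)
      then show False using C[OF G[of k]] I by (simp add: card_gt_0_iff)
    qed
    show "(\<lambda>k. real_of_int (tail_sum r (SN_GSp n (walk k w))) / real k) \<longlonglongrightarrow> ?E"
    proof (rule order_tendstoI)
      fix y assume y: "y < ?E"
      have "(\<lambda>k. real_of_int (weight r (u t * walk k w)) / real k - real_of_int C / real k) \<longlonglongrightarrow> ?E - 0" if "t \<in> I" for t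
        using lim that by (intro tendsto_diff lim_const_over_n) auto
      then have "\<forall>\<^sub>F k in sequentially. y < real_of_int (weight r (u t * walk k w)) / real k - real_of_int C / real k" if "t \<in> I" for t
        using order_tendstoD(1) that y by fastforce
      then have "\<forall>\<^sub>F k in sequentially. \<forall>t\<in>I. y < real_of_int (weight r (u t * walk k w)) / real k - real_of_int C / real k"
        using I(1) by (intro eventually_ball_finite) auto
      then show "\<forall>\<^sub>F k in sequentially. y < real_of_int (tail_sum r (SN_GSp n (walk k w))) / real k"
      proof (rule eventually_mono)
        fix k assume *: "\<forall>t\<in>I. y < real_of_int (weight r (u t * walk k w)) / real k - real_of_int C / real k"
        obtain t where t: "t \<in> I" "weight r (u t * walk k w) \<le> tail_sum r (SN_GSp n (walk k w)) + C" using good by blast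
        have "real_of_int (weight r (u t * walk k w)) - real_of_int C \<le> real_of_int (tail_sum r (SN_GSp n (walk k w)))" using t(2) by linarith
        then have "(real_of_int (weight r (u t * walk k w)) - real_of_int C) / real k \<le> real_of_int (tail_sum r (SN_GSp n (walk k w))) / real k"
          by (rule divide_right_mono) simp
        then show "y < real_of_int (tail_sum r (SN_GSp n (walk k w))) / real k" using *[rule_format, OF t(1)] by (simp add: diff_divide_distrib)
      qed
    next
      fix y assume y: "?E < y"
      obtain t where t: "t \<in> I" using I by blast
      have "\<forall>\<^sub>F k in sequentially. real_of_int (weight r (u t * walk k w)) / real k < y"
        using order_tendstoD(2)[OF lim[rule_format, OF t] y] .
      then show "\<forall>\<^sub>F k in sequentially. real_of_int (tail_sum r (SN_GSp n (walk k w))) / real k < y"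
      proof (rule eventually_mono)
        fix k assume *: "real_of_int (weight r (u t * walk k w)) / real k < y"
        have "real_of_int (tail_sum r (SN_GSp n (walk k w))) / real k \<le> real_of_int (weight r (u t * walk k w)) / real k"
          using tail_sum_le_translate[OF u r G] by (intro divide_right_mono) auto
        then show "real_of_int (tail_sum r (SN_GSp n (walk k w))) / real k < y" using * by simp
      qed
    qed
  qed
qed

text \<open>For every outcome at most a fraction \<epsilon> of the translates is bad; taking
  expectations of this count bounds the sum of the probabilities. Off a bad event the two
  combinations differ by a constant \<open>D\<close> that does not depend on
  \<open>k\<close>.\<close>

lemma generic_events:
  assumes \<epsilon>: "\<epsilon> > 0"
  obtains I :: "(nat \<Rightarrow> nat) set" and u :: "(nat \<Rightarrow> nat) \<Rightarrow> 'p padic mat" and Bad :: "(nat \<Rightarrow> nat) \<Rightarrow> nat \<Rightarrow> 'w set" and D :: real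
  where "finite I" "I \<noteq> {}" "\<forall>t. u t \<in> GSp_Zp n" "\<forall>t k. Bad t k \<in> events"
    "\<forall>k. (\<Sum>t\<in>I. prob (Bad t k)) \<le> \<epsilon> * real (card I)" "D \<ge> 0"
    "\<forall>t k. \<forall>w\<in>space M - Bad t k. \<bar>tsum n a (walk k w) - wsum n a (u t * walk k w)\<bar> \<le> D"
proof -
  obtain I :: "(nat \<Rightarrow> nat) set" and u :: "(nat \<Rightarrow> nat) \<Rightarrow> 'p padic mat" and C
    where I: "finite I" "I \<noteq> {}" and u': "\<forall>t. u t \<in> GSp_Zp n"
    and C': "\<forall>N\<in>GSp_Qp n. real (card {t \<in> I. \<exists>r\<le>2 * n. tail_sum r (SN_GSp n N) + C < weight r (u t * N)}) \<le> \<epsilon> * real (card I)"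
    by (rule generic_translates[OF n \<epsilon>]) blast
  note u = u'[rule_format] and C = C'[rule_format]
  define Bad where "Bad = (\<lambda>t k. {w \<in> space M. \<exists>r\<in>{..2 * n}. tail_sum r (SN_GSp n (walk k w)) + C < weight r (u t * walk k w)})"
  define D where "D = (\<Sum>r\<le>2 * n. \<bar>a r\<bar> * \<bar>real_of_int C\<bar>)"
  have Be: "Bad t k \<in> events" for t k
    unfolding Bad_def
  proof (rule sets.sets_Collect_finite_Ex)
    fix r assume "r \<in> {..2 * n}"
    then have r: "r \<le> 2 * n" by simp
    have [measurable]: "(\<lambda>w. tail_sum r (SN_GSp n (walk k w))) \<in> M \<rightarrow>\<^sub>M count_space UNIV"
      by (rule measurable_compose[OF walk_measurable measurable_tail_sum[OF n r]])
    have [measurable]: "(\<lambda>w. weight r (u t * walk k w)) \<in> M \<rightarrow>\<^sub>M count_space UNIV"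
      by (rule measurable_compose[OF translate_measurable[OF u] measurable_weight[OF r]])
    show "{w \<in> space M. tail_sum r (SN_GSp n (walk k w)) + C < weight r (u t * walk k w)} \<in> events" by measurable
  qed simp
  have "(\<Sum>t\<in>I. prob (Bad t k)) \<le> \<epsilon> * real (card I)" for k
  proof -
    have "(\<Sum>t\<in>I. prob (Bad t k)) = (\<Sum>t\<in>I. expectation (indicator (Bad t k)))" using Be by simp
    also have "\<dots> = expectation (\<lambda>w. \<Sum>t\<in>I. indicator (Bad t k) w)"
      using Be by (intro Bochner_Integration.integral_sum[symmetric]) (auto simp: emeasure_eq_measure)
    also have "\<dots> \<le> expectation (\<lambda>w. \<epsilon> * real (card I))"
    proof (rule integral_mono)
      fix w assume w: "w \<in> space M"
      have "(\<Sum>t\<in>I. indicator (Bad t k) w :: real) = real (card {t \<in> I. w \<in> Bad t k})"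
        using I(1) by (simp add: indicator_def sum.If_cases Int_def)
      also have "{t \<in> I. w \<in> Bad t k} = {t \<in> I. \<exists>r\<le>2 * n. tail_sum r (SN_GSp n (walk k w)) + C < weight r (u t * walk k w)}"
        using w by (auto simp: Bad_def)
      finally show "(\<Sum>t\<in>I. indicator (Bad t k) w :: real) \<le> \<epsilon> * real (card I)" using C[OF walk_GSp[OF w, of k]] by simp
    qed (use Be in \<open>auto simp: emeasure_eq_measure\<close>)
    also have "\<dots> = \<epsilon> * real (card I)" by (simp add: prob_space)
    finally show ?thesis .
  qed
  moreover have "\<bar>tsum n a (walk k w) - wsum n a (u t * walk k w)\<bar> \<le> D" if "w \<in> space M - Bad t k" for t k w
  proof -
    have w: "w \<in> space M" and good: "\<And>r. r \<le> 2 * n \<Longrightarrow> weight r (u t * walk k w) \<le> tail_sum r (SN_GSp n (walk k w)) + C"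
      using that by (auto simp: Bad_def not_less)
    have eq: "tsum n a (walk k w) - wsum n a (u t * walk k w)
        = (\<Sum>r\<le>2 * n. a r * (real_of_int (tail_sum r (SN_GSp n (walk k w))) - real_of_int (weight r (u t * walk k w))))"
      by (simp add: tsum_def wsum_def right_diff_distrib sum_subtractf)
    have "\<bar>tsum n a (walk k w) - wsum n a (u t * walk k w)\<bar>
        \<le> (\<Sum>r\<le>2 * n. \<bar>a r * (real_of_int (tail_sum r (SN_GSp n (walk k w))) - real_of_int (weight r (u t * walk k w)))\<bar>)"
      unfolding eq by (rule sum_abs)
    also have "\<dots> \<le> D"
      unfolding D_def
    proof (rule sum_mono)
      fix r assume "r \<in> {..2 * n}"
      then have r: "r \<le> 2 * n" by simp
      have "\<bar>real_of_int (tail_sum r (SN_GSp n (walk k w))) - real_of_int (weight r (u t * walk k w))\<bar> \<le> \<bar>real_of_int C\<bar>"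
        using good[OF r] tail_sum_le_translate[OF u r walk_GSp[OF w, of k], of t] by linarith
      then show "\<bar>a r * (real_of_int (tail_sum r (SN_GSp n (walk k w))) - real_of_int (weight r (u t * walk k w)))\<bar> \<le> \<bar>a r\<bar> * \<bar>real_of_int C\<bar>"
        unfolding abs_mult by (rule mult_left_mono) simp
    qed
    finally show ?thesis .
  qed
  moreover have "D \<ge> 0" unfolding D_def by (intro sum_nonneg) simp
  ultimately show ?thesis by (intro that[of I u Bad D] I u' allI ballI Be)
qed

lemma centred_incr_iid:
  assumes u: "u \<in> GSp_Zp n" and sq: "integrable M (\<lambda>w. (wsum n a (A 1 w))\<^sup>2)"
  defines "e \<equiv> expectation (\<lambda>w. wsum n a (A 1 w))"
  defines "Y \<equiv> \<lambda>j w. incr a u j w - e"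
  shows "indep_vars (\<lambda>_. borel) Y UNIV" "distr M borel (Y j) = distr M borel (Y 0)" "expectation (Y 0) = 0"
    "integrable M (\<lambda>w. (Y 0 w)\<^sup>2)" "expectation (\<lambda>w. (Y 0 w)\<^sup>2) = expectation (\<lambda>w. (wsum n a (A 1 w) - e)\<^sup>2)"
    "(\<Sum>j<k. Y j w) = wsum n a (u * walk k w) - real k * e"
proof -
  have h: "(\<lambda>x. (x - e)\<^sup>2) \<in> borel_measurable borel" "(\<lambda>x. x - e) \<in> borel_measurable borel" by simp_all
  note eq = same_distr_expectation[OF incr_measurable[OF u] wsum_A_measurable incr_iid(2)[OF u, of a 0]]
  show "indep_vars (\<lambda>_. borel) Y UNIV"
    unfolding Y_def by (rule indep_vars_compose2[OF incr_iid(1)[OF u] h(2)])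
  have dY: "distr M borel (Y j) = distr (distr M borel (incr a u j)) borel (\<lambda>x. x - e)" for j
    unfolding Y_def by (subst distr_distr[OF h(2) incr_measurable[OF u]]) (simp add: comp_def)
  show "distr M borel (Y j) = distr M borel (Y 0)" unfolding dY incr_iid(2)[OF u] ..
  have int: "integrable M (\<lambda>w. wsum n a (A 1 w))" by (rule square_integrable_imp_integrable[OF wsum_A_measurable sq])
  show "expectation (Y 0) = 0" unfolding Y_def eq(2)[OF h(2)] using int by (simp add: e_def prob_space)
  have "integrable M (\<lambda>w. (wsum n a (A 1 w))\<^sup>2 - 2 * e * wsum n a (A 1 w) + e\<^sup>2)" using sq int by simp
  then have "integrable M (\<lambda>w. (wsum n a (A 1 w) - e)\<^sup>2)" by (simp add: power2_diff algebra_simps)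
  then show "integrable M (\<lambda>w. (Y 0 w)\<^sup>2)" unfolding Y_def eq(1)[OF h(1)] .
  show "expectation (\<lambda>w. (Y 0 w)\<^sup>2) = expectation (\<lambda>w. (wsum n a (A 1 w) - e)\<^sup>2)" unfolding Y_def by (rule eq(2)[OF h(1)])
  show "(\<Sum>j<k. Y j w) = wsum n a (u * walk k w) - real k * e"
    unfolding Y_def sum_subtractf sum_incr[OF u] by simp
qed

text \<open>The classical theorem applies to each fixed translate. Since only the average over
  \<open>I\<close> of the bad probabilities is controlled, the comparison is averaged over
  \<open>I\<close> as well. The three errors are the rate of the classical theorem, the quantity
  \<open>D / sqrt (real k)\<close> and twice the average bad probability; each is at most a quarter
  of \<delta>, which explains the choice \<epsilon> = \<delta>/8.\<close>

lemma tsum_clt: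
  assumes sq: "integrable M (\<lambda>w. (wsum n a (A 1 w))\<^sup>2)"
  defines "e \<equiv> expectation (\<lambda>w. wsum n a (A 1 w))"
  shows "(\<lambda>k. expectation (\<lambda>w. iexp ((tsum n a (walk k w) - real k * e) / sqrt (real k))))
    \<longlonglongrightarrow> of_real (exp (- expectation (\<lambda>w. (wsum n a (A 1 w) - e)\<^sup>2) / 2))" (is "?\<psi> \<longlonglongrightarrow> ?L")
proof (rule tendstoI)
  fix \<delta> :: real assume \<delta>: "\<delta> > 0"
  obtain I :: "(nat \<Rightarrow> nat) set" and u :: "(nat \<Rightarrow> nat) \<Rightarrow> 'p padic mat" and Bad D
    where I: "finite I" "I \<noteq> {}" and u: "\<forall>t. u t \<in> GSp_Zp n" and Bad: "\<forall>t k. Bad t k \<in> events"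
    "\<forall>k. (\<Sum>t\<in>I. prob (Bad t k)) \<le> \<delta> / 8 * real (card I)" and D: "D \<ge> 0"
    "\<forall>t k. \<forall>w\<in>space M - Bad t k. \<bar>tsum n a (walk k w) - wsum n a (u t * walk k w)\<bar> \<le> D"
    by (rule generic_events[of "\<delta> / 8" a]) (use \<delta> in auto)
  define \<phi> where "\<phi> = (\<lambda>t k. expectation (\<lambda>w. iexp ((wsum n a (u t * walk k w) - real k * e) / sqrt (real k))))"
  have "\<phi> t \<longlonglongrightarrow> ?L" for t
    using central_limit_char[OF centred_incr_iid(1-4)[OF u[rule_format] sq]]
    unfolding centred_incr_iid(5,6)[OF u[rule_format] sq] \<phi>_def e_def .
  then have "\<forall>\<^sub>F k in sequentially. dist (\<phi> t k) ?L < \<delta> / 4" for t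
    using \<delta> by (intro tendstoD) auto
  then have e1: "\<forall>\<^sub>F k in sequentially. \<forall>t\<in>I. dist (\<phi> t k) ?L < \<delta> / 4" using I(1) by (intro eventually_ball_finite) auto
  have "(\<lambda>k. D / sqrt (real k)) \<longlonglongrightarrow> 0"
    by (rule real_tendsto_divide_at_top[OF tendsto_const filterlim_compose[OF sqrt_at_top filterlim_real_sequentially]])
  then have e2: "\<forall>\<^sub>F k in sequentially. D / sqrt (real k) < \<delta> / 4" using \<delta> by (intro order_tendstoD(2)) auto
  show "\<forall>\<^sub>F k in sequentially. dist (?\<psi> k) ?L < \<delta>"
    using e1 e2
  proof eventually_elim
    fix k assume k: "\<forall>t\<in>I. dist (\<phi> t k) ?L < \<delta> / 4" "D / sqrt (real k) < \<delta> / 4"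
    have one: "norm (?\<psi> k - \<phi> t k) \<le> D / sqrt (real k) + 2 * prob (Bad t k)" for t
      unfolding \<phi>_def
    proof (rule norm_expectation_iexp_diff)
      show "(\<lambda>w. (tsum n a (walk k w) - real k * e) / sqrt (real k)) \<in> borel_measurable M"
        using measurable_compose[OF walk_measurable measurable_tsum[OF n]] by simp
      show "(\<lambda>w. (wsum n a (u t * walk k w) - real k * e) / sqrt (real k)) \<in> borel_measurable M"
        using measurable_compose[OF translate_measurable[OF u[rule_format]] measurable_wsum] by simp
      fix w assume "w \<in> space M" "w \<notin> Bad t k"
      then have "\<bar>tsum n a (walk k w) - wsum n a (u t * walk k w)\<bar> / sqrt (real k) \<le> D / sqrt (real k)"
        using D(2) by (intro divide_right_mono) auto
      then show "\<bar>(tsum n a (walk k w) - real k * e) / sqrt (real k) - (wsum n a (u t * walk k w) - real k * e) / sqrt (real k)\<bar> \<le> D / sqrt (real k)"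
        by (simp add: abs_divide flip: diff_divide_distrib)
    qed (use Bad D in auto)
    have "real (card I) * norm (?\<psi> k - ?L) = (\<Sum>t\<in>I. norm (?\<psi> k - ?L))" by simp
    also have "\<dots> \<le> (\<Sum>t\<in>I. \<delta> / 4 + \<delta> / 4 + 2 * prob (Bad t k))"
    proof (rule sum_mono)
      fix t assume t: "t \<in> I"
      have "norm (?\<psi> k - ?L) \<le> norm (?\<psi> k - \<phi> t k) + norm (\<phi> t k - ?L)" by (rule norm_diff_triangle_ineq[of _ "\<phi> t k" "\<phi> t k", simplified])
      then show "norm (?\<psi> k - ?L) \<le> \<delta> / 4 + \<delta> / 4 + 2 * prob (Bad t k)"
        using one[of t] k(1)[rule_format, OF t] k(2) unfolding dist_norm by linarith
    qed
    also have "\<dots> = real (card I) * (\<delta> / 2) + 2 * (\<Sum>t\<in>I. prob (Bad t k))"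
      by (simp add: sum.distrib sum_distrib_left)
    also have "\<dots> \<le> real (card I) * (\<delta> / 2) + 2 * (\<delta> / 8 * real (card I))" using Bad(2)[rule_format, of k] by linarith
    also have "\<dots> < real (card I) * \<delta>" using \<delta> I by (simp add: card_gt_0_iff field_simps)
    finally show "dist (?\<psi> k) ?L < \<delta>" using I by (simp add: dist_norm card_gt_0_iff)
  qed
qed

text \<open>The same averaging over translates, with Chebyshev's inequality in place of the limit
  theorem.\<close>

lemma tsum_tight:
  assumes sq: "integrable M (\<lambda>w. (wsum n a (A 1 w))\<^sup>2)" and \<delta>: "\<delta> > 0"
  defines "e \<equiv> expectation (\<lambda>w. wsum n a (A 1 w))"
  shows "\<exists>R. \<forall>k\<ge>1. prob {w \<in> space M. R < \<bar>(tsum n a (walk k w) - real k * e) / sqrt (real k)\<bar>} \<le> \<delta>"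
proof -
  obtain I :: "(nat \<Rightarrow> nat) set" and u :: "(nat \<Rightarrow> nat) \<Rightarrow> 'p padic mat" and Bad D
    where I: "finite I" "I \<noteq> {}" and u: "\<forall>t. u t \<in> GSp_Zp n" and Bad: "\<forall>t k. Bad t k \<in> events"
    "\<forall>k. (\<Sum>t\<in>I. prob (Bad t k)) \<le> \<delta> / 2 * real (card I)" and D: "D \<ge> 0"
    "\<forall>t k. \<forall>w\<in>space M - Bad t k. \<bar>tsum n a (walk k w) - wsum n a (u t * walk k w)\<bar> \<le> D"
    by (rule generic_events[of "\<delta> / 2" a]) (use \<delta> in auto)
  define V where "V = expectation (\<lambda>w. (wsum n a (A 1 w) - e)\<^sup>2)"
  \<comment> \<open>Makes the Chebyshev bound at most \<open>\<delta> / 2\<close>; the summand 1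
    keeps \<open>y\<close> positive when the variance is 0.\<close>
  define y where "y = sqrt (2 * V / \<delta>) + 1"
  have V: "V \<ge> 0" by (simp add: V_def)
  have y: "y > 0" using V \<delta> by (simp add: y_def add_nonneg_pos)
  have "2 * V / \<delta> = (sqrt (2 * V / \<delta>))\<^sup>2" using V \<delta> by simp
  also have "\<dots> \<le> y\<^sup>2" unfolding y_def using V \<delta> by (intro power_mono) auto
  finally have Vy: "V / y\<^sup>2 \<le> \<delta> / 2" using \<delta> y by (simp add: field_simps)
  have "prob {w \<in> space M. D + y < \<bar>(tsum n a (walk k w) - real k * e) / sqrt (real k)\<bar>} \<le> \<delta>" (is "prob ?P \<le> _") if k: "k \<ge> 1" for k
  proof -
    have one: "prob ?P \<le> prob (Bad t k) + \<delta> / 2" for t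
    proof -
      have [measurable]: "(\<lambda>w. wsum n a (u t * walk k w)) \<in> borel_measurable M"
        by (rule measurable_compose[OF translate_measurable[OF u[rule_format]] measurable_wsum])
      let ?Q = "{w \<in> space M. y < \<bar>(wsum n a (u t * walk k w) - real k * e) / sqrt (real k)\<bar>}"
      have Q: "?Q \<in> events" by measurable
      have "prob ?Q \<le> V / y\<^sup>2"
        using iid_normalised_tail[OF centred_incr_iid(1-4)[OF u[rule_format] sq] y k]
        unfolding centred_incr_iid(5,6)[OF u[rule_format] sq] V_def e_def .
      note pQ = order_trans[OF this Vy]
      have "?P \<subseteq> Bad t k \<union> ?Q"
      proof
        fix w assume w: "w \<in> ?P"
        have "w \<in> ?Q" if nb: "w \<notin> Bad t k"
        proof -
          have "\<bar>tsum n a (walk k w) - wsum n a (u t * walk k w)\<bar> / sqrt (real k) \<le> D / 1"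
            using D w nb k by (intro frac_le) auto
          then have "\<bar>(tsum n a (walk k w) - real k * e) / sqrt (real k) - (wsum n a (u t * walk k w) - real k * e) / sqrt (real k)\<bar> \<le> D"
            by (simp add: abs_divide flip: diff_divide_distrib)
          moreover have "D + y < \<bar>(tsum n a (walk k w) - real k * e) / sqrt (real k)\<bar>" "w \<in> space M"
            using w by blast+
          ultimately show ?thesis by (intro CollectI conjI) linarith+
        qed
        then show "w \<in> Bad t k \<union> ?Q" by blast
      qed
      then have "prob ?P \<le> prob (Bad t k \<union> ?Q)" using Bad(1) Q by (intro finite_measure_mono) auto
      also have "\<dots> \<le> prob (Bad t k) + prob ?Q" using Bad(1) Q by (intro measure_Un_le) auto
      finally show ?thesis using pQ by linarith
    qed
    have "real (card I) * prob ?P = (\<Sum>t\<in>I. prob ?P)" by simp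
    also have "\<dots> \<le> (\<Sum>t\<in>I. prob (Bad t k) + \<delta> / 2)" by (intro sum_mono one)
    also have "\<dots> = (\<Sum>t\<in>I. prob (Bad t k)) + real (card I) * (\<delta> / 2)" by (simp add: sum.distrib)
    also have "\<dots> \<le> \<delta> / 2 * real (card I) + real (card I) * (\<delta> / 2)" using Bad(2)[rule_format, of k] by linarith
    also have "\<dots> = real (card I) * \<delta>" by simp
    finally show ?thesis using I by (simp add: card_gt_0_iff)
  qed
  then show ?thesis by blast
qed

end

section \<open>From combinations of weights to the individual singular numbers\<close>

lemma integrable_product_of_squares:
  fixes X Y :: "'a \<Rightarrow> real"
  assumes [measurable]: "X \<in> borel_measurable M" "Y \<in> borel_measurable M"
    and "integrable M (\<lambda>w. (X w)\<^sup>2)" "integrable M (\<lambda>w. (Y w)\<^sup>2)"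
  shows "integrable M (\<lambda>w. X w * Y w)"
proof (rule Bochner_Integration.integrable_bound)
  show "integrable M (\<lambda>w. (X w)\<^sup>2 + (Y w)\<^sup>2)" using assms by simp
  have "\<bar>x * y\<bar> \<le> x\<^sup>2 + y\<^sup>2" for x y :: real
  proof -
    have "2 * \<bar>x\<bar> * \<bar>y\<bar> \<le> \<bar>x\<bar>\<^sup>2 + \<bar>y\<bar>\<^sup>2" by (rule sum_squares_bound)
    moreover have "0 \<le> \<bar>x\<bar> * \<bar>y\<bar>" by simp
    ultimately show ?thesis unfolding abs_mult power2_abs by linarith
  qed
  then show "AE w in M. norm (X w * Y w) \<le> norm ((X w)\<^sup>2 + (Y w)\<^sup>2)" by simp
qed measurable

lemma integral_bilinear:
  fixes X :: "'b \<Rightarrow> 'a \<Rightarrow> real"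
  assumes int: "\<And>k l. k \<in> K \<Longrightarrow> l \<in> K \<Longrightarrow> integrable M (\<lambda>w. X k w * X l w)"
  shows "integrable M (\<lambda>w. (\<Sum>k\<in>K. a k * X k w) * (\<Sum>l\<in>K. b l * X l w))"
    and "(\<integral>w. (\<Sum>k\<in>K. a k * X k w) * (\<Sum>l\<in>K. b l * X l w) \<partial>M) = (\<Sum>k\<in>K. \<Sum>l\<in>K. a k * b l * (\<integral>w. X k w * X l w \<partial>M))"
proof -
  have e: "(\<Sum>k\<in>K. a k * X k w) * (\<Sum>l\<in>K. b l * X l w) = (\<Sum>k\<in>K. \<Sum>l\<in>K. a k * b l * (X k w * X l w))" for w
    unfolding sum_product by (intro sum.cong refl) (simp add: ac_simps)
  show "integrable M (\<lambda>w. (\<Sum>k\<in>K. a k * X k w) * (\<Sum>l\<in>K. b l * X l w))"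
    unfolding e using int by (intro Bochner_Integration.integrable_sum integrable_mult_right) auto
  show "(\<integral>w. (\<Sum>k\<in>K. a k * X k w) * (\<Sum>l\<in>K. b l * X l w) \<partial>M) = (\<Sum>k\<in>K. \<Sum>l\<in>K. a k * b l * (\<integral>w. X k w * X l w \<partial>M))"
    unfolding e
  proof (subst Bochner_Integration.integral_sum)
    show "integrable M (\<lambda>w. \<Sum>l\<in>K. a k * b l * (X k w * X l w))" if "k \<in> K" for k
      using int that by (intro Bochner_Integration.integrable_sum integrable_mult_right) auto
    show "(\<Sum>k\<in>K. \<integral>w. (\<Sum>l\<in>K. a k * b l * (X k w * X l w)) \<partial>M) = (\<Sum>k\<in>K. \<Sum>l\<in>K. a k * b l * (\<integral>w. X k w * X l w \<partial>M))"
    proof (intro sum.cong refl)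
      fix k assume k: "k \<in> K"
      have "(\<integral>w. (\<Sum>l\<in>K. a k * b l * (X k w * X l w)) \<partial>M) = (\<Sum>l\<in>K. \<integral>w. a k * b l * (X k w * X l w) \<partial>M)"
        using int k by (intro Bochner_Integration.integral_sum integrable_mult_right) auto
      then show "(\<integral>w. (\<Sum>l\<in>K. a k * b l * (X k w * X l w)) \<partial>M) = (\<Sum>l\<in>K. a k * b l * (\<integral>w. X k w * X l w \<partial>M))" by simp
    qed
  qed
qed

lemma SN_GSp_length: "A \<in> GSp_Qp n \<Longrightarrow> n \<ge> 1 \<Longrightarrow> length (SN_GSp n A) = 2 * n"
  by (rule SN_GSp_decomposition) 

text \<open>The guard \<open>r \<noteq> 0\<close> keeps out \<open>weight 0\<close>, about which the moment hypotheses say nothing.\<close>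

definition coord :: "nat \<Rightarrow> nat \<Rightarrow> nat \<Rightarrow> real" where
  "coord n i r = (if r = 2 * n - i then 1 else 0) - (if r = 2 * n - Suc i \<and> r \<noteq> 0 then 1 else 0)"

lemma sum_coord:
  assumes i: "i < 2 * n"
  shows "(\<Sum>r\<le>2 * n. coord n i r * x r) = x (2 * n - i) - (if Suc i < 2 * n then x (2 * n - Suc i) else 0)"
proof -
  have "(\<Sum>r\<le>2 * n. coord n i r * x r)
      = (\<Sum>r\<le>2 * n. (if r = 2 * n - i then x r else 0) - (if r = 2 * n - Suc i then if Suc i < 2 * n then x r else 0 else 0))"
    using i by (intro sum.cong) (auto simp: coord_def)
  then show ?thesis by (simp add: sum_subtractf)
qed

text \<open>Consecutive tail sums differ by one entry. The guard in \<open>coord\<close> is harmless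
  here because the tail sum of length 0 is 0.\<close>

lemma tsum_coord:
  fixes N :: "'p::prime_card padic mat"
  assumes N: "N \<in> GSp_Qp n" and n: "n \<ge> 1" and i: "i < 2 * n"
  shows "tsum n (coord n i) N = real_of_int (SN_GSp n N ! i)"
proof -
  have "SN_GSp n N ! i = tail_sum (2 * n - i) (SN_GSp n N) - tail_sum (2 * n - Suc i) (SN_GSp n N)"
    using nth_eq_tail_sum_diff[of i "SN_GSp n N"] i SN_GSp_length[OF N n] by simp
  moreover have "tail_sum 0 (SN_GSp n N) = 0" by (simp add: tail_sum_def)
  ultimately show ?thesis unfolding tsum_def sum_coord[OF i] using i by (auto simp: not_less)
qed

context gsp_walk
begin

text \<open>Finitely many tail sums are involved, so their strong laws hold simultaneously, and each
  singular number is a difference of two of them.\<close>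

lemma SN_lln:
  assumes int: "\<forall>r\<in>{1..2 * n}. integrable M (\<lambda>w. real_of_int (weight r (A 1 w)))"
  shows "AE w in M. \<forall>i<2 * n. (\<lambda>k. real_of_int (SN_GSp n (walk k w) ! i) / real k)
    \<longlonglongrightarrow> expectation (\<lambda>w. wsum n (coord n i) (A 1 w))"
proof -
  have "AE w in M. \<forall>r\<in>{1..2 * n}. (\<lambda>k. real_of_int (tail_sum r (SN_GSp n (walk k w))) / real k)
      \<longlonglongrightarrow> expectation (\<lambda>w. real_of_int (weight r (A 1 w)))"
    using tail_sum_lln int by (subst AE_finite_all) auto
  then show ?thesis
  proof (rule AE_mp, intro AE_I2 impI allI)
    fix w i assume w: "w \<in> space M" and i: "i < 2 * n"
      and lim: "\<forall>r\<in>{1..2 * n}. (\<lambda>k. real_of_int (tail_sum r (SN_GSp n (walk k w))) / real k)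
        \<longlonglongrightarrow> expectation (\<lambda>w. real_of_int (weight r (A 1 w)))"
    have e: "real_of_int (SN_GSp n (walk k w) ! i) / real k = real_of_int (tail_sum (2 * n - i) (SN_GSp n (walk k w))) / real k
        - (if Suc i < 2 * n then real_of_int (tail_sum (2 * n - Suc i) (SN_GSp n (walk k w))) / real k else 0)" for k
      unfolding tsum_coord[OF walk_GSp[OF w] n i, symmetric] tsum_def sum_coord[OF i] by (simp add: diff_divide_distrib)
    have "(\<lambda>k. real_of_int (SN_GSp n (walk k w) ! i) / real k) \<longlonglongrightarrow> expectation (\<lambda>w. real_of_int (weight (2 * n - i) (A 1 w)))
        - (if Suc i < 2 * n then expectation (\<lambda>w. real_of_int (weight (2 * n - Suc i) (A 1 w))) else 0)"
      unfolding e
    proof (rule tendsto_diff)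
      show "(\<lambda>k. real_of_int (tail_sum (2 * n - i) (SN_GSp n (walk k w))) / real k) \<longlonglongrightarrow> expectation (\<lambda>w. real_of_int (weight (2 * n - i) (A 1 w)))"
        using i by (intro lim[rule_format]) auto
      show "(\<lambda>k. if Suc i < 2 * n then real_of_int (tail_sum (2 * n - Suc i) (SN_GSp n (walk k w))) / real k else 0)
          \<longlonglongrightarrow> (if Suc i < 2 * n then expectation (\<lambda>w. real_of_int (weight (2 * n - Suc i) (A 1 w))) else 0)"
        using lim[rule_format, of "2 * n - Suc i"] by (cases "Suc i < 2 * n") auto
    qed
    moreover have "expectation (\<lambda>w. real_of_int (weight (2 * n - i) (A 1 w)))
        - (if Suc i < 2 * n then expectation (\<lambda>w. real_of_int (weight (2 * n - Suc i) (A 1 w))) else 0)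
        = expectation (\<lambda>w. wsum n (coord n i) (A 1 w))"
      unfolding wsum_def sum_coord[OF i] using int i by auto
    ultimately show "(\<lambda>k. real_of_int (SN_GSp n (walk k w) ! i) / real k) \<longlonglongrightarrow> expectation (\<lambda>w. wsum n (coord n i) (A 1 w))" by simp
  qed
qed

text \<open>Cramer-Wold: at frequency \<open>t\<close> the characteristic function of the vector is
  that of the single combination \<open>tsum n (a t)\<close>, whose limiting variance is the
  quadratic form of \<open>C\<close> at \<open>t\<close>. The same identity shows that
  \<open>C\<close> is positive semidefinite, so that the Gaussian law exists.\<close>

lemma SN_clt:
  fixes C :: "real mat"
  assumes sq: "\<And>i. i < 2 * n \<Longrightarrow> integrable M (\<lambda>w. (wsum n (coord n i) (A 1 w))\<^sup>2)"
    and C: "\<And>i j. i < 2 * n \<Longrightarrow> j < 2 * n \<Longrightarrow> C $$ (i, j) = covariance M (\<lambda>w. wsum n (coord n i) (A 1 w)) (\<lambda>w. wsum n (coord n j) (A 1 w))"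
  shows "\<exists>G. centered_gaussian (2 * n) C G \<and> weak_conv_R (2 * n)
    (\<lambda>k. distr M (borel_R (2 * n)) (\<lambda>w. \<lambda>i\<in>{..<2 * n}.
      (real_of_int (SN_GSp n (walk k w) ! i) - real k * expectation (\<lambda>w. wsum n (coord n i) (A 1 w))) / sqrt (real k))) G"
proof -
  let ?d = "2 * n"
  define G where "G = (\<lambda>i w. wsum n (coord n i) (A 1 w))"
  define \<mu> where "\<mu> = (\<lambda>i. expectation (G i))"
  define U where "U = (\<lambda>i w. G i w - \<mu> i)"
  have Gm [measurable]: "G i \<in> borel_measurable M" for i unfolding G_def by (rule wsum_A_measurable)
  have Gsq: "integrable M (\<lambda>w. (G i w)\<^sup>2)" if "i < ?d" for i using sq[OF that] by (simp add: G_def)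
  have Gint: "integrable M (G i)" if "i < ?d" for i by (rule square_integrable_imp_integrable[OF Gm Gsq[OF that]])
  have Um [measurable]: "U i \<in> borel_measurable M" for i unfolding U_def by measurable
  have Usq: "integrable M (\<lambda>w. (U i w)\<^sup>2)" if "i < ?d" for i
  proof -
    have "integrable M (\<lambda>w. (G i w)\<^sup>2 - 2 * \<mu> i * G i w + (\<mu> i)\<^sup>2)" using Gsq[OF that] Gint[OF that] by simp
    then show ?thesis by (simp add: U_def power2_diff algebra_simps)
  qed
  have UU: "integrable M (\<lambda>w. U i w * U j w)" if "i \<in> {..<?d}" "j \<in> {..<?d}" for i j
    using that by (intro integrable_product_of_squares Um Usq) auto
  have CU: "C $$ (i, j) = expectation (\<lambda>w. U i w * U j w)" if "i < ?d" "j < ?d" for i j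
    using C[OF that] by (simp add: covariance_def U_def \<mu>_def G_def)
  define a where "a = (\<lambda>t r. \<Sum>i<?d. t i * coord n i r)"
  have ws: "wsum n (a t) N = (\<Sum>i<?d. t i * wsum n (coord n i) N)" for t :: "nat \<Rightarrow> real" and N :: "'p padic mat"
    unfolding wsum_def a_def sum_distrib_left sum_distrib_right by (subst sum.swap) (simp add: mult.assoc)
  have ts: "tsum n (a t) N = (\<Sum>i<?d. t i * tsum n (coord n i) N)" for t :: "nat \<Rightarrow> real" and N :: "'p padic mat"
    unfolding tsum_def a_def sum_distrib_left sum_distrib_right by (subst sum.swap) (simp add: mult.assoc)
  have wG: "wsum n (a t) (A 1 w) = (\<Sum>i<?d. t i * G i w)" for t w unfolding ws G_def ..
  have GG: "integrable M (\<lambda>w. G i w * G j w)" if "i \<in> {..<?d}" "j \<in> {..<?d}" for i j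
    using that by (intro integrable_product_of_squares Gm Gsq) auto
  have wsq: "integrable M (\<lambda>w. (wsum n (a t) (A 1 w))\<^sup>2)" for t
    unfolding wG power2_eq_square by (rule integral_bilinear(1)[OF GG])
  have we: "expectation (\<lambda>w. wsum n (a t) (A 1 w)) = (\<Sum>i<?d. t i * \<mu> i)" for t
    unfolding wG \<mu>_def using Gint by (subst Bochner_Integration.integral_sum) auto
  have var: "expectation (\<lambda>w. (wsum n (a t) (A 1 w) - (\<Sum>i<?d. t i * \<mu> i))\<^sup>2) = (\<Sum>i<?d. \<Sum>j<?d. t i * C $$ (i, j) * t j)" for t
  proof -
    have "wsum n (a t) (A 1 w) - (\<Sum>i<?d. t i * \<mu> i) = (\<Sum>i<?d. t i * U i w)" for w
      unfolding wG U_def right_diff_distrib sum_subtractf ..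
    then have "expectation (\<lambda>w. (wsum n (a t) (A 1 w) - (\<Sum>i<?d. t i * \<mu> i))\<^sup>2)
        = (\<Sum>i<?d. \<Sum>j<?d. t i * t j * expectation (\<lambda>w. U i w * U j w))"
      by (simp only: power2_eq_square integral_bilinear(2)[OF UU])
    also have "\<dots> = (\<Sum>i<?d. \<Sum>j<?d. t i * C $$ (i, j) * t j)" using CU by (intro sum.cong) (auto simp: ac_simps)
    finally show ?thesis .
  qed
  have "\<exists>\<nu>. centered_gaussian ?d C \<nu>"
  proof (rule centered_gaussian_exists)
    show "C $$ (i, j) = C $$ (j, i)" if "i < ?d" "j < ?d" for i j using CU that by (simp add: mult.commute)
    show "0 \<le> (\<Sum>i<?d. \<Sum>j<?d. t i * C $$ (i, j) * t j)" for t unfolding var[symmetric] by simp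
  qed
  then obtain \<nu> where \<nu>: "centered_gaussian ?d C \<nu>" by blast
  define Z where "Z = (\<lambda>k w. \<lambda>i\<in>{..<?d}. (tsum n (coord n i) (walk k w) - real k * \<mu> i) / sqrt (real k))"
  have tm [measurable]: "(\<lambda>w. tsum n b (walk k w)) \<in> borel_measurable M" for b k
    by (rule measurable_compose[OF walk_measurable measurable_tsum[OF n]])
  have Zm: "Z k \<in> M \<rightarrow>\<^sub>M borel_R ?d" for k unfolding Z_def by (intro measurable_restrict) measurable
  have Zd: "distr M (borel_R ?d) (\<lambda>w. \<lambda>i\<in>{..<?d}.
      (real_of_int (SN_GSp n (walk k w) ! i) - real k * expectation (\<lambda>w. wsum n (coord n i) (A 1 w))) / sqrt (real k)) = distr M (borel_R ?d) (Z k)" for k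
  proof (intro distr_cong refl)
    fix w assume w: "w \<in> space M"
    show "(\<lambda>i\<in>{..<?d}. (real_of_int (SN_GSp n (walk k w) ! i) - real k * expectation (\<lambda>w. wsum n (coord n i) (A 1 w))) / sqrt (real k)) = Z k w"
      unfolding Z_def \<mu>_def G_def using tsum_coord[OF walk_GSp[OF w] n] by (intro restrict_ext) simp
  qed
  have "weak_conv_R ?d (\<lambda>k. distr M (borel_R ?d) (Z k)) \<nu>"
  proof (rule weak_conv_R_of_char)
    show "prob_space (distr M (borel_R ?d) (Z k))" for k by (rule prob_space_distr[OF Zm])
    show "prob_space \<nu>" "sets \<nu> = sets (borel_R ?d)" using \<nu> by (simp_all add: centered_gaussian_def)
    fix t :: "nat \<Rightarrow> real"
    have f: "(\<lambda>x. iexp (\<Sum>i<?d. t i * x i)) \<in> borel_measurable (borel_R ?d)" by measurable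
    have "(\<Sum>i<?d. t i * Z k w i) = (tsum n (a t) (walk k w) - real k * (\<Sum>i<?d. t i * \<mu> i)) / sqrt (real k)" for k w
    proof -
      have "(\<Sum>i<?d. t i * Z k w i) = (\<Sum>i<?d. (t i * tsum n (coord n i) (walk k w) - real k * (t i * \<mu> i)) / sqrt (real k))"
        by (intro sum.cong refl) (simp add: Z_def algebra_simps)
      then show ?thesis unfolding ts sum_divide_distrib[symmetric] sum_subtractf sum_distrib_left .
    qed
    then have "(\<integral>x. iexp (\<Sum>i<?d. t i * x i) \<partial>distr M (borel_R ?d) (Z k))
        = expectation (\<lambda>w. iexp ((tsum n (a t) (walk k w) - real k * (\<Sum>i<?d. t i * \<mu> i)) / sqrt (real k)))" for k
      by (simp only: integral_distr[OF Zm f])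
    then show "(\<lambda>k. \<integral>x. iexp (\<Sum>i<?d. t i * x i) \<partial>distr M (borel_R ?d) (Z k)) \<longlonglongrightarrow> (\<integral>x. iexp (\<Sum>i<?d. t i * x i) \<partial>\<nu>)"
      using tsum_clt[OF wsq[of t]] \<nu> unfolding we var centered_gaussian_def by (simp only:)
  next
    fix \<delta> :: real assume \<delta>: "\<delta> > 0"
    have d0: "real ?d > 0" using n by simp
    \<comment> \<open>Tightness is a union bound in which each coordinate receives an equal share of
      \<delta>.\<close>
    define Q where "Q = (\<lambda>i R. \<forall>k\<ge>1. prob {w \<in> space M. R < \<bar>(tsum n (coord n i) (walk k w) - real k * \<mu> i) / sqrt (real k)\<bar>} \<le> \<delta> / real ?d)"
    have "\<delta> / real ?d > 0" using \<delta> d0 by simp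
    then have "\<exists>R. Q i R" if "i < ?d" for i
      unfolding Q_def \<mu>_def G_def by (rule tsum_tight[OF sq[OF that]])
    then obtain R where "\<And>i. i < ?d \<Longrightarrow> Q i (R i)" by metis
    then have R: "prob {w \<in> space M. R i < \<bar>(tsum n (coord n i) (walk k w) - real k * \<mu> i) / sqrt (real k)\<bar>} \<le> \<delta> / real ?d"
      if "i < ?d" "k \<ge> 1" for i k using that unfolding Q_def by simp
    define S where "S = (\<Sum>i<?d. \<bar>R i\<bar>)"
    have S: "R i \<le> S" if "i < ?d" for i
      using member_le_sum[of i "{..<?d}" "\<lambda>i. \<bar>R i\<bar>"] that by (simp add: S_def)
    have bd: "measure (distr M (borel_R ?d) (Z k)) {x \<in> space (distr M (borel_R ?d) (Z k)). \<exists>i<?d. S < \<bar>x i\<bar>} \<le> \<delta>" if k: "k \<ge> 1" for k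
    proof -
      let ?E = "\<lambda>i. {w \<in> space M. S < \<bar>(tsum n (coord n i) (walk k w) - real k * \<mu> i) / sqrt (real k)\<bar>}"
      have Ee: "?E i \<in> events" for i by measurable
      have X: "{x \<in> space (borel_R ?d). \<exists>i\<in>{..<?d}. S < \<bar>x i\<bar>} \<in> sets (borel_R ?d)"
      proof (rule sets.sets_Collect_finite_Ex)
        fix i assume [measurable]: "i \<in> {..<?d}"
        show "{x \<in> space (borel_R ?d). S < \<bar>x i\<bar>} \<in> sets (borel_R ?d)" by measurable
      qed simp
      have sE: "{x \<in> space (distr M (borel_R ?d) (Z k)). \<exists>i<?d. S < \<bar>x i\<bar>} = {x \<in> space (borel_R ?d). \<exists>i\<in>{..<?d}. S < \<bar>x i\<bar>}" by auto
      have eq: "Z k -` {x \<in> space (borel_R ?d). \<exists>i\<in>{..<?d}. S < \<bar>x i\<bar>} \<inter> space M = (\<Union>i<?d. ?E i)"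
        using measurable_space[OF Zm] by (auto simp: Z_def)
      have "measure (distr M (borel_R ?d) (Z k)) {x \<in> space (distr M (borel_R ?d) (Z k)). \<exists>i<?d. S < \<bar>x i\<bar>} = prob (\<Union>i<?d. ?E i)"
        unfolding sE measure_distr[OF Zm X] eq ..
      also have "\<dots> \<le> (\<Sum>i<?d. prob (?E i))" using Ee by (intro measure_UNION_le) auto
      also have "\<dots> \<le> (\<Sum>i<?d. \<delta> / real ?d)"
      proof (rule sum_mono)
        fix i assume "i \<in> {..<?d}"
        then have i: "i < ?d" by simp
        have "prob (?E i) \<le> prob {w \<in> space M. R i < \<bar>(tsum n (coord n i) (walk k w) - real k * \<mu> i) / sqrt (real k)\<bar>}"
          using S[OF i] by (intro finite_measure_mono) (auto intro: le_less_trans)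
        also have "\<dots> \<le> \<delta> / real ?d" by (rule R[OF i k])
        finally show "prob (?E i) \<le> \<delta> / real ?d" .
      qed
      also have "\<dots> = \<delta>" using d0 by simp
      finally show ?thesis .
    qed
    show "\<exists>R. \<forall>\<^sub>F k in sequentially. measure (distr M (borel_R ?d) (Z k)) {x \<in> space (distr M (borel_R ?d) (Z k)). \<exists>i<?d. R < \<bar>x i\<bar>} \<le> \<delta>"
      by (intro exI[of _ S] eventually_sequentiallyI[of 1] bd)
  qed simp
  then show ?thesis unfolding Zd using \<nu> by (intro exI[of _ \<nu>] conjI)
qed

end

theorem theorem4p3:
  fixes M :: "'w measure"
    and A :: "nat \<Rightarrow> 'w \<Rightarrow> 'p::prime_card padic mat"
    and n :: nat
    and lam :: "nat \<Rightarrow> 'w \<Rightarrow> int list"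
    and W :: "nat \<Rightarrow> 'w \<Rightarrow> real"
    and c :: "nat \<Rightarrow> real"
    and L \<Sigma> :: "real mat"
  assumes n: "n \<ge> 1"
    and M: "prob_space M"
    and indep: "prob_space.indep_vars M (\<lambda>_. borel_GSp n) A {1..}"
    and ident: "\<And>k. k \<ge> 1 \<Longrightarrow> distr M (borel_GSp n) (A k) = distr M (borel_GSp n) (A 1)"
    and left_inv: "\<And>U. U \<in> GSp_Zp n \<Longrightarrow>
          distr M (borel_GSp n) (\<lambda>w. U * A 1 w) = distr M (borel_GSp n) (A 1)"
    and right_inv: "\<And>U. U \<in> GSp_Zp n \<Longrightarrow>
          distr M (borel_GSp n) (\<lambda>w. A 1 w * U) = distr M (borel_GSp n) (A 1)"
  defines "lam \<equiv> \<lambda>k w. SN_GSp n (mat_prod (2 * n) (\<lambda>j. A j w) k)"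
    and "W \<equiv> \<lambda>i w. real_of_int (sum_list (SN (last_rows (2 * n - i + 1) (A 1 w))))"
    and "c \<equiv> \<lambda>i. if i < 2 * n then (\<integral>w. W i w \<partial>M) - (\<integral>w. W (i + 1) w \<partial>M)
               else (\<integral>w. W i w \<partial>M)"
    and "L \<equiv> mat (2 * n) (2 * n) (\<lambda>(i, j). if j = i then 1 else if j = i + 1 then -1 else 0)"
    and "\<Sigma> \<equiv> mat (2 * n) (2 * n) (\<lambda>(i, j). covariance M (W (i + 1)) (W (j + 1)))"
  shows "((\<forall>i\<in>{1..2 * n}. integrable M (W i)) \<longrightarrow>
           (AE w in M. \<forall>i\<in>{1..2 * n}. (\<lambda>k. real_of_int (lam k w ! (i - 1)) / real k) \<longlonglongrightarrow> c i)) \<and>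
         ((\<forall>i\<in>{1..2 * n}. integrable M (W i) \<and> integrable M (\<lambda>w. (W i w)\<^sup>2)) \<longrightarrow>
           (\<exists>G. centered_gaussian (2 * n) (L * \<Sigma> * transpose_mat L) G \<and>
                weak_conv_R (2 * n)
                  (\<lambda>k. distr M (borel_R (2 * n))
                     (\<lambda>w. \<lambda>i\<in>{..<2 * n}. (real_of_int (lam k w ! i) - real k * c (i + 1)) / sqrt (real k)))
                  G))"
proof -
  interpret gsp_walk M A n
  proof (rule gsp_walk.intro[OF M], unfold gsp_walk_axioms_def, intro conjI allI impI)
    show "n \<ge> 1" by (rule n)
    show "prob_space.indep_vars M (\<lambda>_. borel_GSp n) A {1..}" by (rule indep)
    show "distr M (borel_GSp n) (A k) = distr M (borel_GSp n) (A 1)" if "k \<ge> 1" for k by (rule ident[OF that])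
    show "distr M (borel_GSp n) (\<lambda>w. U * A 1 w) = distr M (borel_GSp n) (A 1)" if "U \<in> GSp_Zp n" for U by (rule left_inv[OF that])
  qed
  let ?d = "2 * n"
  \<comment> \<open>\<open>W\<close> counts from 1, coordinates count from 0:
    \<open>W (Suc i)\<close> belongs to the last \<open>2 * n - i\<close> rows.\<close>
  have Ww: "W (Suc i) w = real_of_int (weight (?d - i) (A 1 w))" if "i < ?d" for i w
    using that by (simp add: W_def weight_def Suc_diff_Suc)
  have G: "wsum n (coord n i) (A 1 w) = W (Suc i) w - (if Suc i < ?d then W (Suc (Suc i)) w else 0)" if "i < ?d" for i w
    unfolding wsum_def sum_coord[OF that] using Ww that by auto
  have Wr: "\<forall>r\<in>{1..?d}. integrable M (\<lambda>w. real_of_int (weight r (A 1 w)))" if W: "\<forall>i\<in>{1..?d}. integrable M (W i)"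
  proof
    fix r assume r: "r \<in> {1..?d}"
    then have "integrable M (W (Suc (?d - r)))" using W by auto
    moreover have "W (Suc (?d - r)) = (\<lambda>w. real_of_int (weight r (A 1 w)))" using r Ww[of "?d - r"] by (simp add: fun_eq_iff)
    ultimately show "integrable M (\<lambda>w. real_of_int (weight r (A 1 w)))" by simp
  qed
  have cE: "expectation (\<lambda>w. wsum n (coord n i) (A 1 w)) = c (Suc i)" if W: "\<forall>i\<in>{1..?d}. integrable M (W i)" and i: "i < ?d" for i
    unfolding G[OF i] c_def using W i by (cases "Suc i < ?d") auto
  have lln: "AE w in M. \<forall>i\<in>{1..?d}. (\<lambda>k. real_of_int (lam k w ! (i - 1)) / real k) \<longlonglongrightarrow> c i" if W: "\<forall>i\<in>{1..?d}. integrable M (W i)"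
    using SN_lln[OF Wr[OF W]]
  proof (rule AE_mp, intro AE_I2 impI ballI)
    fix w i assume *: "\<forall>i<?d. (\<lambda>k. real_of_int (SN_GSp n (walk k w) ! i) / real k) \<longlonglongrightarrow> expectation (\<lambda>w. wsum n (coord n i) (A 1 w))"
      and i: "i \<in> {1..?d}"
    then have "i - 1 < ?d" "Suc (i - 1) = i" by auto
    then show "(\<lambda>k. real_of_int (lam k w ! (i - 1)) / real k) \<longlonglongrightarrow> c i"
      using *[rule_format, of "i - 1"] cE[OF W, of "i - 1"] by (simp only: lam_def)
  qed
  have clt: "\<exists>G. centered_gaussian ?d (L * \<Sigma> * transpose_mat L) G \<and>
      weak_conv_R ?d (\<lambda>k. distr M (borel_R ?d) (\<lambda>w. \<lambda>i\<in>{..<?d}. (real_of_int (lam k w ! i) - real k * c (i + 1)) / sqrt (real k))) G"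
    if W: "\<forall>i\<in>{1..?d}. integrable M (W i) \<and> integrable M (\<lambda>w. (W i w)\<^sup>2)"
  proof -
    have Wi: "integrable M (W (Suc i))" "integrable M (\<lambda>w. (W (Suc i) w)\<^sup>2)" if "i < ?d" for i using W that by auto
    have Wm: "W (Suc i) \<in> borel_measurable M" if "i < ?d" for i using Wi(1)[OF that] by simp
    define V where "V = (\<lambda>i w. W (Suc i) w - expectation (W (Suc i)))"
    \<comment> \<open>The combination for coordinate \<open>i\<close> is row \<open>i\<close> of
      \<open>L\<close> applied to the vector of weights. By bilinearity the covariance matrix of
      these combinations is \<open>L * \<Sigma> * transpose_mat L\<close>.\<close>
    have GL: "wsum n (coord n i) (A 1 w) = (\<Sum>k<?d. L $$ (i, k) * W (Suc k) w)" if i: "i < ?d" for i w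
    proof -
      have "(\<Sum>k<?d. L $$ (i, k) * W (Suc k) w) = (\<Sum>k<?d. (if k = i then W (Suc k) w else 0) - (if k = Suc i then W (Suc k) w else 0))"
        using i by (intro sum.cong) (auto simp: L_def)
      then show ?thesis unfolding G[OF i] using i by (simp add: sum_subtractf)
    qed
    have EL: "expectation (\<lambda>w. wsum n (coord n i) (A 1 w)) = (\<Sum>k<?d. L $$ (i, k) * expectation (W (Suc k)))" if "i < ?d" for i
      unfolding GL[OF that] using Wi(1) by (subst Bochner_Integration.integral_sum) auto
    have GV: "wsum n (coord n i) (A 1 w) - expectation (\<lambda>w. wsum n (coord n i) (A 1 w)) = (\<Sum>k<?d. L $$ (i, k) * V k w)" if "i < ?d" for i w
      unfolding EL[OF that] unfolding GL[OF that] V_def right_diff_distrib sum_subtractf ..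
    have VV: "integrable M (\<lambda>w. V k w * V l w)" if "k \<in> {..<?d}" "l \<in> {..<?d}" for k l
    proof -
      have "integrable M (\<lambda>w. (V k w)\<^sup>2)" if "k < ?d" for k
      proof -
        have "integrable M (\<lambda>w. (W (Suc k) w)\<^sup>2 - 2 * expectation (W (Suc k)) * W (Suc k) w + (expectation (W (Suc k)))\<^sup>2)"
          using Wi[OF that] by simp
        then show ?thesis by (simp add: V_def power2_diff algebra_simps)
      qed
      then show ?thesis using that Wm unfolding V_def by (intro integrable_product_of_squares borel_measurable_diff) auto
    qed
    have WW: "integrable M (\<lambda>w. W (Suc k) w * W (Suc l) w)" if "k \<in> {..<?d}" "l \<in> {..<?d}" for k l
      using that Wm Wi by (intro integrable_product_of_squares) auto
    have Lc: "L \<in> carrier_mat ?d ?d" "\<Sigma> \<in> carrier_mat ?d ?d" by (simp_all add: L_def \<Sigma>_def)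
    have "(L * \<Sigma> * transpose_mat L) $$ (i, j) = covariance M (\<lambda>w. wsum n (coord n i) (A 1 w)) (\<lambda>w. wsum n (coord n j) (A 1 w))"
      if ij: "i < ?d" "j < ?d" for i j
    proof -
      have "(L * \<Sigma> * transpose_mat L) $$ (i, j) = (\<Sum>l<?d. (L * \<Sigma>) $$ (i, l) * L $$ (j, l))"
        using ij Lc by (subst mult_mat_entry[of _ ?d ?d _ ?d]) (auto intro!: sum.cong)
      also have "\<dots> = (\<Sum>l<?d. \<Sum>k<?d. L $$ (i, k) * L $$ (j, l) * \<Sigma> $$ (k, l))"
      proof (intro sum.cong refl)
        fix l assume "l \<in> {..<?d}"
        then have l: "l < ?d" by simp
        show "(L * \<Sigma>) $$ (i, l) * L $$ (j, l) = (\<Sum>k<?d. L $$ (i, k) * L $$ (j, l) * \<Sigma> $$ (k, l))"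
          unfolding mult_mat_entry[OF Lc ij(1) l] sum_distrib_right by (intro sum.cong refl) (simp only: ac_simps)
      qed
      also have "\<dots> = (\<Sum>k<?d. \<Sum>l<?d. L $$ (i, k) * L $$ (j, l) * \<Sigma> $$ (k, l))" by (rule sum.swap)
      also have "\<dots> = (\<Sum>k<?d. \<Sum>l<?d. L $$ (i, k) * L $$ (j, l) * expectation (\<lambda>w. V k w * V l w))"
        by (intro sum.cong refl) (simp add: \<Sigma>_def covariance_def V_def)
      also have "\<dots> = covariance M (\<lambda>w. wsum n (coord n i) (A 1 w)) (\<lambda>w. wsum n (coord n j) (A 1 w))"
        unfolding covariance_def GV[OF ij(1)] GV[OF ij(2)] by (rule integral_bilinear(2)[OF VV, symmetric])
      finally show ?thesis .
    qed
    moreover have "integrable M (\<lambda>w. (wsum n (coord n i) (A 1 w))\<^sup>2)" if "i < ?d" for i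
      unfolding GL[OF that] power2_eq_square by (rule integral_bilinear(1)[OF WW])
    ultimately have "\<exists>G. centered_gaussian ?d (L * \<Sigma> * transpose_mat L) G \<and> weak_conv_R ?d
      (\<lambda>k. distr M (borel_R ?d) (\<lambda>w. \<lambda>i\<in>{..<?d}.
        (real_of_int (SN_GSp n (walk k w) ! i) - real k * expectation (\<lambda>w. wsum n (coord n i) (A 1 w))) / sqrt (real k))) G"
      by (intro SN_clt)
    moreover have "(\<lambda>i\<in>{..<?d}. (real_of_int (SN_GSp n (walk k w) ! i) - real k * expectation (\<lambda>w. wsum n (coord n i) (A 1 w))) / sqrt (real k))
        = (\<lambda>i\<in>{..<?d}. (real_of_int (lam k w ! i) - real k * c (i + 1)) / sqrt (real k))" for k w
      unfolding lam_def using cE W by (intro restrict_ext) simp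
    ultimately show ?thesis by (simp only:)
  qed
  show ?thesis
  proof (intro conjI impI)
    assume "\<forall>i\<in>{1..?d}. integrable M (W i)"
    then show "AE w in M. \<forall>i\<in>{1..?d}. (\<lambda>k. real_of_int (lam k w ! (i - 1)) / real k) \<longlonglongrightarrow> c i" by (rule lln)
  next
    assume "\<forall>i\<in>{1..?d}. integrable M (W i) \<and> integrable M (\<lambda>w. (W i w)\<^sup>2)"
    then show "\<exists>G. centered_gaussian ?d (L * \<Sigma> * transpose_mat L) G \<and>
      weak_conv_R ?d (\<lambda>k. distr M (borel_R ?d) (\<lambda>w. \<lambda>i\<in>{..<?d}. (real_of_int (lam k w ! i) - real k * c (i + 1)) / sqrt (real k))) G"
      by (rule clt)
  qed
qed

end
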